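(* Let $T>0$, $n\ge1$, let $W=\{W(t),t\in[0,T]\}$ be a standard Brownian motion, and let $f_i\in L^2[0,T]$ for all $i\in\{1,\ldots,n\}$. Let $I_n^S(f_1,\ldots,f_n)(t)=\int_0^t\int_0^{s_n}\cdots\int_0^{s_2}f_n(s_n)\cdots f_1(s_1)\,d^\circ W(s_1)\cdots d^\circ W(s_n)$ be the multiple Stratonovich integral, let $$\mathcal{G}_n=\Big\{(\alpha_1,\ldots,\alpha_m):\ \alpha_i\in\{1,2\}\ \forall i,\ \sum_{i=1}^m\alpha_i=n\Big\}$$ (the length $m$ is allowed to vary), and let $I_{(\alpha_1,\ldots,\alpha_m)}(f_1,\ldots,f_n)$, for $(\alpha_1,\ldots,\alpha_m)\in\mathcal{G}_n$, be the mixed iterated Itô/Lebesgue integrals defined in the context. Then $$I_n^S(f_1,\ldots,f_n)(t)=\sum_{(\alpha_1,\ldots,\alpha_m)\in\mathcal{G}_n}\frac{1}{2^{n-m}}\,I_{(\alpha_1,\ldots,\alpha_m)}(f_1,\ldots,f_n)(t)$$ for any $t\in[0,T]$.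
   Context: Equalities between stochastic integrals are understood almost surely; $dW$ denotes the Itô integral and $d^\circ W$ the Stratonovich integral. Mixed iterated integrals: $I_{(1)}(f_1)(t)=\int_0^tf_1(s)\,dW(s)$, $I_{(2)}(f_1,f_2)(t)=\int_0^tf_2(s)f_1(s)\,ds$, and for $(\alpha_1,\ldots,\alpha_m)\in\mathcal{G}_n$ with $m\ge2$, $$I_{(\alpha_1,\ldots,\alpha_m)}(f_1,\ldots,f_n)(t)=\int_0^tf_n(s)\,I_{(\alpha_1,\ldots,\alpha_{m-1})}(f_1,\ldots,f_{n-1})(s)\,dW(s)\quad\text{if }\alpha_m=1,$$ $$I_{(\alpha_1,\ldots,\alpha_m)}(f_1,\ldots,f_n)(t)=\int_0^tf_n(s)f_{n-1}(s)\,I_{(\alpha_1,\ldots,\alpha_{m-1})}(f_1,\ldots,f_{n-2})(s)\,ds\quad\text{if }\alpha_m=2.$$ Stratonovich integral: for a process $X$, $\int_0^tX(s)\,d^\circ W(s)$ is the limit in probability, as the mesh of the partition $0=t_0<t_1<\cdots<t_N=t$ tends to $0$, of $\sum_{i}\Big(\frac{1}{t_{i+1}-t_i}\int_{t_i}^{t_{i+1}}X(s)\,ds\Big)\big(W(t_{i+1})-W(t_i)\big)$, when this limit exists. The multiple Stratonovich integral $I_n^S(f_1,\ldots,f_n)$ coincides with the iterated integral $Y_n$, where $Y_1(t)=\int_0^tf_1(s)\,d^\circ W(s)$ and $Y_k(t)=\int_0^tf_k(s)Y_{k-1}(s)\,d^\circ W(s)$ for $k\in\{2,\ldots,n\}$;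 for $f_i\in L^2[0,T]$ all these integrals exist and have continuous versions, which are the ones used. *)

theory Defs
  imports "HOL-Probability.Probability"
begin

section \<open>Brownian motion on \<open>[0,T]\<close>\<close>

definition partition_of :: "real \<Rightarrow> real \<Rightarrow> nat \<Rightarrow> (nat \<Rightarrow> real) \<Rightarrow> bool" where
  "partition_of a b N p \<longleftrightarrow> p 0 = a \<and> p N = b \<and> (\<forall>i<N. p i < p (Suc i))"

definition standard_brownian_motion ::
    "'a measure \<Rightarrow> real \<Rightarrow> (real \<Rightarrow> 'a \<Rightarrow> real) \<Rightarrow> bool" where
  "standard_brownian_motion M T W \<longleftrightarrow>
     prob_space M \<and>
     (\<forall>t\<in>{0..T}. W t \<in> borel_measurable M) \<and>
     (AE \<omega> in M. W 0 \<omega> = 0) \<and>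
     (\<forall>N p. (\<forall>i<N. p i < p (Suc i)) \<and> 0 \<le> p 0 \<and> p N \<le> T \<longrightarrow>
        prob_space.indep_vars M (\<lambda>_. borel) (\<lambda>i \<omega>. W (p (Suc i)) \<omega> - W (p i) \<omega>) {..<N}) \<and>
     (\<forall>s t. 0 \<le> s \<and> s < t \<and> t \<le> T \<longrightarrow>
        distributed M lborel (\<lambda>\<omega>. W t \<omega> - W s \<omega>) (normal_density 0 (sqrt (t - s)))) \<and>
     (AE \<omega> in M. continuous_on {0..T} (\<lambda>t. W t \<omega>))"

text \<open>The natural filtration of \<open>W\<close>, augmented by the null sets of \<open>M\<close>.\<close>

definition brownian_filtration ::
    "'a measure \<Rightarrow> (real \<Rightarrow> 'a \<Rightarrow> real) \<Rightarrow> real \<Rightarrow> 'a measure" where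
  "brownian_filtration M W t =
     sigma (space M)
       ({W s -` A \<inter> space M | s A. s \<in> {0..t} \<and> A \<in> sets borel} \<union> null_sets M)"


section \<open>Function and process spaces\<close>

abbreviation lborel_Icc :: "real \<Rightarrow> real measure" where
  "lborel_Icc T \<equiv> restrict_space lborel {0..T}"

text \<open>\<open>L\<^sup>2[0,T]\<close>, through the Borel representatives of its classes.\<close>

definition L2_Icc :: "real \<Rightarrow> (real \<Rightarrow> real) set" where
  "L2_Icc T = {f \<in> borel_measurable (lborel_Icc T). integrable (lborel_Icc T) (\<lambda>s. (f s)\<^sup>2)}"

definition measurable_process ::
    "'a measure \<Rightarrow> real \<Rightarrow> (real \<Rightarrow> 'a \<Rightarrow> real) \<Rightarrow> bool" where
  "measurable_process M T X \<longleftrightarrow>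
     (\<lambda>(s, \<omega>). X s \<omega>) \<in> borel_measurable (lborel_Icc T \<Otimes>\<^sub>M M)"

definition continuous_process ::
    "'a measure \<Rightarrow> real \<Rightarrow> (real \<Rightarrow> 'a \<Rightarrow> real) \<Rightarrow> bool" where
  "continuous_process M T Y \<longleftrightarrow>
     (\<forall>t\<in>{0..T}. Y t \<in> borel_measurable M) \<and>
     (\<forall>\<omega>\<in>space M. continuous_on {0..T} (\<lambda>t. Y t \<omega>))"


section \<open>The Ito integral\<close>

definition simple_process ::
    "'a measure \<Rightarrow> real \<Rightarrow> (real \<Rightarrow> 'a \<Rightarrow> real) \<Rightarrow> nat \<Rightarrow> (nat \<Rightarrow> real) \<Rightarrow> (nat \<Rightarrow> 'a \<Rightarrow> real) \<Rightarrow> bool"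
  where
  "simple_process M T W N p \<xi> \<longleftrightarrow>
     partition_of 0 T N p \<and>
     (\<forall>i<N. \<xi> i \<in> borel_measurable (brownian_filtration M W (p i)) \<and>
            integrable M (\<lambda>\<omega>. (\<xi> i \<omega>)\<^sup>2))"

definition step_process ::
    "nat \<Rightarrow> (nat \<Rightarrow> real) \<Rightarrow> (nat \<Rightarrow> 'a \<Rightarrow> real) \<Rightarrow> real \<Rightarrow> 'a \<Rightarrow> real" where
  "step_process N p \<xi> s \<omega> = (\<Sum>i<N. \<xi> i \<omega> * indicator {p i<..p (Suc i)} s)"

definition step_integral ::
    "(real \<Rightarrow> 'a \<Rightarrow> real) \<Rightarrow> nat \<Rightarrow> (nat \<Rightarrow> real) \<Rightarrow> (nat \<Rightarrow> 'a \<Rightarrow> real) \<Rightarrow> real \<Rightarrow> 'a \<Rightarrow> real" where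
  "step_integral W N p \<xi> t \<omega> =
     (\<Sum>i<N. \<xi> i \<omega> * (W (min t (p (Suc i))) \<omega> - W (min t (p i)) \<omega>))"

text \<open>\<open>Y\<close> is a continuous version of \<open>t \<mapsto> \<integral>\<^sub>0\<^sup>t X dW\<close>: \<open>X\<close> is the limit in \<open>L\<^sup>2([0,T] \<times> \<Omega>)\<close> of simple
  adapted processes, and \<open>Y t\<close> is the limit in \<open>L\<^sup>2(\<Omega>)\<close> of their elementary integrals. Adaptedness of
  \<open>X\<close> (up to modification) is implied by the approximability.\<close>

definition has_ito_integral ::
    "'a measure \<Rightarrow> real \<Rightarrow> (real \<Rightarrow> 'a \<Rightarrow> real) \<Rightarrow> (real \<Rightarrow> 'a \<Rightarrow> real) \<Rightarrow> (real \<Rightarrow> 'a \<Rightarrow> real) \<Rightarrow> bool"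
  where
  "has_ito_integral M T W X Y \<longleftrightarrow>
     measurable_process M T X \<and> continuous_process M T Y \<and>
     (\<exists>N p \<xi>.
        (\<forall>k::nat. simple_process M T W (N k) (p k) (\<xi> k)) \<and>
        (\<lambda>k. \<integral>\<^sup>+(s, \<omega>). ennreal ((step_process (N k) (p k) (\<xi> k) s \<omega> - X s \<omega>)\<^sup>2)
               \<partial>(lborel_Icc T \<Otimes>\<^sub>M M)) \<longlonglongrightarrow> 0 \<and>
        (\<forall>t\<in>{0..T}.
          (\<lambda>k. \<integral>\<^sup>+\<omega>. ennreal ((step_integral W (N k) (p k) (\<xi> k) t \<omega> - Y t \<omega>)\<^sup>2) \<partial>M)
            \<longlonglongrightarrow> 0))"

definition ito_integral ::
    "'a measure \<Rightarrow> real \<Rightarrow> (real \<Rightarrow> 'a \<Rightarrow> real) \<Rightarrow> (real \<Rightarrow> 'a \<Rightarrow> real) \<Rightarrow> real \<Rightarrow> 'a \<Rightarrow> real" where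
  "ito_integral M T W X = (SOME Y. has_ito_integral M T W X Y)"


section \<open>The Stratonovich integral\<close>

definition stratonovich_sum ::
    "(real \<Rightarrow> 'a \<Rightarrow> real) \<Rightarrow> (real \<Rightarrow> 'a \<Rightarrow> real) \<Rightarrow> nat \<Rightarrow> (nat \<Rightarrow> real) \<Rightarrow> 'a \<Rightarrow> real" where
  "stratonovich_sum W X N p \<omega> =
     (\<Sum>i<N. (1 / (p (Suc i) - p i) * (LBINT s:{p i..p (Suc i)}. X s \<omega>))
              * (W (p (Suc i)) \<omega> - W (p i) \<omega>))"

text \<open>\<open>Y\<close> is a continuous version of the Stratonovich integral of \<open>X\<close>: for every \<open>t\<close>, \<open>Y t\<close> is the limit
  in probability of the sums over partitions of \<open>[0,t]\<close> as the mesh tends to \<open>0\<close>.\<close>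

definition has_stratonovich_integral ::
    "'a measure \<Rightarrow> real \<Rightarrow> (real \<Rightarrow> 'a \<Rightarrow> real) \<Rightarrow> (real \<Rightarrow> 'a \<Rightarrow> real) \<Rightarrow> (real \<Rightarrow> 'a \<Rightarrow> real) \<Rightarrow> bool"
  where
  "has_stratonovich_integral M T W X Y \<longleftrightarrow>
     measurable_process M T X \<and>
     (AE \<omega> in M. set_integrable lborel {0..T} (\<lambda>s. X s \<omega>)) \<and>
     continuous_process M T Y \<and>
     (\<forall>t\<in>{0..T}. \<forall>\<epsilon>>0. \<forall>\<eta>>0. \<exists>\<delta>>0. \<forall>N p.
        partition_of 0 t N p \<and> (\<forall>i<N. p (Suc i) - p i < \<delta>) \<longrightarrow>
        measure M {\<omega> \<in> space M. \<epsilon> < \<bar>stratonovich_sum W X N p \<omega> - Y t \<omega>\<bar>} < \<eta>)"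

definition stratonovich_integral ::
    "'a measure \<Rightarrow> real \<Rightarrow> (real \<Rightarrow> 'a \<Rightarrow> real) \<Rightarrow> (real \<Rightarrow> 'a \<Rightarrow> real) \<Rightarrow> real \<Rightarrow> 'a \<Rightarrow> real" where
  "stratonovich_integral M T W X = (SOME Y. has_stratonovich_integral M T W X Y)"


section \<open>Iterated integrals\<close>

text \<open>In both families the integral of order \<open>0\<close> is the constant \<open>1\<close>, so that the integrals of lowest
  order, such as \<open>\<integral>\<^sub>0\<^sup>t f\<^sub>1 dW\<close> or \<open>\<integral>\<^sub>0\<^sup>t f\<^sub>2(s) f\<^sub>1(s) ds\<close>, need no separate clause.\<close>

primrec multiple_stratonovich ::
    "'a measure \<Rightarrow> real \<Rightarrow> (real \<Rightarrow> 'a \<Rightarrow> real) \<Rightarrow> (nat \<Rightarrow> real \<Rightarrow> real) \<Rightarrow> nat \<Rightarrow> real \<Rightarrow> 'a \<Rightarrow> real"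
  where
  "multiple_stratonovich M T W f 0 = (\<lambda>t \<omega>. 1)"
| "multiple_stratonovich M T W f (Suc k) =
     stratonovich_integral M T W (\<lambda>s \<omega>. f (Suc k) s * multiple_stratonovich M T W f k s \<omega>)"

definition multi_indices :: "nat \<Rightarrow> nat list set" where
  "multi_indices n = {\<alpha>. set \<alpha> \<subseteq> {1, 2} \<and> sum_list \<alpha> = n}"

text \<open>Recursion is on the reversed multi-index, whose head is the outermost entry \<open>\<alpha>\<^sub>m\<close>. The number of
  functions consumed is the sum of the multi-index.\<close>

primrec mixed_integral_rev ::
    "'a measure \<Rightarrow> real \<Rightarrow> (real \<Rightarrow> 'a \<Rightarrow> real) \<Rightarrow> (nat \<Rightarrow> real \<Rightarrow> real) \<Rightarrow> nat list \<Rightarrow> real \<Rightarrow> 'a \<Rightarrow> real"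
  where
  "mixed_integral_rev M T W f [] = (\<lambda>t \<omega>. 1)"
| "mixed_integral_rev M T W f (a # \<beta>) =
     (let n = a + sum_list \<beta> in
      if a = 1
      then ito_integral M T W (\<lambda>s \<omega>. f n s * mixed_integral_rev M T W f \<beta> s \<omega>)
      else (\<lambda>t \<omega>. LBINT s:{0..t}. f n s * f (n - 1) s * mixed_integral_rev M T W f \<beta> s \<omega>))"

definition mixed_integral ::
    "'a measure \<Rightarrow> real \<Rightarrow> (real \<Rightarrow> 'a \<Rightarrow> real) \<Rightarrow> (nat \<Rightarrow> real \<Rightarrow> real) \<Rightarrow> nat list \<Rightarrow> real \<Rightarrow> 'a \<Rightarrow> real"
  where
  "mixed_integral M T W f \<alpha> = mixed_integral_rev M T W f (rev \<alpha>)"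

lemma length_multi_indices:
  assumes "\<alpha> \<in> multi_indices n"
  shows "length \<alpha> \<le> n"
proof -
  have "set \<alpha> \<subseteq> {1, 2} \<Longrightarrow> length \<alpha> \<le> sum_list \<alpha>" for \<alpha> :: "nat list"
    by (induction \<alpha>) auto
  with assms show ?thesis
    by (auto simp: multi_indices_def)
qed

lemma finite_multi_indices: "finite (multi_indices n)"
proof (rule finite_subset)
  show "multi_indices n \<subseteq> {\<alpha>. set \<alpha> \<subseteq> {1, 2} \<and> length \<alpha> \<le> n}"
    using length_multi_indices by (auto simp: multi_indices_def)
  show "finite {\<alpha>. set \<alpha> \<subseteq> {1, 2 :: nat} \<and> length \<alpha> \<le> n}"
    by (rule finite_lists_length_le) simp
qed

end

theory Submission
  imports Defs
begin

text \<open>Let \<open>Z\<close> be a continuous adapted process that is \<open>L\<^sup>2\<close>-continuous in time. On each cell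
  \<open>{p\<^sub>i<..p\<^sub>i\<^sub>+\<^sub>1}\<close> write \<open>Z = Z(p\<^sub>i) + (Z - Z(p\<^sub>i))\<close>. The Stratonovich sum of \<open>f Z\<close> then becomes
  an elementary Ito integral, whose coefficients are the cell averages of \<open>f\<close> times \<open>Z(p\<^sub>i)\<close> and which
  converges to \<open>\<integral> f Z dW\<close>, plus a remainder. If \<open>Z\<close> is a Lebesgue integral, the remainder tends to
  \<open>0\<close>. If \<open>Z = \<integral> g U dW\<close>, then \<open>Z(s) - Z(p\<^sub>i)\<close> is close to \<open>\<xi>\<^sub>i (W(s) - W(p\<^sub>i))\<close>, where \<open>\<xi>\<^sub>i\<close> is the
  average of \<open>g\<close> times \<open>U(p\<^sub>i)\<close>. Given the past of \<open>p\<^sub>i\<close>, the mean of the product of \<open>W(s) - W(p\<^sub>i)\<close>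
  with the increment of \<open>W\<close> over the cell is \<open>s - p\<^sub>i\<close>, which averages to half the length of the cell,
  so the remainder tends to \<open>1/2 \<integral> f g U ds\<close>. All limits are in \<open>L\<^sup>1\<close>, uniformly in the partition.
  Thus a Stratonovich integration prepends to an index \<open>\<beta>\<close> of a mixed integral the entry \<open>1\<close> and, if
  \<open>\<beta>\<close> starts with \<open>1\<close>, also replaces this entry by \<open>2\<close> with the factor \<open>1/2\<close>. This is the recursion
  of the multi-indices.\<close>

section \<open>Integral bounds\<close>

text \<open>The \<open>f i\<close> lie only in L^2, so no pointwise bound on them is available.
  Errors are charged to integrals of squares over cells, which add up over a partition and are
  uniformly small on short intervals. Products of such a function with a process in L^2(\<Omega>)
  and an increment of W are controlled in L^1, by the Cauchy-Schwarz inequality on \<Omega> within a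
  cell and once more over the cells. The obstacle is the product of two increments of W on the same
  cell: its fluctuation has the order of the cell length, so absolute values would add up to
  something of order 1, and only the orthogonality of the centred products makes the sum small.

  Both stochastic integrals are defined by \<open>SOME\<close>. For the Ito integral the existence
  of a continuous version is proved, and afterwards it enters only through \<open>ito_limit\<close>,
  which every possible choice satisfies. For the Stratonovich integral the chosen process is
  identified with the constructed one by uniqueness up to indistinguishability.\<close>

text \<open>In \<open>L2le\<close> the constant bounds the square of the norm.\<close>

definition L1le :: "'b measure \<Rightarrow> ('b \<Rightarrow> real) \<Rightarrow> real \<Rightarrow> bool" where
  "L1le N g c \<longleftrightarrow> g \<in> borel_measurable N \<and> (\<integral>\<^sup>+x. ennreal \<bar>g x\<bar> \<partial>N) \<le> ennreal c"

definition L2le :: "'b measure \<Rightarrow> ('b \<Rightarrow> real) \<Rightarrow> real \<Rightarrow> bool" where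
  "L2le N g c \<longleftrightarrow> g \<in> borel_measurable N \<and> (\<integral>\<^sup>+x. ennreal ((g x)\<^sup>2) \<partial>N) \<le> ennreal c"

lemma L1le_measurable: "L1le N g c \<Longrightarrow> g \<in> borel_measurable N"
  by (simp add: L1le_def)

lemma L2le_measurable: "L2le N g c \<Longrightarrow> g \<in> borel_measurable N"
  by (simp add: L2le_def)

lemma L1le_mono: "L1le N g c \<Longrightarrow> c \<le> d \<Longrightarrow> L1le N g d"
  unfolding L1le_def by (meson ennreal_leI order_trans)

lemma L2le_mono: "L2le N g c \<Longrightarrow> c \<le> d \<Longrightarrow> L2le N g d"
  unfolding L2le_def by (meson ennreal_leI order_trans)

lemma L1le_cong:
  assumes "L1le N g c" "\<And>x. x \<in> space N \<Longrightarrow> g x = h x"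
  shows "L1le N h c"
proof -
  have "(\<integral>\<^sup>+x. ennreal \<bar>g x\<bar> \<partial>N) = (\<integral>\<^sup>+x. ennreal \<bar>h x\<bar> \<partial>N)"
    using assms(2) by (intro nn_integral_cong) simp
  then show ?thesis
    using assms measurable_cong[of N g h borel] by (simp add: L1le_def)
qed

lemma L2le_cong:
  assumes "L2le N g c" "\<And>x. x \<in> space N \<Longrightarrow> g x = h x"
  shows "L2le N h c"
proof -
  have "(\<integral>\<^sup>+x. ennreal ((g x)\<^sup>2) \<partial>N) = (\<integral>\<^sup>+x. ennreal ((h x)\<^sup>2) \<partial>N)"
    using assms(2) by (intro nn_integral_cong) simp
  then show ?thesis
    using assms measurable_cong[of N g h borel] by (simp add: L2le_def)
qed

lemma L1le_cong_AE:
  assumes "L1le N g c" "AE x in N. g x = h x" "h \<in> borel_measurable N"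
  shows "L1le N h c"
proof -
  have "(\<integral>\<^sup>+x. ennreal \<bar>g x\<bar> \<partial>N) = (\<integral>\<^sup>+x. ennreal \<bar>h x\<bar> \<partial>N)"
    using assms(2) by (intro nn_integral_cong_AE) auto
  then show ?thesis
    using assms by (simp add: L1le_def)
qed

lemma L2le_cong_AE:
  assumes "L2le N g c" "AE x in N. g x = h x" "h \<in> borel_measurable N"
  shows "L2le N h c"
proof -
  have "(\<integral>\<^sup>+x. ennreal ((g x)\<^sup>2) \<partial>N) = (\<integral>\<^sup>+x. ennreal ((h x)\<^sup>2) \<partial>N)"
    using assms(2) by (intro nn_integral_cong_AE) auto
  then show ?thesis
    using assms by (simp add: L2le_def)
qed

lemma L1le_zero: "0 \<le> c \<Longrightarrow> L1le N (\<lambda>_. 0) c"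
  by (simp add: L1le_def)

lemma L2le_zero: "0 \<le> c \<Longrightarrow> L2le N (\<lambda>_. 0) c"
  by (simp add: L2le_def)

lemma L1le_add:
  assumes "L1le N g a" "L1le N h b" "0 \<le> a" "0 \<le> b"
  shows "L1le N (\<lambda>x. g x + h x) (a + b)"
proof -
  have [measurable]: "g \<in> borel_measurable N" "h \<in> borel_measurable N"
    using assms by (auto simp: L1le_def)
  have "(\<integral>\<^sup>+x. ennreal \<bar>g x + h x\<bar> \<partial>N) \<le> (\<integral>\<^sup>+x. ennreal \<bar>g x\<bar> + ennreal \<bar>h x\<bar> \<partial>N)"
    by (intro nn_integral_mono) (simp add: abs_triangle_ineq flip: ennreal_plus)
  also have "\<dots> = (\<integral>\<^sup>+x. ennreal \<bar>g x\<bar> \<partial>N) + (\<integral>\<^sup>+x. ennreal \<bar>h x\<bar> \<partial>N)"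
    by (simp add: nn_integral_add)
  also have "\<dots> \<le> ennreal a + ennreal b"
    using assms by (intro add_mono) (auto simp: L1le_def)
  finally show ?thesis
    using assms by (simp add: L1le_def)
qed

lemma L1le_cmult:
  assumes "L1le N g c" "0 \<le> c"
  shows "L1le N (\<lambda>x. k * g x) (\<bar>k\<bar> * c)"
proof -
  have [measurable]: "g \<in> borel_measurable N"
    using assms by (auto simp: L1le_def)
  have "(\<integral>\<^sup>+x. ennreal \<bar>k * g x\<bar> \<partial>N) = ennreal \<bar>k\<bar> * (\<integral>\<^sup>+x. ennreal \<bar>g x\<bar> \<partial>N)"
    by (simp add: abs_mult ennreal_mult nn_integral_cmult)
  also have "\<dots> \<le> ennreal \<bar>k\<bar> * ennreal c"
    using assms by (intro mult_left_mono) (auto simp: L1le_def)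
  finally show ?thesis
    using assms by (simp add: L1le_def ennreal_mult)
qed

lemma L1le_sum:
  assumes "\<And>i. i \<in> I \<Longrightarrow> L1le N (g i) (c i)" "\<And>i. i \<in> I \<Longrightarrow> 0 \<le> c i"
  shows "L1le N (\<lambda>x. \<Sum>i\<in>I. g i x) (\<Sum>i\<in>I. c i)"
  using assms
proof (induction I rule: infinite_finite_induct)
  case (insert i I)
  then show ?case
    using L1le_add[of N "g i" "c i" "\<lambda>x. \<Sum>i\<in>I. g i x" "\<Sum>i\<in>I. c i"] by (simp add: sum_nonneg)
qed (simp_all add: L1le_zero)

lemma L2le_cmult:
  assumes "L2le N g c" "0 \<le> c"
  shows "L2le N (\<lambda>x. k * g x) (k\<^sup>2 * c)"
proof -
  have [measurable]: "g \<in> borel_measurable N"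
    using assms by (auto simp: L2le_def)
  have "(\<integral>\<^sup>+x. ennreal ((k * g x)\<^sup>2) \<partial>N) = ennreal (k\<^sup>2) * (\<integral>\<^sup>+x. ennreal ((g x)\<^sup>2) \<partial>N)"
    by (simp add: power_mult_distrib ennreal_mult nn_integral_cmult)
  also have "\<dots> \<le> ennreal (k\<^sup>2) * ennreal c"
    using assms by (intro mult_left_mono) (auto simp: L2le_def)
  finally show ?thesis
    using assms by (simp add: L2le_def ennreal_mult)
qed

text \<open>The triangle inequality for squared norms takes the form (u + v)^2 \<le> 2 u^2 + 2 v^2.
  The factors 2 that accumulate in later bounds come from here.\<close>

lemma L2le_add:
  assumes "L2le N g a" "L2le N h b" "0 \<le> a" "0 \<le> b"
  shows "L2le N (\<lambda>x. g x + h x) (2 * a + 2 * b)"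
proof -
  have [measurable]: "g \<in> borel_measurable N" "h \<in> borel_measurable N"
    using assms by (auto simp: L2le_def)
  have le: "(u + v)\<^sup>2 \<le> 2 * u\<^sup>2 + 2 * v\<^sup>2" for u v :: real
    using zero_le_power2[of "u - v"] by (simp add: power2_eq_square algebra_simps)
  have "(\<integral>\<^sup>+x. ennreal ((g x + h x)\<^sup>2) \<partial>N)
      \<le> (\<integral>\<^sup>+x. ennreal 2 * ennreal ((g x)\<^sup>2) + ennreal 2 * ennreal ((h x)\<^sup>2) \<partial>N)"
    using le by (intro nn_integral_mono) (simp flip: ennreal_mult ennreal_plus ennreal_numeral)
  also have "\<dots> = ennreal 2 * (\<integral>\<^sup>+x. ennreal ((g x)\<^sup>2) \<partial>N) + ennreal 2 * (\<integral>\<^sup>+x. ennreal ((h x)\<^sup>2) \<partial>N)"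
    by (simp add: nn_integral_add nn_integral_cmult del: ennreal_numeral)
  also have "\<dots> \<le> ennreal 2 * ennreal a + ennreal 2 * ennreal b"
    using assms by (intro add_mono mult_left_mono) (auto simp: L2le_def)
  also have "\<dots> = ennreal (2 * a + 2 * b)"
    using assms by (simp add: ennreal_mult del: ennreal_numeral)
  finally show ?thesis
    by (simp add: L2le_def)
qed

lemma L2le_diff:
  assumes "L2le N g a" "L2le N h b" "0 \<le> a" "0 \<le> b"
  shows "L2le N (\<lambda>x. g x - h x) (2 * a + 2 * b)"
  using L2le_add[OF assms(1) L2le_cmult[OF assms(2), of "-1"]] assms by simp

text \<open>Removes the square from the Cauchy-Schwarz inequality in [0,\<infinity>], which bounds
  the square of an integral. A negative \<open>r\<close> is read as 0 by
  \<open>ennreal\<close>.\<close>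

lemma ennreal_power2_le_imp_le:
  fixes x :: ennreal
  assumes "x\<^sup>2 \<le> (ennreal r)\<^sup>2"
  shows "x \<le> ennreal r"
proof (cases x)
  case (real q)
  then show ?thesis
    using assms power2_le_imp_le[of q "max 0 r"]
    by (cases "0 \<le> r") (auto simp: ennreal_power ennreal_neg max_def)
next
  case top
  then show ?thesis
    using assms by (auto simp: power2_eq_square ennreal_mult_eq_top_iff top_unique)
qed

lemma L1le_mult:
  assumes "L2le N g a" "L2le N h b" "0 \<le> a" "0 \<le> b"
  shows "L1le N (\<lambda>x. g x * h x) (sqrt (a * b))"
proof -
  have [measurable]: "g \<in> borel_measurable N" "h \<in> borel_measurable N"
    using assms by (auto simp: L2le_def)
  have "(\<integral>\<^sup>+x. ennreal \<bar>g x\<bar> * ennreal \<bar>h x\<bar> \<partial>N)\<^sup>2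
      \<le> (\<integral>\<^sup>+x. (ennreal \<bar>g x\<bar>)\<^sup>2 \<partial>N) * (\<integral>\<^sup>+x. (ennreal \<bar>h x\<bar>)\<^sup>2 \<partial>N)"
    by (rule Cauchy_Schwarz_nn_integral) measurable
  also have "\<dots> \<le> ennreal a * ennreal b"
    using assms by (intro mult_mono) (auto simp: L2le_def ennreal_power)
  also have "\<dots> = (ennreal (sqrt (a * b)))\<^sup>2"
    using assms by (simp add: ennreal_power ennreal_mult)
  finally have "(\<integral>\<^sup>+x. ennreal \<bar>g x\<bar> * ennreal \<bar>h x\<bar> \<partial>N) \<le> ennreal (sqrt (a * b))"
    by (rule ennreal_power2_le_imp_le)
  then show ?thesis
    by (simp add: L1le_def abs_mult ennreal_mult)
qed

text \<open>Cauchy-Schwarz against the constant 1, whose norm is 1 on a probability space.\<close>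

lemma (in prob_space) L2le_imp_L1le:
  assumes "L2le M g c" "0 \<le> c"
  shows "L1le M g (sqrt c)"
proof -
  have "L2le M (\<lambda>_. 1) 1"
    by (simp add: L2le_def emeasure_space_1)
  from L1le_mult[OF assms(1) this assms(2)] show ?thesis
    by simp
qed

lemma L2le_imp_integrable: "L2le N g c \<Longrightarrow> integrable N (\<lambda>x. (g x)\<^sup>2)"
  unfolding L2le_def by (intro integrableI_bounded) (auto simp: le_less_trans)

lemma L1le_imp_integrable: "L1le N g c \<Longrightarrow> integrable N g"
  unfolding L1le_def by (intro integrableI_bounded) (auto simp: le_less_trans)

lemma L2le_integral:
  assumes "g \<in> borel_measurable N" "integrable N (\<lambda>x. (g x)\<^sup>2)"
  shows "L2le N g (\<integral>x. (g x)\<^sup>2 \<partial>N)"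
  using assms by (simp add: L2le_def nn_integral_eq_integral)

lemma L2le_imp_integral_le:
  assumes "L2le N g c" "0 \<le> c"
  shows "(\<integral>x. (g x)\<^sup>2 \<partial>N) \<le> c"
  using assms L2le_imp_integrable[OF assms(1)]
  by (simp add: L2le_def nn_integral_eq_integral)

lemma L1le_imp_integral_le:
  assumes "L1le N g c" "0 \<le> c"
  shows "(\<integral>x. \<bar>g x\<bar> \<partial>N) \<le> c"
  using assms L1le_imp_integrable[OF assms(1)]
  by (simp add: L1le_def nn_integral_eq_integral)

lemma integrable_mult_of_squares:
  fixes g h :: "'b \<Rightarrow> real"
  assumes "g \<in> borel_measurable N" "integrable N (\<lambda>x. (g x)\<^sup>2)"
    "h \<in> borel_measurable N" "integrable N (\<lambda>x. (h x)\<^sup>2)"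
  shows "integrable N (\<lambda>x. g x * h x)"
  using L1le_mult[OF L2le_integral[OF assms(1,2)] L2le_integral[OF assms(3,4)]]
  by (auto intro: L1le_imp_integrable)

text \<open>Fatou's lemma for the squares. The bounds \<open>c k\<close> may vary with k, so that an
  error that vanishes along the sequence disappears from the bound on the limit.\<close>

lemma L2le_Fatou:
  assumes "\<And>k. L2le N (g k) (c k)" "AE x in N. (\<lambda>k. g k x) \<longlonglongrightarrow> h x" "c \<longlonglongrightarrow> d"
    and h[measurable]: "h \<in> borel_measurable N"
  shows "L2le N h d"
proof -
  have [measurable]: "g k \<in> borel_measurable N" for k
    using assms(1) by (simp add: L2le_def)
  have "(\<integral>\<^sup>+x. ennreal ((h x)\<^sup>2) \<partial>N) = (\<integral>\<^sup>+x. liminf (\<lambda>k. ennreal ((g k x)\<^sup>2)) \<partial>N)"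
    using assms(2)
    by (intro nn_integral_cong_AE)
      (auto elim!: eventually_mono intro!: lim_imp_Liminf[symmetric] tendsto_intros)
  also have "\<dots> \<le> liminf (\<lambda>k. \<integral>\<^sup>+x. ennreal ((g k x)\<^sup>2) \<partial>N)"
    by (intro nn_integral_liminf) measurable
  also have "\<dots> \<le> liminf (\<lambda>k. ennreal (c k))"
    using assms(1) by (intro Liminf_mono) (auto simp: L2le_def)
  also have "\<dots> = ennreal d"
    using assms(3) by (intro lim_imp_Liminf tendsto_intros) auto
  finally show ?thesis
    by (simp add: L2le_def)
qed

lemma L2le_0_AE:
  assumes "\<And>c. 0 < c \<Longrightarrow> L2le N g c"
  shows "AE x in N. g x = 0"
proof -
  have [measurable]: "g \<in> borel_measurable N"
    using assms[of 1] by (simp add: L2le_def)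
  have "(\<integral>\<^sup>+x. ennreal ((g x)\<^sup>2) \<partial>N) \<le> 0"
    by (rule ennreal_le_epsilon) (use assms in \<open>auto simp: L2le_def\<close>)
  then show ?thesis
    by (simp add: nn_integral_0_iff_AE)
qed

lemma L1le_pair:
  assumes "sigma_finite_measure \<Lambda>" "sigma_finite_measure N"
    and X[measurable]: "case_prod X \<in> borel_measurable (\<Lambda> \<Otimes>\<^sub>M N)"
    and le: "\<And>s. s \<in> space \<Lambda> \<Longrightarrow> L1le N (X s) (c s)"
    and c: "integrable \<Lambda> c" "\<And>s. s \<in> space \<Lambda> \<Longrightarrow> 0 \<le> c s"
  shows "L1le (\<Lambda> \<Otimes>\<^sub>M N) (case_prod X) (\<integral>s. c s \<partial>\<Lambda>)"
proof -
  interpret pair_sigma_finite \<Lambda> N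
    using assms by (simp add: pair_sigma_finite_def)
  have "(\<integral>\<^sup>+z. ennreal \<bar>case_prod X z\<bar> \<partial>(\<Lambda> \<Otimes>\<^sub>M N)) = (\<integral>\<^sup>+s. \<integral>\<^sup>+\<omega>. ennreal \<bar>X s \<omega>\<bar> \<partial>N \<partial>\<Lambda>)"
    by (subst M2.nn_integral_fst[symmetric]) auto
  also have "\<dots> \<le> (\<integral>\<^sup>+s. ennreal (c s) \<partial>\<Lambda>)"
    using le by (intro nn_integral_mono) (auto simp: L1le_def)
  also have "\<dots> = ennreal (\<integral>s. c s \<partial>\<Lambda>)"
    using c by (intro nn_integral_eq_integral) auto
  finally show ?thesis
    by (simp add: L1le_def)
qed

lemma L2le_pair:
  assumes "sigma_finite_measure \<Lambda>" "sigma_finite_measure N"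
    and X[measurable]: "case_prod X \<in> borel_measurable (\<Lambda> \<Otimes>\<^sub>M N)"
    and le: "\<And>s. s \<in> space \<Lambda> \<Longrightarrow> L2le N (X s) (c s)"
    and c: "integrable \<Lambda> c" "\<And>s. s \<in> space \<Lambda> \<Longrightarrow> 0 \<le> c s"
  shows "L2le (\<Lambda> \<Otimes>\<^sub>M N) (case_prod X) (\<integral>s. c s \<partial>\<Lambda>)"
proof -
  have "L1le (\<Lambda> \<Otimes>\<^sub>M N) (case_prod (\<lambda>s \<omega>. (X s \<omega>)\<^sup>2)) (\<integral>s. c s \<partial>\<Lambda>)"
    using assms by (intro L1le_pair) (auto simp: L1le_def L2le_def)
  then show ?thesis
    by (simp add: L1le_def L2le_def split_beta)
qed

lemma L1le_integral:
  assumes "sigma_finite_measure \<Lambda>" "sigma_finite_measure N"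
    and L1: "L1le (\<Lambda> \<Otimes>\<^sub>M N) (case_prod X) c"
  shows "L1le N (\<lambda>\<omega>. \<integral>s. X s \<omega> \<partial>\<Lambda>) c"
proof -
  interpret pair_sigma_finite \<Lambda> N
    using assms by (simp add: pair_sigma_finite_def)
  have X[measurable]: "case_prod X \<in> borel_measurable (\<Lambda> \<Otimes>\<^sub>M N)"
    using L1 by (simp add: L1le_def)
  have "(\<integral>\<^sup>+\<omega>. ennreal \<bar>\<integral>s. X s \<omega> \<partial>\<Lambda>\<bar> \<partial>N) \<le> (\<integral>\<^sup>+\<omega>. \<integral>\<^sup>+s. ennreal \<bar>X s \<omega>\<bar> \<partial>\<Lambda> \<partial>N)"
  proof (intro nn_integral_mono)
    fix \<omega> assume "\<omega> \<in> space N"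
    \<comment> \<open>On paths that are not integrable the Bochner integral is 0 by convention, so
      the bound holds there as well.\<close>
    show "ennreal \<bar>\<integral>s. X s \<omega> \<partial>\<Lambda>\<bar> \<le> (\<integral>\<^sup>+s. ennreal \<bar>X s \<omega>\<bar> \<partial>\<Lambda>)"
      using integral_norm_bound_ennreal[of \<Lambda> "\<lambda>s. X s \<omega>"]
      by (cases "integrable \<Lambda> (\<lambda>s. X s \<omega>)") (auto simp: not_integrable_integral_eq)
  qed
  also have "\<dots> = (\<integral>\<^sup>+z. ennreal \<bar>case_prod X z\<bar> \<partial>(\<Lambda> \<Otimes>\<^sub>M N))"
    by (subst nn_integral_snd[symmetric]) auto
  also have "\<dots> \<le> ennreal c"
    using L1 by (simp add: L1le_def)
  finally show ?thesis
    using M1.borel_measurable_lebesgue_integral[of "\<lambda>\<omega> s. X s \<omega>" N]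
    by (auto simp: L1le_def)
qed

section \<open>Brownian increments\<close>

text \<open>Here \<open>W\<close> starts at \<open>0\<close> and is continuous for every \<open>\<omega>\<close>. The general case reduces to this one by
  a modification on a null set, which changes neither the filtration nor any of the integrals.\<close>

locale brownian_motion = prob_space M for M :: "'a measure" +
  fixes T :: real and W :: "real \<Rightarrow> 'a \<Rightarrow> real"
  assumes T_pos: "0 < T"
    and bm: "standard_brownian_motion M T W"
    and W_0: "\<And>\<omega>. \<omega> \<in> space M \<Longrightarrow> W 0 \<omega> = 0"
    and W_cont: "\<And>\<omega>. \<omega> \<in> space M \<Longrightarrow> continuous_on {0..T} (\<lambda>t. W t \<omega>)"
begin

abbreviation F :: "real \<Rightarrow> 'a measure" where
  "F \<equiv> brownian_filtration M W"

section \<open>The augmented filtration\<close>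

lemma W_measurable: "0 \<le> t \<Longrightarrow> t \<le> T \<Longrightarrow> W t \<in> borel_measurable M"
  using bm by (auto simp: standard_brownian_motion_def)

lemma F_generator_subset:
  assumes "t \<le> T"
  shows "{W s -` A \<inter> space M | s A. s \<in> {0..t} \<and> A \<in> sets borel} \<union> null_sets M \<subseteq> sets M"
  using assms W_measurable by (auto intro!: measurable_sets[of _ M borel])

lemma space_F [simp]: "space (F t) = space M"
  by (simp add: brownian_filtration_def space_measure_of_conv)

lemma sets_F:
  assumes "t \<le> T"
  shows "sets (F t) = sigma_sets (space M)
    ({W s -` A \<inter> space M | s A. s \<in> {0..t} \<and> A \<in> sets borel} \<union> null_sets M)"
  unfolding brownian_filtration_def
  using order_trans[OF F_generator_subset[OF assms] sets.space_closed] by (rule sets_measure_of)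

lemma sets_F_subset: "t \<le> T \<Longrightarrow> sets (F t) \<subseteq> sets M"
  using sets.sigma_sets_subset[OF F_generator_subset] sets_F by blast

lemma sets_F_mono: "s \<le> t \<Longrightarrow> t \<le> T \<Longrightarrow> sets (F s) \<subseteq> sets (F t)"
  by (simp add: sets_F) (rule sigma_sets_mono', fastforce)

lemma measurable_F_imp_M: "g \<in> borel_measurable (F t) \<Longrightarrow> t \<le> T \<Longrightarrow> g \<in> borel_measurable M"
  using sets_F_subset by (auto simp: measurable_def)

lemma measurable_F_mono:
  "g \<in> borel_measurable (F s) \<Longrightarrow> s \<le> t \<Longrightarrow> t \<le> T \<Longrightarrow> g \<in> borel_measurable (F t)"
  using sets_F_mono by (auto simp: measurable_def)

lemma null_sets_F: "N \<in> null_sets M \<Longrightarrow> t \<le> T \<Longrightarrow> N \<in> sets (F t)"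
  by (auto simp: sets_F intro: sigma_sets.Basic)

lemma W_measurable_F:
  assumes "0 \<le> s" "s \<le> t" "t \<le> T"
  shows "W s \<in> borel_measurable (F t)"
proof (rule measurableI)
  fix A :: "real set" assume "A \<in> sets borel"
  then show "W s -` A \<inter> space (F t) \<in> sets (F t)"
    using assms by (auto simp: sets_F intro!: sigma_sets.Basic)
qed simp

text \<open>Uses the null sets in the filtration: off a null set \<open>N\<close> the preimages
  under \<open>g\<close> and \<open>h\<close> agree, and the part of the preimage under
  \<open>h\<close> inside \<open>N\<close> is itself a null set.\<close>

lemma measurable_F_cong_AE:
  assumes g: "g \<in> borel_measurable (F t)" and h: "h \<in> borel_measurable M"
    and ae: "AE \<omega> in M. g \<omega> = h \<omega>" and t: "t \<le> T"
  shows "h \<in> borel_measurable (F t)"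
proof -
  obtain N where N: "N \<in> null_sets M" "{\<omega> \<in> space M. g \<omega> \<noteq> h \<omega>} \<subseteq> N"
    using ae by (auto elim!: AE_E simp: null_sets_def)
  have "h -` A \<inter> space (F t) \<in> sets (F t)" if A: "A \<in> sets borel" for A
  proof -
    have "(h -` A \<inter> space M) \<inter> N \<in> null_sets M"
      using N(1) h A by (intro null_set_Int1) (auto intro: measurable_sets)
    then have "(h -` A \<inter> space M) \<inter> N \<in> sets (F t)" "N \<in> sets (F t)"
      using N(1) t null_sets_F by auto
    moreover have "g -` A \<inter> space (F t) \<in> sets (F t)"
      using g A by (rule measurable_sets)
    ultimately have "((g -` A \<inter> space (F t)) - N) \<union> ((h -` A \<inter> space M) \<inter> N) \<in> sets (F t)"
      by blast
    also have "((g -` A \<inter> space (F t)) - N) \<union> ((h -` A \<inter> space M) \<inter> N) = h -` A \<inter> space (F t)"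
      using N(2) by auto
    finally show ?thesis .
  qed
  then show ?thesis
    by (auto intro: measurableI)
qed

section \<open>Independence of a later increment from the past\<close>

lemma indep_increments:
  "(\<And>i. i < N \<Longrightarrow> p i < p (Suc i)) \<Longrightarrow> 0 \<le> p 0 \<Longrightarrow> p N \<le> T \<Longrightarrow>
    indep_vars (\<lambda>_. borel) (\<lambda>i \<omega>. W (p (Suc i)) \<omega> - W (p i) \<omega>) {..<N}"
  using bm by (auto simp: standard_brownian_motion_def)

text \<open>The values of W at finitely many times up to \<open>a\<close> are partial sums of the
  increments over the partition by these times, and W b - W a is one further increment. The
  independence of the increments over this single partition then splits the probability.\<close>

lemma prob_cylinder_increment:
  assumes ab: "0 \<le> a" "a < b" "b \<le> T" and I: "finite I" "I \<subseteq> {0..a}"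
    and A: "\<And>s. A s \<in> sets borel" and B: "B \<in> sets borel"
  shows "prob ({\<omega> \<in> space M. \<forall>s\<in>I. W s \<omega> \<in> A s} \<inter> ((\<lambda>\<omega>. W b \<omega> - W a \<omega>) -` B \<inter> space M)) =
    prob {\<omega> \<in> space M. \<forall>s\<in>I. W s \<omega> \<in> A s} * prob ((\<lambda>\<omega>. W b \<omega> - W a \<omega>) -` B \<inter> space M)"
proof -
  \<comment> \<open>The points 0 and \<open>a\<close> are added so that the partition starts where W
    vanishes and its last cell runs from \<open>a\<close> to \<open>b\<close>.\<close>
  define S where "S = {0, a} \<union> I"
  define L where "L = sorted_list_of_set S"
  define n where "n = length L - 1"
  define p where "p i = (if i \<le> n then L ! i else b)" for i
  define D where "D i \<omega> = W (p (Suc i)) \<omega> - W (p i) \<omega>" for i \<omega>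
  have S: "finite S" "S \<noteq> {}" "S \<subseteq> {0..a}" "0 \<in> S" "a \<in> S" "I \<subseteq> S"
    using I ab by (auto simp: S_def)
  have L: "set L = S" "sorted_wrt (<) L" "L \<noteq> []"
    using S by (auto simp: L_def)
  have len: "length L = Suc n"
    using L(3) by (cases L) (auto simp: n_def)
  have less: "L ! i < L ! j" if "i < j" "j \<le> n" for i j
    using L(2) that len by (simp add: sorted_wrt_iff_nth_less)
  have idx: "\<exists>j\<le>n. L ! j = s" if "s \<in> S" for s
    using that L(1) len by (auto simp: in_set_conv_nth less_Suc_eq_le)
  have mem: "L ! i \<in> {0..a}" if "i \<le> n" for i
    using that len L(1) S(3) nth_mem[of i L] by auto
  have p0: "p 0 = 0"
  proof -
    obtain j where "j \<le> n" "L ! j = 0" using idx[OF S(4)] by auto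
    then show ?thesis using less[of 0 j] mem[of 0] by (cases "j = 0") (auto simp: p_def)
  qed
  have pn: "p n = a"
  proof -
    obtain j where "j \<le> n" "L ! j = a" using idx[OF S(5)] by auto
    then show ?thesis using less[of j n] mem[of n] by (cases "j = n") (auto simp: p_def)
  qed
  have pSn: "p (Suc n) = b" by (simp add: p_def)
  have inc: "p i < p (Suc i)" if "i < Suc n" for i
    using that less[of i "Suc i"] pn pSn ab by (cases "i = n") (auto simp: p_def)
  have ind: "indep_vars (\<lambda>_. borel) D {..<Suc n}"
    unfolding D_def[abs_def] using inc p0 pSn ab by (intro indep_increments) auto
  obtain j where j: "\<And>s. s \<in> S \<Longrightarrow> j s \<le> n \<and> L ! j s = s"
    using idx by metis
  have W_sum: "W s \<omega> = (\<Sum>i<j s. D i \<omega>)" if "s \<in> S" "\<omega> \<in> space M" for s \<omega>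
  proof -
    have "(\<Sum>i<j s. D i \<omega>) = W (p (j s)) \<omega> - W (p 0) \<omega>"
      unfolding D_def by (rule sum_lessThan_telescope)
    then show ?thesis
      using j[OF that(1)] W_0[OF that(2)] p0 by (simp add: p_def)
  qed
  \<comment> \<open>The cylinder event in the coordinates of the increments: W s is the sum of the
    first \<open>j s\<close> of them.\<close>
  define E where "E = {x \<in> space (Pi\<^sub>M {..<n} (\<lambda>_. borel :: real measure)).
    \<forall>s\<in>I. (\<Sum>i<j s. x i) \<in> A s}"
  have E: "E \<in> sets (Pi\<^sub>M {..<n} (\<lambda>_. borel))"
    unfolding E_def
  proof (intro sets.sets_Collect_finite_All I)
    fix s assume "s \<in> I"
    then have "s \<in> S" using S(6) by auto
    then have "(\<lambda>x. \<Sum>i<j s. x i) \<in> borel_measurable (Pi\<^sub>M {..<n} (\<lambda>_. borel :: real measure))"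
      using j[of s] by (intro borel_measurable_sum measurable_component_singleton) auto
    from measurable_sets_Collect[OF this, of "\<lambda>y. y \<in> A s"] A[of s]
    show "{x \<in> space (Pi\<^sub>M {..<n} (\<lambda>_. borel)). (\<Sum>i<j s. x i) \<in> A s} \<in> sets (Pi\<^sub>M {..<n} (\<lambda>_. borel))"
      by simp
  qed
  define E' where "E' = {x \<in> space (Pi\<^sub>M {n} (\<lambda>_. borel :: real measure)). x n \<in> B}"
  have E': "E' \<in> sets (Pi\<^sub>M {n} (\<lambda>_. borel))"
  proof -
    have "(\<lambda>x. x n) \<in> borel_measurable (Pi\<^sub>M {n} (\<lambda>_. borel :: real measure))"
      by (rule measurable_component_singleton) simp
    from measurable_sets_Collect[OF this, of "\<lambda>y. y \<in> B"] B show ?thesis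
      by (simp add: E'_def)
  qed
  let ?X = "\<lambda>\<omega>. restrict (\<lambda>i. D i \<omega>) {..<n}" and ?Y = "\<lambda>\<omega>. restrict (\<lambda>i. D i \<omega>) {n}"
  have "indep_var (Pi\<^sub>M {..<n} (\<lambda>_. borel)) ?X (Pi\<^sub>M {n} (\<lambda>_. borel)) ?Y"
    using ind by (rule indep_var_restrict) auto
  from indep_varD[OF this E E']
  have "prob ((\<lambda>\<omega>. (?X \<omega>, ?Y \<omega>)) -` (E \<times> E') \<inter> space M) =
      prob (?X -` E \<inter> space M) * prob (?Y -` E' \<inter> space M)" .
  moreover have XE: "?X -` E \<inter> space M = {\<omega> \<in> space M. \<forall>s\<in>I. W s \<omega> \<in> A s}"
  proof -
    have "(\<Sum>i<j s. restrict (\<lambda>i. D i \<omega>) {..<n} i) = (\<Sum>i<j s. D i \<omega>)" if "s \<in> I" for s \<omega>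
      using j[of s] that S(6) by (intro sum.cong) auto
    then show ?thesis
      using W_sum S(6) by (auto simp: E_def space_PiM subset_iff)
  qed
  moreover have YE: "?Y -` E' \<inter> space M = (\<lambda>\<omega>. W b \<omega> - W a \<omega>) -` B \<inter> space M"
    by (auto simp: E'_def space_PiM D_def pn pSn)
  moreover have "(\<lambda>\<omega>. (?X \<omega>, ?Y \<omega>)) -` (E \<times> E') \<inter> space M =
      (?X -` E \<inter> space M) \<inter> (?Y -` E' \<inter> space M)"
    by auto
  ultimately show ?thesis
    by simp
qed

text \<open>A \<pi>-\<lambda> argument: the finite-dimensional cylinders together with the null sets
  are stable under intersection and generate F a. The product formula holds for cylinders by
  \<open>prob_cylinder_increment\<close> and for null sets because both sides are 0.\<close>

lemma indep_F_increment:
  assumes ab: "0 \<le> a" "a < b" "b \<le> T"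
  shows "indep_set (sets (F a))
    (sigma_sets (space M) {(\<lambda>\<omega>. W b \<omega> - W a \<omega>) -` B \<inter> space M | B. B \<in> sets borel})"
proof -
  define C where "C = {{\<omega> \<in> space M. \<forall>s\<in>I. W s \<omega> \<in> A s} | I A.
    finite I \<and> I \<subseteq> {0..a} \<and> (\<forall>s. A s \<in> sets (borel :: real measure))}"
  define D where "D = {(\<lambda>\<omega>. W b \<omega> - W a \<omega>) -` B \<inter> space M | B. B \<in> sets borel}"
  have aT: "a \<le> T" using ab by simp
  have CF: "C \<subseteq> sets (F a)"
  proof
    fix c assume "c \<in> C"
    then obtain I A where c: "c = {\<omega> \<in> space M. \<forall>s\<in>I. W s \<omega> \<in> A s}" "finite I" "I \<subseteq> {0..a}"
      "\<And>s. A s \<in> sets borel"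
      unfolding C_def by blast
    have "{\<omega> \<in> space (F a). \<forall>s\<in>I. W s \<omega> \<in> A s} \<in> sets (F a)"
    proof (intro sets.sets_Collect_finite_All c)
      fix s assume "s \<in> I"
      then have "W s \<in> borel_measurable (F a)"
        using c(3) aT by (intro W_measurable_F) auto
      from measurable_sets_Collect[OF this, of "\<lambda>y. y \<in> A s"] c(4)[of s]
      show "{\<omega> \<in> space (F a). W s \<omega> \<in> A s} \<in> sets (F a)" by simp
    qed
    then show "c \<in> sets (F a)" using c(1) by simp
  qed
  have nullF: "null_sets M \<subseteq> sets (F a)"
    using null_sets_F aT by auto
  have gen: "sigma_sets (space M) (C \<union> null_sets M) = sets (F a)"
  proof
    have "sigma_sets (space (F a)) (C \<union> null_sets M) \<subseteq> sets (F a)"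
      by (rule sets.sigma_sets_subset) (use CF nullF in auto)
    then show "sigma_sets (space M) (C \<union> null_sets M) \<subseteq> sets (F a)" by simp
    show "sets (F a) \<subseteq> sigma_sets (space M) (C \<union> null_sets M)"
      unfolding sets_F[OF aT]
    proof (rule sigma_sets_mono', safe)
      fix s :: real and A :: "real set" assume s: "s \<in> {0..a}" and A: "A \<in> sets borel" and n: "W s -` A \<inter> space M \<notin> null_sets M"
      have "W s -` A \<inter> space M = {\<omega> \<in> space M. \<forall>r\<in>{s}. W r \<omega> \<in> (\<lambda>_. A) r}" by auto
      then show "W s -` A \<inter> space M \<in> C"
        unfolding C_def using s A
        by (intro CollectI exI[of _ "{s}"] exI[of _ "\<lambda>_. A"] conjI) auto
    qed
  qed
  have stable: "Int_stable (C \<union> null_sets M)"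
  proof (rule Int_stableI)
    fix x y assume x: "x \<in> C \<union> null_sets M" and y: "y \<in> C \<union> null_sets M"
    have ev: "x \<in> sets M" "y \<in> sets M"
      using x y CF sets_F_subset[OF aT] by auto
    show "x \<inter> y \<in> C \<union> null_sets M"
    proof (cases "x \<in> null_sets M \<or> y \<in> null_sets M")
      case True
      then show ?thesis using ev null_set_Int1[of y M x] null_set_Int1[of x M y]
        by (auto simp: Int_commute)
    next
      case False
      with x y obtain I A J B where xy: "x = {\<omega> \<in> space M. \<forall>s\<in>I. W s \<omega> \<in> A s}" "finite I" "I \<subseteq> {0..a}"
        "\<forall>s. A s \<in> sets borel" "y = {\<omega> \<in> space M. \<forall>s\<in>J. W s \<omega> \<in> B s}" "finite J" "J \<subseteq> {0..a}"
        "\<forall>s. B s \<in> sets borel"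
        unfolding C_def by blast
      \<comment> \<open>The conditions of the two cylinders are merged time by time; a time absent
        from one of them receives the void condition \<open>UNIV\<close> from it.\<close>
      let ?A = "\<lambda>s. (if s \<in> I then A s else UNIV) \<inter> (if s \<in> J then B s else UNIV)"
      have "x \<inter> y = {\<omega> \<in> space M. \<forall>s\<in>I \<union> J. W s \<omega> \<in> ?A s}"
        unfolding xy by auto
      moreover have "\<forall>s. ?A s \<in> sets borel" using xy by auto
      ultimately show ?thesis
        unfolding C_def using xy(2,3,6,7)
        by (intro UnI1 CollectI exI[of _ "I \<union> J"] exI[of _ ?A] conjI) simp_all
    qed
  qed
  have stableD: "Int_stable D"
  proof (rule Int_stableI)
    fix x y assume "x \<in> D" "y \<in> D"
    then obtain A B where "x = (\<lambda>\<omega>. W b \<omega> - W a \<omega>) -` A \<inter> space M"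
      "y = (\<lambda>\<omega>. W b \<omega> - W a \<omega>) -` B \<inter> space M" "A \<in> sets borel" "B \<in> sets borel"
      unfolding D_def by blast
    then show "x \<inter> y \<in> D"
      unfolding D_def by (auto intro!: exI[of _ "A \<inter> B"])
  qed
  have Dev: "D \<subseteq> events"
  proof -
    have "(\<lambda>\<omega>. W b \<omega> - W a \<omega>) \<in> borel_measurable M"
      using ab by (intro borel_measurable_diff W_measurable) auto
    then show ?thesis unfolding D_def by (auto intro: measurable_sets)
  qed
  have "indep_set (C \<union> null_sets M) D"
  proof (rule indep_setI)
    show "C \<union> null_sets M \<subseteq> events" using CF sets_F_subset[OF aT] by auto
    show "D \<subseteq> events" by fact
    fix x y assume x: "x \<in> C \<union> null_sets M" and y: "y \<in> D"
    show "prob (x \<inter> y) = prob x * prob y"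
    proof (cases "x \<in> null_sets M")
      case True
      then have "x \<inter> y \<in> null_sets M" using y Dev by (auto intro: null_set_Int2)
      then show ?thesis using True by (simp add: measure_eq_0_null_sets)
    next
      case False
      with x obtain I A where "x = {\<omega> \<in> space M. \<forall>s\<in>I. W s \<omega> \<in> A s}" "finite I" "I \<subseteq> {0..a}"
        "\<forall>s. A s \<in> sets borel"
        unfolding C_def by blast
      moreover from y obtain B where "y = (\<lambda>\<omega>. W b \<omega> - W a \<omega>) -` B \<inter> space M" "B \<in> sets borel"
        unfolding D_def by blast
      ultimately show ?thesis using prob_cylinder_increment[OF ab, of I A B] by auto
    qed
  qed
  from indep_set_sigma_sets[OF this stable stableD] show ?thesis
    unfolding gen D_def .
qed

lemma indep_var_F_increment:
  assumes ab: "0 \<le> a" "a < b" "b \<le> T" and g: "g \<in> borel_measurable (F a)"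
  shows "indep_var borel g borel (\<lambda>\<omega>. W b \<omega> - W a \<omega>)"
  unfolding indep_var_eq
proof (intro conjI)
  show "random_variable borel g"
    using measurable_F_imp_M[OF g] ab by simp
  show "random_variable borel (\<lambda>\<omega>. W b \<omega> - W a \<omega>)"
    using ab by (intro borel_measurable_diff W_measurable) auto
  have "sigma_sets (space (F a)) {g -` A \<inter> space M | A. A \<in> sets borel} \<subseteq> sets (F a)"
    using measurable_sets[OF g] by (intro sets.sigma_sets_subset) auto
  then have sub: "sigma_sets (space M) {g -` A \<inter> space M | A. A \<in> sets borel} \<subseteq> sets (F a)"
    by simp
  note ind = indep_F_increment[OF ab]
  show "indep_set (sigma_sets (space M) {g -` A \<inter> space M | A. A \<in> sets borel})
    (sigma_sets (space M) {(\<lambda>\<omega>. W b \<omega> - W a \<omega>) -` B \<inter> space M | B. B \<in> sets borel})"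
  proof (rule indep_setI)
    show "sigma_sets (space M) {g -` A \<inter> space M | A. A \<in> sets borel} \<subseteq> events"
      using sub indep_setD_ev1[OF ind] by auto
  qed (use indep_setD_ev2[OF ind] indep_setD[OF ind] sub in auto)
qed

section \<open>Moments of products with an increment\<close>

lemma increment_moment:
  assumes ab: "0 \<le> a" "a < b" "b \<le> T"
  shows "integrable M (\<lambda>\<omega>. (W b \<omega> - W a \<omega>) ^ k)"
    and "expectation (\<lambda>\<omega>. (W b \<omega> - W a \<omega>) ^ k) =
      (\<integral>x. normal_density 0 (sqrt (b - a)) x * x ^ k \<partial>lborel)"
proof -
  have D: "distributed M lborel (\<lambda>\<omega>. W b \<omega> - W a \<omega>) (normal_density 0 (sqrt (b - a)))"
    using bm ab by (auto simp: standard_brownian_motion_def)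
  show "integrable M (\<lambda>\<omega>. (W b \<omega> - W a \<omega>) ^ k)"
    using distributed_integrable[OF D, of "\<lambda>x. x ^ k"] integrable_normal_moment[of "sqrt (b - a)" 0 k] ab
    by simp
  show "expectation (\<lambda>\<omega>. (W b \<omega> - W a \<omega>) ^ k) =
      (\<integral>x. normal_density 0 (sqrt (b - a)) x * x ^ k \<partial>lborel)"
    using distributed_integral[OF D, of "\<lambda>x. x ^ k"] by simp
qed

lemma integrable_mult_increment:
  assumes ab: "0 \<le> a" "a \<le> b" "b \<le> T" and g: "g \<in> borel_measurable (F a)" "integrable M g"
  shows "integrable M (\<lambda>\<omega>. g \<omega> * (W b \<omega> - W a \<omega>) ^ k)"
proof (cases "a = b")
  case True
  then show ?thesis using g by (cases k) auto
next
  case False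
  then have ab': "a < b" using ab by simp
  have "indep_var borel (id \<circ> g) borel ((\<lambda>x. x ^ k) \<circ> (\<lambda>\<omega>. W b \<omega> - W a \<omega>))"
    by (rule indep_var_compose[OF indep_var_F_increment[OF ab(1) ab' ab(3) g(1)]]) auto
  then show ?thesis
    using indep_var_integrable[OF _ g(2) increment_moment(1)[OF ab(1) ab' ab(3), of k]] by (simp add: comp_def)
qed

lemma expectation_mult_increment_power:
  assumes ab: "0 \<le> a" "a < b" "b \<le> T" and g: "g \<in> borel_measurable (F a)" "integrable M g"
  shows "expectation (\<lambda>\<omega>. g \<omega> * (W b \<omega> - W a \<omega>) ^ k) =
    expectation g * (\<integral>x. normal_density 0 (sqrt (b - a)) x * x ^ k \<partial>lborel)"
proof -
  have "indep_var borel (id \<circ> g) borel ((\<lambda>x. x ^ k) \<circ> (\<lambda>\<omega>. W b \<omega> - W a \<omega>))"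
    by (rule indep_var_compose[OF indep_var_F_increment[OF ab g(1)]]) auto
  then show ?thesis
    using indep_var_lebesgue_integral[OF _ g(2) increment_moment(1)[OF ab, of k]] increment_moment(2)[OF ab, of k]
    by (simp add: comp_def)
qed

lemma expectation_mult_increment:
  assumes ab: "0 \<le> a" "a \<le> b" "b \<le> T" and g: "g \<in> borel_measurable (F a)" "integrable M g"
  shows "expectation (\<lambda>\<omega>. g \<omega> * (W b \<omega> - W a \<omega>)) = 0"
    and "expectation (\<lambda>\<omega>. g \<omega> * (W b \<omega> - W a \<omega>)\<^sup>2) = expectation g * (b - a)"
    and "expectation (\<lambda>\<omega>. g \<omega> * (W b \<omega> - W a \<omega>) ^ 4) = expectation g * (3 * (b - a)\<^sup>2)"
proof -
  show "expectation (\<lambda>\<omega>. g \<omega> * (W b \<omega> - W a \<omega>)) = 0"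
    using expectation_mult_increment_power[OF ab(1) _ ab(3) g, of 1]
      integral_normal_moment_odd[of "sqrt (b - a)" 0 0] ab
    by (cases "a = b") auto
  show "expectation (\<lambda>\<omega>. g \<omega> * (W b \<omega> - W a \<omega>)\<^sup>2) = expectation g * (b - a)"
    using expectation_mult_increment_power[OF ab(1) _ ab(3) g, of 2]
      integral_normal_moment_even[of "sqrt (b - a)" 0 1] ab
    by (cases "a = b") auto
  \<comment> \<open>The constant 3 is the fourth moment of the standard normal distribution.\<close>
  show "expectation (\<lambda>\<omega>. g \<omega> * (W b \<omega> - W a \<omega>) ^ 4) = expectation g * (3 * (b - a)\<^sup>2)"
    using expectation_mult_increment_power[OF ab(1) _ ab(3) g, of 4]
      integral_normal_moment_even[of "sqrt (b - a)" 0 2] ab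
    by (cases "a = b") (auto simp: fact_numeral power2_eq_square)
qed

text \<open>The longer increment is split at the end of the shorter one. The product becomes the
  square of the shorter increment plus its product with a later increment, which has mean 0 given
  the past; hence the minimum.\<close>

lemma expectation_mult_two_increments:
  assumes "0 \<le> c" "c \<le> b" "b \<le> T" "c \<le> d" "d \<le> T"
    and g: "g \<in> borel_measurable (F c)" "integrable M g"
  shows "integrable M (\<lambda>\<omega>. g \<omega> * ((W b \<omega> - W c \<omega>) * (W d \<omega> - W c \<omega>)))"
    and "expectation (\<lambda>\<omega>. g \<omega> * ((W b \<omega> - W c \<omega>) * (W d \<omega> - W c \<omega>))) = expectation g * (min b d - c)"
proof -
  have *: "integrable M (\<lambda>\<omega>. g \<omega> * ((W b \<omega> - W c \<omega>) * (W d \<omega> - W c \<omega>))) \<and>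
    expectation (\<lambda>\<omega>. g \<omega> * ((W b \<omega> - W c \<omega>) * (W d \<omega> - W c \<omega>))) = expectation g * (b - c)"
    if "b \<le> d" "c \<le> b" "d \<le> T" for b d
  proof -
    have cT: "0 \<le> c" "c \<le> T" "b \<le> T" "0 \<le> b" using that assms by auto
    have m: "(\<lambda>\<omega>. g \<omega> * (W b \<omega> - W c \<omega>)) \<in> borel_measurable (F b)"
      using g that cT by (intro borel_measurable_times borel_measurable_diff W_measurable_F)
        (auto intro: measurable_F_mono)
    have i: "integrable M (\<lambda>\<omega>. g \<omega> * (W b \<omega> - W c \<omega>))"
      using integrable_mult_increment[of c b g 1] that cT g by simp
    have i1: "integrable M (\<lambda>\<omega>. g \<omega> * (W b \<omega> - W c \<omega>)\<^sup>2)"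
      using integrable_mult_increment[of c b g 2] that cT g by simp
    have i2: "integrable M (\<lambda>\<omega>. (g \<omega> * (W b \<omega> - W c \<omega>)) * (W d \<omega> - W b \<omega>))"
      using integrable_mult_increment[OF _ _ _ m i, of d 1] that cT by simp
    have eq: "g \<omega> * ((W b \<omega> - W c \<omega>) * (W d \<omega> - W c \<omega>)) =
      g \<omega> * (W b \<omega> - W c \<omega>)\<^sup>2 + (g \<omega> * (W b \<omega> - W c \<omega>)) * (W d \<omega> - W b \<omega>)" for \<omega>
      by (simp add: power2_eq_square algebra_simps)
    show ?thesis
      unfolding eq using i1 i2 expectation_mult_increment(2)[of c b g] that cT g
        expectation_mult_increment(1)[OF _ _ _ m i, of d]
      by simp
  qed
  have sym: "(W b \<omega> - W c \<omega>) * (W d \<omega> - W c \<omega>) = (W d \<omega> - W c \<omega>) * (W b \<omega> - W c \<omega>)" for \<omega>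
    by simp
  show "integrable M (\<lambda>\<omega>. g \<omega> * ((W b \<omega> - W c \<omega>) * (W d \<omega> - W c \<omega>)))"
    using *[of b d] *[of d b] assms by (cases "b \<le> d") (auto simp: mult.commute)
  show "expectation (\<lambda>\<omega>. g \<omega> * ((W b \<omega> - W c \<omega>) * (W d \<omega> - W c \<omega>))) = expectation g * (min b d - c)"
  proof (cases "b \<le> d")
    case False
    then show ?thesis using *[of d b] assms unfolding sym by auto
  qed (use *[of b d] assms in auto)
qed

end

section \<open>Elementary integrals\<close>

text \<open>An elementary process is a list of triples \<open>(a, b, \<xi>)\<close>, each standing for \<open>\<xi>\<close> on \<open>{a<..b}\<close>. The
  intervals may overlap, so that differences of processes are concatenations of lists and no common
  refinement of partitions is needed.\<close>

definition elem_process :: "(real \<times> real \<times> ('a \<Rightarrow> real)) list \<Rightarrow> real \<Rightarrow> 'a \<Rightarrow> real" where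
  "elem_process L s \<omega> = (\<Sum>(a, b, \<xi>)\<leftarrow>L. \<xi> \<omega> * indicator {a<..b} s)"

definition elem_integral :: "(real \<Rightarrow> 'a \<Rightarrow> real) \<Rightarrow> (real \<times> real \<times> ('a \<Rightarrow> real)) list \<Rightarrow> 'a \<Rightarrow> real" where
  "elem_integral W L \<omega> = (\<Sum>(a, b, \<xi>)\<leftarrow>L. \<xi> \<omega> * (W b \<omega> - W a \<omega>))"

text \<open>The nested maxima keep the triples ordered: an interval that misses {s<..t} collapses to
  an empty one. The left endpoint moves only to the right, so the coefficient stays measurable
  there.\<close>

definition elem_restrict :: "real \<Rightarrow> real \<Rightarrow> (real \<times> real \<times> ('a \<Rightarrow> real)) list \<Rightarrow> (real \<times> real \<times> ('a \<Rightarrow> real)) list" where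
  "elem_restrict s t L = map (\<lambda>(a, b, \<xi>). (max s a, max (max s a) (min t b), \<xi>)) L"

definition elem_neg :: "(real \<times> real \<times> ('a \<Rightarrow> real)) list \<Rightarrow> (real \<times> real \<times> ('a \<Rightarrow> real)) list" where
  "elem_neg L = map (\<lambda>(a, b, \<xi>). (a, b, \<lambda>\<omega>. - \<xi> \<omega>)) L"

lemma elem_simps [simp]:
  "elem_process [] s \<omega> = 0" "elem_integral W [] \<omega> = 0" "elem_restrict s t [] = []" "elem_neg [] = []"
  "elem_process (L @ L') s \<omega> = elem_process L s \<omega> + elem_process L' s \<omega>"
  "elem_integral W (L @ L') \<omega> = elem_integral W L \<omega> + elem_integral W L' \<omega>"
  "elem_restrict s t (L @ L') = elem_restrict s t L @ elem_restrict s t L'"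
  by (simp_all add: elem_process_def elem_integral_def elem_restrict_def elem_neg_def)

lemma elem_Cons:
  "elem_process ((a, b, \<xi>) # L) s \<omega> = \<xi> \<omega> * indicator {a<..b} s + elem_process L s \<omega>"
  "elem_integral W ((a, b, \<xi>) # L) \<omega> = \<xi> \<omega> * (W b \<omega> - W a \<omega>) + elem_integral W L \<omega>"
  "elem_restrict s t ((a, b, \<xi>) # L) = (max s a, max (max s a) (min t b), \<xi>) # elem_restrict s t L"
  "elem_neg ((a, b, \<xi>) # L) = (a, b, \<lambda>\<omega>. - \<xi> \<omega>) # elem_neg L"
  by (simp_all add: elem_process_def elem_integral_def elem_restrict_def elem_neg_def)

lemma elem_neg_simps [simp]:
  "elem_process (elem_neg L) s \<omega> = - elem_process L s \<omega>" "elem_integral W (elem_neg L) \<omega> = - elem_integral W L \<omega>"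
  "elem_restrict s t (elem_neg L) = elem_neg (elem_restrict s t L)"
  by (induction L) (auto simp: elem_Cons)

lemma elem_process_restr: "elem_process (elem_restrict s t L) r \<omega> = indicator {s<..t} r * elem_process L r \<omega>"
  by (induction L) (auto simp: elem_Cons indicator_def algebra_simps)

text \<open>Translates the convergence to 0 in [0,\<infinity>], in which
  \<open>has_ito_integral\<close> is stated, into bounds with real constants, to which the rules for
  \<open>L2le\<close> apply.\<close>

lemma L2le_eventually_iff:
  assumes [measurable]: "\<And>k. g k \<in> borel_measurable N"
  shows "(\<lambda>k. \<integral>\<^sup>+x. ennreal ((g k x)\<^sup>2) \<partial>N) \<longlonglongrightarrow> 0 \<longleftrightarrow>
    (\<forall>\<epsilon>>0. \<forall>\<^sub>F k in sequentially. L2le N (g k) \<epsilon>)"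
proof
  assume lim: "(\<lambda>k. \<integral>\<^sup>+x. ennreal ((g k x)\<^sup>2) \<partial>N) \<longlonglongrightarrow> 0"
  show "\<forall>\<epsilon>>0. \<forall>\<^sub>F k in sequentially. L2le N (g k) \<epsilon>"
  proof safe
    fix \<epsilon> :: real assume "0 < \<epsilon>"
    then show "\<forall>\<^sub>F k in sequentially. L2le N (g k) \<epsilon>"
      using order_tendstoD(2)[OF lim, of "ennreal \<epsilon>"] by (auto elim!: eventually_mono simp: L2le_def)
  qed
next
  assume ev: "\<forall>\<epsilon>>0. \<forall>\<^sub>F k in sequentially. L2le N (g k) \<epsilon>"
  show "(\<lambda>k. \<integral>\<^sup>+x. ennreal ((g k x)\<^sup>2) \<partial>N) \<longlonglongrightarrow> 0"
  proof (rule order_tendstoI)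
    \<comment> \<open>The level \<open>a\<close> may be infinite; a positive real number below it is
      taken as \<epsilon>.\<close>
    fix a :: ennreal assume "0 < a"
    then obtain \<epsilon> where \<epsilon>: "0 < ennreal \<epsilon>" "ennreal \<epsilon> < a" "0 < \<epsilon>"
      using dense[of 0 a] by (metis ennreal_cases ennreal_less_zero_iff less_top top.not_eq_extremum order_less_le_trans top_greatest order_less_irrefl)
    then have "\<forall>\<^sub>F k in sequentially. L2le N (g k) \<epsilon>" using ev by simp
    then show "\<forall>\<^sub>F k in sequentially. (\<integral>\<^sup>+x. ennreal ((g k x)\<^sup>2) \<partial>N) < a"
      by eventually_elim (use \<epsilon> in \<open>auto simp: L2le_def\<close>)
  qed simp
qed

lemma finite_measure_Icc: "finite_measure (lborel_Icc T)"
  by (rule finite_measureI, cases "0 \<le> T") (auto simp: emeasure_restrict_space)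

text \<open>The maximum covers intervals with b < a, which are empty; they arise as intersections of
  two disjoint intervals.\<close>

lemma integral_indicator_Icc:
  assumes "0 \<le> a" "b \<le> T"
  shows "(\<integral>s. indicator {a<..b} s \<partial>lborel_Icc T) = max 0 (b - a)"
proof -
  have "(\<integral>s. (indicator {a<..b} s :: real) \<partial>lborel_Icc T) = (\<integral>s. indicator {0..T} s *\<^sub>R indicator {a<..b} s \<partial>lborel)"
    by (rule integral_restrict_space) auto
  also have "\<dots> = (\<integral>s. indicator {a<..b} s \<partial>(lborel :: real measure))"
    using assms by (intro Bochner_Integration.integral_cong) (auto simp: indicator_def)
  also have "\<dots> = max 0 (b - a)"
    by (cases "a \<le> b") auto
  finally show ?thesis .
qed

context brownian_motion
begin

abbreviation "P \<equiv> lborel_Icc T \<Otimes>\<^sub>M M"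

sublocale time: finite_measure "lborel_Icc T"
  by (rule finite_measure_Icc)

sublocale time_space: pair_sigma_finite "lborel_Icc T" M ..

definition adapted :: "(real \<times> real \<times> ('a \<Rightarrow> real)) list \<Rightarrow> bool" where
  "adapted L \<longleftrightarrow> (\<forall>(a, b, \<xi>)\<in>set L. 0 \<le> a \<and> a \<le> b \<and> b \<le> T \<and>
     \<xi> \<in> borel_measurable (F a) \<and> integrable M (\<lambda>\<omega>. (\<xi> \<omega>)\<^sup>2))"

lemma adapted_simps [simp]:
  "adapted []"
  "adapted ((a, b, \<xi>) # L) \<longleftrightarrow> 0 \<le> a \<and> a \<le> b \<and> b \<le> T \<and> \<xi> \<in> borel_measurable (F a) \<and>
     integrable M (\<lambda>\<omega>. (\<xi> \<omega>)\<^sup>2) \<and> adapted L"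
  "adapted (L @ L') \<longleftrightarrow> adapted L \<and> adapted L'"
  by (simp_all add: adapted_def ball_Un)

lemma adapted_neg [simp]: "adapted L \<Longrightarrow> adapted (elem_neg L)"
  by (induction L) (auto simp: elem_Cons)

lemma adapted_restr:
  assumes "adapted L" "0 \<le> s" "s \<le> T" "t \<le> T"
  shows "adapted (elem_restrict s t L)"
  using assms(1)
proof (induction L)
  case (Cons x L)
  then show ?case using assms
    by (cases x) (auto simp: elem_Cons intro: measurable_F_mono)
qed simp

lemma elem_process_measurable:
  assumes "adapted L"
  shows "case_prod (elem_process L) \<in> borel_measurable P"
  using assms
proof (induction L)
  case Nil
  have "case_prod (elem_process []) = (\<lambda>_. 0 :: real)" by (auto simp: fun_eq_iff)
  then show ?case by simp
next
  case (Cons x L)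
  obtain a b \<xi> where x: "x = (a, b, \<xi>)" by (cases x)
  have [measurable]: "\<xi> \<in> borel_measurable M"
    using Cons.prems x by (auto intro: measurable_F_imp_M[of _ a])
  have [measurable]: "case_prod (elem_process L) \<in> borel_measurable P" "indicator {a<..b} \<in> borel_measurable (lborel_Icc T)"
    using Cons x by (auto intro: measurable_restrict_space1)
  have "case_prod (elem_process (x # L)) =
    (\<lambda>z. \<xi> (snd z) * indicator {a<..b} (fst z) + case_prod (elem_process L) z)"
    by (auto simp: fun_eq_iff x elem_Cons)
  also have "\<dots> \<in> borel_measurable P" by measurable
  finally show ?case .
qed

lemma elem_integral_measurable:
  assumes "adapted L"
  shows "elem_integral W L \<in> borel_measurable M"
  using assms
proof (induction L)
  case Nil
  have "elem_integral W [] = (\<lambda>_. 0)" by (auto simp: fun_eq_iff)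
  then show ?case by simp
next
  case (Cons x L)
  obtain a b \<xi> where x: "x = (a, b, \<xi>)" by (cases x)
  have [measurable]: "\<xi> \<in> borel_measurable M" "W a \<in> borel_measurable M" "W b \<in> borel_measurable M"
    "elem_integral W L \<in> borel_measurable M"
    using Cons x by (auto intro: measurable_F_imp_M[of _ a] W_measurable)
  have "elem_integral W (x # L) = (\<lambda>\<omega>. \<xi> \<omega> * (W b \<omega> - W a \<omega>) + elem_integral W L \<omega>)"
    by (auto simp: fun_eq_iff x elem_Cons)
  then show ?case by simp
qed

section \<open>The Ito isometry for elementary processes\<close>

lemma integral_time_space_product:
  fixes u :: "real \<Rightarrow> real" and v :: "'a \<Rightarrow> real"
  assumes u: "integrable (lborel_Icc T) u" and v: "integrable M v"
  shows "integrable P (\<lambda>(s, \<omega>). u s * v \<omega>)"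
    and "(\<integral>(s, \<omega>). u s * v \<omega> \<partial>P) = (\<integral>s. u s \<partial>lborel_Icc T) * expectation v"
proof -
  have [measurable]: "u \<in> borel_measurable (lborel_Icc T)" "v \<in> borel_measurable M"
    using u v by auto
  show i: "integrable P (\<lambda>(s, \<omega>). u s * v \<omega>)"
    by (rule time_space.Fubini_integrable) (use u v in \<open>auto simp: abs_mult\<close>)
  show "(\<integral>(s, \<omega>). u s * v \<omega> \<partial>P) = (\<integral>s. u s \<partial>lborel_Icc T) * expectation v"
    using time_space.integral_fst[OF i] by simp
qed

text \<open>Only the overlap of the two intervals contributes. The part of the first interval before
  \<open>c\<close> yields a factor measurable at time \<open>c\<close>, against which the second
  increment has mean 0; what remains are two increments that both start at \<open>c\<close>.\<close>

lemma covariance_increments_aux: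
  assumes x: "adapted [(a, b, \<xi>)]" and y: "adapted [(c, d, \<eta>)]" and ac: "a \<le> c"
  shows "integrable M (\<lambda>\<omega>. (\<xi> \<omega> * (W b \<omega> - W a \<omega>)) * (\<eta> \<omega> * (W d \<omega> - W c \<omega>)))"
    and "expectation (\<lambda>\<omega>. (\<xi> \<omega> * (W b \<omega> - W a \<omega>)) * (\<eta> \<omega> * (W d \<omega> - W c \<omega>))) =
      expectation (\<lambda>\<omega>. \<xi> \<omega> * \<eta> \<omega>) * max 0 (min b d - c)"
proof -
  have facts: "0 \<le> a" "a \<le> b" "b \<le> T" "0 \<le> c" "c \<le> d" "d \<le> T" "a \<le> T" "c \<le> T"
    and \<xi>: "\<xi> \<in> borel_measurable (F a)" "integrable M (\<lambda>\<omega>. (\<xi> \<omega>)\<^sup>2)"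
    and \<eta>: "\<eta> \<in> borel_measurable (F c)" "integrable M (\<lambda>\<omega>. (\<eta> \<omega>)\<^sup>2)"
    using x y by auto
  have [measurable]: "\<xi> \<in> borel_measurable M" "\<eta> \<in> borel_measurable M"
    using measurable_F_imp_M[OF \<xi>(1)] measurable_F_imp_M[OF \<eta>(1)] facts by simp_all
  have \<xi>2: "(\<lambda>\<omega>. (\<xi> \<omega>)\<^sup>2) \<in> borel_measurable (F a)" using \<xi> by measurable
  have \<xi>c: "\<xi> \<in> borel_measurable (F c)"
    using measurable_F_mono[OF \<xi>(1) ac] facts by simp
  \<comment> \<open>The increment up to \<open>m\<close> is absorbed into the coefficient: by
    independence \<xi> (W m - W a) is square integrable, and its product with \<eta> is integrable
    and measurable at time \<open>c\<close>.\<close>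
  have *: "integrable M (\<lambda>\<omega>. (\<xi> \<omega> * (W m \<omega> - W a \<omega>)) * (\<eta> \<omega> * (W d \<omega> - W c \<omega>))) \<and>
     expectation (\<lambda>\<omega>. (\<xi> \<omega> * (W m \<omega> - W a \<omega>)) * (\<eta> \<omega> * (W d \<omega> - W c \<omega>))) = 0"
    if m: "a \<le> m" "m \<le> c" for m
  proof -
    let ?g = "\<lambda>\<omega>. (\<xi> \<omega> * (W m \<omega> - W a \<omega>)) * \<eta> \<omega>"
    have "?g \<in> borel_measurable (F c)"
      using m facts
      by (intro borel_measurable_times borel_measurable_diff W_measurable_F \<xi>c \<eta>) simp_all
    moreover have "integrable M ?g"
    proof (rule integrable_mult_of_squares)
      show "(\<lambda>\<omega>. \<xi> \<omega> * (W m \<omega> - W a \<omega>)) \<in> borel_measurable M"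
        using m facts by (intro borel_measurable_times borel_measurable_diff W_measurable) auto
      show "integrable M (\<lambda>\<omega>. (\<xi> \<omega> * (W m \<omega> - W a \<omega>))\<^sup>2)"
        using integrable_mult_increment[OF _ _ _ \<xi>2 \<xi>(2), of m 2] facts m by (simp add: power_mult_distrib)
    qed (use \<eta> in auto)
    ultimately show ?thesis
      using integrable_mult_increment[of c d ?g 1] expectation_mult_increment(1)[of c d ?g] facts
      by (simp add: mult.assoc)
  qed
  let ?h = "\<lambda>\<omega>. (\<xi> \<omega> * (W b \<omega> - W a \<omega>)) * (\<eta> \<omega> * (W d \<omega> - W c \<omega>))"
  have "integrable M ?h \<and> expectation ?h = expectation (\<lambda>\<omega>. \<xi> \<omega> * \<eta> \<omega>) * max 0 (min b d - c)"
  proof (cases "b \<le> c")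
    case True
    then show ?thesis using *[of b] facts by auto
  next
    case False
    have "(\<lambda>\<omega>. \<xi> \<omega> * \<eta> \<omega>) \<in> borel_measurable (F c)"
      by (intro borel_measurable_times \<xi>c \<eta>)
    moreover have "integrable M (\<lambda>\<omega>. \<xi> \<omega> * \<eta> \<omega>)"
      using \<xi> \<eta> by (intro integrable_mult_of_squares) auto
    ultimately have "integrable M (\<lambda>\<omega>. \<xi> \<omega> * \<eta> \<omega> * ((W b \<omega> - W c \<omega>) * (W d \<omega> - W c \<omega>)))"
      "expectation (\<lambda>\<omega>. \<xi> \<omega> * \<eta> \<omega> * ((W b \<omega> - W c \<omega>) * (W d \<omega> - W c \<omega>))) =
        expectation (\<lambda>\<omega>. \<xi> \<omega> * \<eta> \<omega>) * (min b d - c)"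
      using expectation_mult_two_increments[of c b d "\<lambda>\<omega>. \<xi> \<omega> * \<eta> \<omega>"] facts False by auto
    moreover have "?h \<omega> = \<xi> \<omega> * \<eta> \<omega> * ((W b \<omega> - W c \<omega>) * (W d \<omega> - W c \<omega>)) +
      (\<xi> \<omega> * (W c \<omega> - W a \<omega>)) * (\<eta> \<omega> * (W d \<omega> - W c \<omega>))" for \<omega>
      by (simp add: algebra_simps)
    ultimately show ?thesis using *[of c] ac facts False by simp
  qed
  then show "integrable M ?h" "expectation ?h = expectation (\<lambda>\<omega>. \<xi> \<omega> * \<eta> \<omega>) * max 0 (min b d - c)"
    by auto
qed

lemma covariance_increments:
  assumes x: "adapted [(a, b, \<xi>)]" and y: "adapted [(c, d, \<eta>)]"
  shows "integrable M (\<lambda>\<omega>. (\<xi> \<omega> * (W b \<omega> - W a \<omega>)) * (\<eta> \<omega> * (W d \<omega> - W c \<omega>))) \<and>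
    expectation (\<lambda>\<omega>. (\<xi> \<omega> * (W b \<omega> - W a \<omega>)) * (\<eta> \<omega> * (W d \<omega> - W c \<omega>))) =
      expectation (\<lambda>\<omega>. \<xi> \<omega> * \<eta> \<omega>) * max 0 (min b d - max a c)"
proof (cases "a \<le> c")
  case True
  then show ?thesis using covariance_increments_aux[OF x y] by (simp add: max_absorb2)
next
  case False
  then show ?thesis using covariance_increments_aux[OF y x] by (simp add: mult.commute min.commute max_absorb1)
qed

lemma elem_isometry_single:
  assumes x: "adapted [(a, b, \<xi>)]" and L: "adapted L"
  shows "integrable M (\<lambda>\<omega>. (\<xi> \<omega> * (W b \<omega> - W a \<omega>)) * elem_integral W L \<omega>) \<and>
    integrable P (\<lambda>(s, \<omega>). (\<xi> \<omega> * indicator {a<..b} s) * elem_process L s \<omega>) \<and>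
    expectation (\<lambda>\<omega>. (\<xi> \<omega> * (W b \<omega> - W a \<omega>)) * elem_integral W L \<omega>) =
      (\<integral>(s, \<omega>). (\<xi> \<omega> * indicator {a<..b} s) * elem_process L s \<omega> \<partial>P)"
  using L
proof (induction L)
  case (Cons y L)
  obtain c d \<eta> where y: "y = (c, d, \<eta>)" by (cases y)
  with Cons.prems have ay: "adapted [(c, d, \<eta>)]" and L: "adapted L" by auto
  note IH = Cons.IH[OF L]
  have i: "integrable M (\<lambda>\<omega>. \<xi> \<omega> * \<eta> \<omega>)"
    using x ay by (intro integrable_mult_of_squares)
      (auto intro: measurable_F_imp_M[of \<xi> a] measurable_F_imp_M[of \<eta> c])
  let ?u = "indicator {max a c<..min b d} :: real \<Rightarrow> real"
  have u: "integrable (lborel_Icc T) ?u"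
    by (rule time.integrable_const_bound[of _ 1]) (auto intro: measurable_restrict_space1 simp: indicator_def)
  have I: "(\<integral>s. ?u s \<partial>lborel_Icc T) = max 0 (min b d - max a c)"
    using x ay by (intro integral_indicator_Icc) auto
  have ind: "indicator {a<..b} s * indicator {c<..d} s = ?u s" for s
    by (auto simp: indicator_def)
  have eqP: "(\<xi> \<omega> * indicator {a<..b} s) * elem_process (y # L) s \<omega> =
      ?u s * (\<xi> \<omega> * \<eta> \<omega>) + (\<xi> \<omega> * indicator {a<..b} s) * elem_process L s \<omega>" for s \<omega>
    by (simp add: y elem_Cons algebra_simps flip: ind)
  have eqM: "(\<xi> \<omega> * (W b \<omega> - W a \<omega>)) * elem_integral W (y # L) \<omega> =
     (\<xi> \<omega> * (W b \<omega> - W a \<omega>)) * (\<eta> \<omega> * (W d \<omega> - W c \<omega>)) + (\<xi> \<omega> * (W b \<omega> - W a \<omega>)) * elem_integral W L \<omega>" for \<omega>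
    by (simp add: y elem_Cons distrib_left)
  note C = covariance_increments[OF x ay]
  note PI = integral_time_space_product[OF u i]
  have 1: "integrable P (\<lambda>(s, \<omega>). (\<xi> \<omega> * indicator {a<..b} s) * elem_process (y # L) s \<omega>)"
    using IH PI(1) unfolding eqP split_beta by (intro Bochner_Integration.integrable_add) auto
  have 2: "(\<integral>(s, \<omega>). (\<xi> \<omega> * indicator {a<..b} s) * elem_process (y # L) s \<omega> \<partial>P) =
     expectation (\<lambda>\<omega>. \<xi> \<omega> * \<eta> \<omega>) * max 0 (min b d - max a c) +
     (\<integral>(s, \<omega>). (\<xi> \<omega> * indicator {a<..b} s) * elem_process L s \<omega> \<partial>P)"
  proof -
    have "(\<integral>(s, \<omega>). (\<xi> \<omega> * indicator {a<..b} s) * elem_process (y # L) s \<omega> \<partial>P) =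
      (\<integral>z. (case z of (s, \<omega>) \<Rightarrow> ?u s * (\<xi> \<omega> * \<eta> \<omega>)) +
        (case z of (s, \<omega>) \<Rightarrow> (\<xi> \<omega> * indicator {a<..b} s) * elem_process L s \<omega>) \<partial>P)"
      unfolding eqP by (rule Bochner_Integration.integral_cong) (simp_all add: case_prod_unfold)
    also have "\<dots> = (\<integral>(s, \<omega>). ?u s * (\<xi> \<omega> * \<eta> \<omega>) \<partial>P) +
        (\<integral>(s, \<omega>). (\<xi> \<omega> * indicator {a<..b} s) * elem_process L s \<omega> \<partial>P)"
      by (rule Bochner_Integration.integral_add[OF PI(1) conjunct1[OF conjunct2[OF IH]]])
    finally show ?thesis
      by (simp only: PI(2) I mult.commute[of "max 0 (min b d - max a c)"])
  qed
  show ?case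
  proof (intro conjI 1)
    show "integrable M (\<lambda>\<omega>. (\<xi> \<omega> * (W b \<omega> - W a \<omega>)) * elem_integral W (y # L) \<omega>)"
      unfolding eqM using C IH by (intro Bochner_Integration.integrable_add) auto
    show "expectation (\<lambda>\<omega>. (\<xi> \<omega> * (W b \<omega> - W a \<omega>)) * elem_integral W (y # L) \<omega>) =
      (\<integral>(s, \<omega>). (\<xi> \<omega> * indicator {a<..b} s) * elem_process (y # L) s \<omega> \<partial>P)"
      using Bochner_Integration.integral_add[OF conjunct1[OF C] conjunct1[OF IH]]
      by (simp only: eqM 2 conjunct2[OF C] conjunct2[OF conjunct2[OF IH]])
  qed
qed (simp add: case_prod_unfold)

text \<open>The isometry in polarised form. Both sides are bilinear in the lists, so induction
  reduces them to pairs of triples, and for a pair both sides equal E(\<xi> \<eta>) times the length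
  of the overlap.\<close>

lemma elem_isometry:
  assumes L: "adapted L" and L': "adapted L'"
  shows "integrable M (\<lambda>\<omega>. elem_integral W L \<omega> * elem_integral W L' \<omega>) \<and>
    integrable P (\<lambda>(s, \<omega>). elem_process L s \<omega> * elem_process L' s \<omega>) \<and>
    expectation (\<lambda>\<omega>. elem_integral W L \<omega> * elem_integral W L' \<omega>) =
      (\<integral>(s, \<omega>). elem_process L s \<omega> * elem_process L' s \<omega> \<partial>P)"
  using L
proof (induction L)
  case (Cons x L)
  obtain a b \<xi> where x: "x = (a, b, \<xi>)" by (cases x)
  with Cons.prems have ax: "adapted [(a, b, \<xi>)]" and L: "adapted L" by auto
  note IH = Cons.IH[OF L] and S = elem_isometry_single[OF ax L']
  have eqP: "elem_process (x # L) s \<omega> * elem_process L' s \<omega> =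
    (\<xi> \<omega> * indicator {a<..b} s) * elem_process L' s \<omega> + elem_process L s \<omega> * elem_process L' s \<omega>" for s \<omega>
    by (simp add: x elem_Cons distrib_right)
  have eqM: "elem_integral W (x # L) \<omega> * elem_integral W L' \<omega> =
    (\<xi> \<omega> * (W b \<omega> - W a \<omega>)) * elem_integral W L' \<omega> + elem_integral W L \<omega> * elem_integral W L' \<omega>" for \<omega>
    by (simp add: x elem_Cons distrib_right)
  have 1: "integrable P (\<lambda>(s, \<omega>). elem_process (x # L) s \<omega> * elem_process L' s \<omega>)"
    using IH S unfolding eqP split_beta by (intro Bochner_Integration.integrable_add) auto
  have 2: "(\<integral>(s, \<omega>). elem_process (x # L) s \<omega> * elem_process L' s \<omega> \<partial>P) =
     (\<integral>(s, \<omega>). (\<xi> \<omega> * indicator {a<..b} s) * elem_process L' s \<omega> \<partial>P) +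
     (\<integral>(s, \<omega>). elem_process L s \<omega> * elem_process L' s \<omega> \<partial>P)"
    using IH S unfolding eqP split_beta by (intro Bochner_Integration.integral_add) auto
  show ?case
  proof (intro conjI 1)
    show "integrable M (\<lambda>\<omega>. elem_integral W (x # L) \<omega> * elem_integral W L' \<omega>)"
      unfolding eqM using S IH by (intro Bochner_Integration.integrable_add) auto
    show "expectation (\<lambda>\<omega>. elem_integral W (x # L) \<omega> * elem_integral W L' \<omega>) =
      (\<integral>(s, \<omega>). elem_process (x # L) s \<omega> * elem_process L' s \<omega> \<partial>P)"
      using Bochner_Integration.integral_add[OF conjunct1[OF S] conjunct1[OF IH]]
      by (simp only: eqM 2 conjunct2[OF conjunct2[OF S]] conjunct2[OF conjunct2[OF IH]])
  qed
qed (simp add: case_prod_unfold)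

lemma L2le_elem_integral:
  assumes L: "adapted L" and le: "L2le P (case_prod (elem_process L)) c"
  shows "L2le M (elem_integral W L) c"
proof -
  have "expectation (\<lambda>\<omega>. (elem_integral W L \<omega>)\<^sup>2) = (\<integral>z. (case_prod (elem_process L) z)\<^sup>2 \<partial>P)"
    and i: "integrable M (\<lambda>\<omega>. (elem_integral W L \<omega>)\<^sup>2)" "integrable P (\<lambda>z. (case_prod (elem_process L) z)\<^sup>2)"
    using elem_isometry[OF L L] unfolding power2_eq_square case_prod_unfold by blast+
  then show ?thesis
    using le elem_integral_measurable[OF L] by (simp add: L2le_def nn_integral_eq_integral)
qed

lemma elem_integral_square_integrable:
  assumes "adapted L"
  shows "integrable M (\<lambda>\<omega>. (elem_integral W L \<omega>)\<^sup>2)"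
  unfolding power2_eq_square by (rule conjunct1[OF elem_isometry[OF assms assms]])

section \<open>Elementary integrals as functions of the upper limit\<close>

abbreviation elem_path :: "(real \<times> real \<times> ('a \<Rightarrow> real)) list \<Rightarrow> real \<Rightarrow> 'a \<Rightarrow> real" where
  "elem_path L t \<equiv> elem_integral W (elem_restrict 0 t L)"

lemma elem_path_diff:
  assumes "adapted L" "0 \<le> s" "s \<le> t"
  shows "elem_path L t \<omega> - elem_path L s \<omega> = elem_integral W (elem_restrict s t L) \<omega>"
  using assms(1)
proof (induction L)
  case (Cons x L)
  obtain a b \<xi> where x: "x = (a, b, \<xi>)" by (cases x)
  have "0 \<le> a" "a \<le> b" using Cons.prems x by auto
  then have "W (max (max 0 a) (min t b)) \<omega> - W (max (max 0 a) (min s b)) \<omega> =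
    W (max (max s a) (min t b)) \<omega> - W (max s a) \<omega>"
    using assms(2,3) by (auto simp: max_def min_def)
  moreover have "\<xi> \<omega> * (W (max (max 0 a) (min t b)) \<omega> - W (max 0 a) \<omega>) - \<xi> \<omega> * (W (max (max 0 a) (min s b)) \<omega> - W (max 0 a) \<omega>)
    = \<xi> \<omega> * (W (max (max 0 a) (min t b)) \<omega> - W (max (max 0 a) (min s b)) \<omega>)"
    by (simp add: algebra_simps)
  ultimately show ?case
    using Cons x by (simp add: elem_Cons)
qed simp

lemma elem_path_measurable_F:
  assumes "adapted L" "0 \<le> t" "t \<le> T"
  shows "elem_path L t \<in> borel_measurable (F t)"
  using assms(1)
proof (induction L)
  case Nil
  have "elem_path [] t = (\<lambda>_. 0)" by (auto simp: fun_eq_iff)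
  then show ?case by simp
next
  case (Cons x L)
  obtain a b \<xi> where x: "x = (a, b, \<xi>)" by (cases x)
  have L: "elem_path L t \<in> borel_measurable (F t)" and ab: "0 \<le> a" "a \<le> b" "b \<le> T"
    and \<xi>: "\<xi> \<in> borel_measurable (F a)"
    using Cons x by auto
  have eq: "elem_path (x # L) t = (\<lambda>\<omega>. \<xi> \<omega> * (W (max a (min t b)) \<omega> - W a \<omega>) + elem_path L t \<omega>)"
    using ab by (auto simp: fun_eq_iff x elem_Cons max_absorb2)
  show ?case
  proof (cases "a \<le> t")
    case True
    then show ?thesis
      unfolding eq using \<xi> L ab assms
      by (intro borel_measurable_add borel_measurable_times borel_measurable_diff W_measurable_F)
        (auto intro: measurable_F_mono)
  next
    case False
    \<comment> \<open>The coefficient need not be measurable at the earlier time t, but it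
      multiplies a degenerate increment.\<close>
    then have "max a (min t b) = a" by auto
    then show ?thesis unfolding eq using L by simp
  qed
qed

lemma elem_path_continuous:
  assumes "adapted L" "\<omega> \<in> space M"
  shows "continuous_on {0..T} (\<lambda>t. elem_path L t \<omega>)"
  using assms(1)
proof (induction L)
  case (Cons x L)
  obtain a b \<xi> where x: "x = (a, b, \<xi>)" by (cases x)
  have ab: "0 \<le> a" "a \<le> b" "b \<le> T" using Cons x by auto
  have "continuous_on {0..T} (\<lambda>t. W (max a (min t b)) \<omega>)"
    using W_cont[OF assms(2)] by (rule continuous_on_compose2) (use ab in \<open>auto intro!: continuous_intros\<close>)
  then show ?case
    using Cons x ab by (auto simp: elem_Cons max_absorb2 intro!: continuous_intros)
qed simp

text \<open>The martingale property, tested against \<open>g\<close>. After restriction every triple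
  starts at some c \<ge> s, where both \<open>g\<close> and the coefficient are measurable, so its
  increment has mean 0 against their product.\<close>

lemma elem_martingale:
  assumes L: "adapted L" and st: "0 \<le> s" "s \<le> t" "t \<le> T"
    and g: "g \<in> borel_measurable (F s)" "integrable M (\<lambda>\<omega>. (g \<omega>)\<^sup>2)"
  shows "integrable M (\<lambda>\<omega>. g \<omega> * elem_integral W (elem_restrict s t L) \<omega>) \<and>
    expectation (\<lambda>\<omega>. g \<omega> * elem_integral W (elem_restrict s t L) \<omega>) = 0"
  using L
proof (induction L)
  case (Cons x L)
  obtain a b \<xi> where x: "x = (a, b, \<xi>)" by (cases x)
  have ab: "0 \<le> a" "a \<le> b" "b \<le> T" and L: "adapted L"
    and \<xi>: "\<xi> \<in> borel_measurable (F a)" "integrable M (\<lambda>\<omega>. (\<xi> \<omega>)\<^sup>2)"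
    using Cons x by auto
  define c where "c = max s a"
  define d where "d = max c (min t b)"
  have cd: "0 \<le> c" "c \<le> d" "d \<le> T" "s \<le> c" "a \<le> c" "c \<le> T"
    using ab st by (auto simp: c_def d_def)
  have gF: "(\<lambda>\<omega>. g \<omega> * \<xi> \<omega>) \<in> borel_measurable (F c)"
    using cd g(1) \<xi>(1) by (intro borel_measurable_times) (auto intro: measurable_F_mono)
  have gi: "integrable M (\<lambda>\<omega>. g \<omega> * \<xi> \<omega>)"
    using g \<xi> cd by (intro integrable_mult_of_squares)
      (auto intro: measurable_F_imp_M[of g s] measurable_F_imp_M[of \<xi> a])
  have eq: "g \<omega> * elem_integral W (elem_restrict s t (x # L)) \<omega> =
    g \<omega> * \<xi> \<omega> * (W d \<omega> - W c \<omega>) + g \<omega> * elem_integral W (elem_restrict s t L) \<omega>" for \<omega>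
    by (simp add: x elem_Cons algebra_simps c_def d_def)
  show ?case
    unfolding eq using Cons.IH[OF L] integrable_mult_increment[OF cd(1-3) gF gi, of 1]
      expectation_mult_increment(1)[OF cd(1-3) gF gi] by simp
qed simp

lemma L2le_elem_path_diff:
  assumes L: "adapted L" "adapted L'" and st: "0 \<le> s" "s \<le> t" "t \<le> T"
    and le: "L2le P (\<lambda>(r, \<omega>). indicator {s<..t} r * (elem_process L r \<omega> - elem_process L' r \<omega>)) c"
  shows "L2le M (\<lambda>\<omega>. elem_integral W (elem_restrict s t L) \<omega> - elem_integral W (elem_restrict s t L') \<omega>) c"
proof -
  have ad: "adapted (elem_restrict s t (L @ elem_neg L'))"
    using L st by (intro adapted_restr) auto
  have "case_prod (elem_process (elem_restrict s t (L @ elem_neg L'))) =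
      (\<lambda>(r, \<omega>). indicator {s<..t} r * (elem_process L r \<omega> - elem_process L' r \<omega>))"
    by (auto simp: fun_eq_iff elem_process_restr algebra_simps)
  with L2le_elem_integral[OF ad] le have "L2le M (elem_integral W (elem_restrict s t (L @ elem_neg L'))) c"
    by simp
  then show ?thesis
    by (rule L2le_cong) simp
qed

section \<open>Doob's maximal inequality\<close>

text \<open>The event is split by the first index i at which the level \<open>l\<close> is reached.
  On that part the square of the final value has at least the mean of the square at i, because the
  increment from i to n is orthogonal to everything known at i.\<close>

lemma doob_finite:
  fixes n :: nat
  assumes L: "adapted L" and q: "mono_on {..n} q" "\<And>i. i \<le> n \<Longrightarrow> q i \<in> {0..T}" and pos: "0 < l"
  shows "prob {\<omega> \<in> space M. \<exists>i\<le>n. l \<le> \<bar>elem_path L (q i) \<omega>\<bar>} \<le>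
    expectation (\<lambda>\<omega>. (elem_path L (q n) \<omega>)\<^sup>2) / l\<^sup>2"
proof -
  define A where "A i = {\<omega> \<in> space M. l \<le> \<bar>elem_path L (q i) \<omega>\<bar> \<and> (\<forall>j<i. \<bar>elem_path L (q j) \<omega>\<bar> < l)}" for i
  have qT: "0 \<le> q i" "q i \<le> T" if "i \<le> n" for i using q(2)[OF that] by auto
  have qm: "q i \<le> q j" if "i \<le> j" "j \<le> n" for i j
    using mono_onD[OF q(1), of i j] that by auto
  have AF: "A i \<in> sets (F (q i))" if i: "i \<le> n" for i
  proof -
    have m: "elem_path L (q j) \<in> borel_measurable (F (q i))" if "j \<le> i" for j
      using that i qT[of j] qT[of i] qm[of j i]
      by (intro measurable_F_mono[OF elem_path_measurable_F[OF L]]) auto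
    have "{\<omega> \<in> space (F (q i)). \<forall>j\<in>{..<i}. \<bar>elem_path L (q j) \<omega>\<bar> < l} \<in> sets (F (q i))"
    proof (rule sets.sets_Collect_finite_All)
      fix j assume "j \<in> {..<i}"
      then have [measurable]: "elem_path L (q j) \<in> borel_measurable (F (q i))" by (intro m) simp
      show "{\<omega> \<in> space (F (q i)). \<bar>elem_path L (q j) \<omega>\<bar> < l} \<in> sets (F (q i))" by measurable
    qed simp_all
    moreover have "{\<omega> \<in> space (F (q i)). l \<le> \<bar>elem_path L (q i) \<omega>\<bar>} \<in> sets (F (q i))"
    proof -
      have [measurable]: "elem_path L (q i) \<in> borel_measurable (F (q i))" by (intro m) simp
      show ?thesis by measurable
    qed
    ultimately have "{\<omega> \<in> space (F (q i)). l \<le> \<bar>elem_path L (q i) \<omega>\<bar>} \<inter>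
      {\<omega> \<in> space (F (q i)). \<forall>j\<in>{..<i}. \<bar>elem_path L (q j) \<omega>\<bar> < l} \<in> sets (F (q i))"
      by blast
    also have "{\<omega> \<in> space (F (q i)). l \<le> \<bar>elem_path L (q i) \<omega>\<bar>} \<inter>
      {\<omega> \<in> space (F (q i)). \<forall>j\<in>{..<i}. \<bar>elem_path L (q j) \<omega>\<bar> < l} = A i"
      by (auto simp: A_def)
    finally show ?thesis .
  qed
  have AM: "A i \<in> events" if "i \<le> n" for i
    by (rule subsetD[OF sets_F_subset AF[OF that]]) (rule qT(2)[OF that])
  have sq: "integrable M (\<lambda>\<omega>. (elem_path L (q i) \<omega>)\<^sup>2)" if "i \<le> n" for i
    using qT[OF that] L by (intro elem_integral_square_integrable adapted_restr) auto
  have meas: "elem_path L (q i) \<in> borel_measurable M" if "i \<le> n" for i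
    using qT[OF that] L by (intro elem_integral_measurable adapted_restr) auto
  have step: "l\<^sup>2 * prob (A i) \<le> expectation (\<lambda>\<omega>. indicator (A i) \<omega> * (elem_path L (q n) \<omega>)\<^sup>2)"
    if i: "i \<le> n" for i
  proof -
    let ?g = "\<lambda>\<omega>. indicator (A i) \<omega> * elem_path L (q i) \<omega>"
    let ?d = "elem_integral W (elem_restrict (q i) (q n) L)"
    have [measurable]: "A i \<in> events" using AM[OF i] .
    have gF: "?g \<in> borel_measurable (F (q i))"
      using AF[OF i] qT[OF i] by (intro borel_measurable_times elem_path_measurable_F L) auto
    have gI: "integrable M (\<lambda>\<omega>. (?g \<omega>)\<^sup>2)"
      by (rule Bochner_Integration.integrable_bound[OF sq[OF i]])
        (use meas[OF i] in \<open>auto simp: indicator_def\<close>)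
    have mart: "integrable M (\<lambda>\<omega>. ?g \<omega> * ?d \<omega>)" "expectation (\<lambda>\<omega>. ?g \<omega> * ?d \<omega>) = 0"
      using elem_martingale[OF L _ _ _ gF gI, of "q n"] qT[OF i] qT[of n] qm[OF i] by auto
    have d2: "integrable M (\<lambda>\<omega>. (?d \<omega>)\<^sup>2)"
      using qT[OF i] qT[of n] L by (intro elem_integral_square_integrable adapted_restr) auto
    have dm: "?d \<in> borel_measurable M"
      using qT[OF i] qT[of n] L by (intro elem_integral_measurable adapted_restr) auto
    have I1: "integrable M (\<lambda>\<omega>. indicator (A i) \<omega> * (elem_path L (q i) \<omega>)\<^sup>2)"
      by (rule Bochner_Integration.integrable_bound[OF sq[OF i]])
        (use meas[OF i] in \<open>auto simp: indicator_def\<close>)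
    have I2: "integrable M (\<lambda>\<omega>. indicator (A i) \<omega> * (?d \<omega>)\<^sup>2)"
      by (rule Bochner_Integration.integrable_bound[OF d2])
        (use dm in \<open>auto simp: indicator_def\<close>)
    \<comment> \<open>The final value is the value at \<open>q i\<close> plus the increment
      \<open>?d\<close>. In the expanded square the mixed term has mean 0 by
      \<open>elem_martingale\<close>, and the square of the increment is nonnegative.\<close>
    have eq: "indicator (A i) \<omega> * (elem_path L (q n) \<omega>)\<^sup>2 =
        indicator (A i) \<omega> * (elem_path L (q i) \<omega>)\<^sup>2 + (2 * (?g \<omega> * ?d \<omega>) + indicator (A i) \<omega> * (?d \<omega>)\<^sup>2)" for \<omega>
    proof -
      have "elem_path L (q n) \<omega> = elem_path L (q i) \<omega> + ?d \<omega>"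
        using elem_path_diff[OF L, of "q i" "q n" \<omega>] qT[OF i] qm[OF i] by simp
      then show ?thesis by (simp add: power2_eq_square algebra_simps)
    qed
    have "l\<^sup>2 * prob (A i) = expectation (\<lambda>\<omega>. indicator (A i) \<omega> * l\<^sup>2)"
      by simp
    also have "\<dots> \<le> expectation (\<lambda>\<omega>. indicator (A i) \<omega> * (elem_path L (q i) \<omega>)\<^sup>2)"
    proof (rule integral_mono)
      show "integrable M (\<lambda>\<omega>. indicator (A i) \<omega> * l\<^sup>2)"
        using AM[OF i] by (intro integrable_mult_left) (auto simp: less_top[symmetric])
      fix \<omega> assume "\<omega> \<in> space M"
      show "indicator (A i) \<omega> * l\<^sup>2 \<le> indicator (A i) \<omega> * (elem_path L (q i) \<omega>)\<^sup>2"
        using pos by (auto simp: indicator_def A_def abs_le_square_iff[symmetric])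
    qed (rule I1)
    also have "\<dots> \<le> expectation (\<lambda>\<omega>. indicator (A i) \<omega> * (elem_path L (q i) \<omega>)\<^sup>2) +
        (2 * expectation (\<lambda>\<omega>. ?g \<omega> * ?d \<omega>) + expectation (\<lambda>\<omega>. indicator (A i) \<omega> * (?d \<omega>)\<^sup>2))"
      unfolding mart(2) by (simp add: integral_nonneg_AE)
    also have "\<dots> = expectation (\<lambda>\<omega>. indicator (A i) \<omega> * (elem_path L (q n) \<omega>)\<^sup>2)"
      unfolding eq using I1 I2 mart(1) by simp
    finally show ?thesis .
  qed
  have Un: "{\<omega> \<in> space M. \<exists>i\<le>n. l \<le> \<bar>elem_path L (q i) \<omega>\<bar>} = (\<Union>i\<le>n. A i)"
  proof (intro equalityI subsetI)
    fix \<omega> assume "\<omega> \<in> {\<omega> \<in> space M. \<exists>i\<le>n. l \<le> \<bar>elem_path L (q i) \<omega>\<bar>}"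
    then obtain i where i: "\<omega> \<in> space M" "i \<le> n" "l \<le> \<bar>elem_path L (q i) \<omega>\<bar>" by auto
    define k where "k = (LEAST i. l \<le> \<bar>elem_path L (q i) \<omega>\<bar>)"
    have "l \<le> \<bar>elem_path L (q k) \<omega>\<bar>" "k \<le> i"
      unfolding k_def using i(3) by (rule LeastI, rule Least_le)
    moreover have "\<bar>elem_path L (q j) \<omega>\<bar> < l" if "j < k" for j
      using not_less_Least[of j "\<lambda>i. l \<le> \<bar>elem_path L (q i) \<omega>\<bar>"] that unfolding k_def by auto
    ultimately have "\<omega> \<in> A k" using i by (auto simp: A_def)
    then show "\<omega> \<in> (\<Union>i\<le>n. A i)" using \<open>k \<le> i\<close> i(2) by auto
  qed (auto simp: A_def)
  have disj: "disjoint_family_on A {..n}"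
    unfolding disjoint_family_on_def A_def by (auto, metis linorder_neqE_nat not_le)
  have "l\<^sup>2 * prob (\<Union>i\<le>n. A i) = (\<Sum>i\<le>n. l\<^sup>2 * prob (A i))"
    using AM disj by (subst finite_measure_finite_Union) (auto simp: sum_distrib_left)
  also have "\<dots> \<le> (\<Sum>i\<le>n. expectation (\<lambda>\<omega>. indicator (A i) \<omega> * (elem_path L (q n) \<omega>)\<^sup>2))"
    using step by (intro sum_mono) auto
  also have "\<dots> = expectation (\<lambda>\<omega>. \<Sum>i\<le>n. indicator (A i) \<omega> * (elem_path L (q n) \<omega>)\<^sup>2)"
  proof (rule Bochner_Integration.integral_sum[symmetric])
    fix i assume "i \<in> {..n}"
    then show "integrable M (\<lambda>\<omega>. indicator (A i) \<omega> * (elem_path L (q n) \<omega>)\<^sup>2)"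
      using sq[of n] AM[of i] meas[of n]
      by (intro Bochner_Integration.integrable_bound[OF sq[of n]]) (auto simp: indicator_def)
  qed
  also have "\<dots> \<le> expectation (\<lambda>\<omega>. (elem_path L (q n) \<omega>)\<^sup>2)"
  proof (rule integral_mono')
    fix \<omega>
    have "(\<Sum>i\<le>n. indicator (A i) \<omega> :: real) = indicator (\<Union>i\<le>n. A i) \<omega>"
      using disj by (simp add: indicator_UN_disjoint)
    then have "(\<Sum>i\<le>n. indicator (A i) \<omega> * (elem_path L (q n) \<omega>)\<^sup>2) =
        indicator (\<Union>i\<le>n. A i) \<omega> * (elem_path L (q n) \<omega>)\<^sup>2"
      by (simp only: sum_distrib_right[symmetric])
    then show "(\<Sum>i\<le>n. indicator (A i) \<omega> * (elem_path L (q n) \<omega>)\<^sup>2) \<le> (elem_path L (q n) \<omega>)\<^sup>2"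
      by (simp only:) (simp add: indicator_def)
  qed (use sq[of n] in auto)
  finally show ?thesis
    unfolding Un using pos by (simp add: pos_le_divide_eq mult.commute)
qed

text \<open>By continuity of the paths the event over [0,T] is the increasing union of the events
  over the dyadic grids, which gives both its measurability and the bound. The strict inequality
  matters: an excess over \<open>l\<close> at time t persists at nearby grid points.\<close>

lemma doob_continuous:
  assumes L: "adapted L" and le: "L2le P (case_prod (elem_process L)) c" and c: "0 \<le> c" and pos: "0 < l"
  shows "{\<omega> \<in> space M. \<exists>t\<in>{0..T}. l < \<bar>elem_path L t \<omega>\<bar>} \<in> events"
    and "prob {\<omega> \<in> space M. \<exists>t\<in>{0..T}. l < \<bar>elem_path L t \<omega>\<bar>} \<le> c / l\<^sup>2"
proof -
  define q where "q n i = T * real i / 2 ^ n" for n i :: nat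
  define U where "U n = {\<omega> \<in> space M. \<exists>i\<le>2 ^ n. l < \<bar>elem_path L (q n i) \<omega>\<bar>}" for n
  have q01: "q n i \<in> {0..T}" if "i \<le> 2 ^ n" for n i
  proof -
    have "real i \<le> 2 ^ n" using that by (metis of_nat_le_iff of_nat_numeral of_nat_power)
    then show ?thesis using T_pos by (simp add: q_def field_simps)
  qed
  have meas: "elem_path L t \<in> borel_measurable M" if "t \<in> {0..T}" for t
    using that L by (intro elem_integral_measurable adapted_restr) auto
  have U_ev: "U n \<in> events" for n
  proof -
    have [measurable]: "elem_path L (q n i) \<in> borel_measurable M" if "i \<le> 2 ^ n" for i
      using meas q01[OF that] by simp
    have "{\<omega> \<in> space M. \<exists>i\<in>{..2 ^ n}. l < \<bar>elem_path L (q n i) \<omega>\<bar>} \<in> events"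
      by measurable
    then show ?thesis by (simp add: U_def Bex_def)
  qed
  have inc: "incseq U"
  proof (rule incseq_SucI, safe)
    fix n \<omega> assume "\<omega> \<in> U n"
    then obtain i where i: "\<omega> \<in> space M" "i \<le> 2 ^ n" "l < \<bar>elem_path L (q n i) \<omega>\<bar>"
      by (auto simp: U_def)
    moreover have "q (Suc n) (2 * i) = q n i" by (simp add: q_def)
    ultimately show "\<omega> \<in> U (Suc n)"
      by (auto simp: U_def intro!: exI[of _ "2 * i"])
  qed
  have eq: "{\<omega> \<in> space M. \<exists>t\<in>{0..T}. l < \<bar>elem_path L t \<omega>\<bar>} = (\<Union>n. U n)"
  proof (intro equalityI subsetI)
    fix \<omega> assume "\<omega> \<in> {\<omega> \<in> space M. \<exists>t\<in>{0..T}. l < \<bar>elem_path L t \<omega>\<bar>}"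
    then obtain t where t: "\<omega> \<in> space M" "t \<in> {0..T}" "l < \<bar>elem_path L t \<omega>\<bar>" by auto
    \<comment> \<open>The left neighbour of t on the grid of mesh T / 2^n.\<close>
    define i where "i n = nat \<lfloor>t * 2 ^ n / T\<rfloor>" for n
    have nn: "0 \<le> t * 2 ^ n / T" for n using t T_pos by simp
    then have ri: "real (i n) = of_int \<lfloor>t * 2 ^ n / T\<rfloor>" for n by (simp add: i_def)
    have i_le: "i n \<le> 2 ^ n" for n
    proof -
      have "t * 2 ^ n / T \<le> 2 ^ n" using t T_pos by (simp add: field_simps)
      then have "real (i n) \<le> 2 ^ n" unfolding ri by linarith
      then show ?thesis by (metis of_nat_le_iff of_nat_numeral of_nat_power)
    qed
    have close: "\<bar>q n (i n) - t\<bar> \<le> T * (1 / 2) ^ n" for n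
    proof -
      have "\<bar>real (i n) - t * 2 ^ n / T\<bar> \<le> 1" unfolding ri by linarith
      then have "\<bar>real (i n) - t * 2 ^ n / T\<bar> * (T * (1 / 2) ^ n) \<le> 1 * (T * (1 / 2) ^ n)"
        using T_pos by (intro mult_right_mono) auto
      also have "\<bar>real (i n) - t * 2 ^ n / T\<bar> * (T * (1 / 2) ^ n) =
          \<bar>(real (i n) - t * 2 ^ n / T) * (T * (1 / 2) ^ n)\<bar>"
        using T_pos by (simp add: abs_mult)
      also have "(real (i n) - t * 2 ^ n / T) * (T * (1 / 2) ^ n) = q n (i n) - t"
        using T_pos by (simp add: q_def field_simps power_divide)
      finally show ?thesis by simp
    qed
    have "(\<lambda>n. q n (i n) - t) \<longlonglongrightarrow> 0"
    proof (rule Lim_null_comparison)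
      show "\<forall>\<^sub>F n in sequentially. norm (q n (i n) - t) \<le> T * (1 / 2) ^ n" using close by simp
      show "(\<lambda>n. T * (1 / 2) ^ n) \<longlonglongrightarrow> 0" by (auto intro!: tendsto_eq_intros LIMSEQ_realpow_zero)
    qed
    then have "(\<lambda>n. q n (i n)) \<longlonglongrightarrow> t" by (simp add: LIM_zero_iff)
    moreover have "continuous_on {0..T} (\<lambda>t. \<bar>elem_path L t \<omega>\<bar>)"
      using elem_path_continuous[OF L t(1)] by (intro continuous_intros)
    ultimately have "(\<lambda>n. \<bar>elem_path L (q n (i n)) \<omega>\<bar>) \<longlonglongrightarrow> \<bar>elem_path L t \<omega>\<bar>"
      using t(2) q01[OF i_le] unfolding continuous_on_sequentially comp_def by auto
    from order_tendstoD(1)[OF this t(3)] obtain n where "l < \<bar>elem_path L (q n (i n)) \<omega>\<bar>"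
      by (auto simp: eventually_sequentially)
    then show "\<omega> \<in> (\<Union>n. U n)" using t(1) i_le by (auto simp: U_def)
  next
    fix \<omega> assume "\<omega> \<in> (\<Union>n. U n)"
    then show "\<omega> \<in> {\<omega> \<in> space M. \<exists>t\<in>{0..T}. l < \<bar>elem_path L t \<omega>\<bar>}"
      using q01 by (force simp: U_def)
  qed
  show "{\<omega> \<in> space M. \<exists>t\<in>{0..T}. l < \<bar>elem_path L t \<omega>\<bar>} \<in> events"
    unfolding eq using U_ev by auto
  have le_n: "prob (U n) \<le> c / l\<^sup>2" for n
  proof -
    have m: "mono_on {..2 ^ n} (q n)"
      using T_pos by (auto simp: mono_on_def q_def intro!: divide_right_mono mult_left_mono)
    have ad: "adapted (elem_restrict 0 (q n (2 ^ n)) L)"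
      using L q01[of "2 ^ n" n] by (intro adapted_restr) auto
    have [measurable]: "elem_path L (q n i) \<in> borel_measurable M" if "i \<le> 2 ^ n" for i
      using meas q01[OF that] by simp
    have E: "{\<omega> \<in> space M. \<exists>i\<in>{..2 ^ n}. l \<le> \<bar>elem_path L (q n i) \<omega>\<bar>} \<in> events"
      by measurable
    have "prob (U n) \<le> prob {\<omega> \<in> space M. \<exists>i\<le>2 ^ n. l \<le> \<bar>elem_path L (q n i) \<omega>\<bar>}"
      using E by (intro finite_measure_mono) (auto simp: U_def Bex_def intro: less_imp_le)
    also have "\<dots> \<le> expectation (\<lambda>\<omega>. (elem_path L (q n (2 ^ n)) \<omega>)\<^sup>2) / l\<^sup>2"
      by (rule doob_finite[OF L m q01 pos])
    also have "\<dots> \<le> c / l\<^sup>2"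
    proof (intro divide_right_mono L2le_imp_integral_le L2le_elem_integral[OF ad] c)
      have "(\<integral>\<^sup>+z. ennreal ((case_prod (elem_process (elem_restrict 0 (q n (2 ^ n)) L)) z)\<^sup>2) \<partial>P) \<le>
          (\<integral>\<^sup>+z. ennreal ((case_prod (elem_process L) z)\<^sup>2) \<partial>P)"
        by (intro nn_integral_mono) (auto simp: elem_process_restr indicator_def)
      then show "L2le P (case_prod (elem_process (elem_restrict 0 (q n (2 ^ n)) L))) c"
        using le elem_process_measurable[OF ad] by (auto simp: L2le_def)
    qed simp
    finally show ?thesis .
  qed
  have "(\<lambda>n. prob (U n)) \<longlonglongrightarrow> prob (\<Union>n. U n)"
    using U_ev inc by (intro finite_Lim_measure_incseq) auto
  then show "prob {\<omega> \<in> space M. \<exists>t\<in>{0..T}. l < \<bar>elem_path L t \<omega>\<bar>} \<le> c / l\<^sup>2"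
    unfolding eq by (rule LIMSEQ_le_const2) (use le_n in auto)
qed

end

section \<open>The Ito integral as a limit\<close>

lemma L2le_epsilon:
  assumes "\<And>\<epsilon>. 0 < \<epsilon> \<Longrightarrow> L2le N g (c + \<epsilon>)" "0 \<le> c"
  shows "L2le N g c"
proof -
  have "g \<in> borel_measurable N" using assms(1)[of 1] by (simp add: L2le_def)
  moreover have "(\<integral>\<^sup>+x. ennreal ((g x)\<^sup>2) \<partial>N) \<le> ennreal c"
  proof (rule ennreal_le_epsilon)
    fix e :: real assume "0 < e"
    then show "(\<integral>\<^sup>+x. ennreal ((g x)\<^sup>2) \<partial>N) \<le> ennreal c + ennreal e"
      using assms(1)[of e] assms(2) by (simp add: L2le_def)
  qed
  ultimately show ?thesis by (simp add: L2le_def)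
qed

text \<open>The integrals of the squares are summable, so the series of squares is finite almost
  everywhere and its terms tend to 0. This is how L^2 convergence yields almost sure convergence
  along a subsequence.\<close>

lemma L2le_geometric_AE:
  assumes "\<And>j::nat. L2le N (g j) ((1 / 2) ^ j)"
  shows "AE x in N. (\<lambda>j. g j x) \<longlonglongrightarrow> 0"
proof -
  have [measurable]: "g j \<in> borel_measurable N" for j
    using assms[of j] by (simp add: L2le_def)
  have "(\<integral>\<^sup>+x. (\<Sum>j. ennreal ((g j x)\<^sup>2)) \<partial>N) = (\<Sum>j. \<integral>\<^sup>+x. ennreal ((g j x)\<^sup>2) \<partial>N)"
    by (rule nn_integral_suminf) measurable
  also have "\<dots> \<le> (\<Sum>j. ennreal ((1 / 2) ^ j))"
    using assms by (intro suminf_le) (auto simp: L2le_def)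
  also have "\<dots> = ennreal (\<Sum>j. (1 / 2) ^ j)"
    by (intro suminf_ennreal2) (auto intro: summable_geometric)
  also have "\<dots> < \<infinity>" by simp
  finally have "AE x in N. (\<Sum>j. ennreal ((g j x)\<^sup>2)) \<noteq> \<infinity>"
    by (intro nn_integral_PInf_AE) auto
  then show ?thesis
  proof eventually_elim
    fix x assume "(\<Sum>j. ennreal ((g j x)\<^sup>2)) \<noteq> \<infinity>"
    then have "summable (\<lambda>j. (g j x)\<^sup>2)"
      by (intro summable_suminf_not_top) auto
    then have "(\<lambda>j. sqrt ((g j x)\<^sup>2)) \<longlonglongrightarrow> sqrt 0"
      by (intro tendsto_real_sqrt summable_LIMSEQ_zero)
    then show "(\<lambda>j. g j x) \<longlonglongrightarrow> 0"
      by (simp add: tendsto_rabs_zero_iff)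
  qed
qed

section \<open>Partitions and step processes\<close>

lemma partition_of_mono:
  assumes "partition_of a b N p" "i \<le> j" "j \<le> N"
  shows "p i \<le> p j"
  using assms(2,3)
proof (induction j rule: dec_induct)
  case (step j)
  then have "p j < p (Suc j)" using assms(1) by (auto simp: partition_of_def)
  then show ?case using step by auto
qed simp

lemma partition_of_bounds:
  assumes "partition_of a b N p" "i \<le> N"
  shows "a \<le> p i" "p i \<le> b"
  using partition_of_mono[OF assms(1), of 0 i] partition_of_mono[OF assms(1), of i N] assms
  by (auto simp: partition_of_def)

lemma partition_of_less: "partition_of a b N p \<Longrightarrow> i < N \<Longrightarrow> p i < p (Suc i)"
  by (auto simp: partition_of_def)

definition step_list :: "nat \<Rightarrow> (nat \<Rightarrow> real) \<Rightarrow> (nat \<Rightarrow> 'a \<Rightarrow> real) \<Rightarrow> (real \<times> real \<times> ('a \<Rightarrow> real)) list" where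
  "step_list N p \<xi> = map (\<lambda>i. (p i, p (Suc i), \<xi> i)) [0..<N]"

lemma elem_process_step_list: "elem_process (step_list N p \<xi>) s \<omega> = step_process N p \<xi> s \<omega>"
  by (simp add: elem_process_def step_list_def step_process_def comp_def interv_sum_list_conv_sum_set_nat
      atLeast0LessThan)

lemma elem_integral_step_list:
  "elem_integral W (step_list N p \<xi>) \<omega> = (\<Sum>i<N. \<xi> i \<omega> * (W (p (Suc i)) \<omega> - W (p i) \<omega>))"
  by (simp add: elem_integral_def step_list_def comp_def interv_sum_list_conv_sum_set_nat atLeast0LessThan)

text \<open>On cells after t the two sides stop differently, the restricted list at
  \<open>p i\<close> and \<open>step_integral\<close> at t, but both increments are 0 there.\<close>

lemma elem_path_step_list:
  assumes "partition_of 0 b N p"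
  shows "elem_integral W (elem_restrict 0 t (step_list N p \<xi>)) \<omega> = step_integral W N p \<xi> t \<omega>"
proof -
  have "elem_integral W (elem_restrict 0 t (step_list N p \<xi>)) \<omega> =
      (\<Sum>i<N. \<xi> i \<omega> * (W (max (max 0 (p i)) (min t (p (Suc i)))) \<omega> - W (max 0 (p i)) \<omega>))"
    by (simp add: elem_integral_def elem_restrict_def step_list_def comp_def interv_sum_list_conv_sum_set_nat
        atLeast0LessThan)
  also have "\<dots> = (\<Sum>i<N. \<xi> i \<omega> * (W (min t (p (Suc i))) \<omega> - W (min t (p i)) \<omega>))"
  proof (rule sum.cong)
    fix i assume "i \<in> {..<N}"
    then have "0 \<le> p i" "p i < p (Suc i)"
      using partition_of_bounds[OF assms, of i] partition_of_less[OF assms] by auto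
    then show "\<xi> i \<omega> * (W (max (max 0 (p i)) (min t (p (Suc i)))) \<omega> - W (max 0 (p i)) \<omega>) =
        \<xi> i \<omega> * (W (min t (p (Suc i))) \<omega> - W (min t (p i)) \<omega>)"
      by (cases "t \<le> p i") (auto simp: max_def min_def)
  qed simp
  finally show ?thesis by (simp add: step_integral_def)
qed

lemma continuous_process_measurable: "continuous_process M T Y \<Longrightarrow> 0 \<le> t \<Longrightarrow> t \<le> T \<Longrightarrow> Y t \<in> borel_measurable M"
  by (auto simp: continuous_process_def)

context brownian_motion
begin

lemma adapted_step_list:
  assumes "partition_of 0 b N p" "b \<le> T"
    and "\<And>i. i < N \<Longrightarrow> \<xi> i \<in> borel_measurable (F (p i))"
    and "\<And>i. i < N \<Longrightarrow> integrable M (\<lambda>\<omega>. (\<xi> i \<omega>)\<^sup>2)"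
  shows "adapted (step_list N p \<xi>)"
proof -
  have "0 \<le> p i \<and> p i \<le> p (Suc i) \<and> p (Suc i) \<le> T" if "i < N" for i
    using partition_of_bounds[OF assms(1), of i] partition_of_bounds[OF assms(1), of "Suc i"]
      partition_of_less[OF assms(1) that] assms(2) that by auto
  then show ?thesis
    using assms(3,4) by (auto simp: adapted_def step_list_def)
qed

text \<open>Unlike \<^const>\<open>has_ito_integral\<close>, this allows arbitrary elementary processes as approximations.\<close>

definition ito_limit :: "(real \<Rightarrow> 'a \<Rightarrow> real) \<Rightarrow> (real \<Rightarrow> 'a \<Rightarrow> real) \<Rightarrow> bool" where
  "ito_limit H J \<longleftrightarrow> measurable_process M T H \<and> continuous_process M T J \<and>
     (\<exists>L. (\<forall>k::nat. adapted (L k)) \<and>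
       (\<forall>\<epsilon>>0. \<forall>\<^sub>F k in sequentially. L2le P (\<lambda>(s, \<omega>). elem_process (L k) s \<omega> - H s \<omega>) \<epsilon>) \<and>
       (\<forall>t\<in>{0..T}. \<forall>\<epsilon>>0. \<forall>\<^sub>F k in sequentially. L2le M (\<lambda>\<omega>. elem_path (L k) t \<omega> - J t \<omega>) \<epsilon>))"

lemma L2le_indicator:
  assumes "L2le P (\<lambda>(s, \<omega>). g s \<omega>) c"
  shows "L2le P (\<lambda>(s, \<omega>). indicator {a<..b} s * g s \<omega>) c"
proof -
  have [measurable]: "case_prod g \<in> borel_measurable P" "indicator {a<..b} \<in> borel_measurable (lborel_Icc T)"
    using assms by (auto simp: L2le_def intro: measurable_restrict_space1)
  have "(\<lambda>(s, \<omega>). (indicator {a<..b} s :: real) * g s \<omega>) \<in> borel_measurable P" by measurable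
  moreover have "(\<integral>\<^sup>+z. ennreal ((case z of (s, \<omega>) \<Rightarrow> indicator {a<..b} s * g s \<omega>)\<^sup>2) \<partial>P) \<le>
      (\<integral>\<^sup>+z. ennreal ((case z of (s, \<omega>) \<Rightarrow> g s \<omega>)\<^sup>2) \<partial>P)"
    by (intro nn_integral_mono) (auto simp: indicator_def)
  ultimately show ?thesis
    using assms by (auto simp: L2le_def)
qed

lemma elem_process_diff_measurable:
  assumes "adapted L" "measurable_process M T H"
  shows "(\<lambda>(s, \<omega>). elem_process L s \<omega> - H s \<omega>) \<in> borel_measurable P"
  using elem_process_measurable[OF assms(1)] assms(2)
  unfolding measurable_process_def case_prod_unfold by (rule borel_measurable_diff)

lemma elem_path_measurable:
  assumes "adapted L" "0 \<le> t" "t \<le> T"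
  shows "elem_path L t \<in> borel_measurable M"
  using assms by (intro elem_integral_measurable adapted_restr) auto

lemma elem_path_diff_measurable:
  assumes "adapted L" "continuous_process M T J" "0 \<le> t" "t \<le> T"
  shows "(\<lambda>\<omega>. elem_path L t \<omega> - J t \<omega>) \<in> borel_measurable M"
  using elem_path_measurable[OF assms(1,3,4)] continuous_process_measurable[OF assms(2-4)]
  by (rule borel_measurable_diff)

lemma has_ito_integral_step_iff:
  assumes H: "measurable_process M T H" and J: "continuous_process M T J"
    and S: "\<And>k. simple_process M T W (N k) (p k) (\<xi> k)"
  shows "(\<lambda>k. \<integral>\<^sup>+(s, \<omega>). ennreal ((step_process (N k) (p k) (\<xi> k) s \<omega> - H s \<omega>)\<^sup>2) \<partial>P) \<longlonglongrightarrow> 0 \<longleftrightarrow>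
      (\<forall>\<epsilon>>0. \<forall>\<^sub>F k in sequentially. L2le P (\<lambda>(s, \<omega>). elem_process (step_list (N k) (p k) (\<xi> k)) s \<omega> - H s \<omega>) \<epsilon>)"
    and "t \<in> {0..T} \<Longrightarrow>
      (\<lambda>k. \<integral>\<^sup>+\<omega>. ennreal ((step_integral W (N k) (p k) (\<xi> k) t \<omega> - J t \<omega>)\<^sup>2) \<partial>M) \<longlonglongrightarrow> 0 \<longleftrightarrow>
      (\<forall>\<epsilon>>0. \<forall>\<^sub>F k in sequentially. L2le M (\<lambda>\<omega>. elem_path (step_list (N k) (p k) (\<xi> k)) t \<omega> - J t \<omega>) \<epsilon>)"
    and "adapted (step_list (N k) (p k) (\<xi> k))"
proof -
  have pt: "partition_of 0 T (N k) (p k)" for k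
    using S by (auto simp: simple_process_def)
  show ad: "adapted (step_list (N k) (p k) (\<xi> k))" for k
    using S[of k] by (intro adapted_step_list[OF pt]) (auto simp: simple_process_def)
  show "(\<lambda>k. \<integral>\<^sup>+(s, \<omega>). ennreal ((step_process (N k) (p k) (\<xi> k) s \<omega> - H s \<omega>)\<^sup>2) \<partial>P) \<longlonglongrightarrow> 0 \<longleftrightarrow>
      (\<forall>\<epsilon>>0. \<forall>\<^sub>F k in sequentially. L2le P (\<lambda>(s, \<omega>). elem_process (step_list (N k) (p k) (\<xi> k)) s \<omega> - H s \<omega>) \<epsilon>)"
    using L2le_eventually_iff[OF elem_process_diff_measurable[OF ad H]]
    by (simp add: elem_process_step_list case_prod_unfold)
  show "(\<lambda>k. \<integral>\<^sup>+\<omega>. ennreal ((step_integral W (N k) (p k) (\<xi> k) t \<omega> - J t \<omega>)\<^sup>2) \<partial>M) \<longlonglongrightarrow> 0 \<longleftrightarrow>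
      (\<forall>\<epsilon>>0. \<forall>\<^sub>F k in sequentially. L2le M (\<lambda>\<omega>. elem_path (step_list (N k) (p k) (\<xi> k)) t \<omega> - J t \<omega>) \<epsilon>)"
    if t: "t \<in> {0..T}"
    using L2le_eventually_iff[OF elem_path_diff_measurable[OF ad J, of t]] t
    by (simp add: elem_path_step_list[OF pt])
qed

lemma has_ito_integral_imp_ito_limit:
  assumes "has_ito_integral M T W H J"
  shows "ito_limit H J"
proof -
  obtain N p \<xi> where S: "\<And>k::nat. simple_process M T W (N k) (p k) (\<xi> k)"
    and lim: "(\<lambda>k. \<integral>\<^sup>+(s, \<omega>). ennreal ((step_process (N k) (p k) (\<xi> k) s \<omega> - H s \<omega>)\<^sup>2) \<partial>P) \<longlonglongrightarrow> 0"
      "\<And>t. t \<in> {0..T} \<Longrightarrow> (\<lambda>k. \<integral>\<^sup>+\<omega>. ennreal ((step_integral W (N k) (p k) (\<xi> k) t \<omega> - J t \<omega>)\<^sup>2) \<partial>M) \<longlonglongrightarrow> 0"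
    and HJ: "measurable_process M T H" "continuous_process M T J"
    using assms unfolding has_ito_integral_def by blast
  note iff = has_ito_integral_step_iff[of H J N p \<xi>, OF HJ S]
  show ?thesis
    unfolding ito_limit_def
  proof (intro conjI HJ exI[of _ "\<lambda>k. step_list (N k) (p k) (\<xi> k)"] allI ballI)
    show "adapted (step_list (N k) (p k) (\<xi> k))" for k by (rule iff(3))
  next
    fix \<epsilon> :: real
    show "0 < \<epsilon> \<longrightarrow> (\<forall>\<^sub>F k in sequentially.
        L2le P (\<lambda>(s, \<omega>). elem_process (step_list (N k) (p k) (\<xi> k)) s \<omega> - H s \<omega>) \<epsilon>)"
      using iff(1) lim(1) by blast
  next
    fix t \<epsilon> :: real assume "t \<in> {0..T}"
    then show "0 < \<epsilon> \<longrightarrow> (\<forall>\<^sub>F k in sequentially.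
        L2le M (\<lambda>\<omega>. elem_path (step_list (N k) (p k) (\<xi> k)) t \<omega> - J t \<omega>) \<epsilon>)"
      using iff(2) lim(2) by blast
  qed
qed

section \<open>Existence of continuous versions\<close>

text \<open>Along a fast subsequence the maximal inequality and the Borel-Cantelli lemma give almost
  surely uniform convergence of the paths, hence a continuous limit. Fatou's lemma then yields L^2
  convergence of the whole sequence at each time.\<close>

lemma ito_path_converges:
  assumes L: "\<And>k::nat. adapted (L k)" and H: "measurable_process M T H"
    and lim: "\<And>\<epsilon>. 0 < \<epsilon> \<Longrightarrow> \<forall>\<^sub>F k in sequentially. L2le P (\<lambda>(s, \<omega>). elem_process (L k) s \<omega> - H s \<omega>) \<epsilon>"
  shows "\<exists>Y. continuous_process M T Y \<and>
    (\<forall>t\<in>{0..T}. \<forall>\<epsilon>>0. \<forall>\<^sub>F k in sequentially. L2le M (\<lambda>\<omega>. elem_path (L k) t \<omega> - Y t \<omega>) \<epsilon>)"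
proof -
  \<comment> \<open>The rate makes the squared norms of consecutive differences at most 8^(-j):
    against the level 2^(-j) the maximal inequality then gives the summable bound 8^(-j) / 4^(-j) =
    2^(-j). The division by 4 absorbs the factors 2 of \<open>L2le_diff\<close>.\<close>
  have "\<exists>m. L2le P (\<lambda>(s, \<omega>). elem_process (L m) s \<omega> - H s \<omega>) ((1 / 8) ^ j / 4)" for j :: nat
    using eventually_happens'[OF _ lim[of "(1 / 8) ^ j / 4"]] by auto
  then obtain r where r: "\<And>j. L2le P (\<lambda>(s, \<omega>). elem_process (L (r j)) s \<omega> - H s \<omega>) ((1 / 8) ^ j / 4)"
    by metis
  have close: "L2le P (\<lambda>(s, \<omega>). elem_process (L i) s \<omega> - elem_process (L (r j)) s \<omega>) (2 * e + 2 * ((1 / 8) ^ j / 4))"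
    if "L2le P (\<lambda>(s, \<omega>). elem_process (L i) s \<omega> - H s \<omega>) e" "0 \<le> e" for i j e
    by (rule L2le_cong[OF L2le_diff[OF that(1) r[of j] that(2)]]) auto
  define D where "D j = L (r (Suc j)) @ elem_neg (L (r j))" for j
  have D: "adapted (D j)" for j using L by (simp add: D_def)
  have D_le: "L2le P (case_prod (elem_process (D j))) ((1 / 8) ^ j)" for j
  proof -
    have "L2le P (case_prod (elem_process (D j))) (2 * ((1 / 8) ^ Suc j / 4) + 2 * ((1 / 8) ^ j / 4))"
      by (rule L2le_cong[OF close[OF r[of "Suc j"]]]) (auto simp: D_def)
    then show ?thesis by (rule L2le_mono) simp
  qed
  define A where "A j = {\<omega> \<in> space M. \<exists>t\<in>{0..T}. (1 / 2) ^ j < \<bar>elem_path (D j) t \<omega>\<bar>}" for j :: nat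
  have A: "A j \<in> events" "prob (A j) \<le> (1 / 2) ^ j" for j
  proof -
    note d = doob_continuous[OF D[of j] D_le[of j], where l="(1 / 2) ^ j"]
    show "A j \<in> events" using d(1) by (simp add: A_def)
    have "prob (A j) \<le> (1 / 8) ^ j / ((1 / 2) ^ j)\<^sup>2" using d(2) by (simp add: A_def)
    also have "\<dots> = (1 / 8) ^ j / (1 / 4) ^ j"
      by (simp add: power2_eq_square flip: power_mult_distrib)
    also have "\<dots> = (1 / 2) ^ j" by (simp flip: power_divide)
    finally show "prob (A j) \<le> (1 / 2) ^ j" .
  qed
  have summ: "summable (\<lambda>j. prob (A j))"
  proof (rule summable_comparison_test'[of "\<lambda>j. (1 / 2 :: real) ^ j" 0])
    show "summable (\<lambda>j. (1 / 2 :: real) ^ j)" by (rule summable_geometric) simp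
    show "norm (prob (A j)) \<le> (1 / 2) ^ j" for j using A(2)[of j] by simp
  qed
  have "AE \<omega> in M. \<forall>\<^sub>F j in sequentially. \<omega> \<in> space M - A j"
    by (rule borel_cantelli_AE1[OF A(1) _ summ]) (simp add: emeasure_eq_measure)
  then obtain Z where Z: "Z \<in> null_sets M"
    "\<And>\<omega>. \<omega> \<in> space M - Z \<Longrightarrow> \<forall>\<^sub>F j in sequentially. \<omega> \<notin> A j"
    by (auto elim!: AE_E3)
  \<comment> \<open>The value 0 on the exceptional null set makes every path continuous, as
    \<open>continuous_process\<close> demands. Elsewhere Y is the telescoping series of the
    differences.\<close>
  define Y where "Y t \<omega> = (if \<omega> \<in> Z then 0 else elem_path (L (r 0)) t \<omega> + (\<Sum>j. elem_path (D j) t \<omega>))" for t \<omega>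
  have partial: "(\<Sum>j<n. elem_path (D j) t \<omega>) = elem_path (L (r n)) t \<omega> - elem_path (L (r 0)) t \<omega>" for n t \<omega>
    using sum_lessThan_telescope[of "\<lambda>n. elem_path (L (r n)) t \<omega>" n] by (simp add: D_def)
  have unif: "uniform_limit {0..T} (\<lambda>n t. \<Sum>j<n. elem_path (D j) t \<omega>) (\<lambda>t. \<Sum>j. elem_path (D j) t \<omega>) sequentially"
    if "\<omega> \<in> space M - Z" for \<omega>
  proof (rule Weierstrass_m_test_ev)
    show "\<forall>\<^sub>F n in sequentially. \<forall>t\<in>{0..T}. norm (elem_path (D n) t \<omega>) \<le> (1 / 2) ^ n"
      using Z(2)[OF that] by eventually_elim (use that in \<open>auto simp: A_def not_less\<close>)
    show "summable (\<lambda>n. (1 / 2 :: real) ^ n)" by (rule summable_geometric) simp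
  qed
  have conv: "(\<lambda>j. elem_path (L (r j)) t \<omega>) \<longlonglongrightarrow> Y t \<omega>" if "\<omega> \<in> space M - Z" "t \<in> {0..T}" for t \<omega>
  proof -
    have "(\<lambda>n. elem_path (L (r n)) t \<omega> - elem_path (L (r 0)) t \<omega>) \<longlonglongrightarrow> (\<Sum>j. elem_path (D j) t \<omega>)"
      using tendsto_uniform_limitI[OF unif[OF that(1)] that(2)] by (simp add: partial)
    from tendsto_add[OF this tendsto_const[of "elem_path (L (r 0)) t \<omega>"]] that(1) show ?thesis
      by (simp add: Y_def add.commute)
  qed
  have Y: "continuous_process M T Y"
    unfolding continuous_process_def
  proof (intro conjI ballI)
    fix t assume t: "t \<in> {0..T}"
    have [measurable]: "elem_path (D j) t \<in> borel_measurable M" "elem_path (L (r 0)) t \<in> borel_measurable M" for j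
      using t by (auto intro: elem_path_measurable D L)
    have [measurable]: "Z \<in> events" using Z(1) by auto
    show "Y t \<in> borel_measurable M" unfolding Y_def[abs_def] by measurable
  next
    fix \<omega> assume \<omega>: "\<omega> \<in> space M"
    show "continuous_on {0..T} (\<lambda>t. Y t \<omega>)"
    proof (cases "\<omega> \<in> Z")
      case False
      have "continuous_on {0..T} (\<lambda>t. \<Sum>j. elem_path (D j) t \<omega>)"
      proof (rule uniform_limit_theorem[OF _ unif])
        show "\<forall>\<^sub>F n in sequentially. continuous_on {0..T} (\<lambda>t. \<Sum>j<n. elem_path (D j) t \<omega>)"
          by (intro always_eventually allI continuous_on_sum elem_path_continuous D \<omega>)
      qed (use \<omega> False in auto)
      then show ?thesis
        using False elem_path_continuous[OF L \<omega>] by (auto simp: Y_def intro!: continuous_on_add)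
    qed (simp add: Y_def)
  qed
  have AE_conv: "AE \<omega> in M. (\<lambda>j. elem_path (L (r j)) t \<omega>) \<longlonglongrightarrow> Y t \<omega>" if "t \<in> {0..T}" for t
    using AE_not_in[OF Z(1)] AE_space by eventually_elim (use conv that in auto)
  have "\<forall>\<^sub>F k in sequentially. L2le M (\<lambda>\<omega>. elem_path (L k) t \<omega> - Y t \<omega>) \<epsilon>"
    if t: "t \<in> {0..T}" and \<epsilon>: "0 < \<epsilon>" for t \<epsilon>
  proof -
    have "\<forall>\<^sub>F k in sequentially. L2le P (\<lambda>(s, \<omega>). elem_process (L k) s \<omega> - H s \<omega>) (\<epsilon> / 2)"
      using \<epsilon> by (intro lim) simp
    then show ?thesis
    proof eventually_elim
      fix k assume k: "L2le P (\<lambda>(s, \<omega>). elem_process (L k) s \<omega> - H s \<omega>) (\<epsilon> / 2)"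
      \<comment> \<open>Here k is fixed and the comparison is with the j-th member of the
        subsequence; as j tends to infinity, Fatou's lemma removes the term in j from the
        bound.\<close>
      have "L2le M (\<lambda>\<omega>. elem_path (L k) t \<omega> - elem_path (L (r j)) t \<omega>) (\<epsilon> + (1 / 8) ^ j / 2)" for j
      proof (rule L2le_elem_path_diff)
        have "L2le P (\<lambda>(s, \<omega>). elem_process (L k) s \<omega> - elem_process (L (r j)) s \<omega>) (\<epsilon> + (1 / 8) ^ j / 2)"
          using close[OF k, of j] \<epsilon> by simp
        then show "L2le P (\<lambda>(s, \<omega>). indicator {0<..t} s * (elem_process (L k) s \<omega> - elem_process (L (r j)) s \<omega>)) (\<epsilon> + (1 / 8) ^ j / 2)"
          by (rule L2le_indicator)
      qed (use t L in auto)
      then show "L2le M (\<lambda>\<omega>. elem_path (L k) t \<omega> - Y t \<omega>) \<epsilon>"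
      proof (rule L2le_Fatou)
        show "AE \<omega> in M. (\<lambda>j. elem_path (L k) t \<omega> - elem_path (L (r j)) t \<omega>) \<longlonglongrightarrow> elem_path (L k) t \<omega> - Y t \<omega>"
          using AE_conv[OF t] by eventually_elim (intro tendsto_intros)
        have "(\<lambda>j. \<epsilon> + (1 / 8) ^ j / 2) \<longlonglongrightarrow> \<epsilon> + 0 / 2"
          by (intro tendsto_intros LIMSEQ_realpow_zero) auto
        then show "(\<lambda>j. \<epsilon> + (1 / 8) ^ j / 2) \<longlonglongrightarrow> \<epsilon>" by simp
        show "(\<lambda>\<omega>. elem_path (L k) t \<omega> - Y t \<omega>) \<in> borel_measurable M"
          using t by (intro elem_path_diff_measurable L Y) auto
      qed
    qed
  qed
  with Y show ?thesis by blast
qed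

lemma has_ito_integral_exists:
  assumes H: "measurable_process M T H"
    and S: "\<And>k::nat. simple_process M T W (N k) (p k) (\<xi> k)"
    and lim: "\<And>\<epsilon>. 0 < \<epsilon> \<Longrightarrow> \<forall>\<^sub>F k in sequentially.
      L2le P (\<lambda>(s, \<omega>). elem_process (step_list (N k) (p k) (\<xi> k)) s \<omega> - H s \<omega>) \<epsilon>"
  shows "\<exists>J. has_ito_integral M T W H J"
proof -
  have ad: "adapted (step_list (N k) (p k) (\<xi> k))" for k
    using S[of k] by (intro adapted_step_list[of T]) (auto simp: simple_process_def)
  obtain J where J: "continuous_process M T J"
    "\<And>t \<epsilon>. t \<in> {0..T} \<Longrightarrow> 0 < \<epsilon> \<Longrightarrow> \<forall>\<^sub>F k in sequentially.
      L2le M (\<lambda>\<omega>. elem_path (step_list (N k) (p k) (\<xi> k)) t \<omega> - J t \<omega>) \<epsilon>"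
    using ito_path_converges[OF ad H lim] by blast
  note iff = has_ito_integral_step_iff[of H J N p \<xi>, OF H J(1) S]
  have "has_ito_integral M T W H J"
    unfolding has_ito_integral_def
  proof (intro conjI H J(1) exI[of _ N] exI[of _ p] exI[of _ \<xi>] allI S ballI)
    show "(\<lambda>k. \<integral>\<^sup>+(s, \<omega>). ennreal ((step_process (N k) (p k) (\<xi> k) s \<omega> - H s \<omega>)\<^sup>2) \<partial>P) \<longlonglongrightarrow> 0"
      using iff(1) lim by blast
    fix t assume "t \<in> {0..T}"
    then show "(\<lambda>k. \<integral>\<^sup>+\<omega>. ennreal ((step_integral W (N k) (p k) (\<xi> k) t \<omega> - J t \<omega>)\<^sup>2) \<partial>M) \<longlonglongrightarrow> 0"
      using iff(2) J(2) by blast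
  qed
  then show ?thesis by blast
qed

end

section \<open>Averages over the cells of a partition\<close>

lemma measurable_lborel_Icc: "f \<in> borel_measurable lborel \<Longrightarrow> f \<in> borel_measurable (lborel_Icc T)"
  by (rule measurable_restrict_space1)

lemma indicator_measurable_Icc [measurable]: "indicator {a<..b::real} \<in> borel_measurable (lborel_Icc T)"
  by (rule measurable_lborel_Icc) simp

lemma partition_sum_indicator:
  fixes c :: "nat \<Rightarrow> real"
  assumes p: "partition_of a b N p" and i: "i < N" and s: "p i < s" "s \<le> p (Suc i)"
  shows "(\<Sum>j<N. c j * indicator {p j<..p (Suc j)} s) = c i"
proof -
  have "(\<Sum>j<N. c j * indicator {p j<..p (Suc j)} s) = (\<Sum>j\<in>{i}. c j * indicator {p j<..p (Suc j)} s)"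
  proof (rule sum.mono_neutral_right)
    show "\<forall>j\<in>{..<N} - {i}. c j * indicator {p j<..p (Suc j)} s = 0"
    proof
      fix j assume j: "j \<in> {..<N} - {i}"
      then consider "j < i" | "i < j" by fastforce
      then show "c j * indicator {p j<..p (Suc j)} s = 0"
      proof cases
        case 1
        then have "p (Suc j) \<le> p i" using i by (intro partition_of_mono[OF p]) auto
        then show ?thesis using s by (auto simp: indicator_def)
      next
        case 2
        then have "p (Suc i) \<le> p j" using j by (intro partition_of_mono[OF p]) auto
        then show ?thesis using s by (auto simp: indicator_def)
      qed
    qed
  qed (use i in auto)
  then show ?thesis using s by simp
qed

lemma partition_of_cell:
  assumes p: "partition_of a b N p" and s: "a < s" "s \<le> b"
  obtains i where "i < N" "p i < s" "s \<le> p (Suc i)"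
proof -
  define k where "k = (LEAST k. s \<le> p k)"
  have "s \<le> p N" using p s by (auto simp: partition_of_def)
  then have k: "s \<le> p k" "k \<le> N" unfolding k_def by (rule LeastI, rule Least_le)
  have "k \<noteq> 0" using k(1) p s by (cases k) (auto simp: partition_of_def)
  then obtain i where i: "k = Suc i" by (cases k) auto
  have "p i < s" using not_less_Least[of i "\<lambda>k. s \<le> p k"] i unfolding k_def by simp
  then show thesis using that[of i] k i by auto
qed

lemma partition_sum_outside:
  fixes c :: "nat \<Rightarrow> real"
  assumes p: "partition_of a b N p" and s: "s \<notin> {a<..b}"
  shows "(\<Sum>j<N. c j * indicator {p j<..p (Suc j)} s) = 0"
proof (rule sum.neutral, rule)
  fix j assume "j \<in> {..<N}"
  then have "a \<le> p j" "p (Suc j) \<le> b"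
    using partition_of_bounds[OF p, of j] partition_of_bounds[OF p, of "Suc j"] by auto
  then show "c j * indicator {p j<..p (Suc j)} s = 0" using s by (auto simp: indicator_def)
qed

text \<open>At most one summand is nonzero, so a map that fixes 0 can be taken inside the sum; it is
  applied to squares.\<close>

lemma partition_sum_comp:
  fixes c :: "nat \<Rightarrow> real"
  assumes p: "partition_of a b N p" and h: "h 0 = (0::real)"
  shows "h (\<Sum>j<N. c j * indicator {p j<..p (Suc j)} s) = (\<Sum>j<N. h (c j) * indicator {p j<..p (Suc j)} s)"
proof (cases "s \<in> {a<..b}")
  case True
  then obtain i where i: "i < N" "p i < s" "s \<le> p (Suc i)"
    using partition_of_cell[OF p, of s] by auto
  show ?thesis unfolding partition_sum_indicator[OF p i] ..
next
  case False
  show ?thesis unfolding partition_sum_outside[OF p False] by (rule h)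
qed

lemma partition_sum_const:
  fixes h :: real
  assumes p: "partition_of a b N p"
  shows "(\<Sum>j<N. h * indicator {p j<..p (Suc j)} s) = indicator {a<..b} s * h"
proof (cases "s \<in> {a<..b}")
  case True
  then obtain i where i: "i < N" "p i < s" "s \<le> p (Suc i)"
    using partition_of_cell[OF p, of s] by auto
  show ?thesis using True unfolding partition_sum_indicator[OF p i] by simp
next
  case False
  then show ?thesis unfolding partition_sum_outside[OF p False] by simp
qed

text \<open>The summands have disjoint supports in time, so their squares add exactly, without the
  factors 2 of \<open>L2le_add\<close>. This keeps bounds independent of the number of cells. The
  map \<pi> extracts the time from a point.\<close>

lemma L2le_partition_sum:
  assumes p: "partition_of a b N p"
    and le: "\<And>i. i < N \<Longrightarrow> L2le \<Lambda> (\<lambda>z. c i z * indicator {p i<..p (Suc i)} (\<pi> z)) (\<rho> i)"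
    and \<rho>: "\<And>i. i < N \<Longrightarrow> 0 \<le> \<rho> i"
  shows "L2le \<Lambda> (\<lambda>z. \<Sum>i<N. c i z * indicator {p i<..p (Suc i)} (\<pi> z)) (\<Sum>i<N. \<rho> i)"
proof -
  have m: "(\<lambda>z. c i z * indicator {p i<..p (Suc i)} (\<pi> z)) \<in> borel_measurable \<Lambda>" if "i < N" for i
    using le[OF that] by (simp add: L2le_def)
  have "((\<Sum>i<N. c i z * indicator {p i<..p (Suc i)} (\<pi> z)))\<^sup>2 =
      (\<Sum>i<N. (c i z * indicator {p i<..p (Suc i)} (\<pi> z))\<^sup>2)" for z
  proof -
    have "((\<Sum>i<N. c i z * indicator {p i<..p (Suc i)} (\<pi> z)))\<^sup>2 =
        (\<Sum>i<N. (c i z)\<^sup>2 * indicator {p i<..p (Suc i)} (\<pi> z))"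
      by (rule partition_sum_comp[OF p, where h="\<lambda>x. x\<^sup>2"]) simp
    also have "\<dots> = (\<Sum>i<N. (c i z * indicator {p i<..p (Suc i)} (\<pi> z))\<^sup>2)"
      by (intro sum.cong) (auto simp: indicator_def)
    finally show ?thesis .
  qed
  then have "(\<integral>\<^sup>+z. ennreal ((\<Sum>i<N. c i z * indicator {p i<..p (Suc i)} (\<pi> z))\<^sup>2) \<partial>\<Lambda>) =
      (\<integral>\<^sup>+z. (\<Sum>i<N. ennreal ((c i z * indicator {p i<..p (Suc i)} (\<pi> z))\<^sup>2)) \<partial>\<Lambda>)"
    by (simp add: sum_ennreal)
  also have "\<dots> = (\<Sum>i<N. \<integral>\<^sup>+z. ennreal ((c i z * indicator {p i<..p (Suc i)} (\<pi> z))\<^sup>2) \<partial>\<Lambda>)"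
  proof (rule nn_integral_sum)
    fix i assume "i \<in> {..<N}"
    then have [measurable]: "(\<lambda>z. c i z * indicator {p i<..p (Suc i)} (\<pi> z)) \<in> borel_measurable \<Lambda>"
      using m by simp
    show "(\<lambda>z. ennreal ((c i z * indicator {p i<..p (Suc i)} (\<pi> z))\<^sup>2)) \<in> borel_measurable \<Lambda>"
      by measurable
  qed
  also have "\<dots> \<le> (\<Sum>i<N. ennreal (\<rho> i))"
    using le by (intro sum_mono) (auto simp: L2le_def)
  also have "\<dots> = ennreal (\<Sum>i<N. \<rho> i)"
    using \<rho> by (intro sum_ennreal) auto
  finally have "(\<integral>\<^sup>+z. ennreal ((\<Sum>i<N. c i z * indicator {p i<..p (Suc i)} (\<pi> z))\<^sup>2) \<partial>\<Lambda>) \<le>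
      ennreal (\<Sum>i<N. \<rho> i)" .
  moreover have "(\<lambda>z. \<Sum>i<N. c i z * indicator {p i<..p (Suc i)} (\<pi> z)) \<in> borel_measurable \<Lambda>"
    by (rule borel_measurable_sum) (use m in simp)
  ultimately show ?thesis
    unfolding L2le_def by blast
qed

section \<open>Functions in L^2 and their cell averages\<close>

lemma L2_Icc_measurable: "f \<in> L2_Icc T \<Longrightarrow> f \<in> borel_measurable (lborel_Icc T)"
  by (simp add: L2_Icc_def)

lemma L2_Icc_integrable_square: "f \<in> L2_Icc T \<Longrightarrow> integrable (lborel_Icc T) (\<lambda>s. (f s)\<^sup>2)"
  by (simp add: L2_Icc_def)

lemma L2_Icc_product_integrable:
  assumes "f \<in> L2_Icc T" "g \<in> L2_Icc T"
  shows "integrable (lborel_Icc T) (\<lambda>s. f s * g s)"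
  using assms by (intro integrable_mult_of_squares) (auto simp: L2_Icc_def)

lemma const_L2_Icc: "(\<lambda>_. c) \<in> L2_Icc T"
proof -
  interpret finite_measure "lborel_Icc T" by (rule finite_measure_Icc)
  show ?thesis by (simp add: L2_Icc_def)
qed

lemma L2_Icc_integrable: "f \<in> L2_Icc T \<Longrightarrow> integrable (lborel_Icc T) f"
  using L2_Icc_product_integrable[OF _ const_L2_Icc[of 1]] by simp

lemma integrable_indicator_mult:
  fixes h :: "real \<Rightarrow> real"
  assumes "integrable (lborel_Icc T) h"
  shows "integrable (lborel_Icc T) (\<lambda>s. indicator {a<..b} s * h s)"
proof (rule Bochner_Integration.integrable_bound[OF assms])
  have [measurable]: "h \<in> borel_measurable (lborel_Icc T)" using assms by simp
  show "(\<lambda>s. indicator {a<..b} s * h s) \<in> borel_measurable (lborel_Icc T)" by measurable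
qed (auto simp: indicator_def)

text \<open>The measure with density f^2, evaluated on an interval. Half-open intervals make it
  additive over a partition.\<close>

definition sq_int :: "real \<Rightarrow> (real \<Rightarrow> real) \<Rightarrow> real \<Rightarrow> real \<Rightarrow> real" where
  "sq_int T f a b = (\<integral>s. indicator {a<..b} s * (f s)\<^sup>2 \<partial>lborel_Icc T)"

lemma sq_int_nonneg: "0 \<le> sq_int T f a b"
  by (simp add: sq_int_def integral_nonneg_AE)

lemma L2le_sq_int:
  assumes "f \<in> L2_Icc T"
  shows "L2le (lborel_Icc T) (\<lambda>s. indicator {a<..b} s * f s) (sq_int T f a b)"
proof -
  have eq: "(indicator {a<..b} s * f s)\<^sup>2 = indicator {a<..b} s * (f s)\<^sup>2" for s
    by (simp add: indicator_def)
  show ?thesis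
    unfolding sq_int_def eq[symmetric]
    using L2_Icc_measurable[OF assms] integrable_indicator_mult[OF L2_Icc_integrable_square[OF assms], of a b]
    by (intro L2le_integral) (auto simp: eq)
qed

lemma integral_partition_sum:
  fixes h :: "real \<Rightarrow> real"
  assumes p: "partition_of a b N p" and h: "integrable (lborel_Icc T) h"
  shows "(\<Sum>i<N. \<integral>s. indicator {p i<..p (Suc i)} s * h s \<partial>lborel_Icc T) =
    (\<integral>s. indicator {a<..b} s * h s \<partial>lborel_Icc T)"
proof -
  have "(\<Sum>i<N. \<integral>s. indicator {p i<..p (Suc i)} s * h s \<partial>lborel_Icc T) =
      (\<integral>s. (\<Sum>i<N. indicator {p i<..p (Suc i)} s * h s) \<partial>lborel_Icc T)"
    by (rule Bochner_Integration.integral_sum[symmetric]) (rule integrable_indicator_mult[OF h])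
  also have "\<dots> = (\<integral>s. indicator {a<..b} s * h s \<partial>lborel_Icc T)"
    unfolding partition_sum_const[OF p, symmetric] by (simp only: mult.commute)
  finally show ?thesis .
qed

lemma sq_int_partition_sum:
  assumes "partition_of a b N p" "f \<in> L2_Icc T"
  shows "(\<Sum>i<N. sq_int T f (p i) (p (Suc i))) = sq_int T f a b"
  unfolding sq_int_def using assms by (intro integral_partition_sum) (auto simp: L2_Icc_def)

definition avg :: "real \<Rightarrow> (real \<Rightarrow> real) \<Rightarrow> real \<Rightarrow> real \<Rightarrow> real" where
  "avg T f a b = 1 / (b - a) * (\<integral>s. indicator {a<..b} s * f s \<partial>lborel_Icc T)"

text \<open>The orthogonal projection of f onto the functions that are constant on the cells and 0
  outside the partitioned interval.\<close>

definition step_avg :: "real \<Rightarrow> nat \<Rightarrow> (nat \<Rightarrow> real) \<Rightarrow> (real \<Rightarrow> real) \<Rightarrow> real \<Rightarrow> real" where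
  "step_avg T N p f s = (\<Sum>i<N. avg T f (p i) (p (Suc i)) * indicator {p i<..p (Suc i)} s)"

lemma step_avg_measurable [measurable]: "step_avg T N p f \<in> borel_measurable (lborel_Icc S)"
  unfolding step_avg_def[abs_def] by measurable

lemma L1_sq_int_bound:
  assumes f: "f \<in> L2_Icc T" and ab: "0 \<le> a" "a \<le> b" "b \<le> T"
  shows "(\<integral>s. indicator {a<..b} s * \<bar>f s\<bar> \<partial>lborel_Icc T) \<le> sqrt ((b - a) * sq_int T f a b)"
proof -
  have "sq_int T (\<lambda>_. 1) a b = b - a"
    using integral_indicator_Icc[of a b T] ab by (simp add: sq_int_def)
  then have "L2le (lborel_Icc T) (\<lambda>s. indicator {a<..b} s * 1) (b - a)"
    using L2le_sq_int[OF const_L2_Icc[of 1], of T a b] by simp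
  from L1le_mult[OF this L2le_sq_int[OF f, of a b]] ab
  have "L1le (lborel_Icc T) (\<lambda>s. indicator {a<..b} s * 1 * (indicator {a<..b} s * f s)) (sqrt ((b - a) * sq_int T f a b))"
    by (simp add: sq_int_nonneg)
  from L1le_imp_integral_le[OF this]
  have "(\<integral>s. \<bar>indicator {a<..b} s * 1 * (indicator {a<..b} s * f s)\<bar> \<partial>lborel_Icc T) \<le> sqrt ((b - a) * sq_int T f a b)"
    using ab by (simp add: sq_int_nonneg)
  also have "(\<lambda>s. \<bar>indicator {a<..b} s * 1 * (indicator {a<..b} s * f s)\<bar>) = (\<lambda>s. indicator {a<..b} s * \<bar>f s\<bar>)"
    by (auto simp: indicator_def fun_eq_iff)
  finally show ?thesis .
qed

text \<open>Jensen's inequality on one cell, multiplied by the length of the cell so that it can be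
  summed over a partition.\<close>

lemma avg_square_le:
  assumes f: "f \<in> L2_Icc T" and ab: "0 \<le> a" "a < b" "b \<le> T"
  shows "(avg T f a b)\<^sup>2 * (b - a) \<le> sq_int T f a b"
proof -
  let ?I = "\<integral>s. indicator {a<..b} s * f s \<partial>lborel_Icc T"
  have "\<bar>?I\<bar> \<le> (\<integral>s. \<bar>indicator {a<..b} s * f s\<bar> \<partial>lborel_Icc T)"
    by (rule integral_abs_bound)
  also have "(\<lambda>s. \<bar>indicator {a<..b} s * f s\<bar>) = (\<lambda>s. indicator {a<..b} s * \<bar>f s\<bar>)"
    by (auto simp: indicator_def fun_eq_iff)
  also have "(\<integral>s. indicator {a<..b} s * \<bar>f s\<bar> \<partial>lborel_Icc T) \<le> sqrt ((b - a) * sq_int T f a b)"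
    using ab by (intro L1_sq_int_bound f) auto
  finally have "\<bar>?I\<bar>\<^sup>2 \<le> (sqrt ((b - a) * sq_int T f a b))\<^sup>2"
    by (rule power_mono) simp
  then have "?I\<^sup>2 \<le> (b - a) * sq_int T f a b"
    using ab by (simp add: sq_int_nonneg)
  then have "?I\<^sup>2 / (b - a) \<le> sq_int T f a b"
    using ab by (simp add: pos_divide_le_eq mult.commute)
  moreover have "(avg T f a b)\<^sup>2 * (b - a) = ?I\<^sup>2 / (b - a)"
    using ab by (simp add: avg_def power_mult_distrib power_divide power2_eq_square)
  ultimately show ?thesis by simp
qed

text \<open>The projection is a contraction, by summing \<open>avg_square_le\<close> over the cells.
  This transfers an L^2 approximation of f to its averages, uniformly in the partition.\<close>

lemma L2le_step_avg:
  assumes p: "partition_of a b N p" and ab: "0 \<le> a" "b \<le> T" and f: "f \<in> L2_Icc T"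
  shows "L2le (lborel_Icc T) (step_avg T N p f) (sq_int T f a b)"
  unfolding step_avg_def[abs_def] sq_int_partition_sum[OF p f, symmetric]
proof (rule L2le_partition_sum[OF p, where \<pi>="\<lambda>s. s"])
  fix i assume i: "i < N"
  have b: "0 \<le> p i" "p i < p (Suc i)" "p (Suc i) \<le> T"
    using partition_of_bounds[OF p, of i] partition_of_bounds[OF p, of "Suc i"] partition_of_less[OF p i] i ab by auto
  have "L2le (lborel_Icc T) (\<lambda>s. indicator {p i<..p (Suc i)} s * avg T f (p i) (p (Suc i)))
      (sq_int T (\<lambda>_. avg T f (p i) (p (Suc i))) (p i) (p (Suc i)))"
    by (rule L2le_sq_int[OF const_L2_Icc])
  moreover have "sq_int T (\<lambda>_. avg T f (p i) (p (Suc i))) (p i) (p (Suc i)) =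
      (avg T f (p i) (p (Suc i)))\<^sup>2 * (p (Suc i) - p i)"
    using integral_indicator_Icc[of "p i" "p (Suc i)" T] b by (simp add: sq_int_def mult.commute)
  ultimately show "L2le (lborel_Icc T) (\<lambda>z. avg T f (p i) (p (Suc i)) * indicator {p i<..p (Suc i)} z)
      (sq_int T f (p i) (p (Suc i)))"
    using avg_square_le[OF f b] by (auto simp: mult.commute intro: L2le_mono)
qed (rule sq_int_nonneg)

lemma avg_diff:
  assumes "f \<in> L2_Icc T" "g \<in> L2_Icc T"
  shows "avg T (\<lambda>s. f s - g s) a b = avg T f a b - avg T g a b"
  using integrable_indicator_mult[OF L2_Icc_integrable[OF assms(1)], of a b]
    integrable_indicator_mult[OF L2_Icc_integrable[OF assms(2)], of a b]
  by (simp add: avg_def right_diff_distrib)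

lemma step_avg_diff:
  assumes "f \<in> L2_Icc T" "g \<in> L2_Icc T"
  shows "step_avg T N p (\<lambda>s. f s - g s) s = step_avg T N p f s - step_avg T N p g s"
  by (simp add: step_avg_def avg_diff[OF assms] left_diff_distrib sum_subtractf)

lemma L2_Icc_diff:
  assumes "f \<in> L2_Icc T" "g \<in> L2_Icc T"
  shows "(\<lambda>s. f s - g s) \<in> L2_Icc T"
proof -
  have "L2le (lborel_Icc T) (\<lambda>s. f s - g s) (2 * (\<integral>s. (f s)\<^sup>2 \<partial>lborel_Icc T) + 2 * (\<integral>s. (g s)\<^sup>2 \<partial>lborel_Icc T))"
    using assms by (intro L2le_diff L2le_integral) (auto simp: L2_Icc_def integral_nonneg_AE)
  then show ?thesis
    using L2le_imp_integrable L2le_measurable unfolding L2_Icc_def by blast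
qed

section \<open>Approximation by continuous functions\<close>

lemma continuous_L2_Icc:
  assumes "continuous_on UNIV (g :: real \<Rightarrow> real)"
  shows "g \<in> L2_Icc T"
proof -
  interpret finite_measure "lborel_Icc T" by (rule finite_measure_Icc)
  have m: "g \<in> borel_measurable (lborel_Icc T)"
    using borel_measurable_continuous_onI[OF assms] by (intro measurable_lborel_Icc) simp
  have "compact (g ` {0..T})"
    using assms by (intro compact_continuous_image) (auto intro: continuous_on_subset)
  then obtain B where B: "\<And>s. s \<in> {0..T} \<Longrightarrow> \<bar>g s\<bar> \<le> B"
    using compact_imp_bounded[THEN bounded_iff[THEN iffD1]] by fastforce
  have "integrable (lborel_Icc T) (\<lambda>s. (g s)\<^sup>2)"
  proof (rule integrable_const_bound[where B="B\<^sup>2"])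
    show "AE s in lborel_Icc T. norm ((g s)\<^sup>2) \<le> B\<^sup>2"
      using B by (intro AE_I2) (auto simp: space_restrict_space intro: power_mono[of "\<bar>g _\<bar>" B 2, simplified])
    show "(\<lambda>s. (g s)\<^sup>2) \<in> borel_measurable (lborel_Icc T)" using m by measurable
  qed
  then show ?thesis using m by (simp add: L2_Icc_def)
qed

text \<open>Truncating f at a high level K costs little by dominated convergence. Since f is an
  almost everywhere limit of continuous functions, truncating these at the same level, which
  preserves continuity, gives bounded approximations of the truncated f, and dominated convergence
  applies again.\<close>

lemma L2_Icc_continuous_approx:
  assumes f: "f \<in> L2_Icc T" and \<epsilon>: "0 < \<epsilon>"
  obtains g where "continuous_on UNIV g" "L2le (lborel_Icc T) (\<lambda>s. f s - g s) \<epsilon>"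
proof -
  interpret finite_measure "lborel_Icc T" by (rule finite_measure_Icc)
  define clip where "clip K x = max (- K) (min K x)" for K x :: real
  note fm[measurable] = L2_Icc_measurable[OF f]
  have [measurable]: "(\<lambda>s. clip K (f s)) \<in> borel_measurable (lborel_Icc T)" for K
    unfolding clip_def by measurable
  have "(\<lambda>n. \<integral>s. (f s - clip (real n) (f s))\<^sup>2 \<partial>lborel_Icc T) \<longlonglongrightarrow> (\<integral>s. 0 \<partial>lborel_Icc T)"
  proof (rule integral_dominated_convergence[where w="\<lambda>s. (f s)\<^sup>2"])
    show "integrable (lborel_Icc T) (\<lambda>s. (f s)\<^sup>2)" using f by (simp add: L2_Icc_def)
    show "AE s in lborel_Icc T. (\<lambda>n. (f s - clip (real n) (f s))\<^sup>2) \<longlonglongrightarrow> 0"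
    proof (intro AE_I2 tendsto_eventually)
      fix s
      obtain n0 where n0: "\<bar>f s\<bar> \<le> real n0" using real_arch_simple by blast
      show "\<forall>\<^sub>F n in sequentially. (f s - clip (real n) (f s))\<^sup>2 = 0"
        using eventually_ge_at_top[of n0]
      proof eventually_elim
        fix n assume "n0 \<le> n"
        then have "\<bar>f s\<bar> \<le> real n" using n0 by linarith
        then show "(f s - clip (real n) (f s))\<^sup>2 = 0" by (simp add: clip_def)
      qed
    qed
    show "AE s in lborel_Icc T. norm ((f s - clip (real n) (f s))\<^sup>2) \<le> (f s)\<^sup>2" for n
    proof (rule AE_I2)
      fix s
      have "\<bar>f s - clip (real n) (f s)\<bar> \<le> \<bar>f s\<bar>" by (auto simp: clip_def max_def min_def)
      then show "norm ((f s - clip (real n) (f s))\<^sup>2) \<le> (f s)\<^sup>2" by (simp add: abs_le_square_iff)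
    qed
  qed measurable
  then have "(\<lambda>n. \<integral>s. (f s - clip (real n) (f s))\<^sup>2 \<partial>lborel_Icc T) \<longlonglongrightarrow> 0" by simp
  from order_tendstoD(2)[OF this, of "\<epsilon> / 4"] \<epsilon>
  obtain n where n: "(\<integral>s. (f s - clip (real n) (f s))\<^sup>2 \<partial>lborel_Icc T) < \<epsilon> / 4"
    by (auto simp: eventually_sequentially)
  define K where "K = real n"
  have K: "0 \<le> K" by (simp add: K_def)
  have cl_le: "\<bar>clip K x\<bar> \<le> K" for x using K by (auto simp: clip_def)
  \<comment> \<open>Extension by 0 to the real line, where a Lebesgue measurable function is an
    almost everywhere limit of continuous ones.\<close>
  define f0 where "f0 s = indicator {0..T} s *\<^sub>R f s" for s
  have "f0 \<in> borel_measurable lborel"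
    unfolding f0_def[abs_def] using fm by (subst (asm) borel_measurable_restrict_space_iff) auto
  then have "f0 \<in> borel_measurable lebesgue" by (simp add: measurable_completion)
  then have "f0 measurable_on UNIV"
    by (rule lebesgue_measurable_imp_measurable_on) simp
  then obtain Z h where Z: "negligible Z" and h: "\<And>n. continuous_on UNIV (h n)"
    and lim: "\<And>x. x \<notin> Z \<Longrightarrow> (\<lambda>n. h n x) \<longlonglongrightarrow> f0 x"
    unfolding measurable_on_def by auto
  have hm[measurable]: "h n \<in> borel_measurable (lborel_Icc T)" for n
    using borel_measurable_continuous_onI[OF h[of n]] by (intro measurable_lborel_Icc) simp
  have hcm[measurable]: "(\<lambda>s. clip K (h n s)) \<in> borel_measurable (lborel_Icc T)" for n
    unfolding clip_def by measurable
  have "AE x in lebesgue. x \<notin> Z"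
    using Z by (simp add: negligible_iff_null_sets AE_not_in)
  then have "AE x in lborel. x \<notin> Z"
    by (simp add: AE_completion_iff)
  then have aeZ: "AE x in lborel_Icc T. x \<notin> Z"
    by (subst AE_restrict_space_iff) auto
  have "(\<lambda>m. \<integral>s. (clip K (f s) - clip K (h m s))\<^sup>2 \<partial>lborel_Icc T) \<longlonglongrightarrow> (\<integral>s. 0 \<partial>lborel_Icc T)"
  proof (rule integral_dominated_convergence[where w="\<lambda>s. (2 * K)\<^sup>2"])
    show "AE s in lborel_Icc T. (\<lambda>m. (clip K (f s) - clip K (h m s))\<^sup>2) \<longlonglongrightarrow> 0"
      using aeZ AE_space
    proof eventually_elim
      fix s assume s: "s \<notin> Z" "s \<in> space (lborel_Icc T)"
      then have "(\<lambda>m. h m s) \<longlonglongrightarrow> f s" using lim[of s] by (simp add: f0_def space_restrict_space)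
      then have "(\<lambda>m. (clip K (f s) - clip K (h m s))\<^sup>2) \<longlonglongrightarrow> (clip K (f s) - clip K (f s))\<^sup>2"
        unfolding clip_def by (intro tendsto_intros)
      then show "(\<lambda>m. (clip K (f s) - clip K (h m s))\<^sup>2) \<longlonglongrightarrow> 0" by simp
    qed
    show "AE s in lborel_Icc T. norm ((clip K (f s) - clip K (h m s))\<^sup>2) \<le> (2 * K)\<^sup>2" for m
    proof (rule AE_I2)
      fix s
      have "\<bar>clip K (f s) - clip K (h m s)\<bar> \<le> \<bar>2 * K\<bar>"
        using cl_le[of "f s"] cl_le[of "h m s"] by linarith
      then show "norm ((clip K (f s) - clip K (h m s))\<^sup>2) \<le> (2 * K)\<^sup>2"
        using abs_le_square_iff[of "clip K (f s) - clip K (h m s)" "2 * K"] by simp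
    qed
    show "(\<lambda>s. (clip K (f s) - clip K (h m s))\<^sup>2) \<in> borel_measurable (lborel_Icc T)" for m
      by measurable
  qed simp_all
  then have "(\<lambda>m. \<integral>s. (clip K (f s) - clip K (h m s))\<^sup>2 \<partial>lborel_Icc T) \<longlonglongrightarrow> 0" by simp
  from order_tendstoD(2)[OF this, of "\<epsilon> / 4"] \<epsilon>
  obtain m where m: "(\<integral>s. (clip K (f s) - clip K (h m s))\<^sup>2 \<partial>lborel_Icc T) < \<epsilon> / 4"
    by (auto simp: eventually_sequentially)
  have 1: "L2le (lborel_Icc T) (\<lambda>s. f s - clip K (f s)) (\<epsilon> / 4)"
  proof (rule L2le_mono[OF L2le_integral])
    show "integrable (lborel_Icc T) (\<lambda>s. (f s - clip K (f s))\<^sup>2)"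
    proof (rule Bochner_Integration.integrable_bound[OF L2_Icc_integrable_square[OF f]])
      show "AE s in lborel_Icc T. norm ((f s - clip K (f s))\<^sup>2) \<le> norm ((f s)\<^sup>2)"
      proof (rule AE_I2)
        fix s
        have "\<bar>f s - clip K (f s)\<bar> \<le> \<bar>f s\<bar>" using K by (auto simp: clip_def max_def min_def)
        then show "norm ((f s - clip K (f s))\<^sup>2) \<le> norm ((f s)\<^sup>2)" by (simp add: abs_le_square_iff)
      qed
    qed measurable
  qed (use n K_def in auto)
  have 2: "L2le (lborel_Icc T) (\<lambda>s. clip K (f s) - clip K (h m s)) (\<epsilon> / 4)"
  proof (rule L2le_mono[OF L2le_integral])
    show "integrable (lborel_Icc T) (\<lambda>s. (clip K (f s) - clip K (h m s))\<^sup>2)"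
    proof (rule integrable_const_bound[where B="(2 * K)\<^sup>2"])
      show "AE s in lborel_Icc T. norm ((clip K (f s) - clip K (h m s))\<^sup>2) \<le> (2 * K)\<^sup>2"
      proof (rule AE_I2)
        fix s
        have "\<bar>clip K (f s) - clip K (h m s)\<bar> \<le> \<bar>2 * K\<bar>"
          using cl_le[of "f s"] cl_le[of "h m s"] by linarith
        then show "norm ((clip K (f s) - clip K (h m s))\<^sup>2) \<le> (2 * K)\<^sup>2"
        using abs_le_square_iff[of "clip K (f s) - clip K (h m s)" "2 * K"] by simp
      qed
    qed measurable
  qed (use m in auto)
  have "L2le (lborel_Icc T) (\<lambda>s. f s - clip K (h m s)) \<epsilon>"
    using L2le_add[OF 1 2] \<epsilon> by simp
  moreover have "continuous_on UNIV (\<lambda>s. clip K (h m s))"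
    unfolding clip_def using h by (intro continuous_intros)
  ultimately show thesis using that by blast
qed

text \<open>Absolute continuity of the measure with density f^2. For a continuous approximation g,
  the part f - g is small on every interval, and g^2 is bounded, so it contributes little on short
  ones.\<close>

lemma sq_int_uniformly_small:
  assumes f: "f \<in> L2_Icc T" and \<epsilon>: "0 < \<epsilon>"
  obtains \<delta> where "0 < \<delta>" "\<And>a b. 0 \<le> a \<Longrightarrow> a \<le> b \<Longrightarrow> b \<le> T \<Longrightarrow> b - a < \<delta> \<Longrightarrow> sq_int T f a b \<le> \<epsilon>"
proof -
  obtain g where g: "continuous_on UNIV g" "L2le (lborel_Icc T) (\<lambda>s. f s - g s) (\<epsilon> / 4)"
    using L2_Icc_continuous_approx[OF f, of "\<epsilon> / 4"] \<epsilon> by auto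
  have "compact (g ` {0..T})"
    using g(1) by (intro compact_continuous_image) (auto intro: continuous_on_subset)
  then obtain B where B: "\<And>s. s \<in> {0..T} \<Longrightarrow> \<bar>g s\<bar> \<le> B"
    using compact_imp_bounded[THEN bounded_iff[THEN iffD1]] by fastforce
  \<comment> \<open>On an interval of this length the bound B^2 for g^2 contributes at most
    \<epsilon>/4; the added 1 keeps the denominator positive.\<close>
  define \<delta> where "\<delta> = \<epsilon> / 4 / (B\<^sup>2 + 1)"
  have pos: "0 < B\<^sup>2 + 1" by (simp add: add_nonneg_pos)
  show thesis
  proof
    show "0 < \<delta>" using \<epsilon> pos by (simp add: \<delta>_def)
    fix a b assume ab: "0 \<le> a" "a \<le> b" "b \<le> T" "b - a < \<delta>"
    have gL: "g \<in> L2_Icc T" by (rule continuous_L2_Icc[OF g(1)])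
    have gB: "L2le (lborel_Icc T) (\<lambda>s. indicator {a<..b} s * g s) (\<epsilon> / 4)"
    proof (rule L2le_mono[OF L2le_sq_int[OF gL]])
      have "sq_int T g a b \<le> (\<integral>s. indicator {a<..b} s * B\<^sup>2 \<partial>lborel_Icc T)"
        unfolding sq_int_def
      proof (rule integral_mono)
        show "integrable (lborel_Icc T) (\<lambda>s. indicator {a<..b} s * (g s)\<^sup>2)"
          by (rule integrable_indicator_mult[OF L2_Icc_integrable_square[OF gL]])
        show "integrable (lborel_Icc T) (\<lambda>s. indicator {a<..b} s * B\<^sup>2)"
          by (rule integrable_indicator_mult[OF L2_Icc_integrable[OF const_L2_Icc]])
        fix s assume "s \<in> space (lborel_Icc T)"
        then have "\<bar>g s\<bar> \<le> B" using B by (simp add: space_restrict_space)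
        then have "(g s)\<^sup>2 \<le> B\<^sup>2" using power_mono[of "\<bar>g s\<bar>" B 2] by simp
        then show "indicator {a<..b} s * (g s)\<^sup>2 \<le> indicator {a<..b} s * B\<^sup>2" by (simp add: indicator_def)
      qed
      also have "\<dots> = B\<^sup>2 * (b - a)"
        using integral_indicator_Icc[of a b T] ab by simp
      also have "\<dots> \<le> (B\<^sup>2 + 1) * \<delta>"
        using ab by (intro mult_mono) auto
      also have "\<dots> = \<epsilon> / 4"
        using nonzero_mult_div_cancel_left[of "B\<^sup>2 + 1" "\<epsilon> / 4"] pos unfolding \<delta>_def
        by (simp only: times_divide_eq_right)
      finally show "sq_int T g a b \<le> \<epsilon> / 4" .
    qed
    have fg: "L2le (lborel_Icc T) (\<lambda>s. indicator {a<..b} s * (f s - g s)) (\<epsilon> / 4)"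
    proof -
      have "(\<integral>\<^sup>+s. ennreal ((indicator {a<..b} s * (f s - g s))\<^sup>2) \<partial>lborel_Icc T) \<le>
          (\<integral>\<^sup>+s. ennreal ((f s - g s)\<^sup>2) \<partial>lborel_Icc T)"
        by (intro nn_integral_mono) (auto simp: indicator_def)
      then show ?thesis using g(2) by (auto simp: L2le_def)
    qed
    have "L2le (lborel_Icc T) (\<lambda>s. indicator {a<..b} s * f s) \<epsilon>"
      using L2le_add[OF fg gB] \<epsilon> by (simp add: algebra_simps)
    from L2le_imp_integral_le[OF this] \<epsilon>
    have "(\<integral>s. (indicator {a<..b} s * f s)\<^sup>2 \<partial>lborel_Icc T) \<le> \<epsilon>" by simp
    also have "(\<lambda>s. (indicator {a<..b} s * f s)\<^sup>2) = (\<lambda>s. indicator {a<..b} s * (f s)\<^sup>2)"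
      by (auto simp: indicator_def fun_eq_iff)
    finally show "sq_int T f a b \<le> \<epsilon>" by (simp add: sq_int_def)
  qed
qed

text \<open>By uniform continuity all values of g on the cell of s differ from \<open>g s\<close> by
  at most \<eta>, hence so does their average. Outside {0<..t} both terms are 0.\<close>

lemma step_avg_continuous_close:
  assumes g: "continuous_on UNIV g" and \<eta>: "0 < \<eta>"
  obtains \<delta> where "0 < \<delta>" "\<And>t N p s. t \<le> T \<Longrightarrow> partition_of 0 t N p \<Longrightarrow> (\<forall>i<N. p (Suc i) - p i < \<delta>) \<Longrightarrow>
    \<bar>indicator {0<..t} s * g s - step_avg T N p g s\<bar> \<le> \<eta>"
proof -
  have "uniformly_continuous_on {0..T} g"
    using g by (intro compact_uniformly_continuous) (auto intro: continuous_on_subset)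
  then obtain \<delta> where \<delta>: "0 < \<delta>" "\<And>x y. x \<in> {0..T} \<Longrightarrow> y \<in> {0..T} \<Longrightarrow> dist y x < \<delta> \<Longrightarrow> dist (g y) (g x) < \<eta>"
    unfolding uniformly_continuous_on_def using \<eta> by metis
  have gL: "g \<in> L2_Icc T" by (rule continuous_L2_Icc[OF g])
  show thesis
  proof
    show "0 < \<delta>" by fact
    fix t N p s assume t: "t \<le> T" and p: "partition_of 0 t N p" and mesh: "\<forall>i<N. p (Suc i) - p i < \<delta>"
    show "\<bar>indicator {0<..t} s * g s - step_avg T N p g s\<bar> \<le> \<eta>"
    proof (cases "s \<in> {0<..t}")
      case False
      then show ?thesis using \<eta> partition_sum_outside[OF p False] by (simp add: step_avg_def)
    next
      case True
      then obtain i where i: "i < N" "p i < s" "s \<le> p (Suc i)"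
        using partition_of_cell[OF p, of s] by auto
      let ?a = "p i" and ?b = "p (Suc i)"
      have b: "0 \<le> ?a" "?a < ?b" "?b \<le> T"
        using partition_of_bounds[OF p, of i] partition_of_bounds[OF p, of "Suc i"] i t by auto
      have eq: "step_avg T N p g s = avg T g ?a ?b"
        unfolding step_avg_def by (rule partition_sum_indicator[OF p i])
      have I1: "(\<integral>r. indicator {?a<..?b} r \<partial>lborel_Icc T) = ?b - ?a"
        using integral_indicator_Icc[of ?a ?b T] b by simp
      have I2: "(\<integral>r. indicator {?a<..?b} r * c \<partial>lborel_Icc T) = (?b - ?a) * c" for c
        unfolding I1[symmetric] by (rule integral_mult_left_zero)
      have int1: "integrable (lborel_Icc T) (\<lambda>r. indicator {?a<..?b} r * c)" for c :: real
        by (rule integrable_indicator_mult[OF L2_Icc_integrable[OF const_L2_Icc]])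
      have intg: "integrable (lborel_Icc T) (\<lambda>r. indicator {?a<..?b} r * g r)"
        by (rule integrable_indicator_mult[OF L2_Icc_integrable[OF gL]])
      have close: "g r \<le> g s + \<eta>" "g s - \<eta> \<le> g r" if "r \<in> {?a<..?b}" for r
      proof -
        have "?b - ?a < \<delta>" using mesh i by auto
        then have "dist r s < \<delta>" using that i by (auto simp: dist_real_def)
        then have "dist (g r) (g s) < \<eta>" using that b i by (intro \<delta>(2)) auto
        then show "g r \<le> g s + \<eta>" "g s - \<eta> \<le> g r" by (simp_all add: dist_real_def abs_less_iff)
      qed
      have "(\<integral>r. indicator {?a<..?b} r * g r \<partial>lborel_Icc T) \<le> (\<integral>r. indicator {?a<..?b} r * (g s + \<eta>) \<partial>lborel_Icc T)"
        using close by (intro integral_mono intg int1) (auto simp: indicator_def)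
      then have up: "(\<integral>r. indicator {?a<..?b} r * g r \<partial>lborel_Icc T) \<le> (?b - ?a) * (g s + \<eta>)"
        unfolding I2 .
      have "(\<integral>r. indicator {?a<..?b} r * (g s - \<eta>) \<partial>lborel_Icc T) \<le> (\<integral>r. indicator {?a<..?b} r * g r \<partial>lborel_Icc T)"
        using close by (intro integral_mono intg int1) (auto simp: indicator_def)
      then have lo: "(?b - ?a) * (g s - \<eta>) \<le> (\<integral>r. indicator {?a<..?b} r * g r \<partial>lborel_Icc T)"
        unfolding I2 .
      have "avg T g ?a ?b \<le> g s + \<eta>" "g s - \<eta> \<le> avg T g ?a ?b"
        using up lo b by (auto simp: avg_def field_simps)
      then show ?thesis using True by (simp add: eq abs_le_iff)
    qed
  qed
qed

text \<open>As the projections are contractions, it suffices to treat a continuous function close to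
  f. The combined bound is 2 (2 + 2) + 2 = 10 parts of \<epsilon>/12.\<close>

lemma step_avg_converges:
  assumes f: "f \<in> L2_Icc T" and \<epsilon>: "0 < \<epsilon>" and T: "0 < T"
  obtains \<delta> where "0 < \<delta>" "\<And>t N p. t \<le> T \<Longrightarrow> partition_of 0 t N p \<Longrightarrow> (\<forall>i<N. p (Suc i) - p i < \<delta>) \<Longrightarrow>
    L2le (lborel_Icc T) (\<lambda>s. indicator {0<..t} s * f s - step_avg T N p f s) \<epsilon>"
proof -
  obtain g where g: "continuous_on UNIV g" "L2le (lborel_Icc T) (\<lambda>s. f s - g s) (\<epsilon> / 12)"
    using L2_Icc_continuous_approx[OF f, of "\<epsilon> / 12"] \<epsilon> by auto
  have gL: "g \<in> L2_Icc T" by (rule continuous_L2_Icc[OF g(1)])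
  have dL: "(\<lambda>s. f s - g s) \<in> L2_Icc T" by (rule L2_Icc_diff[OF f gL])
  \<comment> \<open>A uniform error \<eta> has squared norm at most \<eta>^2 T on [0,T].\<close>
  define \<eta> where "\<eta> = sqrt (\<epsilon> / (12 * T))"
  have \<eta>: "0 < \<eta>" "\<eta>\<^sup>2 * T = \<epsilon> / 12" using \<epsilon> T by (auto simp: \<eta>_def)
  obtain \<delta> where \<delta>: "0 < \<delta>" "\<And>t N p s. t \<le> T \<Longrightarrow> partition_of 0 t N p \<Longrightarrow> (\<forall>i<N. p (Suc i) - p i < \<delta>) \<Longrightarrow>
    \<bar>indicator {0<..t} s * g s - step_avg T N p g s\<bar> \<le> \<eta>"
    using step_avg_continuous_close[OF g(1) \<eta>(1), of T] by blast
  have sq_le: "sq_int T (\<lambda>s. f s - g s) a b \<le> \<epsilon> / 12" for a b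
  proof -
    have "sq_int T (\<lambda>s. f s - g s) a b \<le> (\<integral>s. (f s - g s)\<^sup>2 \<partial>lborel_Icc T)"
      unfolding sq_int_def
      by (intro integral_mono integrable_indicator_mult L2_Icc_integrable_square[OF dL]) (auto simp: indicator_def)
    also have "\<dots> \<le> \<epsilon> / 12" using g(2) \<epsilon> by (intro L2le_imp_integral_le) auto
    finally show ?thesis .
  qed
  show thesis
  proof
    show "0 < \<delta>" by fact
    fix t N p assume t: "t \<le> T" and p: "partition_of 0 t N p" and mesh: "\<forall>i<N. p (Suc i) - p i < \<delta>"
    have 1: "L2le (lborel_Icc T) (\<lambda>s. indicator {0<..t} s * (f s - g s)) (\<epsilon> / 12)"
      by (rule L2le_mono[OF L2le_sq_int[OF dL] sq_le])
    have 2: "L2le (lborel_Icc T) (step_avg T N p (\<lambda>s. f s - g s)) (\<epsilon> / 12)"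
      using L2le_step_avg[OF p _ t dL] sq_le by (auto intro: L2le_mono)
    have 3: "L2le (lborel_Icc T) (\<lambda>s. indicator {0<..t} s * g s - step_avg T N p g s) (\<epsilon> / 12)"
      unfolding L2le_def
    proof
      show "(\<lambda>s. indicator {0<..t} s * g s - step_avg T N p g s) \<in> borel_measurable (lborel_Icc T)"
        using L2_Icc_measurable[OF gL] by measurable
      have "(\<integral>\<^sup>+s. ennreal ((indicator {0<..t} s * g s - step_avg T N p g s)\<^sup>2) \<partial>lborel_Icc T) \<le>
          (\<integral>\<^sup>+s. ennreal (\<eta>\<^sup>2) \<partial>lborel_Icc T)"
      proof (intro nn_integral_mono ennreal_leI)
        fix s
        have "\<bar>indicator {0<..t} s * g s - step_avg T N p g s\<bar> \<le> \<eta>" by (rule \<delta>(2)[OF t p mesh])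
        then show "(indicator {0<..t} s * g s - step_avg T N p g s)\<^sup>2 \<le> \<eta>\<^sup>2"
          using \<eta>(1) by (intro power2_le_iff_abs_le[THEN iffD2]) auto
      qed
      also have "\<dots> = ennreal (\<eta>\<^sup>2) * ennreal T"
        using T by (simp add: emeasure_restrict_space space_restrict_space)
      also have "\<dots> = ennreal (\<epsilon> / 12)" using T by (simp add: \<eta>(2) flip: ennreal_mult)
      finally show "(\<integral>\<^sup>+s. ennreal ((indicator {0<..t} s * g s - step_avg T N p g s)\<^sup>2) \<partial>lborel_Icc T) \<le> ennreal (\<epsilon> / 12)" .
    qed
    have "L2le (lborel_Icc T) (\<lambda>s. indicator {0<..t} s * (f s - g s) - step_avg T N p (\<lambda>s. f s - g s) s +
        (indicator {0<..t} s * g s - step_avg T N p g s)) (2 * (2 * (\<epsilon> / 12) + 2 * (\<epsilon> / 12)) + 2 * (\<epsilon> / 12))"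
      using \<epsilon> by (intro L2le_add[OF L2le_diff[OF 1 2] 3]) auto
    then have "L2le (lborel_Icc T) (\<lambda>s. indicator {0<..t} s * f s - step_avg T N p f s)
        (2 * (2 * (\<epsilon> / 12) + 2 * (\<epsilon> / 12)) + 2 * (\<epsilon> / 12))"
      by (rule L2le_cong) (simp add: step_avg_diff[OF f gL] algebra_simps)
    then show "L2le (lborel_Icc T) (\<lambda>s. indicator {0<..t} s * f s - step_avg T N p f s) \<epsilon>"
      by (rule L2le_mono) (use \<epsilon> in simp)
  qed
qed

text \<open>The definitions integrate over closed intervals while the cells are half-open; the
  difference is one point. The indicator of [0,T] masks the values of X outside the time
  interval.\<close>

lemma LBINT_eq_integral_Icc:
  fixes X :: "real \<Rightarrow> real"
  assumes X: "X \<in> borel_measurable (lborel_Icc T)" and ab: "0 \<le> a" "b \<le> T"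
  shows "(LBINT s:{a..b}. X s) = (\<integral>s. indicator {a<..b} s * X s \<partial>lborel_Icc T)"
proof -
  have [measurable]: "(\<lambda>s. indicator {0..T} s *\<^sub>R X s) \<in> borel_measurable lborel"
    using X by (subst (asm) borel_measurable_restrict_space_iff) auto
  have "(LBINT s:{a..b}. X s) = (\<integral>s. indicator {a..b} s * (indicator {0..T} s *\<^sub>R X s) \<partial>lborel)"
    unfolding set_lebesgue_integral_def using ab
    by (intro Bochner_Integration.integral_cong) (auto simp: indicator_def)
  also have "\<dots> = (\<integral>s. indicator {a<..b} s * (indicator {0..T} s *\<^sub>R X s) \<partial>lborel)"
  proof (rule integral_cong_AE)
    show "AE s in lborel. indicator {a..b} s * (indicator {0..T} s *\<^sub>R X s) =
        indicator {a<..b} s * (indicator {0..T} s *\<^sub>R X s)"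
      using AE_lborel_singleton[of a] by eventually_elim (auto simp: indicator_def)
  qed measurable
  also have "\<dots> = (\<integral>s. indicator {0..T} s *\<^sub>R (indicator {a<..b} s * X s) \<partial>lborel)"
    by (intro Bochner_Integration.integral_cong) (auto simp: indicator_def)
  also have "\<dots> = (\<integral>s. indicator {a<..b} s * X s \<partial>lborel_Icc T)"
    by (rule integral_restrict_space[symmetric]) auto
  finally show ?thesis .
qed

text \<open>The path is evaluated at the grid point at or before s, which takes countably many
  values, and the mesh tends to 0. With N = F t this becomes progressive measurability, which is why
  N and t are arbitrary.\<close>

lemma continuous_paths_jointly_measurable:
  fixes Y :: "real \<Rightarrow> 'b \<Rightarrow> real"
  assumes Y: "\<And>s. s \<in> {0..t} \<Longrightarrow> Y s \<in> borel_measurable N"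
    and cont: "\<And>\<omega>. \<omega> \<in> space N \<Longrightarrow> continuous_on {0..t} (\<lambda>s. Y s \<omega>)" and t: "0 \<le> t"
  shows "case_prod Y \<in> borel_measurable (lborel_Icc t \<Otimes>\<^sub>M N)"
proof -
  \<comment> \<open>Clamping keeps the evaluation times in [0,t], where Y is measurable, for every
    integer index.\<close>
  define r where "r n i = max 0 (min t (of_int i / real (Suc n)))" for n and i :: int
  define q where "q n s = r n \<lfloor>s * real (Suc n)\<rfloor>" for n s
  have r01: "r n i \<in> {0..t}" for n i using t by (auto simp: r_def)
  have close: "\<bar>q n s - s\<bar> \<le> 1 / real (Suc n)" if "s \<in> {0..t}" for n s
  proof -
    have "\<bar>of_int \<lfloor>s * real (Suc n)\<rfloor> - s * real (Suc n)\<bar> \<le> 1" by linarith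
    then have "\<bar>of_int \<lfloor>s * real (Suc n)\<rfloor> - s * real (Suc n)\<bar> / real (Suc n) \<le> 1 / real (Suc n)"
      by (rule divide_right_mono) simp
    also have "\<bar>of_int \<lfloor>s * real (Suc n)\<rfloor> - s * real (Suc n)\<bar> / real (Suc n) =
        \<bar>(of_int \<lfloor>s * real (Suc n)\<rfloor> - s * real (Suc n)) / real (Suc n)\<bar>"
      by simp
    also have "(of_int \<lfloor>s * real (Suc n)\<rfloor> - s * real (Suc n)) / real (Suc n) =
        of_int \<lfloor>s * real (Suc n)\<rfloor> / real (Suc n) - s"
      by (simp add: diff_divide_distrib del: of_nat_Suc)
    finally have "\<bar>of_int \<lfloor>s * real (Suc n)\<rfloor> / real (Suc n) - s\<bar> \<le> 1 / real (Suc n)" .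
    then show ?thesis using that unfolding q_def r_def by (auto simp: max_def min_def)
  qed
  show ?thesis
  proof (rule borel_measurable_LIMSEQ_real)
    fix z assume z: "z \<in> space (lborel_Icc t \<Otimes>\<^sub>M N)"
    then have s: "fst z \<in> {0..t}" and \<omega>: "snd z \<in> space N"
      by (auto simp: space_pair_measure space_restrict_space)
    have "(\<lambda>n. q n (fst z) - fst z) \<longlonglongrightarrow> 0"
    proof (rule Lim_null_comparison)
      show "\<forall>\<^sub>F n in sequentially. norm (q n (fst z) - fst z) \<le> 1 / real (Suc n)"
        using close[OF s] by simp
      show "(\<lambda>n. 1 / real (Suc n)) \<longlonglongrightarrow> 0" using LIMSEQ_inverse_real_of_nat by (simp only: inverse_eq_divide)
    qed
    then have "(\<lambda>n. q n (fst z)) \<longlonglongrightarrow> fst z" by (simp add: LIM_zero_iff)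
    then have "(\<lambda>n. Y (q n (fst z)) (snd z)) \<longlonglongrightarrow> Y (fst z) (snd z)"
      by (rule continuous_on_tendsto_compose[OF cont[OF \<omega>] _ s])
        (intro always_eventually allI, unfold q_def, rule r01)
    then show "(\<lambda>n. Y (q n (fst z)) (snd z)) \<longlonglongrightarrow> case_prod Y z"
      by (simp add: case_prod_unfold)
  next
    fix n
    have "(\<lambda>z. Y (r n \<lfloor>fst z * real (Suc n)\<rfloor>) (snd z)) \<in> borel_measurable (lborel_Icc t \<Otimes>\<^sub>M N)"
    proof (rule measurable_compose_countable'[where I=UNIV and f="\<lambda>i z. Y (r n i) (snd z)"])
      show "(\<lambda>z. Y (r n i) (snd z)) \<in> borel_measurable (lborel_Icc t \<Otimes>\<^sub>M N)" for i
        by (rule measurable_compose[OF measurable_snd Y[OF r01]])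
      have "fst \<in> borel_measurable (lborel_Icc t \<Otimes>\<^sub>M N)"
        by (rule measurable_compose[OF measurable_fst, where g="\<lambda>x. x"]) (simp add: measurable_lborel_Icc)
      then show "(\<lambda>z. \<lfloor>fst z * real (Suc n)\<rfloor>) \<in> lborel_Icc t \<Otimes>\<^sub>M N \<rightarrow>\<^sub>M count_space UNIV"
        by measurable
    qed simp
    then show "(\<lambda>z. Y (q n (fst z)) (snd z)) \<in> borel_measurable (lborel_Icc t \<Otimes>\<^sub>M N)"
      by (simp add: q_def)
  qed
qed

context brownian_motion
begin

section \<open>Ito and Lebesgue integrals of regular processes\<close>

text \<open>The invariant of the iteration: it passes from Z to Ito integrals of f Z and to Lebesgue
  integrals of f g Z. Uniform L^2 continuity is what allows Z to be frozen at the left end of a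
  short cell.\<close>

definition regular :: "(real \<Rightarrow> 'a \<Rightarrow> real) \<Rightarrow> bool" where
  "regular Y \<longleftrightarrow> continuous_process M T Y \<and> (\<forall>t\<in>{0..T}. Y t \<in> borel_measurable (F t)) \<and>
     (\<exists>K\<ge>0. \<forall>t\<in>{0..T}. L2le M (Y t) K) \<and>
     (\<forall>\<epsilon>>0. \<exists>\<delta>>0. \<forall>s t. 0 \<le> s \<longrightarrow> s \<le> t \<longrightarrow> t \<le> T \<longrightarrow> t - s < \<delta> \<longrightarrow> L2le M (\<lambda>\<omega>. Y t \<omega> - Y s \<omega>) \<epsilon>)"

lemma regularD:
  assumes "regular Y"
  shows "continuous_process M T Y" "0 \<le> t \<Longrightarrow> t \<le> T \<Longrightarrow> Y t \<in> borel_measurable (F t)"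
    and "\<omega> \<in> space M \<Longrightarrow> continuous_on {0..T} (\<lambda>t. Y t \<omega>)"
  using assms by (auto simp: regular_def continuous_process_def)

lemma regular_bound:
  assumes "regular Y"
  obtains K where "0 \<le> K" "\<And>t. 0 \<le> t \<Longrightarrow> t \<le> T \<Longrightarrow> L2le M (Y t) K"
  using assms unfolding regular_def by auto

lemma regular_increment:
  assumes "regular Y" "0 < \<epsilon>"
  obtains \<delta> where "0 < \<delta>" "\<And>s t. 0 \<le> s \<Longrightarrow> s \<le> t \<Longrightarrow> t \<le> T \<Longrightarrow> t - s < \<delta> \<Longrightarrow> L2le M (\<lambda>\<omega>. Y t \<omega> - Y s \<omega>) \<epsilon>"
  using assms unfolding regular_def by blast

lemma continuous_process_jointly_measurable:
  assumes "continuous_process M T Y"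
  shows "case_prod Y \<in> borel_measurable P"
  using assms T_pos by (intro continuous_paths_jointly_measurable) (auto simp: continuous_process_def)

lemma regular_jointly_measurable: "regular Y \<Longrightarrow> case_prod Y \<in> borel_measurable P"
  by (intro continuous_process_jointly_measurable regularD)

lemma measurable_time_factor:
  fixes f :: "real \<Rightarrow> real" and Z :: "real \<Rightarrow> 'a \<Rightarrow> real"
  assumes "f \<in> borel_measurable (lborel_Icc T)" "case_prod Z \<in> borel_measurable P"
  shows "(\<lambda>(s, \<omega>). f s * Z s \<omega>) \<in> borel_measurable P"
  unfolding case_prod_unfold
proof (rule borel_measurable_times)
  show "(\<lambda>z. f (fst z)) \<in> borel_measurable P"
    by (rule measurable_compose[OF measurable_fst assms(1)])
  show "(\<lambda>z. Z (fst z) (snd z)) \<in> borel_measurable P"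
    using assms(2) by (simp add: case_prod_unfold)
qed

lemma measurable_process_mult:
  assumes "f \<in> L2_Icc T" "continuous_process M T Z"
  shows "measurable_process M T (\<lambda>s \<omega>. f s * Z s \<omega>)"
  unfolding measurable_process_def
  using assms by (intro measurable_time_factor continuous_process_jointly_measurable L2_Icc_measurable)

lemma L2le_const: "L2le M (\<lambda>_. c) (c\<^sup>2)"
  by (simp add: L2le_def emeasure_space_1)

lemma regular_const: "regular (\<lambda>_ _. c)"
  unfolding regular_def continuous_process_def
proof (intro conjI ballI allI impI)
  show "\<exists>K\<ge>0. \<forall>t\<in>{0..T}. L2le M (\<lambda>_. c) K"
    using L2le_const[of c] zero_le_power2[of c] by blast
  show "\<exists>\<delta>>0. \<forall>s t. 0 \<le> s \<longrightarrow> s \<le> t \<longrightarrow> t \<le> T \<longrightarrow> t - s < \<delta> \<longrightarrow> L2le M (\<lambda>\<omega>. c - c) \<epsilon>"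
    if "0 < \<epsilon>" for \<epsilon> :: real
    using that by (intro exI[of _ 1]) (simp add: L2le_zero)
qed simp_all

lemma L2le_time_factor:
  assumes u: "u \<in> borel_measurable (lborel_Icc T)" "integrable (lborel_Icc T) (\<lambda>s. (u s)\<^sup>2)"
    and Z: "case_prod Z \<in> borel_measurable P" and K: "0 \<le> K"
    and le: "\<And>s. 0 \<le> s \<Longrightarrow> s \<le> T \<Longrightarrow> u s \<noteq> 0 \<Longrightarrow> L2le M (Z s) K"
  shows "L2le P (\<lambda>(s, \<omega>). u s * Z s \<omega>) ((\<integral>s. (u s)\<^sup>2 \<partial>lborel_Icc T) * K)"
proof -
  have "L2le P (case_prod (\<lambda>s \<omega>. u s * Z s \<omega>)) (\<integral>s. (u s)\<^sup>2 * K \<partial>lborel_Icc T)"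
  proof (rule L2le_pair)
    show "sigma_finite_measure (lborel_Icc T)" "sigma_finite_measure M" by unfold_locales
    show "(\<lambda>(s, \<omega>). u s * Z s \<omega>) \<in> borel_measurable P"
      by (rule measurable_time_factor[OF u(1) Z])
    show "integrable (lborel_Icc T) (\<lambda>s. (u s)\<^sup>2 * K)" using u(2) by simp
    show "L2le M (\<lambda>\<omega>. u s * Z s \<omega>) ((u s)\<^sup>2 * K)" if "s \<in> space (lborel_Icc T)" for s
    proof (cases "u s = 0")
      case False
      then show ?thesis
        using le[of s] that K by (intro L2le_cmult) (auto simp: space_restrict_space)
    qed (simp add: L2le_zero)
  qed (use K in simp)
  then show ?thesis by simp
qed

text \<open>Approximations are obtained on {0<..T} only, because elementary processes live on
  intervals that are open on the left. Time 0 is a null set of the product measure.\<close>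

lemma L2le_time_indicator:
  assumes g: "(\<lambda>(s, \<omega>). g s \<omega>) \<in> borel_measurable P"
    and le: "L2le P (\<lambda>(s, \<omega>). indicator {0<..T} s * g s \<omega>) c"
  shows "L2le P (\<lambda>(s, \<omega>). g s \<omega>) c"
proof -
  have "{0} \<times> space M \<in> null_sets P"
  proof (rule null_setsI)
    have "{0} \<in> sets (lborel_Icc T)" using T_pos by (auto simp: sets_restrict_space_iff)
    then show "{0} \<times> space M \<in> sets P" by auto
    have "emeasure (lborel_Icc T) {0} = 0" using T_pos by (simp add: emeasure_restrict_space)
    then show "emeasure P ({0} \<times> space M) = 0"
      using \<open>{0} \<in> sets (lborel_Icc T)\<close> by (subst emeasure_pair_measure_Times) auto
  qed
  then have "AE z in P. z \<notin> {0} \<times> space M"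
    by (rule AE_not_in)
  then have ae: "AE z in P. (case z of (s, \<omega>) \<Rightarrow> indicator {0<..T} s * g s \<omega>) = (case z of (s, \<omega>) \<Rightarrow> g s \<omega>)"
    using AE_space
  proof eventually_elim
    fix z assume "z \<notin> {0} \<times> space M" "z \<in> space P"
    then show "(case z of (s, \<omega>) \<Rightarrow> indicator {0<..T} s * g s \<omega>) = (case z of (s, \<omega>) \<Rightarrow> g s \<omega>)"
      by (auto simp: space_pair_measure space_restrict_space indicator_def)
  qed
  show ?thesis
    by (rule L2le_cong_AE[OF le ae g])
qed

text \<open>A local stability estimate: J is compared with its own approximating integrals, and
  these with the integral of \<open>L\<close> by the isometry on {s<..t}. So only the distance of H
  to \<open>L\<close> on that interval enters.\<close>

lemma ito_limit_approx:
  assumes J: "ito_limit H J" and L: "adapted L" and st: "0 \<le> s" "s \<le> t" "t \<le> T" and c: "0 \<le> c"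
    and le: "L2le P (\<lambda>(r, \<omega>). indicator {s<..t} r * (H r \<omega> - elem_process L r \<omega>)) c"
  shows "L2le M (\<lambda>\<omega>. J t \<omega> - J s \<omega> - elem_integral W (elem_restrict s t L) \<omega>) (4 * c)"
proof (rule L2le_epsilon)
  obtain K where K: "\<And>k::nat. adapted (K k)"
    "\<And>\<epsilon>. 0 < \<epsilon> \<Longrightarrow> \<forall>\<^sub>F k in sequentially. L2le P (\<lambda>(s, \<omega>). elem_process (K k) s \<omega> - H s \<omega>) \<epsilon>"
    "\<And>t \<epsilon>. t \<in> {0..T} \<Longrightarrow> 0 < \<epsilon> \<Longrightarrow> \<forall>\<^sub>F k in sequentially. L2le M (\<lambda>\<omega>. elem_path (K k) t \<omega> - J t \<omega>) \<epsilon>"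
    using J unfolding ito_limit_def by blast
  fix e :: real assume e: "0 < e"
  \<comment> \<open>The bound obtained below is 4 c + 12 \<epsilon>.\<close>
  define \<epsilon> where "\<epsilon> = e / 12"
  have \<epsilon>: "0 < \<epsilon>" using e by (simp add: \<epsilon>_def)
  have "\<forall>\<^sub>F k in sequentially. L2le P (\<lambda>(s, \<omega>). elem_process (K k) s \<omega> - H s \<omega>) \<epsilon> \<and>
      L2le M (\<lambda>\<omega>. elem_path (K k) t \<omega> - J t \<omega>) \<epsilon> \<and> L2le M (\<lambda>\<omega>. elem_path (K k) s \<omega> - J s \<omega>) \<epsilon>"
    using st \<epsilon> by (intro eventually_conj K) auto
  then obtain k where k: "L2le P (\<lambda>(s, \<omega>). elem_process (K k) s \<omega> - H s \<omega>) \<epsilon>"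
      "L2le M (\<lambda>\<omega>. elem_path (K k) t \<omega> - J t \<omega>) \<epsilon>" "L2le M (\<lambda>\<omega>. elem_path (K k) s \<omega> - J s \<omega>) \<epsilon>"
    by (auto simp: eventually_sequentially)
  have "L2le P (\<lambda>(r, \<omega>). indicator {s<..t} r * (elem_process (K k) r \<omega> - elem_process L r \<omega>)) (2 * \<epsilon> + 2 * c)"
    by (rule L2le_cong[OF L2le_add[OF L2le_indicator[OF k(1), of s t] le]]) (use \<epsilon> c in \<open>auto simp: algebra_simps\<close>)
  from L2le_elem_path_diff[OF K(1) L st this]
  have 1: "L2le M (\<lambda>\<omega>. elem_integral W (elem_restrict s t (K k)) \<omega> - elem_integral W (elem_restrict s t L) \<omega>) (2 * \<epsilon> + 2 * c)" .
  have 2: "L2le M (\<lambda>\<omega>. (elem_path (K k) s \<omega> - J s \<omega>) - (elem_path (K k) t \<omega> - J t \<omega>)) (2 * \<epsilon> + 2 * \<epsilon>)"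
    using \<epsilon> by (intro L2le_diff k) auto
  have "L2le M (\<lambda>\<omega>. (elem_integral W (elem_restrict s t (K k)) \<omega> - elem_integral W (elem_restrict s t L) \<omega>) +
      ((elem_path (K k) s \<omega> - J s \<omega>) - (elem_path (K k) t \<omega> - J t \<omega>))) (2 * (2 * \<epsilon> + 2 * c) + 2 * (2 * \<epsilon> + 2 * \<epsilon>))"
    using \<epsilon> c by (intro L2le_add 1 2) auto
  then have "L2le M (\<lambda>\<omega>. J t \<omega> - J s \<omega> - elem_integral W (elem_restrict s t L) \<omega>) (2 * (2 * \<epsilon> + 2 * c) + 2 * (2 * \<epsilon> + 2 * \<epsilon>))"
    by (rule L2le_cong) (use elem_path_diff[OF K(1) st(1,2)] in \<open>simp add: algebra_simps\<close>)
  then show "L2le M (\<lambda>\<omega>. J t \<omega> - J s \<omega> - elem_integral W (elem_restrict s t L) \<omega>) (4 * c + e)"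
    by (rule L2le_mono) (simp add: \<epsilon>_def)
qed (use c in simp)

lemma elem_path_0:
  assumes "adapted L"
  shows "elem_path L 0 \<omega> = 0"
  using assms
proof (induction L)
  case (Cons x L)
  obtain a b \<xi> where x: "x = (a, b, \<xi>)" by (cases x)
  have "max 0 a = a" "max a (min 0 b) = a" using Cons.prems x by auto
  then show ?case using Cons x by (simp add: elem_Cons)
qed simp

text \<open>J 0 is determined only as an L^2 limit of integrals that are 0, hence only almost
  surely.\<close>

lemma ito_limit_0:
  assumes "ito_limit H J"
  shows "AE \<omega> in M. J 0 \<omega> = 0"
proof (rule L2le_0_AE)
  obtain K where K: "\<And>k::nat. adapted (K k)"
    "\<And>t \<epsilon>. t \<in> {0..T} \<Longrightarrow> 0 < \<epsilon> \<Longrightarrow> \<forall>\<^sub>F k in sequentially. L2le M (\<lambda>\<omega>. elem_path (K k) t \<omega> - J t \<omega>) \<epsilon>"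
    using assms unfolding ito_limit_def by blast
  fix c :: real assume c: "0 < c"
  have "\<forall>\<^sub>F k in sequentially. L2le M (\<lambda>\<omega>. elem_path (K k) 0 \<omega> - J 0 \<omega>) c"
    using T_pos c by (intro K(2)) auto
  then obtain k where "L2le M (\<lambda>\<omega>. elem_path (K k) 0 \<omega> - J 0 \<omega>) c"
    by (auto simp: eventually_sequentially)
  from L2le_cmult[OF this, of "-1"] c show "L2le M (\<lambda>\<omega>. J 0 \<omega>) c"
    by (simp add: elem_path_0[OF K(1)])
qed

text \<open>Along a subsequence the elementary integrals converge almost surely. Their
  \<open>lim\<close> is measurable at time t, and J t agrees with it off a null set, which the
  augmented filtration can absorb.\<close>

lemma ito_limit_measurable_F:
  assumes J: "ito_limit H J" and t: "0 \<le> t" "t \<le> T"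
  shows "J t \<in> borel_measurable (F t)"
proof -
  obtain K where K: "\<And>k::nat. adapted (K k)"
    "\<And>t \<epsilon>. t \<in> {0..T} \<Longrightarrow> 0 < \<epsilon> \<Longrightarrow> \<forall>\<^sub>F k in sequentially. L2le M (\<lambda>\<omega>. elem_path (K k) t \<omega> - J t \<omega>) \<epsilon>"
    and cp: "continuous_process M T J"
    using J unfolding ito_limit_def by blast
  have "\<exists>m. L2le M (\<lambda>\<omega>. elem_path (K m) t \<omega> - J t \<omega>) ((1 / 2) ^ j)" for j :: nat
    using eventually_happens'[OF _ K(2)[of t "(1 / 2) ^ j"]] t by auto
  then obtain r where r: "\<And>j. L2le M (\<lambda>\<omega>. elem_path (K (r j)) t \<omega> - J t \<omega>) ((1 / 2) ^ j)"
    by metis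
  have "AE \<omega> in M. (\<lambda>j. elem_path (K (r j)) t \<omega> - J t \<omega>) \<longlonglongrightarrow> 0"
    by (rule L2le_geometric_AE[OF r])
  then have ae: "AE \<omega> in M. lim (\<lambda>j. elem_path (K (r j)) t \<omega>) = J t \<omega>"
    by eventually_elim (simp add: LIM_zero_iff limI)
  have "(\<lambda>\<omega>. lim (\<lambda>j. elem_path (K (r j)) t \<omega>)) \<in> borel_measurable (F t)"
    using t by (intro borel_measurable_lim_metric elem_path_measurable_F K)
  then show ?thesis
    using ae t continuous_process_measurable[OF cp t] by (intro measurable_F_cong_AE[of _ t "J t"])
qed

lemma indicator_square: "(indicator A s * x)\<^sup>2 = indicator A s * (x::real)\<^sup>2"
  by (simp add: indicator_def)

text \<open>Comparison with the zero process bounds the squared norm of an increment of J by 4 K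
  times the integral of f^2 over the interval, which is uniformly small on short intervals.\<close>

lemma regular_ito:
  assumes Z: "regular Z" and f: "f \<in> L2_Icc T" and J: "ito_limit (\<lambda>s \<omega>. f s * Z s \<omega>) J"
  shows "regular J"
proof -
  obtain K where K: "0 \<le> K" "\<And>t. 0 \<le> t \<Longrightarrow> t \<le> T \<Longrightarrow> L2le M (Z t) K"
    using regular_bound[OF Z] by blast
  have inc: "L2le M (\<lambda>\<omega>. J t \<omega> - J s \<omega>) (4 * (sq_int T f s t * K))" if st: "0 \<le> s" "s \<le> t" "t \<le> T" for s t
  proof -
    have "L2le P (\<lambda>(r, \<omega>). (indicator {s<..t} r * f r) * Z r \<omega>) ((\<integral>r. (indicator {s<..t} r * f r)\<^sup>2 \<partial>lborel_Icc T) * K)"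
    proof (rule L2le_time_factor)
      show "(\<lambda>r. indicator {s<..t} r * f r) \<in> borel_measurable (lborel_Icc T)"
        using L2_Icc_measurable[OF f] by measurable
      show "integrable (lborel_Icc T) (\<lambda>r. (indicator {s<..t} r * f r)\<^sup>2)"
        unfolding indicator_square by (rule integrable_indicator_mult[OF L2_Icc_integrable_square[OF f]])
    qed (use regular_jointly_measurable[OF Z] K in auto)
    \<comment> \<open>The empty list represents the zero process in
      \<open>ito_limit_approx\<close>.\<close>
    then have "L2le P (\<lambda>(r, \<omega>). indicator {s<..t} r * (f r * Z r \<omega> - elem_process [] r \<omega>)) (sq_int T f s t * K)"
      by (simp add: indicator_square sq_int_def mult.assoc)
    from ito_limit_approx[OF J _ st _ this] K(1) show ?thesis
      by (simp add: sq_int_nonneg)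
  qed
  have cp: "continuous_process M T J" using J by (simp add: ito_limit_def)
  show ?thesis
    unfolding regular_def
  proof (intro conjI ballI allI impI cp)
    show "J t \<in> borel_measurable (F t)" if "t \<in> {0..T}" for t
      using that by (intro ito_limit_measurable_F[OF J]) auto
    have b: "L2le M (J t) (4 * (sq_int T f 0 T * K))" if t: "t \<in> {0..T}" for t
    proof -
      have "L2le M (\<lambda>\<omega>. J t \<omega> - J 0 \<omega>) (4 * (sq_int T f 0 t * K))" using t by (intro inc) auto
      then have "L2le M (J t) (4 * (sq_int T f 0 t * K))"
      proof (rule L2le_cong_AE)
        show "AE \<omega> in M. J t \<omega> - J 0 \<omega> = J t \<omega>"
          using ito_limit_0[OF J] by eventually_elim simp
        show "J t \<in> borel_measurable M" using t by (intro continuous_process_measurable[OF cp]) auto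
      qed
      moreover have "sq_int T f 0 t \<le> sq_int T f 0 T"
        unfolding sq_int_def using t
        by (intro integral_mono integrable_indicator_mult L2_Icc_integrable_square[OF f]) (auto simp: indicator_def)
      then have "4 * (sq_int T f 0 t * K) \<le> 4 * (sq_int T f 0 T * K)"
        using K(1) by (intro mult_left_mono mult_right_mono) auto
      ultimately show ?thesis by (rule L2le_mono)
    qed
    then show "\<exists>K\<ge>0. \<forall>t\<in>{0..T}. L2le M (J t) K"
      using K(1) by (intro exI[of _ "4 * (sq_int T f 0 T * K)"]) (auto simp: sq_int_nonneg)
    fix \<epsilon> :: real assume \<epsilon>: "0 < \<epsilon>"
    then have "0 < \<epsilon> / (4 * (K + 1))" using K(1) by simp
    then obtain \<delta> where \<delta>: "0 < \<delta>" "\<And>a b. 0 \<le> a \<Longrightarrow> a \<le> b \<Longrightarrow> b \<le> T \<Longrightarrow> b - a < \<delta> \<Longrightarrow> sq_int T f a b \<le> \<epsilon> / (4 * (K + 1))"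
      using sq_int_uniformly_small[OF f] by blast
    have "L2le M (\<lambda>\<omega>. J t \<omega> - J s \<omega>) \<epsilon>" if st: "0 \<le> s" "s \<le> t" "t \<le> T" "t - s < \<delta>" for s t
    proof (rule L2le_mono[OF inc[OF st(1-3)]])
      have "4 * (sq_int T f s t * K) \<le> 4 * (\<epsilon> / (4 * (K + 1)) * (K + 1))"
        using \<delta>(2)[OF st] K(1) \<epsilon> by (intro mult_left_mono mult_mono) auto
      also have "\<dots> = \<epsilon>" using K(1) by (simp add: field_simps)
      finally show "4 * (sq_int T f s t * K) \<le> \<epsilon>" .
    qed
    then show "\<exists>\<delta>>0. \<forall>s t. 0 \<le> s \<longrightarrow> s \<le> t \<longrightarrow> t \<le> T \<longrightarrow> t - s < \<delta> \<longrightarrow> L2le M (\<lambda>\<omega>. J t \<omega> - J s \<omega>) \<epsilon>"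
      using \<delta>(1) by blast
  qed
qed

end

section \<open>Elementary approximations with averaged coefficients\<close>

text \<open>Point values of f at the partition points would say nothing about its class in L^2;
  averages do.\<close>

definition ito_approx ::
    "real \<Rightarrow> (real \<Rightarrow> real) \<Rightarrow> (real \<Rightarrow> 'a \<Rightarrow> real) \<Rightarrow> nat \<Rightarrow> (nat \<Rightarrow> real) \<Rightarrow> (real \<times> real \<times> ('a \<Rightarrow> real)) list" where
  "ito_approx T f Z N p = step_list N p (\<lambda>i \<omega>. avg T f (p i) (p (Suc i)) * Z (p i) \<omega>)"

lemma uniform_partition:
  assumes "0 < t"
  shows "partition_of 0 t (Suc k) (\<lambda>i. t * real i / real (Suc k))"
    and "t * real (Suc i) / real (Suc k) - t * real i / real (Suc k) = t / real (Suc k)"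
proof -
  show "partition_of 0 t (Suc k) (\<lambda>i. t * real i / real (Suc k))"
    unfolding partition_of_def using assms by (auto intro!: divide_strict_right_mono simp del: of_nat_Suc)
  show "t * real (Suc i) / real (Suc k) - t * real i / real (Suc k) = t / real (Suc k)"
    unfolding diff_divide_distrib[symmetric] by (simp add: algebra_simps)
qed

text \<open>Provides \<eta> = e / (K + 1), which also covers K = 0, through an equation free of
  division.\<close>

lemma ex_scaled_positive:
  fixes e K :: real
  assumes "0 < e" "0 \<le> K"
  obtains \<eta> where "0 < \<eta>" "\<eta> * (K + 1) = e"
proof
  have "K + 1 \<noteq> 0" using assms by simp
  then show "e / (K + 1) * (K + 1) = e" by (subst nonzero_eq_divide_eq[symmetric]) auto
  show "0 < e / (K + 1)" using assms by simp
qed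

context brownian_motion
begin

lemma ito_approx_coefficient:
  assumes Z: "regular Z" and p: "partition_of 0 t N p" and t: "t \<le> T" and i: "i < N"
  shows "(\<lambda>\<omega>. avg T f (p i) (p (Suc i)) * Z (p i) \<omega>) \<in> borel_measurable (F (p i))"
    and "integrable M (\<lambda>\<omega>. (avg T f (p i) (p (Suc i)) * Z (p i) \<omega>)\<^sup>2)"
proof -
  have pi: "0 \<le> p i" "p i \<le> T"
    using partition_of_bounds[OF p, of i] i t by auto
  show "(\<lambda>\<omega>. avg T f (p i) (p (Suc i)) * Z (p i) \<omega>) \<in> borel_measurable (F (p i))"
    by (intro borel_measurable_times borel_measurable_const regularD(2)[OF Z pi])
  obtain K where K: "0 \<le> K" "\<And>t. 0 \<le> t \<Longrightarrow> t \<le> T \<Longrightarrow> L2le M (Z t) K"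
    using regular_bound[OF Z] by blast
  show "integrable M (\<lambda>\<omega>. (avg T f (p i) (p (Suc i)) * Z (p i) \<omega>)\<^sup>2)"
    by (rule L2le_imp_integrable[OF L2le_cmult[OF K(2)[OF pi] K(1)]])
qed

lemma adapted_ito_approx:
  assumes "regular Z" "partition_of 0 t N p" "t \<le> T"
  shows "adapted (ito_approx T f Z N p)"
  unfolding ito_approx_def
  by (intro adapted_step_list[OF assms(2,3)] ito_approx_coefficient[OF assms])

lemma elem_process_ito_approx:
  "elem_process (ito_approx T f Z N p) s \<omega> = (\<Sum>i<N. avg T f (p i) (p (Suc i)) * Z (p i) \<omega> * indicator {p i<..p (Suc i)} s)"
  by (simp add: ito_approx_def elem_process_step_list step_process_def)

text \<open>On a cell the error is (f - average) Z(p i) + f (Z - Z(p i)). The first part is small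
  because the averages converge in L^2 and Z is bounded in L^2(\<Omega>), the second because Z is
  uniformly L^2-continuous and f is square integrable.\<close>

lemma ito_approx_converges:
  assumes Z: "regular Z" and f: "f \<in> L2_Icc T" and \<epsilon>: "0 < \<epsilon>"
  obtains \<delta> where "0 < \<delta>" "\<And>t N p. t \<le> T \<Longrightarrow> partition_of 0 t N p \<Longrightarrow> (\<forall>i<N. p (Suc i) - p i < \<delta>) \<Longrightarrow>
    L2le P (\<lambda>(s, \<omega>). indicator {0<..t} s * (f s * Z s \<omega> - elem_process (ito_approx T f Z N p) s \<omega>)) \<epsilon>"
proof -
  obtain K where K: "0 \<le> K" "\<And>t. 0 \<le> t \<Longrightarrow> t \<le> T \<Longrightarrow> L2le M (Z t) K"
    using regular_bound[OF Z] by blast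
  define \<phi> where "\<phi> = (\<integral>s. (f s)\<^sup>2 \<partial>lborel_Icc T)"
  have \<phi>: "0 \<le> \<phi>" by (simp add: \<phi>_def integral_nonneg_AE)
  obtain \<epsilon>1 where e1: "0 < \<epsilon>1" "\<epsilon>1 * (K + 1) = \<epsilon> / 4"
    using ex_scaled_positive[of "\<epsilon> / 4" K] K(1) \<epsilon> by auto
  obtain \<epsilon>2 where e2: "0 < \<epsilon>2" "\<epsilon>2 * (\<phi> + 1) = \<epsilon> / 4"
    using ex_scaled_positive[of "\<epsilon> / 4" \<phi>] \<phi> \<epsilon> by auto
  obtain \<delta>1 where \<delta>1: "0 < \<delta>1" "\<And>t N p. t \<le> T \<Longrightarrow> partition_of 0 t N p \<Longrightarrow> (\<forall>i<N. p (Suc i) - p i < \<delta>1) \<Longrightarrow>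
      L2le (lborel_Icc T) (\<lambda>s. indicator {0<..t} s * f s - step_avg T N p f s) \<epsilon>1"
    using step_avg_converges[OF f e1(1) T_pos] by blast
  obtain \<delta>2 where \<delta>2: "0 < \<delta>2" "\<And>s t. 0 \<le> s \<Longrightarrow> s \<le> t \<Longrightarrow> t \<le> T \<Longrightarrow> t - s < \<delta>2 \<Longrightarrow> L2le M (\<lambda>\<omega>. Z t \<omega> - Z s \<omega>) \<epsilon>2"
    using regular_increment[OF Z e2(1)] by blast
  show thesis
  proof
    show "0 < min \<delta>1 \<delta>2" using \<delta>1(1) \<delta>2(1) by simp
    fix t N p assume t: "t \<le> T" and p: "partition_of 0 t N p" and mesh: "\<forall>i<N. p (Suc i) - p i < min \<delta>1 \<delta>2"
    let ?d = "\<lambda>s. indicator {0<..t} s * f s - step_avg T N p f s"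
    let ?X = "\<lambda>s \<omega>. indicator {0<..t} s * (f s * Z s \<omega> - elem_process (ito_approx T f Z N p) s \<omega>)"
    \<comment> \<open>A bound on the squared L^2(\<Omega>) norm of the error at time s; its integral
      over time bounds the squared norm on the product space.\<close>
    define c where "c s = 2 * ((?d s)\<^sup>2 * K) + 2 * ((f s)\<^sup>2 * \<epsilon>2)" for s
    have dL: "L2le (lborel_Icc T) ?d \<epsilon>1" using mesh by (intro \<delta>1(2) t p) auto
    have c: "integrable (lborel_Icc T) c" "(\<integral>s. c s \<partial>lborel_Icc T) = 2 * ((\<integral>s. (?d s)\<^sup>2 \<partial>lborel_Icc T) * K) + 2 * (\<phi> * \<epsilon>2)"
      unfolding c_def \<phi>_def using L2le_imp_integrable[OF dL] L2_Icc_integrable_square[OF f] by simp_all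
    have ad: "adapted (ito_approx T f Z N p)" by (rule adapted_ito_approx[OF Z p t])
    have "L2le P (case_prod ?X) (\<integral>s. c s \<partial>lborel_Icc T)"
    proof (rule L2le_pair)
      show "sigma_finite_measure (lborel_Icc T)" "sigma_finite_measure M" by unfold_locales
      have m1: "(\<lambda>(s, \<omega>). f s * Z s \<omega>) \<in> borel_measurable P"
        by (rule measurable_time_factor[OF L2_Icc_measurable[OF f] regular_jointly_measurable[OF Z]])
      have m2: "(\<lambda>(s, \<omega>). f s * Z s \<omega> - elem_process (ito_approx T f Z N p) s \<omega>) \<in> borel_measurable P"
        using m1 elem_process_measurable[OF ad] unfolding case_prod_unfold by (rule borel_measurable_diff)
      show "case_prod ?X \<in> borel_measurable P"
        by (rule measurable_time_factor[OF indicator_measurable_Icc m2])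
      show "integrable (lborel_Icc T) c" by (rule c)
      show "0 \<le> c s" for s using K(1) e2(1) by (simp add: c_def)
      show "L2le M (?X s) (c s)" if "s \<in> space (lborel_Icc T)" for s
      proof (cases "s \<in> {0<..t}")
        case False
        then have "?X s = (\<lambda>_. 0)" by auto
        then show ?thesis using K(1) e2(1) by (simp add: c_def L2le_zero)
      next
        case True
        then obtain i where i: "i < N" "p i < s" "s \<le> p (Suc i)"
          using partition_of_cell[OF p, of s] by auto
        have pi: "0 \<le> p i" "p (Suc i) \<le> t" using partition_of_bounds[OF p, of i] partition_of_bounds[OF p, of "Suc i"] i by auto
        have L: "elem_process (ito_approx T f Z N p) s \<omega> = avg T f (p i) (p (Suc i)) * Z (p i) \<omega>" for \<omega>
          unfolding elem_process_ito_approx by (rule partition_sum_indicator[OF p i])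
        have S: "step_avg T N p f s = avg T f (p i) (p (Suc i))"
          unfolding step_avg_def by (rule partition_sum_indicator[OF p i])
        have zi: "L2le M (Z (p i)) K" using pi t i by (intro K(2)) auto
        have ps: "p (Suc i) - p i < \<delta>2" using mesh i(1) by auto
        have zs: "L2le M (\<lambda>\<omega>. Z s \<omega> - Z (p i) \<omega>) \<epsilon>2"
          using pi t i ps by (intro \<delta>2(2)) auto
        have "L2le M (\<lambda>\<omega>. ?d s * Z (p i) \<omega> + f s * (Z s \<omega> - Z (p i) \<omega>)) (c s)"
          unfolding c_def using K(1) e2(1) by (intro L2le_add L2le_cmult zi zs) auto
        then show ?thesis
          by (rule L2le_cong) (use True in \<open>simp add: L S algebra_simps\<close>)
      qed
    qed
    moreover have "(\<integral>s. c s \<partial>lborel_Icc T) \<le> \<epsilon>"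
    proof -
      have "(\<integral>s. (?d s)\<^sup>2 \<partial>lborel_Icc T) * K \<le> \<epsilon>1 * (K + 1)"
        using L2le_imp_integral_le[OF dL] e1(1) K(1) by (intro mult_mono) auto
      moreover have "\<phi> * \<epsilon>2 \<le> \<epsilon>2 * (\<phi> + 1)" using e2(1) by (simp add: algebra_simps)
      ultimately show ?thesis unfolding c(2) using e1(2) e2(2) by linarith
    qed
    ultimately show "L2le P (\<lambda>(s, \<omega>). indicator {0<..t} s * (f s * Z s \<omega> - elem_process (ito_approx T f Z N p) s \<omega>)) \<epsilon>"
      by (rule L2le_mono)
  qed
qed

text \<open>The process picked by \<open>SOME\<close> has the defining property as soon as some
  integral exists; the approximations on uniform partitions provide one.\<close>

lemma has_ito_integral_ito_integral:
  assumes Z: "regular Z" and f: "f \<in> L2_Icc T"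
  shows "has_ito_integral M T W (\<lambda>s \<omega>. f s * Z s \<omega>) (ito_integral M T W (\<lambda>s \<omega>. f s * Z s \<omega>))"
proof -
  define p where "p k i = T * real i / real (Suc k)" for k i :: nat
  have p: "partition_of 0 T (Suc k) (p k)" for k
    unfolding p_def by (rule uniform_partition(1)[OF T_pos])
  have mesh: "p k (Suc i) - p k i = T / real (Suc k)" for k i
    unfolding p_def by (rule uniform_partition(2)[OF T_pos])
  let ?\<xi> = "\<lambda>k i \<omega>. avg T f (p k i) (p k (Suc i)) * Z (p k i) \<omega>"
  have H: "measurable_process M T (\<lambda>s \<omega>. f s * Z s \<omega>)"
    by (rule measurable_process_mult[OF f regularD(1)[OF Z]])
  have "\<exists>J. has_ito_integral M T W (\<lambda>s \<omega>. f s * Z s \<omega>) J"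
  proof (rule has_ito_integral_exists[OF H])
    show "simple_process M T W (Suc k) (p k) (?\<xi> k)" for k
      unfolding simple_process_def using p[of k] ito_approx_coefficient[OF Z p[of k]] by auto
    fix \<epsilon> :: real assume "0 < \<epsilon>"
    then obtain \<delta> where \<delta>: "0 < \<delta>" "\<And>t N p. t \<le> T \<Longrightarrow> partition_of 0 t N p \<Longrightarrow> (\<forall>i<N. p (Suc i) - p i < \<delta>) \<Longrightarrow>
      L2le P (\<lambda>(s, \<omega>). indicator {0<..t} s * (f s * Z s \<omega> - elem_process (ito_approx T f Z N p) s \<omega>)) \<epsilon>"
      using ito_approx_converges[OF Z f] by blast
    have "(\<lambda>k. T * inverse (real (Suc k))) \<longlonglongrightarrow> T * 0"
      by (intro tendsto_intros LIMSEQ_inverse_real_of_nat)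
    then have "\<forall>\<^sub>F k in sequentially. T * inverse (real (Suc k)) < \<delta>"
      using order_tendstoD(2)[of _ "T * 0" sequentially \<delta>] \<delta>(1) by simp
    then show "\<forall>\<^sub>F k in sequentially. L2le P (\<lambda>(s, \<omega>). elem_process (step_list (Suc k) (p k) (?\<xi> k)) s \<omega> - f s * Z s \<omega>) \<epsilon>"
    proof eventually_elim
      fix k assume "T * inverse (real (Suc k)) < \<delta>"
      then have "\<forall>i<Suc k. p k (Suc i) - p k i < \<delta>" unfolding mesh by (simp only: divide_inverse) simp
      from \<delta>(2)[OF order_refl p this]
      have "L2le P (\<lambda>(s, \<omega>). indicator {0<..T} s * (f s * Z s \<omega> - elem_process (ito_approx T f Z (Suc k) (p k)) s \<omega>)) \<epsilon>" .
      from L2le_cmult[OF this, of "-1"] \<open>0 < \<epsilon>\<close>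
      have "L2le P (\<lambda>z. - 1 * (case z of (s, \<omega>) \<Rightarrow> indicator {0<..T} s * (f s * Z s \<omega> - elem_process (ito_approx T f Z (Suc k) (p k)) s \<omega>))) \<epsilon>"
        by simp
      then have "L2le P (\<lambda>(s, \<omega>). indicator {0<..T} s * (elem_process (ito_approx T f Z (Suc k) (p k)) s \<omega> - f s * Z s \<omega>)) \<epsilon>"
        by (rule L2le_cong) (auto simp: algebra_simps)
      then have "L2le P (\<lambda>(s, \<omega>). elem_process (ito_approx T f Z (Suc k) (p k)) s \<omega> - f s * Z s \<omega>) \<epsilon>"
        by (rule L2le_time_indicator[rotated])
          (rule elem_process_diff_measurable[OF adapted_ito_approx[OF Z p order_refl] H])
      then show "L2le P (\<lambda>(s, \<omega>). elem_process (step_list (Suc k) (p k) (?\<xi> k)) s \<omega> - f s * Z s \<omega>) \<epsilon>"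
        by (simp only: ito_approx_def)
    qed
  qed
  then show ?thesis
    unfolding ito_integral_def by (rule someI_ex)
qed

lemma ito_limit_ito_integral:
  assumes "regular Z" "f \<in> L2_Icc T"
  shows "ito_limit (\<lambda>s \<omega>. f s * Z s \<omega>) (ito_integral M T W (\<lambda>s \<omega>. f s * Z s \<omega>))"
  by (rule has_ito_integral_imp_ito_limit[OF has_ito_integral_ito_integral[OF assms]])

section \<open>The Lebesgue integral of a regular process\<close>

definition drift :: "(real \<Rightarrow> real) \<Rightarrow> (real \<Rightarrow> 'a \<Rightarrow> real) \<Rightarrow> real \<Rightarrow> 'a \<Rightarrow> real" where
  "drift h Z t \<omega> = (LBINT s:{0..t}. h s * Z s \<omega>)"

lemma regular_path_bounded:
  assumes "regular Z" "\<omega> \<in> space M"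
  obtains B where "0 \<le> B" "\<And>s. 0 \<le> s \<Longrightarrow> s \<le> T \<Longrightarrow> \<bar>Z s \<omega>\<bar> \<le> B"
proof -
  have "compact ((\<lambda>s. Z s \<omega>) ` {0..T})"
    by (intro compact_continuous_image regularD(3)[OF assms]) simp
  then obtain B where B: "\<forall>x\<in>(\<lambda>s. Z s \<omega>) ` {0..T}. norm x \<le> B"
    using compact_imp_bounded bounded_iff by blast
  show thesis
  proof (rule that[of "max 0 B"])
    fix s assume "0 \<le> s" "s \<le> T"
    then have "norm (Z s \<omega>) \<le> B" by (intro B[rule_format] imageI) simp
    then show "\<bar>Z s \<omega>\<bar> \<le> max 0 B" by simp
  qed simp
qed

lemma regular_path_measurable:
  assumes "regular Z" "\<omega> \<in> space M"
  shows "(\<lambda>s. Z s \<omega>) \<in> borel_measurable (lborel_Icc T)"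
  using measurable_Pair1[OF regular_jointly_measurable[OF assms(1)] assms(2)] by (simp only: prod.case)

lemma path_integrable:
  assumes Z: "regular Z" and \<omega>: "\<omega> \<in> space M" and h: "integrable (lborel_Icc T) h"
  shows "integrable (lborel_Icc T) (\<lambda>s. h s * Z s \<omega>)"
proof -
  obtain B where B: "0 \<le> B" "\<And>s. 0 \<le> s \<Longrightarrow> s \<le> T \<Longrightarrow> \<bar>Z s \<omega>\<bar> \<le> B"
    using regular_path_bounded[OF Z \<omega>] by blast
  have "integrable (lborel_Icc T) (\<lambda>s. B * h s)" using h by simp
  then show ?thesis
  proof (rule Bochner_Integration.integrable_bound)
    show "(\<lambda>s. h s * Z s \<omega>) \<in> borel_measurable (lborel_Icc T)"
      using h regular_path_measurable[OF Z \<omega>] by (intro borel_measurable_times) auto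
    show "AE s in lborel_Icc T. norm (h s * Z s \<omega>) \<le> norm (B * h s)"
    proof (rule AE_I2)
      fix s assume "s \<in> space (lborel_Icc T)"
      then have "\<bar>Z s \<omega>\<bar> \<le> B" using B(2) by (simp add: space_restrict_space)
      then have "\<bar>h s\<bar> * \<bar>Z s \<omega>\<bar> \<le> \<bar>h s\<bar> * B" by (intro mult_left_mono) auto
      then show "norm (h s * Z s \<omega>) \<le> norm (B * h s)" using B(1) by (simp add: abs_mult mult.commute)
    qed
  qed
qed

lemma drift_eq:
  assumes Z: "regular Z" and \<omega>: "\<omega> \<in> space M" and h: "integrable (lborel_Icc T) h" and t: "t \<le> T"
  shows "drift h Z t \<omega> = (\<integral>s. indicator {0<..t} s * (h s * Z s \<omega>) \<partial>lborel_Icc T)"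
  unfolding drift_def
  by (rule LBINT_eq_integral_Icc[OF borel_measurable_integrable[OF path_integrable[OF Z \<omega> h]] _ t]) simp

lemma drift_increment:
  assumes Z: "regular Z" and \<omega>: "\<omega> \<in> space M" and h: "integrable (lborel_Icc T) h"
    and st: "0 \<le> s" "s \<le> t" "t \<le> T"
  shows "drift h Z t \<omega> - drift h Z s \<omega> = (\<integral>r. indicator {s<..t} r * (h r * Z r \<omega>) \<partial>lborel_Icc T)"
proof -
  note i = integrable_indicator_mult[OF path_integrable[OF Z \<omega> h]]
  have "drift h Z t \<omega> - drift h Z s \<omega> =
      (\<integral>r. indicator {0<..t} r * (h r * Z r \<omega>) - indicator {0<..s} r * (h r * Z r \<omega>) \<partial>lborel_Icc T)"
    using st by (subst Bochner_Integration.integral_diff[OF i i]) (simp add: drift_eq[OF Z \<omega> h])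
  also have "\<dots> = (\<integral>r. indicator {s<..t} r * (h r * Z r \<omega>) \<partial>lborel_Icc T)"
    using st by (intro Bochner_Integration.integral_cong) (auto simp: indicator_def)
  finally show ?thesis .
qed

text \<open>As h is only integrable, |h| is split into two factors sqrt |h|. The Cauchy-Schwarz
  inequality then gives (\<integral> |h| |Z|)^2 \<le> (\<integral> |h|) (\<integral> |h| Z^2), and
  the mean of the last factor is at most K \<integral> |h|.\<close>

lemma L2le_drift_increment:
  assumes Z: "regular Z" and h: "integrable (lborel_Icc T) h" and st: "0 \<le> s" "s \<le> t" "t \<le> T"
    and K: "0 \<le> K" "\<And>r. 0 \<le> r \<Longrightarrow> r \<le> T \<Longrightarrow> L2le M (Z r) K"
    and m: "(\<lambda>\<omega>. drift h Z t \<omega> - drift h Z s \<omega>) \<in> borel_measurable M"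
  shows "L2le M (\<lambda>\<omega>. drift h Z t \<omega> - drift h Z s \<omega>) (K * (\<integral>r. indicator {s<..t} r * \<bar>h r\<bar> \<partial>lborel_Icc T)\<^sup>2)"
proof -
  let ?u = "\<lambda>r. indicator {s<..t} r * \<bar>h r\<bar>"
  define a where "a = (\<integral>r. ?u r \<partial>lborel_Icc T)"
  have ui: "integrable (lborel_Icc T) ?u" using h by (intro integrable_indicator_mult) simp
  have [measurable]: "?u \<in> borel_measurable (lborel_Icc T)" using ui by simp
  have a0: "0 \<le> a" unfolding a_def by (intro integral_nonneg_AE AE_I2) simp
  have su: "L2le (lborel_Icc T) (\<lambda>r. sqrt (?u r)) a"
    unfolding L2le_def a_def using ui by (simp add: nn_integral_eq_integral)
  define E where "E \<omega> = (\<integral>r. ?u r * (Z r \<omega>)\<^sup>2 \<partial>lborel_Icc T)" for \<omega>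
  have Zm: "case_prod Z \<in> borel_measurable P" by (rule regular_jointly_measurable[OF Z])
  have le1: "(drift h Z t \<omega> - drift h Z s \<omega>)\<^sup>2 \<le> a * E \<omega>" if \<omega>: "\<omega> \<in> space M" for \<omega>
  proof -
    have [measurable]: "(\<lambda>r. Z r \<omega>) \<in> borel_measurable (lborel_Icc T)" by (rule regular_path_measurable[OF Z \<omega>])
    obtain B where B: "0 \<le> B" "\<And>s. 0 \<le> s \<Longrightarrow> s \<le> T \<Longrightarrow> \<bar>Z s \<omega>\<bar> \<le> B"
      using regular_path_bounded[OF Z \<omega>] by blast
    have i2: "integrable (lborel_Icc T) (\<lambda>r. ?u r * (Z r \<omega>)\<^sup>2)"
    proof (rule Bochner_Integration.integrable_bound[of _ "\<lambda>r. B\<^sup>2 * ?u r"])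
      show "integrable (lborel_Icc T) (\<lambda>r. B\<^sup>2 * ?u r)" using ui by simp
      show "AE r in lborel_Icc T. norm (?u r * (Z r \<omega>)\<^sup>2) \<le> norm (B\<^sup>2 * ?u r)"
      proof (rule AE_I2)
        fix r assume "r \<in> space (lborel_Icc T)"
        then have "(Z r \<omega>)\<^sup>2 \<le> B\<^sup>2" using B(2)[of r] power_mono[of "\<bar>Z r \<omega>\<bar>" B 2] by (simp add: space_restrict_space)
        then have "?u r * (Z r \<omega>)\<^sup>2 \<le> ?u r * B\<^sup>2" by (intro mult_left_mono) auto
        then show "norm (?u r * (Z r \<omega>)\<^sup>2) \<le> norm (B\<^sup>2 * ?u r)" by (simp add: abs_mult mult.commute)
      qed
    qed measurable
    have eq: "(sqrt (?u r) * \<bar>Z r \<omega>\<bar>)\<^sup>2 = ?u r * (Z r \<omega>)\<^sup>2" for r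
      by (simp add: power_mult_distrib)
    have "L2le (lborel_Icc T) (\<lambda>r. sqrt (?u r) * \<bar>Z r \<omega>\<bar>) (\<integral>r. (sqrt (?u r) * \<bar>Z r \<omega>\<bar>)\<^sup>2 \<partial>lborel_Icc T)"
      by (rule L2le_integral) (measurable, simp only: eq i2)
    then have zu: "L2le (lborel_Icc T) (\<lambda>r. sqrt (?u r) * \<bar>Z r \<omega>\<bar>) (E \<omega>)"
      by (simp only: eq E_def)
    have E0: "0 \<le> E \<omega>" unfolding E_def by (intro integral_nonneg_AE AE_I2) simp
    have "\<bar>drift h Z t \<omega> - drift h Z s \<omega>\<bar> \<le> (\<integral>r. \<bar>indicator {s<..t} r * (h r * Z r \<omega>)\<bar> \<partial>lborel_Icc T)"
      unfolding drift_increment[OF Z \<omega> h st] by (rule integral_abs_bound)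
    also have "\<dots> = (\<integral>r. \<bar>sqrt (?u r) * (sqrt (?u r) * \<bar>Z r \<omega>\<bar>)\<bar> \<partial>lborel_Icc T)"
      by (intro Bochner_Integration.integral_cong) (auto simp: indicator_def abs_mult simp flip: mult.assoc)
    also have "\<dots> \<le> sqrt (a * E \<omega>)"
      using a0 E0 by (intro L1le_imp_integral_le L1le_mult[OF su zu]) auto
    finally have "\<bar>drift h Z t \<omega> - drift h Z s \<omega>\<bar>\<^sup>2 \<le> (sqrt (a * E \<omega>))\<^sup>2"
      by (rule power_mono) simp
    then show ?thesis using a0 E0 by simp
  qed
  have "L1le P (case_prod (\<lambda>r \<omega>. ?u r * (Z r \<omega>)\<^sup>2)) (\<integral>r. ?u r * K \<partial>lborel_Icc T)"
  proof (rule L1le_pair)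
    show "sigma_finite_measure (lborel_Icc T)" "sigma_finite_measure M" by unfold_locales
    have "(\<lambda>(r, \<omega>). (Z r \<omega>)\<^sup>2) \<in> borel_measurable P"
      using Zm unfolding case_prod_unfold by (rule borel_measurable_power)
    then show "(\<lambda>(r, \<omega>). ?u r * (Z r \<omega>)\<^sup>2) \<in> borel_measurable P"
      by (rule measurable_time_factor[OF borel_measurable_integrable[OF ui]])
    show "integrable (lborel_Icc T) (\<lambda>r. ?u r * K)" using ui by simp
    fix r assume r: "r \<in> space (lborel_Icc T)"
    then have "L2le M (Z r) K" by (intro K(2)) (auto simp: space_restrict_space)
    then have "L1le M (\<lambda>\<omega>. (Z r \<omega>)\<^sup>2) K"
      unfolding L1le_def L2le_def abs_power2 by (intro conjI borel_measurable_power) blast+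
    from L1le_cmult[OF this K(1), of "?u r"] show "L1le M (\<lambda>\<omega>. ?u r * (Z r \<omega>)\<^sup>2) (?u r * K)"
      by (simp add: abs_mult)
  qed (use K(1) in auto)
  then have "L1le M E (a * K)"
    unfolding E_def[abs_def] a_def
    by (intro L1le_integral) (unfold_locales, simp)
  from L1le_cmult[OF this, of a] a0 K(1) have aE: "L1le M (\<lambda>\<omega>. a * E \<omega>) (a * (a * K))" by simp
  have "(\<integral>\<^sup>+\<omega>. ennreal ((drift h Z t \<omega> - drift h Z s \<omega>)\<^sup>2) \<partial>M) \<le> (\<integral>\<^sup>+\<omega>. ennreal \<bar>a * E \<omega>\<bar> \<partial>M)"
    using le1 by (intro nn_integral_mono ennreal_leI) (meson abs_ge_self order_trans)
  also have "\<dots> \<le> ennreal (a * (a * K))" using aE by (simp add: L1le_def)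
  also have "a * (a * K) = K * a\<^sup>2" by (simp add: power2_eq_square)
  finally show ?thesis using m by (simp add: L2le_def a_def)
qed

text \<open>Only times up to t enter the integral, and on them Z is jointly measurable with respect
  to F t; so the result is measurable at time t and not merely at time T.\<close>

lemma drift_measurable_F:
  assumes Z: "regular Z" and h: "integrable (lborel_Icc T) h" and t: "0 \<le> t" "t \<le> T"
  shows "drift h Z t \<in> borel_measurable (F t)"
proof -
  have Zm: "case_prod Z \<in> borel_measurable (lborel_Icc t \<Otimes>\<^sub>M F t)"
  proof (rule continuous_paths_jointly_measurable)
    show "Z s \<in> borel_measurable (F t)" if "s \<in> {0..t}" for s
      using that t by (intro measurable_F_mono[OF regularD(2)[OF Z]]) auto
    show "continuous_on {0..t} (\<lambda>s. Z s \<omega>)" if "\<omega> \<in> space (F t)" for \<omega>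
      using that t by (intro continuous_on_subset[OF regularD(3)[OF Z]]) auto
  qed (use t in simp)
  have "restrict_space (lborel_Icc T) {0..t} = lborel_Icc t"
    using t by (subst restrict_restrict_space) (auto simp: Int_absorb1 Int_commute)
  then have hm: "h \<in> borel_measurable (lborel_Icc t)"
    using measurable_restrict_space1[of h "lborel_Icc T" borel "{0..t}"] h by simp
  have "(\<lambda>(\<omega>, s). h s * Z s \<omega>) \<in> borel_measurable (F t \<Otimes>\<^sub>M lborel_Icc t)"
  proof -
    have "(\<lambda>z. h (fst z) * Z (fst z) (snd z)) \<in> borel_measurable (lborel_Icc t \<Otimes>\<^sub>M F t)"
      using Zm by (intro borel_measurable_times measurable_compose[OF measurable_fst hm]) (simp add: case_prod_unfold)
    from measurable_compose[OF measurable_pair_swap' this] show ?thesis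
      by (simp add: case_prod_unfold)
  qed
  then have "(\<lambda>\<omega>. \<integral>s. h s * Z s \<omega> \<partial>lborel_Icc t) \<in> borel_measurable (F t)"
    using finite_measure_Icc[of t]
    by (intro sigma_finite_measure.borel_measurable_lebesgue_integral) (auto simp: finite_measure_def)
  also have "(\<lambda>\<omega>. \<integral>s. h s * Z s \<omega> \<partial>lborel_Icc t) = drift h Z t"
    by (auto simp: drift_def[abs_def] set_lebesgue_integral_def integral_restrict_space)
  finally show ?thesis .
qed

text \<open>The integral of |f g| over an interval controls the increments both in L^2(\<Omega>) and
  along each path. By Cauchy-Schwarz it is uniformly small on short intervals, which gives both
  kinds of continuity.\<close>

lemma regular_drift:
  assumes Z: "regular Z" and f: "f \<in> L2_Icc T" and g: "g \<in> L2_Icc T"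
  shows "regular (drift (\<lambda>s. f s * g s) Z)"
proof -
  let ?h = "\<lambda>s. f s * g s" and ?D = "drift (\<lambda>s. f s * g s) Z"
  have h: "integrable (lborel_Icc T) ?h" by (rule L2_Icc_product_integrable[OF f g])
  define a where "a s t = (\<integral>r. indicator {s<..t} r * \<bar>?h r\<bar> \<partial>lborel_Icc T)" for s t
  have a0: "0 \<le> a s t" for s t unfolding a_def by (intro integral_nonneg_AE AE_I2) simp
  have a_le: "a s t \<le> sqrt (sq_int T f s t * sq_int T g s t)" for s t
  proof -
    have "a s t = (\<integral>r. \<bar>(indicator {s<..t} r * f r) * (indicator {s<..t} r * g r)\<bar> \<partial>lborel_Icc T)"
      unfolding a_def by (intro Bochner_Integration.integral_cong) (auto simp: indicator_def)
    also have "\<dots> \<le> sqrt (sq_int T f s t * sq_int T g s t)"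
      by (intro L1le_imp_integral_le L1le_mult L2le_sq_int f g) (auto simp: sq_int_nonneg)
    finally show ?thesis .
  qed
  have a_small: "\<exists>\<delta>>0. \<forall>s t. 0 \<le> s \<longrightarrow> s \<le> t \<longrightarrow> t \<le> T \<longrightarrow> t - s < \<delta> \<longrightarrow> a s t \<le> \<epsilon>" if \<epsilon>: "0 < \<epsilon>" for \<epsilon>
  proof -
    obtain d1 where d1: "0 < d1" "\<And>a b. 0 \<le> a \<Longrightarrow> a \<le> b \<Longrightarrow> b \<le> T \<Longrightarrow> b - a < d1 \<Longrightarrow> sq_int T f a b \<le> \<epsilon>"
      using sq_int_uniformly_small[OF f \<epsilon>] by blast
    obtain d2 where d2: "0 < d2" "\<And>a b. 0 \<le> a \<Longrightarrow> a \<le> b \<Longrightarrow> b \<le> T \<Longrightarrow> b - a < d2 \<Longrightarrow> sq_int T g a b \<le> \<epsilon>"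
      using sq_int_uniformly_small[OF g \<epsilon>] by blast
    have "a s t \<le> \<epsilon>" if "0 \<le> s" "s \<le> t" "t \<le> T" "t - s < min d1 d2" for s t
    proof -
      have "sq_int T f s t * sq_int T g s t \<le> \<epsilon> * \<epsilon>"
        using that d1(2)[of s t] d2(2)[of s t] \<epsilon> by (intro mult_mono) (auto simp: sq_int_nonneg)
      then have "sqrt (sq_int T f s t * sq_int T g s t) \<le> sqrt (\<epsilon> * \<epsilon>)" by (rule real_sqrt_le_mono)
      then show ?thesis using a_le[of s t] \<epsilon> by simp
    qed
    then show ?thesis using d1(1) d2(1) by (intro exI[of _ "min d1 d2"]) auto
  qed
  obtain K where K: "0 \<le> K" "\<And>t. 0 \<le> t \<Longrightarrow> t \<le> T \<Longrightarrow> L2le M (Z t) K"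
    using regular_bound[OF Z] by blast
  have DF: "?D t \<in> borel_measurable (F t)" if "0 \<le> t" "t \<le> T" for t
    by (rule drift_measurable_F[OF Z h that])
  have DM: "?D t \<in> borel_measurable M" if "0 \<le> t" "t \<le> T" for t
    by (rule measurable_F_imp_M[OF DF[OF that] that(2)])
  have inc: "L2le M (\<lambda>\<omega>. ?D t \<omega> - ?D s \<omega>) (K * (a s t)\<^sup>2)" if "0 \<le> s" "s \<le> t" "t \<le> T" for s t
    unfolding a_def using that by (intro L2le_drift_increment Z h K borel_measurable_diff DM) auto
  have D0: "?D 0 \<omega> = 0" if "\<omega> \<in> space M" for \<omega>
    using T_pos by (subst drift_eq[OF Z that h]) auto
  have cont: "continuous_on {0..T} (\<lambda>t. ?D t \<omega>)" if \<omega>: "\<omega> \<in> space M" for \<omega>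
  proof -
    obtain B where B: "0 \<le> B" "\<And>s. 0 \<le> s \<Longrightarrow> s \<le> T \<Longrightarrow> \<bar>Z s \<omega>\<bar> \<le> B"
      using regular_path_bounded[OF Z \<omega>] by blast
    have bound: "\<bar>?D t \<omega> - ?D s \<omega>\<bar> \<le> B * a s t" if st: "0 \<le> s" "s \<le> t" "t \<le> T" for s t
    proof -
      have "\<bar>?D t \<omega> - ?D s \<omega>\<bar> \<le> (\<integral>r. \<bar>indicator {s<..t} r * (?h r * Z r \<omega>)\<bar> \<partial>lborel_Icc T)"
        unfolding drift_increment[OF Z \<omega> h st] by (rule integral_abs_bound)
      also have "\<dots> \<le> (\<integral>r. B * (indicator {s<..t} r * \<bar>?h r\<bar>) \<partial>lborel_Icc T)"
      proof (rule integral_mono)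
        show "integrable (lborel_Icc T) (\<lambda>r. \<bar>indicator {s<..t} r * (?h r * Z r \<omega>)\<bar>)"
          by (intro integrable_abs integrable_indicator_mult path_integrable Z \<omega> h)
        have "integrable (lborel_Icc T) (\<lambda>r. indicator {s<..t} r * \<bar>?h r\<bar>)"
          by (intro integrable_indicator_mult integrable_abs h)
        then show "integrable (lborel_Icc T) (\<lambda>r. B * (indicator {s<..t} r * \<bar>?h r\<bar>))" by simp
        fix r assume "r \<in> space (lborel_Icc T)"
        then have "\<bar>Z r \<omega>\<bar> \<le> B" using B(2) by (simp add: space_restrict_space)
        then have "\<bar>?h r\<bar> * \<bar>Z r \<omega>\<bar> \<le> \<bar>?h r\<bar> * B" by (intro mult_left_mono) auto
        then show "\<bar>indicator {s<..t} r * (?h r * Z r \<omega>)\<bar> \<le> B * (indicator {s<..t} r * \<bar>?h r\<bar>)"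
          by (simp add: abs_mult indicator_def mult_ac)
      qed
      also have "\<dots> = B * a s t" by (simp add: a_def)
      finally show ?thesis .
    qed
    show ?thesis
      unfolding continuous_on_iff
    proof (intro ballI allI impI)
      fix t e :: real assume t: "t \<in> {0..T}" and e: "0 < e"
      obtain \<eta> where \<eta>: "0 < \<eta>" "\<eta> * (B + 1) = e / 2"
        using ex_scaled_positive[of "e / 2" B] e B(1) by auto
      obtain d where d: "0 < d" "\<forall>s t. 0 \<le> s \<longrightarrow> s \<le> t \<longrightarrow> t \<le> T \<longrightarrow> t - s < d \<longrightarrow> a s t \<le> \<eta>"
        using a_small[OF \<eta>(1)] by blast
      have small: "B * a s r < e" if "0 \<le> s" "s \<le> r" "r \<le> T" "r - s < d" for s r
      proof -
        have "B * a s r \<le> (B + 1) * \<eta>"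
          using d(2) that a0[of s r] B(1) by (intro mult_mono) auto
        also have "\<dots> = e / 2" using \<eta>(2) by (simp only: mult.commute)
        finally show ?thesis using e by simp
      qed
      have "dist (?D s \<omega>) (?D t \<omega>) < e" if s: "s \<in> {0..T}" "dist s t < d" for s
      proof (cases "s \<le> t")
        case True
        then show ?thesis using bound[of s t] small[of s t] s t by (auto simp: dist_real_def)
      next
        case False
        then show ?thesis using bound[of t s] small[of t s] s t by (auto simp: dist_real_def)
      qed
      then show "\<exists>d>0. \<forall>s\<in>{0..T}. dist s t < d \<longrightarrow> dist (?D s \<omega>) (?D t \<omega>) < e"
        using d(1) by blast
    qed
  qed
  have cp: "continuous_process M T ?D"
    unfolding continuous_process_def using cont DM by auto
  show ?thesis
    unfolding regular_def
  proof (intro conjI ballI allI impI cp)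
    show "?D t \<in> borel_measurable (F t)" if "t \<in> {0..T}" for t using that by (intro DF) auto
    have mono: "a 0 t \<le> a 0 T" if "t \<le> T" for t
      unfolding a_def using that
      by (intro integral_mono integrable_indicator_mult integrable_abs h) (auto simp: indicator_def)
    have "L2le M (?D t) (K * (a 0 T)\<^sup>2)" if t: "t \<in> {0..T}" for t
    proof -
      have "L2le M (\<lambda>\<omega>. ?D t \<omega> - ?D 0 \<omega>) (K * (a 0 t)\<^sup>2)" using t by (intro inc) auto
      then have "L2le M (?D t) (K * (a 0 t)\<^sup>2)" by (rule L2le_cong) (simp add: D0)
      moreover have "K * (a 0 t)\<^sup>2 \<le> K * (a 0 T)\<^sup>2"
        using mono[of t] t K(1) a0 by (intro mult_left_mono power_mono) auto
      ultimately show ?thesis by (rule L2le_mono)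
    qed
    then show "\<exists>K\<ge>0. \<forall>t\<in>{0..T}. L2le M (?D t) K"
      using K(1) by (intro exI[of _ "K * (a 0 T)\<^sup>2"]) simp
    fix \<epsilon> :: real assume \<epsilon>: "0 < \<epsilon>"
    obtain \<eta>' where \<eta>': "0 < \<eta>'" "\<eta>' * (K + 1) = \<epsilon>"
      using ex_scaled_positive[OF \<epsilon> K(1)] by blast
    define \<eta> where "\<eta> = sqrt \<eta>'"
    have \<eta>: "0 < \<eta>" "(K + 1) * \<eta>\<^sup>2 = \<epsilon>" using \<eta>' by (auto simp: \<eta>_def mult.commute)
    obtain \<delta> where \<delta>: "0 < \<delta>" "\<forall>s t. 0 \<le> s \<longrightarrow> s \<le> t \<longrightarrow> t \<le> T \<longrightarrow> t - s < \<delta> \<longrightarrow> a s t \<le> \<eta>"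
      using a_small[OF \<eta>(1)] by blast
    have "L2le M (\<lambda>\<omega>. ?D t \<omega> - ?D s \<omega>) \<epsilon>" if st: "0 \<le> s" "s \<le> t" "t \<le> T" "t - s < \<delta>" for s t
    proof (rule L2le_mono[OF inc[OF st(1-3)]])
      have "K * (a s t)\<^sup>2 \<le> (K + 1) * \<eta>\<^sup>2"
        using \<delta>(2) st a0[of s t] K(1) by (intro mult_mono power_mono) auto
      then show "K * (a s t)\<^sup>2 \<le> \<epsilon>" using \<eta>(2) by simp
    qed
    then show "\<exists>\<delta>>0. \<forall>s t. 0 \<le> s \<longrightarrow> s \<le> t \<longrightarrow> t \<le> T \<longrightarrow> t - s < \<delta> \<longrightarrow> L2le M (\<lambda>\<omega>. ?D t \<omega> - ?D s \<omega>) \<epsilon>"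
      using \<delta>(1) by blast
  qed
qed

lemma L2le_increment:
  assumes ab: "0 \<le> a" "a \<le> b" "b \<le> T" and \<xi>: "\<xi> \<in> borel_measurable (F a)" and le: "L2le M \<xi> c" and c: "0 \<le> c"
  shows "L2le M (\<lambda>\<omega>. \<xi> \<omega> * (W b \<omega> - W a \<omega>)) (c * (b - a))"
proof -
  have g: "(\<lambda>\<omega>. (\<xi> \<omega>)\<^sup>2) \<in> borel_measurable (F a)" using \<xi> by (rule borel_measurable_power)
  note gi = L2le_imp_integrable[OF le]
  have eq: "(\<xi> \<omega> * (W b \<omega> - W a \<omega>))\<^sup>2 = (\<xi> \<omega>)\<^sup>2 * (W b \<omega> - W a \<omega>)\<^sup>2" for \<omega>
    by (rule power_mult_distrib)
  have m: "(\<lambda>\<omega>. \<xi> \<omega> * (W b \<omega> - W a \<omega>)) \<in> borel_measurable M"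
    using ab by (intro borel_measurable_times borel_measurable_diff W_measurable L2le_measurable[OF le]) auto
  have "L2le M (\<lambda>\<omega>. \<xi> \<omega> * (W b \<omega> - W a \<omega>)) (expectation (\<lambda>\<omega>. (\<xi> \<omega> * (W b \<omega> - W a \<omega>))\<^sup>2))"
    by (rule L2le_integral[OF m]) (unfold eq, rule integrable_mult_increment[OF ab g gi])
  also have "expectation (\<lambda>\<omega>. (\<xi> \<omega> * (W b \<omega> - W a \<omega>))\<^sup>2) = expectation (\<lambda>\<omega>. (\<xi> \<omega>)\<^sup>2) * (b - a)"
    unfolding eq by (rule expectation_mult_increment(2)[OF ab g gi])
  finally have "L2le M (\<lambda>\<omega>. \<xi> \<omega> * (W b \<omega> - W a \<omega>)) (expectation (\<lambda>\<omega>. (\<xi> \<omega>)\<^sup>2) * (b - a))" .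
  then show ?thesis
    by (rule L2le_mono) (use L2le_imp_integral_le[OF le c] ab in \<open>intro mult_right_mono, auto\<close>)
qed

lemma L2le_W_increment:
  assumes "0 \<le> a" "a \<le> b" "b \<le> T"
  shows "L2le M (\<lambda>\<omega>. W b \<omega> - W a \<omega>) (b - a)"
  using L2le_increment[OF assms, of "\<lambda>_. 1" 1] L2le_const[of 1] by simp

text \<open>With W among the regular processes, its joint measurability and the integrability of f W
  along paths come from the general lemmas.\<close>

lemma regular_W: "regular W"
  unfolding regular_def
proof (intro conjI ballI allI impI)
  show "continuous_process M T W"
    unfolding continuous_process_def using W_measurable W_cont by auto
  show "W t \<in> borel_measurable (F t)" if "t \<in> {0..T}" for t
    using that by (intro W_measurable_F) auto
  have "L2le M (W t) T" if t: "t \<in> {0..T}" for t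
  proof -
    have "L2le M (\<lambda>\<omega>. W t \<omega> - W 0 \<omega>) (t - 0)" using t by (intro L2le_W_increment) auto
    then have "L2le M (\<lambda>\<omega>. W t \<omega> - W 0 \<omega>) T" by (rule L2le_mono) (use t in simp)
    then show ?thesis by (rule L2le_cong) (simp add: W_0)
  qed
  then show "\<exists>K\<ge>0. \<forall>t\<in>{0..T}. L2le M (W t) K" using T_pos by (intro exI[of _ T]) simp
  fix \<epsilon> :: real assume "0 < \<epsilon>"
  moreover have "L2le M (\<lambda>\<omega>. W t \<omega> - W s \<omega>) \<epsilon>" if "0 \<le> s" "s \<le> t" "t \<le> T" "t - s < \<epsilon>" for s t
    by (rule L2le_mono[OF L2le_W_increment[OF that(1-3)]]) (use that(4) in simp)
  ultimately show "\<exists>\<delta>>0. \<forall>s t. 0 \<le> s \<longrightarrow> s \<le> t \<longrightarrow> t \<le> T \<longrightarrow> t - s < \<delta> \<longrightarrow> L2le M (\<lambda>\<omega>. W t \<omega> - W s \<omega>) \<epsilon>"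
    by blast
qed

section \<open>The remainder of the Stratonovich sum\<close>

text \<open>The summand of a Stratonovich sum for the integrand q R on one cell. The two factors are
  kept apart because they are bounded in different ways: q in L^2 over time, R in L^2(\<Omega>)
  uniformly on the cell.\<close>

definition strat_remainder :: "(real \<Rightarrow> real) \<Rightarrow> (real \<Rightarrow> 'a \<Rightarrow> real) \<Rightarrow> real \<Rightarrow> real \<Rightarrow> 'a \<Rightarrow> real" where
  "strat_remainder q R a b \<omega> = 1 / (b - a) * (\<integral>s. indicator {a<..b} s * (q s * R s \<omega>) \<partial>lborel_Icc T) * (W b \<omega> - W a \<omega>)"

text \<open>For each s the Cauchy-Schwarz inequality on \<Omega> bounds R s times the increment of W
  by sqrt (\<rho> (b - a)) in L^1. Averaging |q| contributes at most sqrt ((b - a)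
  \<open>sq_int T q a b\<close>) / (b - a), so the length of the cell cancels.\<close>

lemma strat_remainder_bound:
  assumes q: "q \<in> L2_Icc T" and ab: "0 \<le> a" "a < b" "b \<le> T"
    and R: "case_prod R \<in> borel_measurable P" and \<rho>: "0 \<le> \<rho>"
    and le: "\<And>s. a < s \<Longrightarrow> s \<le> b \<Longrightarrow> L2le M (R s) \<rho>"
  shows "L1le M (strat_remainder q R a b) (sqrt (sq_int T q a b * \<rho>))"
proof -
  define u where "u s = 1 / (b - a) * (indicator {a<..b} s * q s)" for s
  let ?D = "\<lambda>\<omega>. W b \<omega> - W a \<omega>"
  have D: "L2le M ?D (b - a)" using ab by (intro L2le_W_increment) auto
  have ui: "integrable (lborel_Icc T) u"
    unfolding u_def[abs_def] by (intro integrable_mult_right integrable_indicator_mult L2_Icc_integrable q)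
  have "L1le P (case_prod (\<lambda>s \<omega>. u s * (R s \<omega> * ?D \<omega>))) (\<integral>s. \<bar>u s\<bar> * sqrt (\<rho> * (b - a)) \<partial>lborel_Icc T)"
  proof (rule L1le_pair)
    show "sigma_finite_measure (lborel_Icc T)" "sigma_finite_measure M" by unfold_locales
    have "(\<lambda>(s, \<omega>). R s \<omega> * ?D \<omega>) \<in> borel_measurable P"
      unfolding case_prod_unfold
      using R measurable_compose[OF measurable_snd L2le_measurable[OF D]]
      by (intro borel_measurable_times) (simp_all add: case_prod_unfold)
    then show "(\<lambda>(s, \<omega>). u s * (R s \<omega> * ?D \<omega>)) \<in> borel_measurable P"
      by (rule measurable_time_factor[OF borel_measurable_integrable[OF ui]])
    show "integrable (lborel_Icc T) (\<lambda>s. \<bar>u s\<bar> * sqrt (\<rho> * (b - a)))"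
      using ui by (intro integrable_mult_left integrable_abs)
    show "0 \<le> \<bar>u s\<bar> * sqrt (\<rho> * (b - a))" for s using \<rho> ab by simp
    show "L1le M (\<lambda>\<omega>. u s * (R s \<omega> * ?D \<omega>)) (\<bar>u s\<bar> * sqrt (\<rho> * (b - a)))" for s
    proof (cases "s \<in> {a<..b}")
      case True
      then show ?thesis using \<rho> ab by (intro L1le_cmult L1le_mult le D) auto
    next
      case False
      then have "u s = 0" by (simp add: u_def)
      then show ?thesis by (simp add: L1le_zero)
    qed
  qed
  then have "L1le M (\<lambda>\<omega>. \<integral>s. u s * (R s \<omega> * ?D \<omega>) \<partial>lborel_Icc T) (\<integral>s. \<bar>u s\<bar> * sqrt (\<rho> * (b - a)) \<partial>lborel_Icc T)"
    by (intro L1le_integral) (unfold_locales, simp)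
  then have "L1le M (strat_remainder q R a b) (\<integral>s. \<bar>u s\<bar> * sqrt (\<rho> * (b - a)) \<partial>lborel_Icc T)"
  proof (rule L1le_cong)
    fix \<omega>
    have "u s * (R s \<omega> * ?D \<omega>) = (1 / (b - a)) * (indicator {a<..b} s * (q s * R s \<omega>) * ?D \<omega>)" for s
      by (simp add: u_def)
    then have "(\<integral>s. u s * (R s \<omega> * ?D \<omega>) \<partial>lborel_Icc T) =
        (1 / (b - a)) * (\<integral>s. indicator {a<..b} s * (q s * R s \<omega>) * ?D \<omega> \<partial>lborel_Icc T)"
      by (simp only: integral_mult_right_zero)
    also have "\<dots> = strat_remainder q R a b \<omega>"
      unfolding strat_remainder_def integral_mult_left_zero by (simp only: mult.assoc)
    finally show "(\<integral>s. u s * (R s \<omega> * ?D \<omega>) \<partial>lborel_Icc T) = strat_remainder q R a b \<omega>" .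
  qed
  moreover have "(\<integral>s. \<bar>u s\<bar> * sqrt (\<rho> * (b - a)) \<partial>lborel_Icc T) \<le> sqrt (sq_int T q a b * \<rho>)"
  proof -
    have "\<bar>u s\<bar> = 1 / (b - a) * (indicator {a<..b} s * \<bar>q s\<bar>)" for s
      using ab by (simp add: u_def abs_mult)
    then have "(\<integral>s. \<bar>u s\<bar> \<partial>lborel_Icc T) = 1 / (b - a) * (\<integral>s. indicator {a<..b} s * \<bar>q s\<bar> \<partial>lborel_Icc T)"
      by (simp only: integral_mult_right_zero)
    also have "\<dots> \<le> 1 / (b - a) * sqrt ((b - a) * sq_int T q a b)"
      using ab by (intro mult_left_mono L1_sq_int_bound q) auto
    finally have "(\<integral>s. \<bar>u s\<bar> \<partial>lborel_Icc T) * sqrt (\<rho> * (b - a)) \<le>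
        1 / (b - a) * sqrt ((b - a) * sq_int T q a b) * sqrt (\<rho> * (b - a))"
      by (rule mult_right_mono) (use \<rho> ab in simp)
    also have "\<dots> = 1 / (b - a) * sqrt ((b - a)\<^sup>2 * (sq_int T q a b * \<rho>))"
      by (simp add: power2_eq_square mult_ac flip: real_sqrt_mult)
    also have "\<dots> = sqrt (sq_int T q a b * \<rho>)"
      using ab by (simp add: real_sqrt_mult)
    finally show ?thesis by simp
  qed
  ultimately show ?thesis by (rule L1le_mono)
qed

section \<open>Centred products of two increments\<close>

lemma centred_product_expectation:
  assumes m: "0 \<le> a" "a \<le> m" "m \<le> b" "b \<le> T" and g: "g \<in> borel_measurable (F a)" "integrable M g"
  shows "integrable M (\<lambda>\<omega>. g \<omega> * ((W m \<omega> - W a \<omega>) * (W b \<omega> - W a \<omega>) - (m - a)))"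
    and "expectation (\<lambda>\<omega>. g \<omega> * ((W m \<omega> - W a \<omega>) * (W b \<omega> - W a \<omega>) - (m - a))) = 0"
proof -
  have *: "integrable M (\<lambda>\<omega>. g \<omega> * ((W m \<omega> - W a \<omega>) * (W b \<omega> - W a \<omega>)))"
    "expectation (\<lambda>\<omega>. g \<omega> * ((W m \<omega> - W a \<omega>) * (W b \<omega> - W a \<omega>))) = expectation g * (min m b - a)"
    using expectation_mult_two_increments[of a m b g] m g by simp_all
  have gc: "integrable M (\<lambda>\<omega>. g \<omega> * (m - a))" using g(2) by simp
  show "integrable M (\<lambda>\<omega>. g \<omega> * ((W m \<omega> - W a \<omega>) * (W b \<omega> - W a \<omega>) - (m - a)))"
    unfolding right_diff_distrib[of "g _" "_ * _"] by (rule Bochner_Integration.integrable_diff[OF *(1) gc])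
  have "expectation (\<lambda>\<omega>. g \<omega> * ((W m \<omega> - W a \<omega>) * (W b \<omega> - W a \<omega>)) - g \<omega> * (m - a)) =
      expectation (\<lambda>\<omega>. g \<omega> * ((W m \<omega> - W a \<omega>) * (W b \<omega> - W a \<omega>))) - expectation (\<lambda>\<omega>. g \<omega> * (m - a))"
    by (rule Bochner_Integration.integral_diff[OF *(1) gc])
  also have "\<dots> = 0" unfolding *(2) using m by simp
  finally show "expectation (\<lambda>\<omega>. g \<omega> * ((W m \<omega> - W a \<omega>) * (W b \<omega> - W a \<omega>) - (m - a))) = 0"
    unfolding right_diff_distrib[of "g _" "_ * _"] .
qed

text \<open>With D1 and D2 the increments over {a<..m} and {m<..b}, the centred product is D1^2 + D1
  D2 - (m - a). The fourth moment 3 (m - a)^2 of D1 and the independence of D2 give the order (b -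
  a)^2. The constant is 15 = 3 (3 + 1) + 3, where the outer factor 3 comes from squaring a sum of
  three terms.\<close>

lemma centred_product_L2le:
  assumes m: "0 \<le> a" "a \<le> m" "m \<le> b" "b \<le> T" and \<xi>: "\<xi> \<in> borel_measurable (F a)" "L2le M \<xi> c" and c: "0 \<le> c"
  shows "L2le M (\<lambda>\<omega>. \<xi> \<omega> * ((W m \<omega> - W a \<omega>) * (W b \<omega> - W a \<omega>) - (m - a))) (15 * c * (b - a)\<^sup>2)"
proof -
  let ?D1 = "\<lambda>\<omega>. W m \<omega> - W a \<omega>" and ?D2 = "\<lambda>\<omega>. W b \<omega> - W m \<omega>"
  have mT: "m \<le> T" "0 \<le> m" "a \<le> T" "0 \<le> b" using m by auto
  have g: "(\<lambda>\<omega>. (\<xi> \<omega>)\<^sup>2) \<in> borel_measurable (F a)" using \<xi>(1) by (rule borel_measurable_power)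
  note gi = L2le_imp_integrable[OF \<xi>(2)]
  define e where "e = expectation (\<lambda>\<omega>. (\<xi> \<omega>)\<^sup>2)"
  have e: "e \<le> c" "0 \<le> e" unfolding e_def using L2le_imp_integral_le[OF \<xi>(2) c] by auto
  have g1: "(\<lambda>\<omega>. (\<xi> \<omega>)\<^sup>2 * (?D1 \<omega>)\<^sup>2) \<in> borel_measurable (F m)"
    using mT m by (intro borel_measurable_times borel_measurable_power borel_measurable_diff W_measurable_F measurable_F_mono[OF \<xi>(1)]) auto
  have i1: "integrable M (\<lambda>\<omega>. (\<xi> \<omega>)\<^sup>2 * (?D1 \<omega>)\<^sup>2)"
    by (rule integrable_mult_increment[OF m(1,2) mT(1) g gi])
  have E1: "expectation (\<lambda>\<omega>. (\<xi> \<omega>)\<^sup>2 * (?D1 \<omega>)\<^sup>2) = e * (m - a)"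
    unfolding e_def by (rule expectation_mult_increment(2)[OF m(1,2) mT(1) g gi])
  have i4: "integrable M (\<lambda>\<omega>. (\<xi> \<omega>)\<^sup>2 * (?D1 \<omega>) ^ 4)"
    by (rule integrable_mult_increment[OF m(1,2) mT(1) g gi])
  have E4: "expectation (\<lambda>\<omega>. (\<xi> \<omega>)\<^sup>2 * (?D1 \<omega>) ^ 4) = e * (3 * (m - a)\<^sup>2)"
    unfolding e_def by (rule expectation_mult_increment(3)[OF m(1,2) mT(1) g gi])
  have i2: "integrable M (\<lambda>\<omega>. (\<xi> \<omega>)\<^sup>2 * (?D1 \<omega>)\<^sup>2 * (?D2 \<omega>)\<^sup>2)"
    by (rule integrable_mult_increment[OF mT(2) m(3,4) g1 i1])
  have E2: "expectation (\<lambda>\<omega>. (\<xi> \<omega>)\<^sup>2 * (?D1 \<omega>)\<^sup>2 * (?D2 \<omega>)\<^sup>2) = e * (m - a) * (b - m)"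
    unfolding E1[symmetric] by (rule expectation_mult_increment(2)[OF mT(2) m(3,4) g1 i1])
  have three: "(x + y - z)\<^sup>2 \<le> 3 * (x\<^sup>2 + y\<^sup>2 + z\<^sup>2)" for x y z :: real
  proof -
    have "0 \<le> (x - y)\<^sup>2 + (x + z)\<^sup>2 + (y + z)\<^sup>2" by simp
    then show ?thesis by (simp add: power2_eq_square algebra_simps)
  qed
  define B where "B \<omega> = 3 * ((\<xi> \<omega>)\<^sup>2 * (?D1 \<omega>) ^ 4 + (\<xi> \<omega>)\<^sup>2 * (?D1 \<omega>)\<^sup>2 * (?D2 \<omega>)\<^sup>2 + (m - a)\<^sup>2 * (\<xi> \<omega>)\<^sup>2)" for \<omega>
  have Bi: "integrable M B"
    unfolding B_def[abs_def]
    by (intro integrable_mult_right Bochner_Integration.integrable_add i4 i2 gi)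
  have EB: "expectation B = 3 * (e * (3 * (m - a)\<^sup>2) + e * (m - a) * (b - m) + (m - a)\<^sup>2 * e)"
    unfolding B_def[abs_def] integral_mult_right_zero
      Bochner_Integration.integral_add[OF Bochner_Integration.integrable_add[OF i4 i2] integrable_mult_right[OF gi]]
      Bochner_Integration.integral_add[OF i4 i2] E4 E2 e_def ..
  have le: "(\<xi> \<omega> * (?D1 \<omega> * (W b \<omega> - W a \<omega>) - (m - a)))\<^sup>2 \<le> B \<omega>" for \<omega>
  proof -
    have "?D1 \<omega> * (W b \<omega> - W a \<omega>) - (m - a) = (?D1 \<omega>)\<^sup>2 + ?D1 \<omega> * ?D2 \<omega> - (m - a)"
      by (simp add: power2_eq_square algebra_simps)
    then have "(?D1 \<omega> * (W b \<omega> - W a \<omega>) - (m - a))\<^sup>2 \<le> 3 * (((?D1 \<omega>)\<^sup>2)\<^sup>2 + (?D1 \<omega> * ?D2 \<omega>)\<^sup>2 + (m - a)\<^sup>2)"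
      using three[of "(?D1 \<omega>)\<^sup>2" "?D1 \<omega> * ?D2 \<omega>" "m - a"] by simp
    then have "(\<xi> \<omega>)\<^sup>2 * (?D1 \<omega> * (W b \<omega> - W a \<omega>) - (m - a))\<^sup>2 \<le>
        (\<xi> \<omega>)\<^sup>2 * (3 * (((?D1 \<omega>)\<^sup>2)\<^sup>2 + (?D1 \<omega> * ?D2 \<omega>)\<^sup>2 + (m - a)\<^sup>2))"
      by (rule mult_left_mono) simp
    also have "\<dots> = B \<omega>"
      by (simp add: B_def power_mult_distrib distrib_left mult_ac flip: power_mult)
    finally show ?thesis by (simp only: power_mult_distrib)
  qed
  have "expectation B \<le> 15 * c * (b - a)\<^sup>2"
  proof -
    have 1: "(m - a)\<^sup>2 \<le> (b - a)\<^sup>2" using m by (intro power_mono) auto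
    have 2: "(m - a) * (b - m) \<le> (b - a)\<^sup>2" unfolding power2_eq_square using m by (intro mult_mono) auto
    have "expectation B = e * (12 * (m - a)\<^sup>2 + 3 * ((m - a) * (b - m)))"
      unfolding EB by (simp add: algebra_simps)
    also have "\<dots> \<le> c * (15 * (b - a)\<^sup>2)"
    proof (intro mult_mono e c)
      show "12 * (m - a)\<^sup>2 + 3 * ((m - a) * (b - m)) \<le> 15 * (b - a)\<^sup>2" using 1 2 by linarith
      show "0 \<le> 12 * (m - a)\<^sup>2 + 3 * ((m - a) * (b - m))" using m by simp
    qed
    finally show ?thesis by simp
  qed
  moreover have "(\<integral>\<^sup>+\<omega>. ennreal ((\<xi> \<omega> * (?D1 \<omega> * (W b \<omega> - W a \<omega>) - (m - a)))\<^sup>2) \<partial>M) \<le> (\<integral>\<^sup>+\<omega>. ennreal (B \<omega>) \<partial>M)"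
    by (intro nn_integral_mono ennreal_leI le)
  moreover have "(\<integral>\<^sup>+\<omega>. ennreal (B \<omega>) \<partial>M) = ennreal (expectation B)"
    by (rule nn_integral_eq_integral[OF Bi]) (simp add: B_def)
  moreover have "(\<lambda>\<omega>. \<xi> \<omega> * (?D1 \<omega> * (W b \<omega> - W a \<omega>) - (m - a))) \<in> borel_measurable M"
    using mT m by (intro borel_measurable_times borel_measurable_diff W_measurable L2le_measurable[OF \<xi>(2)] borel_measurable_const) auto
  ultimately show ?thesis
    unfolding L2le_def using ennreal_leI[of "expectation B" "15 * c * (b - a)\<^sup>2"] by simp
qed

text \<open>The products are centred given the past of their cell and their coefficients are known
  at its left end, so the summands are martingale differences: mixed terms have mean 0 and the
  squared norms add.\<close>

lemma orthogonal_sum_L2le: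
  assumes p: "partition_of 0 t N p" and t: "t \<le> T" and \<theta>: "0 \<le> \<theta>" "\<theta> \<le> 1"
    and \<xi>: "\<And>i. i < N \<Longrightarrow> \<xi> i \<in> borel_measurable (F (p i))" "\<And>i. i < N \<Longrightarrow> L2le M (\<xi> i) (c i)" "\<And>i. i < N \<Longrightarrow> 0 \<le> c i"
  shows "L2le M (\<lambda>\<omega>. \<Sum>i<N. \<xi> i \<omega> * ((W (p i + \<theta> * (p (Suc i) - p i)) \<omega> - W (p i) \<omega>) * (W (p (Suc i)) \<omega> - W (p i) \<omega>)
      - \<theta> * (p (Suc i) - p i))) (\<Sum>i<N. 15 * c i * (p (Suc i) - p i)\<^sup>2)"
proof -
  define m where "m i = p i + \<theta> * (p (Suc i) - p i)" for i
  define Q where "Q i \<omega> = (W (m i) \<omega> - W (p i) \<omega>) * (W (p (Suc i)) \<omega> - W (p i) \<omega>) - (m i - p i)" for i \<omega>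
  have b: "0 \<le> p i" "p i \<le> m i" "m i \<le> p (Suc i)" "p (Suc i) \<le> T" "p i \<le> T" if "i < N" for i
  proof -
    have *: "0 \<le> p i" "p i < p (Suc i)" "p (Suc i) \<le> T"
      using partition_of_bounds[OF p, of i] partition_of_bounds[OF p, of "Suc i"] partition_of_less[OF p that] that t by auto
    have "0 \<le> (1 - \<theta>) * (p (Suc i) - p i)" using * \<theta> by simp
    then show "m i \<le> p (Suc i)" by (simp add: m_def algebra_simps)
    show "0 \<le> p i" "p i \<le> m i" "p (Suc i) \<le> T" "p i \<le> T"
      using * \<theta> by (auto simp: m_def)
  qed
  have Q2: "L2le M (\<lambda>\<omega>. \<xi> i \<omega> * Q i \<omega>) (15 * c i * (p (Suc i) - p i)\<^sup>2)" if "i < N" for i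
    unfolding Q_def using b[OF that] \<xi>[OF that] by (intro centred_product_L2le)
  \<comment> \<open>Measurability at \<open>p n\<close> is carried along because it makes the
    partial sum, times the next coefficient, a factor known at the left end of the next
    cell.\<close>
  have "(\<lambda>\<omega>. \<Sum>i<n. \<xi> i \<omega> * Q i \<omega>) \<in> borel_measurable (F (p n)) \<and>
      L2le M (\<lambda>\<omega>. \<Sum>i<n. \<xi> i \<omega> * Q i \<omega>) (\<Sum>i<n. 15 * c i * (p (Suc i) - p i)\<^sup>2)" if "n \<le> N" for n
    using that
  proof (induction n)
    case 0
    show ?case by (simp add: L2le_zero)
  next
    case (Suc n)
    define S where "S \<omega> = (\<Sum>i<n. \<xi> i \<omega> * Q i \<omega>)" for \<omega>
    have n: "n < N" using Suc by simp
    have S: "S \<in> borel_measurable (F (p n))" "L2le M S (\<Sum>i<n. 15 * c i * (p (Suc i) - p i)\<^sup>2)"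
      using Suc unfolding S_def[abs_def] by auto
    have sn: "0 \<le> (\<Sum>i<n. 15 * c i * (p (Suc i) - p i)\<^sup>2)"
      using \<xi>(3) n by (intro sum_nonneg) auto
    have mF: "(\<lambda>\<omega>. S \<omega> + \<xi> n \<omega> * Q n \<omega>) \<in> borel_measurable (F (p (Suc n)))"
      unfolding Q_def using b[OF n]
      by (intro borel_measurable_add borel_measurable_times borel_measurable_diff W_measurable_F
          borel_measurable_const measurable_F_mono[OF S(1)] measurable_F_mono[OF \<xi>(1)[OF n]]) auto
    let ?g = "\<lambda>\<omega>. S \<omega> * \<xi> n \<omega>"
    have gF: "?g \<in> borel_measurable (F (p n))" by (rule borel_measurable_times[OF S(1) \<xi>(1)[OF n]])
    have gI: "integrable M ?g"
      by (rule integrable_mult_of_squares[OF L2le_measurable[OF S(2)] L2le_imp_integrable[OF S(2)]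
          L2le_measurable[OF \<xi>(2)[OF n]] L2le_imp_integrable[OF \<xi>(2)[OF n]]])
    note cross = centred_product_expectation[OF b(1-4)[OF n] gF gI, folded Q_def]
    have iS: "integrable M (\<lambda>\<omega>. (S \<omega>)\<^sup>2)" by (rule L2le_imp_integrable[OF S(2)])
    have iQ: "integrable M (\<lambda>\<omega>. (\<xi> n \<omega> * Q n \<omega>)\<^sup>2)" by (rule L2le_imp_integrable[OF Q2[OF n]])
    have eq: "(S \<omega> + \<xi> n \<omega> * Q n \<omega>)\<^sup>2 = (S \<omega>)\<^sup>2 + 2 * (?g \<omega> * Q n \<omega>) + (\<xi> n \<omega> * Q n \<omega>)\<^sup>2" for \<omega>
      by (simp add: power2_eq_square algebra_simps)
    have i12: "integrable M (\<lambda>\<omega>. (S \<omega>)\<^sup>2 + 2 * (?g \<omega> * Q n \<omega>))"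
      by (rule Bochner_Integration.integrable_add[OF iS integrable_mult_right[OF cross(1)]])
    have "expectation (\<lambda>\<omega>. (S \<omega> + \<xi> n \<omega> * Q n \<omega>)\<^sup>2) =
        expectation (\<lambda>\<omega>. (S \<omega>)\<^sup>2) + 2 * 0 + expectation (\<lambda>\<omega>. (\<xi> n \<omega> * Q n \<omega>)\<^sup>2)"
      unfolding eq Bochner_Integration.integral_add[OF i12 iQ]
        Bochner_Integration.integral_add[OF iS integrable_mult_right[OF cross(1)]]
        integral_mult_right_zero cross(2) ..
    also have "\<dots> \<le> (\<Sum>i<Suc n. 15 * c i * (p (Suc i) - p i)\<^sup>2)"
      using L2le_imp_integral_le[OF S(2) sn] L2le_imp_integral_le[OF Q2[OF n]] \<xi>(3)[OF n] by simp
    finally have le: "expectation (\<lambda>\<omega>. (S \<omega> + \<xi> n \<omega> * Q n \<omega>)\<^sup>2) \<le> (\<Sum>i<Suc n. 15 * c i * (p (Suc i) - p i)\<^sup>2)" .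
    have "L2le M (\<lambda>\<omega>. S \<omega> + \<xi> n \<omega> * Q n \<omega>) (expectation (\<lambda>\<omega>. (S \<omega> + \<xi> n \<omega> * Q n \<omega>)\<^sup>2))"
    proof (rule L2le_integral)
      show "(\<lambda>\<omega>. S \<omega> + \<xi> n \<omega> * Q n \<omega>) \<in> borel_measurable M"
        by (rule measurable_F_imp_M[OF mF b(4)[OF n]])
      show "integrable M (\<lambda>\<omega>. (S \<omega> + \<xi> n \<omega> * Q n \<omega>)\<^sup>2)"
        unfolding eq by (rule Bochner_Integration.integrable_add[OF i12 iQ])
    qed
    then have "L2le M (\<lambda>\<omega>. S \<omega> + \<xi> n \<omega> * Q n \<omega>) (\<Sum>i<Suc n. 15 * c i * (p (Suc i) - p i)\<^sup>2)"
      by (rule L2le_mono[OF _ le])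
    then show ?case using mF by (simp add: S_def)
  qed
  from this[of N] show ?thesis
    unfolding Q_def m_def by simp
qed

end

text \<open>Parametrises all cells by the same \<theta>, so that for fixed \<theta> the sum over the
  cells can be estimated as a whole.\<close>

lemma integral_Icc_affine:
  fixes \<phi> :: "real \<Rightarrow> real"
  assumes "0 \<le> a" "a < b" "b \<le> T"
  shows "(\<integral>s. indicator {a<..b} s * \<phi> s \<partial>lborel_Icc T) =
    (b - a) * (\<integral>\<theta>. indicator {0<..1} \<theta> * \<phi> (a + \<theta> * (b - a)) \<partial>lborel_Icc 1)"
proof -
  have "(\<integral>s. indicator {a<..b} s * \<phi> s \<partial>lborel_Icc T) = (\<integral>s. indicator {0..T} s *\<^sub>R (indicator {a<..b} s * \<phi> s) \<partial>lborel)"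
    by (rule integral_restrict_space) auto
  also have "\<dots> = (\<integral>s. indicator {a<..b} s * \<phi> s \<partial>lborel)"
    using assms by (intro Bochner_Integration.integral_cong) (auto simp: indicator_def)
  also have "\<dots> = \<bar>b - a\<bar> *\<^sub>R (\<integral>\<theta>. indicator {a<..b} (a + (b - a) * \<theta>) * \<phi> (a + (b - a) * \<theta>) \<partial>lborel)"
    using assms by (intro lborel_integral_real_affine) simp
  also have "(\<integral>\<theta>. indicator {a<..b} (a + (b - a) * \<theta>) * \<phi> (a + (b - a) * \<theta>) \<partial>lborel) =
      (\<integral>\<theta>. indicator {0..1} \<theta> *\<^sub>R (indicator {0<..1} \<theta> * \<phi> (a + \<theta> * (b - a))) \<partial>lborel)"
  proof (intro Bochner_Integration.integral_cong refl)
    fix \<theta> :: real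
    have "a + (b - a) * \<theta> \<in> {a<..b} \<longleftrightarrow> \<theta> \<in> {0<..1}"
    proof -
      have "a + (b - a) * \<theta> \<le> b \<longleftrightarrow> (b - a) * \<theta> \<le> (b - a) * 1" by (simp only: mult_1_right) linarith
      then show ?thesis using assms by (simp add: zero_less_mult_iff)
    qed
    then show "indicator {a<..b} (a + (b - a) * \<theta>) * \<phi> (a + (b - a) * \<theta>) =
        indicator {0..1} \<theta> *\<^sub>R (indicator {0<..1} \<theta> * \<phi> (a + \<theta> * (b - a)))"
      by (auto simp: indicator_def mult.commute)
  qed
  also have "\<dots> = (\<integral>\<theta>. indicator {0<..1} \<theta> * \<phi> (a + \<theta> * (b - a)) \<partial>lborel_Icc 1)"
    by (rule integral_restrict_space[symmetric]) auto
  finally show ?thesis using assms by simp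
qed

text \<open>Cauchy-Schwarz over the cells: bounds sqrt (x i y i) on the single cells have a small
  sum as soon as one of the two series is small and the other is bounded.\<close>

lemma sum_sqrt_mult_le:
  fixes x y :: "nat \<Rightarrow> real"
  assumes "\<And>i. i < n \<Longrightarrow> 0 \<le> x i" "\<And>i. i < n \<Longrightarrow> 0 \<le> y i"
  shows "(\<Sum>i<n. sqrt (x i * y i)) \<le> sqrt ((\<Sum>i<n. x i) * (\<Sum>i<n. y i))"
proof -
  have "(\<Sum>i<n. sqrt (x i) * sqrt (y i))\<^sup>2 \<le> (\<Sum>i<n. (sqrt (x i))\<^sup>2) * (\<Sum>i<n. (sqrt (y i))\<^sup>2)"
    by (rule Cauchy_Schwarz_ineq_sum)
  also have "\<dots> = (\<Sum>i<n. x i) * (\<Sum>i<n. y i)"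
    using assms by (intro arg_cong2[where f="(*)"] sum.cong) auto
  finally have "sqrt ((\<Sum>i<n. sqrt (x i) * sqrt (y i))\<^sup>2) \<le> sqrt ((\<Sum>i<n. x i) * (\<Sum>i<n. y i))"
    by (rule real_sqrt_le_mono)
  then show ?thesis
    using assms by (simp add: real_sqrt_mult sum_nonneg)
qed

definition sq_norm :: "real \<Rightarrow> (real \<Rightarrow> real) \<Rightarrow> real" where
  "sq_norm T f = (\<integral>s. (f s)\<^sup>2 \<partial>lborel_Icc T)"

lemma sq_norm_nonneg: "0 \<le> sq_norm T f"
  by (simp add: sq_norm_def integral_nonneg_AE)

lemma sq_int_le_sq_norm:
  assumes "f \<in> L2_Icc T"
  shows "sq_int T f a b \<le> sq_norm T f"
  unfolding sq_int_def sq_norm_def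
  by (intro integral_mono integrable_indicator_mult L2_Icc_integrable_square assms) (auto simp: indicator_def)

lemma continuous_integrable_Icc:
  assumes "continuous_on {0..t} (u :: real \<Rightarrow> real)"
  shows "integrable (lborel_Icc t) u"
  using borel_integrable_atLeastAtMost'[OF assms]
  by (simp add: integrable_restrict_space set_integrable_def)

text \<open>The mean relative position in a cell; the factor 1/2 of the Stratonovich correction
  originates here.\<close>

lemma integral_identity_Icc_1: "(\<integral>\<theta>. indicator {0<..1} \<theta> * \<theta> \<partial>lborel_Icc 1) = 1 / 2"
proof -
  have i: "set_integrable lborel {0..1} (\<lambda>\<theta>::real. \<theta>)"
    by (rule borel_integrable_atLeastAtMost') (intro continuous_intros)
  have "(\<integral>\<theta>. indicator {0<..1} \<theta> * \<theta> \<partial>lborel_Icc 1) = (LBINT \<theta>:{0..1}. \<theta>)"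
    by (rule LBINT_eq_integral_Icc[symmetric]) (auto intro: measurable_lborel_Icc)
  also have "\<dots> = integral {0..1} (\<lambda>\<theta>. \<theta>)"
    by (rule set_borel_integral_eq_integral(2)[OF i])
  also have "\<dots> = 1 / 2"
    using ident_has_integral[of 0 "1::real"] by (simp add: integral_unique)
  finally show ?thesis .
qed

context brownian_motion
begin

section \<open>The Ito part of the Stratonovich sum\<close>

lemma stratonovich_sum_decomposition:
  assumes Z: "regular Z" and f: "f \<in> L2_Icc T" and p: "partition_of 0 t N p" and t: "t \<le> T" and \<omega>: "\<omega> \<in> space M"
  shows "stratonovich_sum W (\<lambda>s \<omega>. f s * Z s \<omega>) N p \<omega> = elem_integral W (ito_approx T f Z N p) \<omega> +
    (\<Sum>i<N. strat_remainder f (\<lambda>s \<omega>. Z s \<omega> - Z (p i) \<omega>) (p i) (p (Suc i)) \<omega>)"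
proof -
  have "1 / (p (Suc i) - p i) * (LBINT s:{p i..p (Suc i)}. f s * Z s \<omega>) * (W (p (Suc i)) \<omega> - W (p i) \<omega>) =
      avg T f (p i) (p (Suc i)) * Z (p i) \<omega> * (W (p (Suc i)) \<omega> - W (p i) \<omega>) +
      strat_remainder f (\<lambda>s \<omega>. Z s \<omega> - Z (p i) \<omega>) (p i) (p (Suc i)) \<omega>" if i: "i < N" for i
  proof -
    let ?a = "p i" and ?b = "p (Suc i)"
    have b: "0 \<le> ?a" "?b \<le> T"
      using partition_of_bounds[OF p, of i] partition_of_bounds[OF p, of "Suc i"] i t by auto
    note fZ = path_integrable[OF Z \<omega> L2_Icc_integrable[OF f]]
    have i1: "integrable (lborel_Icc T) (\<lambda>s. indicator {?a<..?b} s * (f s * Z s \<omega>))"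
      by (rule integrable_indicator_mult[OF fZ])
    have i2: "integrable (lborel_Icc T) (\<lambda>s. indicator {?a<..?b} s * f s * Z ?a \<omega>)"
      by (intro integrable_mult_left integrable_indicator_mult L2_Icc_integrable f)
    have "(\<integral>s. indicator {?a<..?b} s * (f s * (Z s \<omega> - Z ?a \<omega>)) \<partial>lborel_Icc T) =
        (\<integral>s. indicator {?a<..?b} s * (f s * Z s \<omega>) - indicator {?a<..?b} s * f s * Z ?a \<omega> \<partial>lborel_Icc T)"
      by (intro Bochner_Integration.integral_cong) (auto simp: algebra_simps)
    also have "\<dots> = (\<integral>s. indicator {?a<..?b} s * (f s * Z s \<omega>) \<partial>lborel_Icc T) -
        (\<integral>s. indicator {?a<..?b} s * f s \<partial>lborel_Icc T) * Z ?a \<omega>"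
      unfolding Bochner_Integration.integral_diff[OF i1 i2] integral_mult_left_zero ..
    also have "(\<integral>s. indicator {?a<..?b} s * (f s * Z s \<omega>) \<partial>lborel_Icc T) = (LBINT s:{?a..?b}. f s * Z s \<omega>)"
      by (rule LBINT_eq_integral_Icc[symmetric, OF borel_measurable_integrable[OF fZ] b])
    finally have X: "(\<integral>s. indicator {?a<..?b} s * (f s * (Z s \<omega> - Z ?a \<omega>)) \<partial>lborel_Icc T) =
        (LBINT s:{?a..?b}. f s * Z s \<omega>) - (\<integral>s. indicator {?a<..?b} s * f s \<partial>lborel_Icc T) * Z ?a \<omega>" .
    have "k * L * w = k * A * z * w + k * x * w" if "x = L - A * z" for k L w A z x :: real
      unfolding that by (simp add: algebra_simps)
    from this[OF X] show ?thesis unfolding strat_remainder_def avg_def .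
  qed
  then show ?thesis
    by (simp add: stratonovich_sum_def ito_approx_def elem_integral_step_list sum.distrib)
qed

lemma elem_restrict_partition:
  assumes p: "partition_of 0 t N p"
  shows "elem_integral W (elem_restrict 0 t (step_list N p \<xi>)) \<omega> = elem_integral W (step_list N p \<xi>) \<omega>"
  unfolding elem_path_step_list[OF p] elem_integral_step_list step_integral_def
proof (rule sum.cong)
  fix i assume "i \<in> {..<N}"
  then have "p i \<le> t" "p (Suc i) \<le> t"
    using partition_of_bounds[OF p, of i] partition_of_bounds[OF p, of "Suc i"] by auto
  then show "\<xi> i \<omega> * (W (min t (p (Suc i))) \<omega> - W (min t (p i)) \<omega>) = \<xi> i \<omega> * (W (p (Suc i)) \<omega> - W (p i) \<omega>)"
    by (simp add: min_absorb2)
qed simp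

lemma ito_sum_converges:
  assumes Z: "regular Z" and f: "f \<in> L2_Icc T" and I: "ito_limit (\<lambda>s \<omega>. f s * Z s \<omega>) I" and \<epsilon>: "0 < \<epsilon>"
  obtains \<delta> where "0 < \<delta>" "\<And>t N p. 0 \<le> t \<Longrightarrow> t \<le> T \<Longrightarrow> partition_of 0 t N p \<Longrightarrow> (\<forall>i<N. p (Suc i) - p i < \<delta>) \<Longrightarrow>
    L1le M (\<lambda>\<omega>. elem_integral W (ito_approx T f Z N p) \<omega> - I t \<omega>) \<epsilon>"
proof -
  \<comment> \<open>The estimate \<open>ito_limit_approx\<close> has a factor 4 on squared norms,
    and the passage from L^2 to L^1 takes a square root.\<close>
  define \<eta> where "\<eta> = \<epsilon>\<^sup>2 / 4"
  have \<eta>: "0 < \<eta>" "sqrt (4 * \<eta>) = \<epsilon>" using \<epsilon> by (auto simp: \<eta>_def)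
  obtain \<delta> where \<delta>: "0 < \<delta>" "\<And>t N p. t \<le> T \<Longrightarrow> partition_of 0 t N p \<Longrightarrow> (\<forall>i<N. p (Suc i) - p i < \<delta>) \<Longrightarrow>
    L2le P (\<lambda>(s, \<omega>). indicator {0<..t} s * (f s * Z s \<omega> - elem_process (ito_approx T f Z N p) s \<omega>)) \<eta>"
    using ito_approx_converges[OF Z f \<eta>(1)] by blast
  show thesis
  proof
    show "0 < \<delta>" by fact
    fix t N p assume t: "0 \<le> t" "t \<le> T" and p: "partition_of 0 t N p" and mesh: "\<forall>i<N. p (Suc i) - p i < \<delta>"
    let ?L = "ito_approx T f Z N p"
    have ad: "adapted ?L" by (rule adapted_ito_approx[OF Z p t(2)])
    have eq: "elem_integral W (elem_restrict 0 t ?L) \<omega> = elem_integral W ?L \<omega>" for \<omega>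
      unfolding ito_approx_def by (rule elem_restrict_partition[OF p])
    have "L2le M (\<lambda>\<omega>. I t \<omega> - I 0 \<omega> - elem_integral W (elem_restrict 0 t ?L) \<omega>) (4 * \<eta>)"
      using \<eta>(1) by (intro ito_limit_approx[OF I ad order_refl t] \<delta>(2)[OF t(2) p mesh]) simp
    then have "L2le M (\<lambda>\<omega>. I t \<omega> - I 0 \<omega> - elem_integral W ?L \<omega>) (4 * \<eta>)" unfolding eq .
    from L2le_imp_L1le[OF this] \<eta> have 1: "L1le M (\<lambda>\<omega>. I t \<omega> - I 0 \<omega> - elem_integral W ?L \<omega>) \<epsilon>" by simp
    have "L1le M (\<lambda>\<omega>. - 1 * (I t \<omega> - I 0 \<omega> - elem_integral W ?L \<omega>)) \<epsilon>"
      using L1le_cmult[OF 1, of "- 1"] \<epsilon> by simp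
    then show "L1le M (\<lambda>\<omega>. elem_integral W ?L \<omega> - I t \<omega>) \<epsilon>"
    proof (rule L1le_cong_AE)
      show "AE \<omega> in M. - 1 * (I t \<omega> - I 0 \<omega> - elem_integral W ?L \<omega>) = elem_integral W ?L \<omega> - I t \<omega>"
        using ito_limit_0[OF I] by eventually_elim simp
      have "continuous_process M T I" using I by (simp add: ito_limit_def)
      then show "(\<lambda>\<omega>. elem_integral W ?L \<omega> - I t \<omega>) \<in> borel_measurable M"
        by (intro borel_measurable_diff elem_integral_measurable[OF ad] continuous_process_measurable[OF _ t])
    qed
  qed
qed

lemma jointly_measurable_at:
  assumes "X \<in> borel_measurable M"
  shows "(\<lambda>z. X (snd z)) \<in> borel_measurable (\<Lambda> \<Otimes>\<^sub>M M)"
  by (rule measurable_compose[OF measurable_snd assms])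

section \<open>Limits of the remainders\<close>

text \<open>On a cell the L^2(\<Omega>) norm of the increments of the Lebesgue integral is at most
  sqrt K times the integral of |g h| over the cell, which is additive over the partition, while the
  factor contributed by f is small uniformly in the cell. So the L^1 bounds of the single cells have
  a small sum.\<close>

lemma drift_remainder_converges:
  assumes U: "regular U" and f: "f \<in> L2_Icc T" and g: "g \<in> L2_Icc T" and h: "h \<in> L2_Icc T" and \<epsilon>: "0 < \<epsilon>"
  obtains \<delta> where "0 < \<delta>" "\<And>t N p. t \<le> T \<Longrightarrow> partition_of 0 t N p \<Longrightarrow> (\<forall>i<N. p (Suc i) - p i < \<delta>) \<Longrightarrow>
    L1le M (\<lambda>\<omega>. \<Sum>i<N. strat_remainder f (\<lambda>s \<omega>. drift (\<lambda>s. g s * h s) U s \<omega> - drift (\<lambda>s. g s * h s) U (p i) \<omega>) (p i) (p (Suc i)) \<omega>) \<epsilon>"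
proof -
  let ?D = "drift (\<lambda>s. g s * h s) U"
  have D: "regular ?D" by (rule regular_drift[OF U g h])
  have gh: "integrable (lborel_Icc T) (\<lambda>s. g s * h s)" by (rule L2_Icc_product_integrable[OF g h])
  obtain K where K: "0 \<le> K" "\<And>t. 0 \<le> t \<Longrightarrow> t \<le> T \<Longrightarrow> L2le M (U t) K"
    using regular_bound[OF U] by blast
  define a where "a s t = (\<integral>r. indicator {s<..t} r * \<bar>g r * h r\<bar> \<partial>lborel_Icc T)" for s t
  have a0: "0 \<le> a s t" for s t unfolding a_def by (intro integral_nonneg_AE AE_I2) simp
  have a_mono: "a s t \<le> a s' t'" if "s' \<le> s" "t \<le> t'" for s t s' t'
    unfolding a_def using that
    by (intro integral_mono integrable_indicator_mult integrable_abs gh) (auto simp: indicator_def)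
  obtain \<eta>' where \<eta>': "0 < \<eta>'" "\<eta>' * (sqrt K * a 0 T + 1) = \<epsilon>"
    using ex_scaled_positive[OF \<epsilon>, of "sqrt K * a 0 T"] K(1) a0 by auto
  then have "0 < \<eta>'\<^sup>2" by simp
  then obtain \<delta> where \<delta>: "0 < \<delta>" "\<And>a b. 0 \<le> a \<Longrightarrow> a \<le> b \<Longrightarrow> b \<le> T \<Longrightarrow> b - a < \<delta> \<Longrightarrow> sq_int T f a b \<le> \<eta>'\<^sup>2"
    using sq_int_uniformly_small[OF f] by blast
  show thesis
  proof
    show "0 < \<delta>" by fact
    fix t N p assume t: "t \<le> T" and p: "partition_of 0 t N p" and mesh: "\<forall>i<N. p (Suc i) - p i < \<delta>"
    have b: "0 \<le> p i" "p i < p (Suc i)" "p (Suc i) \<le> T" if "i < N" for i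
      using partition_of_bounds[OF p, of i] partition_of_bounds[OF p, of "Suc i"] partition_of_less[OF p that] that t by auto
    have "L1le M (\<lambda>\<omega>. \<Sum>i<N. strat_remainder f (\<lambda>s \<omega>. ?D s \<omega> - ?D (p i) \<omega>) (p i) (p (Suc i)) \<omega>)
        (\<Sum>i<N. \<eta>' * sqrt K * a (p i) (p (Suc i)))"
    proof (rule L1le_sum)
      fix i assume "i \<in> {..<N}"
      then have i: "i < N" by simp
      show "0 \<le> \<eta>' * sqrt K * a (p i) (p (Suc i))" using \<eta>'(1) K(1) a0 by simp
      have Dm: "?D (p i) \<in> borel_measurable M"
        using b[OF i] by (intro measurable_F_imp_M[OF regularD(2)[OF D]]) auto
      have "L1le M (strat_remainder f (\<lambda>s \<omega>. ?D s \<omega> - ?D (p i) \<omega>) (p i) (p (Suc i))) (sqrt (sq_int T f (p i) (p (Suc i)) * (K * (a (p i) (p (Suc i)))\<^sup>2)))"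
      proof (rule strat_remainder_bound[OF f b[OF i]])
        show "(\<lambda>(s, \<omega>). ?D s \<omega> - ?D (p i) \<omega>) \<in> borel_measurable P"
          using regular_jointly_measurable[OF D] jointly_measurable_at[OF Dm]
          unfolding case_prod_unfold by (rule borel_measurable_diff)
        show "0 \<le> K * (a (p i) (p (Suc i)))\<^sup>2" using K(1) by simp
        fix s assume s: "p i < s" "s \<le> p (Suc i)"
        have Ds: "?D s \<in> borel_measurable M"
          using b[OF i] s by (intro measurable_F_imp_M[OF regularD(2)[OF D]]) auto
        have "L2le M (\<lambda>\<omega>. ?D s \<omega> - ?D (p i) \<omega>) (K * (a (p i) s)\<^sup>2)"
          unfolding a_def using b[OF i] s
          by (intro L2le_drift_increment U gh K borel_measurable_diff Ds Dm) auto
        moreover have "K * (a (p i) s)\<^sup>2 \<le> K * (a (p i) (p (Suc i)))\<^sup>2"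
          using K(1) a0 s by (intro mult_left_mono power_mono a_mono) auto
        ultimately show "L2le M (\<lambda>\<omega>. ?D s \<omega> - ?D (p i) \<omega>) (K * (a (p i) (p (Suc i)))\<^sup>2)"
          by (rule L2le_mono)
      qed
      moreover have "sqrt (sq_int T f (p i) (p (Suc i)) * (K * (a (p i) (p (Suc i)))\<^sup>2)) \<le> \<eta>' * sqrt K * a (p i) (p (Suc i))"
      proof -
        have "sq_int T f (p i) (p (Suc i)) \<le> \<eta>'\<^sup>2" using b[OF i] mesh i by (intro \<delta>(2)) auto
        then have "sq_int T f (p i) (p (Suc i)) * (K * (a (p i) (p (Suc i)))\<^sup>2) \<le> \<eta>'\<^sup>2 * (K * (a (p i) (p (Suc i)))\<^sup>2)"
          using K(1) by (intro mult_right_mono) auto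
        then have "sqrt (sq_int T f (p i) (p (Suc i)) * (K * (a (p i) (p (Suc i)))\<^sup>2)) \<le> sqrt (\<eta>'\<^sup>2 * (K * (a (p i) (p (Suc i)))\<^sup>2))"
          by (rule real_sqrt_le_mono)
        also have "\<dots> = \<eta>' * sqrt K * a (p i) (p (Suc i))"
          using \<eta>'(1) a0 by (simp add: real_sqrt_mult)
        finally show ?thesis .
      qed
      ultimately show "L1le M (strat_remainder f (\<lambda>s \<omega>. ?D s \<omega> - ?D (p i) \<omega>) (p i) (p (Suc i))) (\<eta>' * sqrt K * a (p i) (p (Suc i)))"
        by (rule L1le_mono)
    qed
    moreover have "(\<Sum>i<N. \<eta>' * sqrt K * a (p i) (p (Suc i))) \<le> \<epsilon>"
    proof -
      have "(\<Sum>i<N. a (p i) (p (Suc i))) = a 0 t"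
        unfolding a_def by (rule integral_partition_sum[OF p]) (intro integrable_abs gh)
      then have "(\<Sum>i<N. \<eta>' * sqrt K * a (p i) (p (Suc i))) = \<eta>' * (sqrt K * a 0 t)"
        by (simp add: mult.assoc flip: sum_distrib_left)
      also have "\<dots> \<le> \<eta>' * (sqrt K * a 0 T + 1)"
        using \<eta>'(1) K(1) a_mono[of 0 0 t T] t by (intro mult_left_mono add_increasing2 mult_left_mono) auto
      finally show ?thesis using \<eta>'(2) by simp
    qed
    ultimately show "L1le M (\<lambda>\<omega>. \<Sum>i<N. strat_remainder f (\<lambda>s \<omega>. ?D s \<omega> - ?D (p i) \<omega>) (p i) (p (Suc i)) \<omega>) \<epsilon>"
      by (rule L1le_mono)
  qed
qed

text \<open>The three terms are the error of replacing \<open>J\<close> by an elementary integral, the error of replacing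
  \<open>f\<close> by a constant on the cell, and the main term.\<close>

lemma strat_remainder_split:
  assumes J: "regular J" and f: "f \<in> L2_Icc T" and \<omega>: "\<omega> \<in> space M"
  shows "strat_remainder f (\<lambda>s \<omega>. J s \<omega> - J a \<omega>) a b \<omega> =
    strat_remainder f (\<lambda>s \<omega>. J s \<omega> - J a \<omega> - \<xi> \<omega> * (W s \<omega> - W a \<omega>)) a b \<omega> +
    strat_remainder (\<lambda>s. f s - c) (\<lambda>s \<omega>. \<xi> \<omega> * (W s \<omega> - W a \<omega>)) a b \<omega> +
    c * \<xi> \<omega> * strat_remainder (\<lambda>_. 1) (\<lambda>s \<omega>. W s \<omega> - W a \<omega>) a b \<omega>"
proof -
  let ?i = "indicator {a<..b} :: real \<Rightarrow> real" and ?x = "\<xi> \<omega>"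
  have ifJ: "integrable (lborel_Icc T) (\<lambda>s. ?i s * (f s * J s \<omega>))"
    by (rule integrable_indicator_mult[OF path_integrable[OF J \<omega> L2_Icc_integrable[OF f]]])
  have ifW: "integrable (lborel_Icc T) (\<lambda>s. ?i s * (f s * W s \<omega>))"
    by (rule integrable_indicator_mult[OF path_integrable[OF regular_W \<omega> L2_Icc_integrable[OF f]]])
  have i1W: "integrable (lborel_Icc T) (\<lambda>s. ?i s * (1 * W s \<omega>))"
    by (rule integrable_indicator_mult[OF path_integrable[OF regular_W \<omega> L2_Icc_integrable[OF const_L2_Icc]]])
  have if1: "integrable (lborel_Icc T) (\<lambda>s. ?i s * f s)"
    by (rule integrable_indicator_mult[OF L2_Icc_integrable[OF f]])
  have i1: "integrable (lborel_Icc T) (\<lambda>s. ?i s * 1)"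
    by (rule integrable_indicator_mult[OF L2_Icc_integrable[OF const_L2_Icc]])
  have X: "integrable (lborel_Icc T) (\<lambda>s. ?i s * (f s * (J s \<omega> - J a \<omega> - ?x * (W s \<omega> - W a \<omega>))))"
  proof -
    have "integrable (lborel_Icc T) (\<lambda>s. ?i s * (f s * J s \<omega>) - J a \<omega> * (?i s * f s) - ?x * (?i s * (f s * W s \<omega>)) + ?x * W a \<omega> * (?i s * f s))"
      by (intro Bochner_Integration.integrable_add Bochner_Integration.integrable_diff integrable_mult_right ifJ ifW if1)
    then show ?thesis by (rule Bochner_Integration.integrable_cong[THEN iffD1, rotated -1]) (simp_all add: algebra_simps)
  qed
  have Y: "integrable (lborel_Icc T) (\<lambda>s. ?i s * ((f s - c) * (?x * (W s \<omega> - W a \<omega>))))"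
  proof -
    have "integrable (lborel_Icc T) (\<lambda>s. ?x * (?i s * (f s * W s \<omega>)) - ?x * W a \<omega> * (?i s * f s) - c * ?x * (?i s * (1 * W s \<omega>)) + c * ?x * W a \<omega> * (?i s * 1))"
      by (intro Bochner_Integration.integrable_add Bochner_Integration.integrable_diff integrable_mult_right ifW i1W if1 i1)
    then show ?thesis by (rule Bochner_Integration.integrable_cong[THEN iffD1, rotated -1]) (simp_all add: algebra_simps)
  qed
  have V: "integrable (lborel_Icc T) (\<lambda>s. c * ?x * (?i s * (1 * (W s \<omega> - W a \<omega>))))"
  proof -
    have "integrable (lborel_Icc T) (\<lambda>s. c * ?x * (?i s * (1 * W s \<omega>)) - c * ?x * W a \<omega> * (?i s * 1))"
      by (intro Bochner_Integration.integrable_diff integrable_mult_right i1W i1)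
    then show ?thesis by (rule Bochner_Integration.integrable_cong[THEN iffD1, rotated -1]) (simp_all add: algebra_simps)
  qed
  have "(\<integral>s. ?i s * (f s * (J s \<omega> - J a \<omega>)) \<partial>lborel_Icc T) =
      (\<integral>s. ?i s * (f s * (J s \<omega> - J a \<omega> - ?x * (W s \<omega> - W a \<omega>))) +
        ?i s * ((f s - c) * (?x * (W s \<omega> - W a \<omega>))) + c * ?x * (?i s * (1 * (W s \<omega> - W a \<omega>))) \<partial>lborel_Icc T)"
    by (intro Bochner_Integration.integral_cong) (auto simp: algebra_simps)
  also have "\<dots> = (\<integral>s. ?i s * (f s * (J s \<omega> - J a \<omega> - ?x * (W s \<omega> - W a \<omega>))) \<partial>lborel_Icc T) +
      (\<integral>s. ?i s * ((f s - c) * (?x * (W s \<omega> - W a \<omega>))) \<partial>lborel_Icc T) +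
      c * ?x * (\<integral>s. ?i s * (1 * (W s \<omega> - W a \<omega>)) \<partial>lborel_Icc T)"
    unfolding Bochner_Integration.integral_add[OF Bochner_Integration.integrable_add[OF X Y] V]
      Bochner_Integration.integral_add[OF X Y] integral_mult_right_zero ..
  finally show ?thesis
    unfolding strat_remainder_def by (simp only: distrib_left distrib_right mult_ac)
qed

text \<open>For fixed \<open>\<theta>\<close>, the products with \<open>W\<close> evaluated at \<open>p\<^sub>i + \<theta> (p\<^sub>i\<^sub>+\<^sub>1 - p\<^sub>i)\<close>, centred, are orthogonal
  in \<open>i\<close>. So the sum is bounded in \<open>L\<^sup>2\<close> before averaging over \<open>\<theta>\<close>; bounding the cells separately in
  \<open>L\<^sup>1\<close> would not give a small sum.\<close>

lemma bridge_sum_L1le: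
  assumes p: "partition_of 0 t N p" and t: "t \<le> T"
    and \<xi>: "\<And>i. i < N \<Longrightarrow> \<xi> i \<in> borel_measurable (F (p i))" "\<And>i. i < N \<Longrightarrow> L2le M (\<xi> i) (c i)" "\<And>i. i < N \<Longrightarrow> 0 \<le> c i"
  shows "L1le M (\<lambda>\<omega>. \<Sum>i<N. \<xi> i \<omega> * (strat_remainder (\<lambda>_. 1) (\<lambda>s \<omega>. W s \<omega> - W (p i) \<omega>) (p i) (p (Suc i)) \<omega> - (p (Suc i) - p i) / 2))
    (sqrt (\<Sum>i<N. 15 * c i * (p (Suc i) - p i)\<^sup>2))"
proof -
  define B where "B = (\<Sum>i<N. 15 * c i * (p (Suc i) - p i)\<^sup>2)"
  have B: "0 \<le> B" unfolding B_def using \<xi>(3) by (intro sum_nonneg) auto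
  define Q where "Q i \<theta> \<omega> = (W (p i + \<theta> * (p (Suc i) - p i)) \<omega> - W (p i) \<omega>) * (W (p (Suc i)) \<omega> - W (p i) \<omega>)
      - \<theta> * (p (Suc i) - p i)" for i \<theta> \<omega>
  define R where "R \<theta> \<omega> = (\<Sum>i<N. \<xi> i \<omega> * Q i \<theta> \<omega>)" for \<theta> \<omega>
  have b: "0 \<le> p i" "p i < p (Suc i)" "p (Suc i) \<le> T" if "i < N" for i
    using partition_of_bounds[OF p, of i] partition_of_bounds[OF p, of "Suc i"] partition_of_less[OF p that] that t by auto
  have R2: "L2le M (R \<theta>) B" if "\<theta> \<in> {0..1}" for \<theta>
    unfolding R_def[abs_def] Q_def B_def by (rule orthogonal_sum_L2le[OF p t _ _ \<xi>]) (use that in auto)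
  have R1: "L1le M (R \<theta>) (sqrt B)" if "\<theta> \<in> {0..1}" for \<theta>
    by (rule L2le_imp_L1le[OF R2[OF that] B])
  have contW: "continuous_on {0..1} (\<lambda>\<theta>. W (p i + \<theta> * (p (Suc i) - p i)) \<omega>)" if "i < N" "\<omega> \<in> space M" for i \<omega>
  proof (rule continuous_on_compose2[OF W_cont[OF that(2)]])
    show "continuous_on {0..1} (\<lambda>\<theta>. p i + \<theta> * (p (Suc i) - p i))" by (intro continuous_intros)
    show "(\<lambda>\<theta>. p i + \<theta> * (p (Suc i) - p i)) ` {0..1} \<subseteq> {0..T}"
    proof safe
      fix \<theta> :: real assume \<theta>: "\<theta> \<in> {0..1}"
      have "0 \<le> (1 - \<theta>) * (p (Suc i) - p i)" using b[OF that(1)] \<theta> by simp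
      then have "p i + \<theta> * (p (Suc i) - p i) \<le> p (Suc i)" by (simp add: algebra_simps)
      then show "p i + \<theta> * (p (Suc i) - p i) \<in> {0..T}" using b[OF that(1)] \<theta> by auto
    qed
  qed
  have contQ: "continuous_on {0..1} (\<lambda>\<theta>. Q i \<theta> \<omega>)" if "i < N" "\<omega> \<in> space M" for i \<omega>
    unfolding Q_def by (intro continuous_intros contW that)
  \<comment> \<open>Joint measurability comes from continuity in \<theta>, which is inherited from
    the paths of W.\<close>
  have Rm: "case_prod R \<in> borel_measurable (lborel_Icc 1 \<Otimes>\<^sub>M M)"
  proof (rule continuous_paths_jointly_measurable)
    show "R \<theta> \<in> borel_measurable M" if "\<theta> \<in> {0..1}" for \<theta> by (rule L1le_measurable[OF R1[OF that]])
    show "continuous_on {0..1} (\<lambda>\<theta>. R \<theta> \<omega>)" if "\<omega> \<in> space M" for \<omega>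
      unfolding R_def using that by (intro continuous_on_sum continuous_on_mult continuous_on_const contQ) auto
  qed simp
  have sf: "sigma_finite_measure (lborel_Icc 1)"
    using finite_measure_Icc[of 1] by (simp add: finite_measure_def)
  have "L1le (lborel_Icc 1 \<Otimes>\<^sub>M M) (case_prod (\<lambda>\<theta> \<omega>. indicator {0<..1} \<theta> * R \<theta> \<omega>)) (\<integral>\<theta>. indicator {0<..1} \<theta> * sqrt B \<partial>lborel_Icc 1)"
  proof (rule L1le_pair[OF sf])
    show "sigma_finite_measure M" by unfold_locales
    show "(\<lambda>(\<theta>, \<omega>). indicator {0<..1} \<theta> * R \<theta> \<omega>) \<in> borel_measurable (lborel_Icc 1 \<Otimes>\<^sub>M M)"
      using Rm measurable_compose[OF measurable_fst indicator_measurable_Icc] unfolding case_prod_unfold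
      by (intro borel_measurable_times) auto
    show "integrable (lborel_Icc 1) (\<lambda>\<theta>. indicator {0<..1} \<theta> * sqrt B)"
      by (intro integrable_indicator_mult L2_Icc_integrable const_L2_Icc)
    show "0 \<le> indicator {0<..1} \<theta> * sqrt B" for \<theta> :: real using B by simp
    fix \<theta> :: real assume "\<theta> \<in> space (lborel_Icc 1)"
    then have "\<theta> \<in> {0..1}" by (simp add: space_restrict_space)
    from L1le_cmult[OF R1[OF this], of "indicator {0<..1} \<theta>"] B
    show "L1le M (\<lambda>\<omega>. indicator {0<..1} \<theta> * R \<theta> \<omega>) (indicator {0<..1} \<theta> * sqrt B)" by simp
  qed
  moreover have "(\<integral>\<theta>. indicator {0<..1} \<theta> * sqrt B \<partial>lborel_Icc 1) = sqrt B"
    unfolding integral_mult_left_zero using integral_indicator_Icc[of 0 1 1] by simp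
  ultimately have RL: "L1le (lborel_Icc 1 \<Otimes>\<^sub>M M) (case_prod (\<lambda>\<theta> \<omega>. indicator {0<..1} \<theta> * R \<theta> \<omega>)) (sqrt B)"
    by (simp only:)
  have "sigma_finite_measure M" by unfold_locales
  from L1le_integral[OF sf this RL]
  have "L1le M (\<lambda>\<omega>. \<integral>\<theta>. indicator {0<..1} \<theta> * R \<theta> \<omega> \<partial>lborel_Icc 1) (sqrt B)" .
  then show ?thesis
    unfolding B_def
  proof (rule L1le_cong)
    fix \<omega> assume \<omega>: "\<omega> \<in> space M"
    \<comment> \<open>Averaging over \<theta> undoes the substitution: the product of increments
      becomes the summand of the cell, and the centring \<theta> (p (Suc i) - p i) averages to half
      the length.\<close>
    have QI: "(\<integral>\<theta>. indicator {0<..1} \<theta> * Q i \<theta> \<omega> \<partial>lborel_Icc 1) =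
        strat_remainder (\<lambda>_. 1) (\<lambda>s \<omega>. W s \<omega> - W (p i) \<omega>) (p i) (p (Suc i)) \<omega> - (p (Suc i) - p i) / 2" if i: "i < N" for i
    proof -
      let ?a = "p i" and ?b = "p (Suc i)"
      have A: "(\<integral>s. indicator {?a<..?b} s * (1 * (W s \<omega> - W ?a \<omega>)) \<partial>lborel_Icc T) =
          (?b - ?a) * (\<integral>\<theta>. indicator {0<..1} \<theta> * (1 * (W (?a + \<theta> * (?b - ?a)) \<omega> - W ?a \<omega>)) \<partial>lborel_Icc 1)"
        by (rule integral_Icc_affine[OF b[OF i]])
      have i1: "integrable (lborel_Icc 1) (\<lambda>\<theta>. indicator {0<..1} \<theta> * (1 * (W (?a + \<theta> * (?b - ?a)) \<omega> - W ?a \<omega>)) * (W ?b \<omega> - W ?a \<omega>))"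
        by (intro integrable_mult_left integrable_indicator_mult continuous_integrable_Icc continuous_intros contW i \<omega>)
      have i2: "integrable (lborel_Icc 1) (\<lambda>\<theta>. indicator {0<..1} \<theta> * \<theta> * (?b - ?a))"
        by (intro integrable_mult_left integrable_indicator_mult continuous_integrable_Icc continuous_intros)
      have "(\<integral>\<theta>. indicator {0<..1} \<theta> * Q i \<theta> \<omega> \<partial>lborel_Icc 1) =
        (\<integral>\<theta>. indicator {0<..1} \<theta> * (1 * (W (?a + \<theta> * (?b - ?a)) \<omega> - W ?a \<omega>)) * (W ?b \<omega> - W ?a \<omega>) - indicator {0<..1} \<theta> * \<theta> * (?b - ?a) \<partial>lborel_Icc 1)"
        by (intro Bochner_Integration.integral_cong) (auto simp: Q_def algebra_simps)
      also have "\<dots> = (\<integral>\<theta>. indicator {0<..1} \<theta> * (1 * (W (?a + \<theta> * (?b - ?a)) \<omega> - W ?a \<omega>)) \<partial>lborel_Icc 1) * (W ?b \<omega> - W ?a \<omega>) - 1 / 2 * (?b - ?a)"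
        unfolding Bochner_Integration.integral_diff[OF i1 i2] integral_mult_left_zero integral_identity_Icc_1 ..
      also have "\<dots> = strat_remainder (\<lambda>_. 1) (\<lambda>s \<omega>. W s \<omega> - W (p i) \<omega>) (p i) (p (Suc i)) \<omega> - (?b - ?a) / 2"
        unfolding strat_remainder_def A using b[OF i] by simp
      finally show ?thesis .
    qed
    have "(\<integral>\<theta>. indicator {0<..1} \<theta> * R \<theta> \<omega> \<partial>lborel_Icc 1) = (\<integral>\<theta>. (\<Sum>i<N. \<xi> i \<omega> * (indicator {0<..1} \<theta> * Q i \<theta> \<omega>)) \<partial>lborel_Icc 1)"
      by (intro Bochner_Integration.integral_cong) (auto simp: R_def sum_distrib_left mult_ac)
    also have "\<dots> = (\<Sum>i<N. \<integral>\<theta>. \<xi> i \<omega> * (indicator {0<..1} \<theta> * Q i \<theta> \<omega>) \<partial>lborel_Icc 1)"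
      by (rule Bochner_Integration.integral_sum)
        (use \<omega> in \<open>intro integrable_mult_right integrable_indicator_mult continuous_integrable_Icc contQ, auto\<close>)
    also have "\<dots> = (\<Sum>i<N. \<xi> i \<omega> * (strat_remainder (\<lambda>_. 1) (\<lambda>s \<omega>. W s \<omega> - W (p i) \<omega>) (p i) (p (Suc i)) \<omega> - (p (Suc i) - p i) / 2))"
      by (rule sum.cong) (simp_all add: integral_mult_right_zero QI)
    finally show "(\<integral>\<theta>. indicator {0<..1} \<theta> * R \<theta> \<omega> \<partial>lborel_Icc 1) =
      (\<Sum>i<N. \<xi> i \<omega> * (strat_remainder (\<lambda>_. 1) (\<lambda>s \<omega>. W s \<omega> - W (p i) \<omega>) (p i) (p (Suc i)) \<omega> - (p (Suc i) - p i) / 2))" .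
  qed
qed

text \<open>The errors are: freezing the integrand of J on each cell (\<open>T1\<close>), replacing
  f by its cell averages (\<open>T2\<close>), the fluctuation of the product of two increments
  (\<open>T3\<close>), and the passage from the sum of the means to the Lebesgue integral
  (\<open>T4\<close>). Each is \<eta>' times a constant independent of the partition.\<close>

lemma ito_remainder_converges:
  assumes U: "regular U" and f: "f \<in> L2_Icc T" and g: "g \<in> L2_Icc T"
    and J: "ito_limit (\<lambda>s \<omega>. g s * U s \<omega>) J" and \<epsilon>: "0 < \<epsilon>"
  obtains \<delta> where "0 < \<delta>" "\<And>t N p. t \<le> T \<Longrightarrow> partition_of 0 t N p \<Longrightarrow> (\<forall>i<N. p (Suc i) - p i < \<delta>) \<Longrightarrow>
    L1le M (\<lambda>\<omega>. (\<Sum>i<N. strat_remainder f (\<lambda>s \<omega>. J s \<omega> - J (p i) \<omega>) (p i) (p (Suc i)) \<omega>) - 1 / 2 * drift (\<lambda>s. f s * g s) U t \<omega>) \<epsilon>"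
proof -
  have Jg: "regular J" by (rule regular_ito[OF U g J])
  obtain K where K: "0 \<le> K" "\<And>t. 0 \<le> t \<Longrightarrow> t \<le> T \<Longrightarrow> L2le M (U t) K"
    using regular_bound[OF U] by blast
  define \<phi> where "\<phi> = sq_norm T f"
  define \<gamma> where "\<gamma> = sq_norm T g"
  have \<phi>: "0 \<le> \<phi>" and \<gamma>: "0 \<le> \<gamma>" by (simp_all add: \<phi>_def \<gamma>_def sq_norm_nonneg)
  \<comment> \<open>The constants of \<open>T1\<close> to \<open>T4\<close> in this order.\<close>
  define C where "C = sqrt (4 * \<phi>) + sqrt (K * \<gamma>) + sqrt (15 * K * \<gamma>) + 1 / 2 * sqrt \<phi>"
  have C: "0 \<le> C" using \<phi> \<gamma> K(1) by (simp add: C_def)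
  obtain \<eta>' where \<eta>': "0 < \<eta>'" "\<eta>' * (C + 1) = \<epsilon>"
    using ex_scaled_positive[OF \<epsilon> C] by blast
  define \<eta> where "\<eta> = \<eta>'\<^sup>2"
  have \<eta>: "0 < \<eta>" "sqrt \<eta> = \<eta>'" using \<eta>' by (auto simp: \<eta>_def)
  obtain \<delta>1 where \<delta>1: "0 < \<delta>1" "\<And>t N p. t \<le> T \<Longrightarrow> partition_of 0 t N p \<Longrightarrow> (\<forall>i<N. p (Suc i) - p i < \<delta>1) \<Longrightarrow>
    L2le P (\<lambda>(s, \<omega>). indicator {0<..t} s * (g s * U s \<omega> - elem_process (ito_approx T g U N p) s \<omega>)) \<eta>"
    using ito_approx_converges[OF U g \<eta>(1)] by blast
  obtain \<delta>2 where \<delta>2: "0 < \<delta>2" "\<And>t N p. t \<le> T \<Longrightarrow> partition_of 0 t N p \<Longrightarrow> (\<forall>i<N. p (Suc i) - p i < \<delta>2) \<Longrightarrow>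
    L2le (lborel_Icc T) (\<lambda>s. indicator {0<..t} s * f s - step_avg T N p f s) \<eta>"
    using step_avg_converges[OF f \<eta>(1) T_pos] by blast
  obtain \<delta>3 where \<delta>3: "0 < \<delta>3" "\<And>a b. 0 \<le> a \<Longrightarrow> a \<le> b \<Longrightarrow> b \<le> T \<Longrightarrow> b - a < \<delta>3 \<Longrightarrow> sq_int T f a b \<le> \<eta>"
    using sq_int_uniformly_small[OF f \<eta>(1)] by blast
  show thesis
  proof
    show "0 < min \<delta>1 (min \<delta>2 \<delta>3)" using \<delta>1 \<delta>2 \<delta>3 by simp
    fix t N p assume t: "t \<le> T" and p: "partition_of 0 t N p"
      and mesh: "\<forall>i<N. p (Suc i) - p i < min \<delta>1 (min \<delta>2 \<delta>3)"
    have b: "0 \<le> p i" "p i < p (Suc i)" "p (Suc i) \<le> T" if "i < N" for i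
      using partition_of_bounds[OF p, of i] partition_of_bounds[OF p, of "Suc i"] partition_of_less[OF p that] that t by auto
    let ?L = "ito_approx T g U N p"
    define H where "H s \<omega> = g s * U s \<omega>" for s \<omega>
    define G where "G = (\<lambda>(s, \<omega>). indicator {0<..t} s * (H s \<omega> - elem_process ?L s \<omega>))"
    have G: "L2le P G \<eta>" unfolding G_def H_def using mesh by (intro \<delta>1(2) t p) auto
    define cf where "cf i = avg T f (p i) (p (Suc i))" for i
    define cg where "cg i = avg T g (p i) (p (Suc i))" for i
    define \<xi> where "\<xi> i \<omega> = cg i * U (p i) \<omega>" for i \<omega>
    define D where "D i = p (Suc i) - p i" for i
    have Hm: "case_prod H \<in> borel_measurable P"
      unfolding H_def by (rule measurable_time_factor[OF L2_Icc_measurable[OF g] regular_jointly_measurable[OF U]])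
    have \<xi>F: "\<xi> i \<in> borel_measurable (F (p i))" if "i < N" for i
      unfolding \<xi>_def[abs_def] cg_def by (rule ito_approx_coefficient(1)[OF U p t that])
    have \<xi>2: "L2le M (\<xi> i) ((cg i)\<^sup>2 * K)" if "i < N" for i
      unfolding \<xi>_def[abs_def] using b[OF that] K(1) by (intro L2le_cmult K(2)) auto
    have cg: "(cg i)\<^sup>2 * D i \<le> sq_int T g (p i) (p (Suc i))" if "i < N" for i
      unfolding cg_def D_def by (rule avg_square_le[OF g b[OF that]])
    have cf: "(cf i)\<^sup>2 * D i \<le> sq_int T f (p i) (p (Suc i))" if "i < N" for i
      unfolding cf_def D_def by (rule avg_square_le[OF f b[OF that]])
    have sumf: "(\<Sum>i<N. sq_int T f (p i) (p (Suc i))) \<le> \<phi>"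
      unfolding sq_int_partition_sum[OF p f] \<phi>_def by (rule sq_int_le_sq_norm[OF f])
    have sumg: "(\<Sum>i<N. sq_int T g (p i) (p (Suc i))) \<le> \<gamma>"
      unfolding sq_int_partition_sum[OF p g] \<gamma>_def by (rule sq_int_le_sq_norm[OF g])
    have L_at: "elem_process ?L s \<omega> = \<xi> i \<omega>" if "i < N" "p i < s" "s \<le> p (Suc i)" for i s \<omega>
      unfolding elem_process_ito_approx \<xi>_def cg_def by (rule partition_sum_indicator[OF p that])

    define r where "r i s \<omega> = J s \<omega> - J (p i) \<omega> - \<xi> i \<omega> * (W s \<omega> - W (p i) \<omega>)" for i s \<omega>
    \<comment> \<open>The share of the i-th cell in the squared error of the elementary
      approximation of g U. The shares sum to at most \<eta>, so the estimates of J on the single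
      cells do not accumulate.\<close>
    define c where "c i = (\<integral>z. indicator {p i<..p (Suc i)} (fst z) * (G z)\<^sup>2 \<partial>P)" for i
    note G2i = L2le_imp_integrable[OF G]
    have Gm: "G \<in> borel_measurable P" by (rule L2le_measurable[OF G])
    have indm: "(\<lambda>z. indicator {x<..y} (fst z) :: real) \<in> borel_measurable P" for x y
      by (rule measurable_compose[OF measurable_fst indicator_measurable_Icc])
    have ci: "integrable P (\<lambda>z. indicator {p i<..p (Suc i)} (fst z) * (G z)\<^sup>2)" for i
    proof (rule Bochner_Integration.integrable_bound[OF G2i])
      show "(\<lambda>z. indicator {p i<..p (Suc i)} (fst z) * (G z)\<^sup>2) \<in> borel_measurable P"
        by (intro borel_measurable_times borel_measurable_power indm Gm)
    qed (simp add: indicator_def)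
    have c0: "0 \<le> c i" for i unfolding c_def by (intro integral_nonneg_AE AE_I2) simp
    have sumc: "(\<Sum>i<N. c i) \<le> \<eta>"
    proof -
      have "(\<Sum>i<N. c i) = (\<integral>z. (\<Sum>i<N. indicator {p i<..p (Suc i)} (fst z) * (G z)\<^sup>2) \<partial>P)"
        unfolding c_def by (rule Bochner_Integration.integral_sum[symmetric]) (rule ci)
      also have "\<dots> = (\<integral>z. (G z)\<^sup>2 \<partial>P)"
      proof (rule Bochner_Integration.integral_cong)
        fix z
        have "(\<Sum>i<N. indicator {p i<..p (Suc i)} (fst z) * (G z)\<^sup>2) = indicator {0<..t} (fst z) * (G z)\<^sup>2"
          using partition_sum_const[OF p, of "(G z)\<^sup>2" "fst z"] by (simp only: mult.commute)
        also have "\<dots> = (G z)\<^sup>2" by (simp add: G_def case_prod_unfold indicator_def)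
        finally show "(\<Sum>i<N. indicator {p i<..p (Suc i)} (fst z) * (G z)\<^sup>2) = (G z)\<^sup>2" .
      qed simp
      also have "\<dots> \<le> \<eta>" using L2le_imp_integral_le[OF G] \<eta>(1) by simp
      finally show ?thesis .
    qed
    \<comment> \<open>On one cell the approximation of g U is the single triple with coefficient
      \<open>\<xi> i\<close>, whose integral up to s is \<open>\<xi> i\<close> (W s - W (p i)); the
      local form of \<open>ito_limit_approx\<close> compares J with it.\<close>
    have r_le: "L2le M (r i s) (4 * c i)" if i: "i < N" and s: "p i < s" "s \<le> p (Suc i)" for i s
    proof -
      let ?l = "[(p i, p (Suc i), \<xi> i)]"
      have ad: "adapted ?l"
        using b[OF i] \<xi>F[OF i] L2le_imp_integrable[OF \<xi>2[OF i]] by auto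
      have "L2le P (\<lambda>(x, \<omega>). indicator {p i<..s} x * (H x \<omega> - elem_process ?l x \<omega>)) (c i)"
        unfolding L2le_def
      proof
        have m2: "(\<lambda>(x, \<omega>). H x \<omega> - elem_process ?l x \<omega>) \<in> borel_measurable P"
          using Hm elem_process_measurable[OF ad] unfolding case_prod_unfold by (rule borel_measurable_diff)
        show "(\<lambda>(x, \<omega>). indicator {p i<..s} x * (H x \<omega> - elem_process ?l x \<omega>)) \<in> borel_measurable P"
          by (rule measurable_time_factor[OF indicator_measurable_Icc m2])
        have "(\<integral>\<^sup>+z. ennreal ((case z of (x, \<omega>) \<Rightarrow> indicator {p i<..s} x * (H x \<omega> - elem_process ?l x \<omega>))\<^sup>2) \<partial>P) \<le>
            (\<integral>\<^sup>+z. ennreal (indicator {p i<..p (Suc i)} (fst z) * (G z)\<^sup>2) \<partial>P)"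
        proof (intro nn_integral_mono ennreal_leI)
          fix z :: "real \<times> 'a"
          obtain x \<omega> where z: "z = (x, \<omega>)" by (cases z)
          show "(case z of (x, \<omega>) \<Rightarrow> indicator {p i<..s} x * (H x \<omega> - elem_process ?l x \<omega>))\<^sup>2 \<le>
              indicator {p i<..p (Suc i)} (fst z) * (G z)\<^sup>2"
          proof (cases "x \<in> {p i<..s}")
            case True
            then have x: "p i < x" "x \<le> p (Suc i)" using s by auto
            have "p (Suc i) \<le> t" using partition_of_bounds[OF p, of "Suc i"] i by auto
            then have "x \<in> {0<..t}" using x b[OF i] by auto
            then show ?thesis using x True by (simp add: z G_def elem_Cons L_at[OF i x])
          qed (simp add: z)
        qed
        also have "\<dots> = ennreal (c i)"
          unfolding c_def by (rule nn_integral_eq_integral[OF ci]) simp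
        finally show "(\<integral>\<^sup>+z. ennreal ((case z of (x, \<omega>) \<Rightarrow> indicator {p i<..s} x * (H x \<omega> - elem_process ?l x \<omega>))\<^sup>2) \<partial>P) \<le> ennreal (c i)" .
      qed
      then have "L2le M (\<lambda>\<omega>. J s \<omega> - J (p i) \<omega> - elem_integral W (elem_restrict (p i) s ?l) \<omega>) (4 * c i)"
        using b[OF i] s by (intro ito_limit_approx[OF J ad _ _ _ c0]) (auto simp: H_def)
      moreover have "elem_integral W (elem_restrict (p i) s ?l) \<omega> = \<xi> i \<omega> * (W s \<omega> - W (p i) \<omega>)" for \<omega>
      proof -
        have "max (p i) (min s (p (Suc i))) = s" using s by simp
        then show ?thesis by (simp add: elem_Cons)
      qed
      ultimately show ?thesis unfolding r_def[abs_def] by simp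
    qed
    have Jm: "J (p i) \<in> borel_measurable M" if "i < N" for i
      using b[OF that] by (intro continuous_process_measurable[OF regularD(1)[OF Jg]]) auto
    have Wm: "(\<lambda>(s, \<omega>). \<xi> i \<omega> * (W s \<omega> - W (p i) \<omega>)) \<in> borel_measurable P" if i: "i < N" for i
    proof -
      have wm: "(\<lambda>z. W (fst z) (snd z)) \<in> borel_measurable P"
        using regular_jointly_measurable[OF regular_W] by (simp add: case_prod_unfold)
      have pm: "W (p i) \<in> borel_measurable M" using b[OF i] by (intro W_measurable) auto
      show ?thesis unfolding case_prod_unfold
        by (intro borel_measurable_times borel_measurable_diff wm jointly_measurable_at[OF pm]
            jointly_measurable_at[OF L2le_measurable[OF \<xi>2[OF i]]])
    qed
    have rm: "case_prod (r i) \<in> borel_measurable P" if i: "i < N" for i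
    proof -
      have jm: "(\<lambda>z. J (fst z) (snd z)) \<in> borel_measurable P"
        using regular_jointly_measurable[OF Jg] by (simp add: case_prod_unfold)
      show ?thesis unfolding r_def case_prod_unfold
        using Wm[OF i] by (intro borel_measurable_diff jm jointly_measurable_at[OF Jm[OF i]]) (simp add: case_prod_unfold)
    qed

    \<comment> \<open>Cauchy-Schwarz over the cells: the integrals of f^2 sum to at most \<phi> and
      the shares \<open>c i\<close> to at most \<eta>.\<close>
    have T1: "L1le M (\<lambda>\<omega>. \<Sum>i<N. strat_remainder f (r i) (p i) (p (Suc i)) \<omega>) (sqrt (4 * \<phi>) * \<eta>')"
    proof (rule L1le_mono)
      show "L1le M (\<lambda>\<omega>. \<Sum>i<N. strat_remainder f (r i) (p i) (p (Suc i)) \<omega>) (\<Sum>i<N. sqrt (sq_int T f (p i) (p (Suc i)) * (4 * c i)))"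
        using c0 by (intro L1le_sum strat_remainder_bound f b rm r_le) (auto simp: sq_int_nonneg)
      have "(\<Sum>i<N. sqrt (sq_int T f (p i) (p (Suc i)) * (4 * c i))) \<le>
          sqrt ((\<Sum>i<N. sq_int T f (p i) (p (Suc i))) * (\<Sum>i<N. 4 * c i))"
        using c0 by (intro sum_sqrt_mult_le) (auto simp: sq_int_nonneg)
      also have "\<dots> \<le> sqrt (\<phi> * (4 * \<eta>))"
        using sumf sumc \<phi> c0 by (intro real_sqrt_le_mono mult_mono) (auto simp: sum_nonneg simp flip: sum_distrib_left)
      also have "\<dots> = sqrt (4 * \<phi>) * \<eta>'" by (simp add: real_sqrt_mult \<eta>(2))
      finally show "(\<Sum>i<N. sqrt (sq_int T f (p i) (p (Suc i)) * (4 * c i))) \<le> sqrt (4 * \<phi>) * \<eta>'" .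
    qed

    have fcL: "(\<lambda>s. f s - cf i) \<in> L2_Icc T" for i by (rule L2_Icc_diff[OF f const_L2_Icc])
    \<comment> \<open>On each cell f minus its average is the error of \<open>step_avg\<close>, so
      the sum is at most the squared norm of that error.\<close>
    have sumd: "(\<Sum>i<N. sq_int T (\<lambda>s. f s - cf i) (p i) (p (Suc i))) \<le> \<eta>"
    proof -
      let ?d = "\<lambda>s. indicator {0<..t} s * f s - step_avg T N p f s"
      have dL: "L2le (lborel_Icc T) ?d \<eta>" using mesh by (intro \<delta>2(2) t p) auto
      have eq: "sq_int T (\<lambda>s. f s - cf i) (p i) (p (Suc i)) = (\<integral>s. indicator {p i<..p (Suc i)} s * (?d s)\<^sup>2 \<partial>lborel_Icc T)"
        if i: "i < N" for i
        unfolding sq_int_def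
      proof (rule Bochner_Integration.integral_cong)
        fix s
        show "indicator {p i<..p (Suc i)} s * (f s - cf i)\<^sup>2 = indicator {p i<..p (Suc i)} s * (?d s)\<^sup>2"
        proof (cases "s \<in> {p i<..p (Suc i)}")
          case True
          then have x: "p i < s" "s \<le> p (Suc i)" by auto
          have "step_avg T N p f s = cf i"
            unfolding step_avg_def cf_def by (rule partition_sum_indicator[OF p i x])
          moreover have "p (Suc i) \<le> t" using partition_of_bounds[OF p, of "Suc i"] i by auto
          then have "s \<in> {0<..t}" using x b[OF i] by auto
          ultimately show ?thesis by simp
        qed simp
      qed simp
      have "(\<Sum>i<N. sq_int T (\<lambda>s. f s - cf i) (p i) (p (Suc i))) =
          (\<Sum>i<N. \<integral>s. indicator {p i<..p (Suc i)} s * (?d s)\<^sup>2 \<partial>lborel_Icc T)"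
        using eq by (intro sum.cong) auto
      also have "\<dots> = (\<integral>s. indicator {0<..t} s * (?d s)\<^sup>2 \<partial>lborel_Icc T)"
        by (rule integral_partition_sum[OF p L2le_imp_integrable[OF dL]])
      also have "\<dots> \<le> (\<integral>s. (?d s)\<^sup>2 \<partial>lborel_Icc T)"
        by (intro integral_mono integrable_indicator_mult L2le_imp_integrable[OF dL]) (auto simp: indicator_def)
      also have "\<dots> \<le> \<eta>" using L2le_imp_integral_le[OF dL] \<eta>(1) by simp
      finally show ?thesis .
    qed
    have T2: "L1le M (\<lambda>\<omega>. \<Sum>i<N. strat_remainder (\<lambda>s. f s - cf i) (\<lambda>s \<omega>. \<xi> i \<omega> * (W s \<omega> - W (p i) \<omega>)) (p i) (p (Suc i)) \<omega>)
        (sqrt (K * \<gamma>) * \<eta>')"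
    proof (rule L1le_mono)
      show "L1le M (\<lambda>\<omega>. \<Sum>i<N. strat_remainder (\<lambda>s. f s - cf i) (\<lambda>s \<omega>. \<xi> i \<omega> * (W s \<omega> - W (p i) \<omega>)) (p i) (p (Suc i)) \<omega>)
          (\<Sum>i<N. sqrt (sq_int T (\<lambda>s. f s - cf i) (p i) (p (Suc i)) * (K * sq_int T g (p i) (p (Suc i)))))"
      proof (rule L1le_sum)
        fix i assume "i \<in> {..<N}"
        then have i: "i < N" by simp
        show "L1le M (strat_remainder (\<lambda>s. f s - cf i) (\<lambda>s \<omega>. \<xi> i \<omega> * (W s \<omega> - W (p i) \<omega>)) (p i) (p (Suc i)))
            (sqrt (sq_int T (\<lambda>s. f s - cf i) (p i) (p (Suc i)) * (K * sq_int T g (p i) (p (Suc i)))))"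
        proof (rule strat_remainder_bound[OF fcL b[OF i] Wm[OF i]])
          show "0 \<le> K * sq_int T g (p i) (p (Suc i))" using K(1) by (simp add: sq_int_nonneg)
          fix s assume s: "p i < s" "s \<le> p (Suc i)"
          have "L2le M (\<lambda>\<omega>. \<xi> i \<omega> * (W s \<omega> - W (p i) \<omega>)) ((cg i)\<^sup>2 * K * (s - p i))"
            using b[OF i] s K(1) by (intro L2le_increment \<xi>F \<xi>2 i) auto
          moreover have "(cg i)\<^sup>2 * K * (s - p i) \<le> K * sq_int T g (p i) (p (Suc i))"
          proof -
            have "(cg i)\<^sup>2 * (s - p i) \<le> (cg i)\<^sup>2 * D i" using s by (intro mult_left_mono) (auto simp: D_def)
            then have "(cg i)\<^sup>2 * (s - p i) \<le> sq_int T g (p i) (p (Suc i))" using cg[OF i] by linarith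
            then have "K * ((cg i)\<^sup>2 * (s - p i)) \<le> K * sq_int T g (p i) (p (Suc i))" using K(1) by (rule mult_left_mono)
            then show ?thesis by (simp add: mult_ac)
          qed
          ultimately show "L2le M (\<lambda>\<omega>. \<xi> i \<omega> * (W s \<omega> - W (p i) \<omega>)) (K * sq_int T g (p i) (p (Suc i)))"
            by (rule L2le_mono)
        qed
        show "0 \<le> sqrt (sq_int T (\<lambda>s. f s - cf i) (p i) (p (Suc i)) * (K * sq_int T g (p i) (p (Suc i))))"
          using K(1) by (simp add: sq_int_nonneg)
      qed
      have "(\<Sum>i<N. sqrt (sq_int T (\<lambda>s. f s - cf i) (p i) (p (Suc i)) * (K * sq_int T g (p i) (p (Suc i))))) \<le>
          sqrt ((\<Sum>i<N. sq_int T (\<lambda>s. f s - cf i) (p i) (p (Suc i))) * (\<Sum>i<N. K * sq_int T g (p i) (p (Suc i))))"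
        using K(1) by (intro sum_sqrt_mult_le) (auto simp: sq_int_nonneg)
      also have "\<dots> \<le> sqrt (\<eta> * (K * \<gamma>))"
        using sumd sumg \<eta>(1) K(1)
        by (intro real_sqrt_le_mono mult_mono) (auto simp: sum_nonneg sq_int_nonneg intro!: mult_left_mono simp flip: sum_distrib_left)
      also have "\<dots> = sqrt (K * \<gamma>) * \<eta>'" by (simp add: real_sqrt_mult \<eta>(2))
      finally show "(\<Sum>i<N. sqrt (sq_int T (\<lambda>s. f s - cf i) (p i) (p (Suc i)) * (K * sq_int T g (p i) (p (Suc i))))) \<le> sqrt (K * \<gamma>) * \<eta>'" .
    qed

    let ?w = "\<lambda>i \<omega>. strat_remainder (\<lambda>_. 1) (\<lambda>s \<omega>. W s \<omega> - W (p i) \<omega>) (p i) (p (Suc i)) \<omega>"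
    have T3: "L1le M (\<lambda>\<omega>. \<Sum>i<N. (cf i * \<xi> i \<omega>) * (?w i \<omega> - D i / 2)) (sqrt (15 * K * \<gamma>) * \<eta>')"
    proof (rule L1le_mono)
      show "L1le M (\<lambda>\<omega>. \<Sum>i<N. (cf i * \<xi> i \<omega>) * (?w i \<omega> - D i / 2))
          (sqrt (\<Sum>i<N. 15 * ((cf i)\<^sup>2 * ((cg i)\<^sup>2 * K)) * (D i)\<^sup>2))"
        unfolding D_def
      proof (rule bridge_sum_L1le[OF p t])
        fix i assume i: "i < N"
        show "(\<lambda>\<omega>. cf i * \<xi> i \<omega>) \<in> borel_measurable (F (p i))"
          by (intro borel_measurable_times borel_measurable_const \<xi>F i)
        show "L2le M (\<lambda>\<omega>. cf i * \<xi> i \<omega>) ((cf i)\<^sup>2 * ((cg i)\<^sup>2 * K))"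
          using K(1) by (intro L2le_cmult \<xi>2 i) simp
        show "0 \<le> (cf i)\<^sup>2 * ((cg i)\<^sup>2 * K)" using K(1) by simp
      qed
      \<comment> \<open>Of the two factors \<open>D i\<close>, one is spent on \<open>cf i\<close>
        squared, which makes it at most \<eta> by absolute continuity, and the other on
        \<open>cg i\<close> squared, whose contributions sum to at most \<gamma>.\<close>
      have "15 * ((cf i)\<^sup>2 * ((cg i)\<^sup>2 * K)) * (D i)\<^sup>2 \<le> 15 * K * \<eta> * sq_int T g (p i) (p (Suc i))" if i: "i < N" for i
      proof -
        have "sq_int T f (p i) (p (Suc i)) \<le> \<eta>" using b[OF i] mesh i by (intro \<delta>3(2)) auto
        then have "(cf i)\<^sup>2 * D i \<le> \<eta>" using cf[OF i] by linarith
        then have "((cf i)\<^sup>2 * D i) * ((cg i)\<^sup>2 * D i) \<le> \<eta> * sq_int T g (p i) (p (Suc i))"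
          using cg[OF i] \<eta>(1) b[OF i] by (intro mult_mono) (auto simp: D_def)
        then have "15 * K * (((cf i)\<^sup>2 * D i) * ((cg i)\<^sup>2 * D i)) \<le> 15 * K * (\<eta> * sq_int T g (p i) (p (Suc i)))"
          using K(1) by (intro mult_left_mono) auto
        then show ?thesis by (simp add: power2_eq_square mult_ac)
      qed
      then have "(\<Sum>i<N. 15 * ((cf i)\<^sup>2 * ((cg i)\<^sup>2 * K)) * (D i)\<^sup>2) \<le> (\<Sum>i<N. 15 * K * \<eta> * sq_int T g (p i) (p (Suc i)))"
        by (intro sum_mono) auto
      also have "\<dots> \<le> 15 * K * \<eta> * \<gamma>"
        using sumg K(1) \<eta>(1) by (auto intro!: mult_left_mono simp flip: sum_distrib_left)
      finally have "sqrt (\<Sum>i<N. 15 * ((cf i)\<^sup>2 * ((cg i)\<^sup>2 * K)) * (D i)\<^sup>2) \<le> sqrt (15 * K * \<eta> * \<gamma>)"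
        by (rule real_sqrt_le_mono)
      also have "\<dots> = sqrt (15 * K * \<gamma>) * \<eta>'" by (simp add: real_sqrt_mult \<eta>(2))
      finally show "sqrt (\<Sum>i<N. 15 * ((cf i)\<^sup>2 * ((cg i)\<^sup>2 * K)) * (D i)\<^sup>2) \<le> sqrt (15 * K * \<gamma>) * \<eta>'" .
    qed

    \<comment> \<open>As \<open>cf i * D i\<close> is the integral of f over the cell, the sum of
      the means is half the integral of f against the elementary approximation of g U. Its distance
      to half the Lebesgue integral is thus f tested against the error \<open>G\<close>.\<close>
    have T4: "L1le M (\<lambda>\<omega>. (- 1 / 2) * (\<integral>s. f s * G (s, \<omega>) \<partial>lborel_Icc T)) (1 / 2 * sqrt \<phi> * \<eta>')"
    proof -
      have "L2le P (\<lambda>(s, \<omega>). f s * 1) (sq_norm T f * 1)"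
        unfolding sq_norm_def
        by (rule L2le_time_factor[OF L2_Icc_measurable[OF f] L2_Icc_integrable_square[OF f] _ _ ])
          (use L2le_const[of 1] in \<open>auto simp: case_prod_unfold\<close>)
      then have f2: "L2le P (\<lambda>z. f (fst z)) \<phi>" by (simp add: case_prod_unfold \<phi>_def)
      have "L1le P (case_prod (\<lambda>s \<omega>. f s * G (s, \<omega>))) (sqrt (\<phi> * \<eta>))"
        by (rule L1le_cong[OF L1le_mult[OF f2 G \<phi>]]) (use \<eta>(1) in auto)
      then have "L1le M (\<lambda>\<omega>. \<integral>s. f s * G (s, \<omega>) \<partial>lborel_Icc T) (sqrt (\<phi> * \<eta>))"
        by (intro L1le_integral) (unfold_locales, simp)
      then have I: "L1le M (\<lambda>\<omega>. \<integral>s. f s * G (s, \<omega>) \<partial>lborel_Icc T) (sqrt \<phi> * \<eta>')"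
        by (simp only: real_sqrt_mult \<eta>(2))
      have "0 \<le> sqrt \<phi> * \<eta>'" using \<phi> \<eta>'(1) by simp
      from L1le_cmult[OF I this, of "- 1 / 2"] show ?thesis
        by (simp only: abs_divide abs_minus_cancel abs_one abs_numeral mult.assoc)
    qed
    have T4_eq: "(\<integral>s. f s * G (s, \<omega>) \<partial>lborel_Icc T) = drift (\<lambda>s. f s * g s) U t \<omega> - (\<Sum>i<N. cf i * \<xi> i \<omega> * D i)"
      if \<omega>: "\<omega> \<in> space M" for \<omega>
    proof -
      have fg: "integrable (lborel_Icc T) (\<lambda>s. f s * g s)" by (rule L2_Icc_product_integrable[OF f g])
      have i1: "integrable (lborel_Icc T) (\<lambda>s. indicator {0<..t} s * (f s * g s * U s \<omega>))"
        by (intro integrable_indicator_mult path_integrable[OF U \<omega> fg])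
      have i2: "integrable (lborel_Icc T) (\<lambda>s. \<xi> i \<omega> * (indicator {p i<..p (Suc i)} s * f s))" for i
        by (intro integrable_mult_right integrable_indicator_mult L2_Icc_integrable f)
      have i3: "integrable (lborel_Icc T) (\<lambda>s. \<Sum>i<N. \<xi> i \<omega> * (indicator {p i<..p (Suc i)} s * f s))"
        by (intro Bochner_Integration.integrable_sum i2)
      have "f s * G (s, \<omega>) = indicator {0<..t} s * (f s * g s * U s \<omega>) - (\<Sum>i<N. \<xi> i \<omega> * (indicator {p i<..p (Suc i)} s * f s))" for s
      proof -
        have eL: "indicator {0<..t} s * elem_process ?L s \<omega> = elem_process ?L s \<omega>"
        proof (cases "s \<in> {0<..t}")
          case False
          then show ?thesis unfolding elem_process_ito_approx partition_sum_outside[OF p False] by simp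
        qed simp
        have "(\<Sum>i<N. \<xi> i \<omega> * (indicator {p i<..p (Suc i)} s * f s)) = f s * elem_process ?L s \<omega>"
          unfolding elem_process_ito_approx \<xi>_def cg_def sum_distrib_left by (intro sum.cong) auto
        also have "\<dots> = f s * (indicator {0<..t} s * elem_process ?L s \<omega>)" unfolding eL ..
        finally show ?thesis by (simp add: G_def H_def right_diff_distrib mult_ac)
      qed
      then have "(\<integral>s. f s * G (s, \<omega>) \<partial>lborel_Icc T) =
          (\<integral>s. indicator {0<..t} s * (f s * g s * U s \<omega>) \<partial>lborel_Icc T) -
          (\<integral>s. (\<Sum>i<N. \<xi> i \<omega> * (indicator {p i<..p (Suc i)} s * f s)) \<partial>lborel_Icc T)"
        by (simp only: Bochner_Integration.integral_diff[OF i1 i3])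
      also have "(\<integral>s. indicator {0<..t} s * (f s * g s * U s \<omega>) \<partial>lborel_Icc T) = drift (\<lambda>s. f s * g s) U t \<omega>"
        by (rule drift_eq[OF U \<omega> fg t, symmetric])
      also have "(\<integral>s. (\<Sum>i<N. \<xi> i \<omega> * (indicator {p i<..p (Suc i)} s * f s)) \<partial>lborel_Icc T) =
          (\<Sum>i<N. \<xi> i \<omega> * (\<integral>s. indicator {p i<..p (Suc i)} s * f s \<partial>lborel_Icc T))"
        using i2 by (simp only: Bochner_Integration.integral_sum integral_mult_right_zero)
      also have "\<dots> = (\<Sum>i<N. cf i * \<xi> i \<omega> * D i)"
      proof (rule sum.cong)
        fix i assume "i \<in> {..<N}"
        then show "\<xi> i \<omega> * (\<integral>s. indicator {p i<..p (Suc i)} s * f s \<partial>lborel_Icc T) = cf i * \<xi> i \<omega> * D i"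
          using b[of i] by (simp add: cf_def avg_def D_def)
      qed simp
      finally show ?thesis .
    qed

    have "L1le M (\<lambda>\<omega>. (\<Sum>i<N. strat_remainder f (r i) (p i) (p (Suc i)) \<omega>) +
        (\<Sum>i<N. strat_remainder (\<lambda>s. f s - cf i) (\<lambda>s \<omega>. \<xi> i \<omega> * (W s \<omega> - W (p i) \<omega>)) (p i) (p (Suc i)) \<omega>) +
        (\<Sum>i<N. (cf i * \<xi> i \<omega>) * (?w i \<omega> - D i / 2)) +
        (- 1 / 2) * (\<integral>s. f s * G (s, \<omega>) \<partial>lborel_Icc T))
      (sqrt (4 * \<phi>) * \<eta>' + sqrt (K * \<gamma>) * \<eta>' + sqrt (15 * K * \<gamma>) * \<eta>' + 1 / 2 * sqrt \<phi> * \<eta>')"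
      using \<phi> \<gamma> K(1) \<eta>'(1) by (intro L1le_add T1 T2 T3 T4) auto
    then have "L1le M (\<lambda>\<omega>. (\<Sum>i<N. strat_remainder f (\<lambda>s \<omega>. J s \<omega> - J (p i) \<omega>) (p i) (p (Suc i)) \<omega>) - 1 / 2 * drift (\<lambda>s. f s * g s) U t \<omega>)
      (sqrt (4 * \<phi>) * \<eta>' + sqrt (K * \<gamma>) * \<eta>' + sqrt (15 * K * \<gamma>) * \<eta>' + 1 / 2 * sqrt \<phi> * \<eta>')"
    proof (rule L1le_cong)
      fix \<omega> assume \<omega>: "\<omega> \<in> space M"
      have split: "strat_remainder f (\<lambda>s \<omega>. J s \<omega> - J (p i) \<omega>) (p i) (p (Suc i)) \<omega> =
          strat_remainder f (r i) (p i) (p (Suc i)) \<omega> +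
          strat_remainder (\<lambda>s. f s - cf i) (\<lambda>s \<omega>. \<xi> i \<omega> * (W s \<omega> - W (p i) \<omega>)) (p i) (p (Suc i)) \<omega> +
          cf i * \<xi> i \<omega> * ?w i \<omega>" for i
        unfolding r_def[abs_def] by (rule strat_remainder_split[OF Jg f \<omega>])
      have bridge: "(\<Sum>i<N. (cf i * \<xi> i \<omega>) * (?w i \<omega> - D i / 2)) =
          (\<Sum>i<N. cf i * \<xi> i \<omega> * ?w i \<omega>) - 1 / 2 * (\<Sum>i<N. cf i * \<xi> i \<omega> * D i)"
        by (simp add: right_diff_distrib sum_subtractf sum_distrib_left)
      show "(\<Sum>i<N. strat_remainder f (r i) (p i) (p (Suc i)) \<omega>) +
        (\<Sum>i<N. strat_remainder (\<lambda>s. f s - cf i) (\<lambda>s \<omega>. \<xi> i \<omega> * (W s \<omega> - W (p i) \<omega>)) (p i) (p (Suc i)) \<omega>) +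
        (\<Sum>i<N. (cf i * \<xi> i \<omega>) * (?w i \<omega> - D i / 2)) +
        (- 1 / 2) * (\<integral>s. f s * G (s, \<omega>) \<partial>lborel_Icc T) =
        (\<Sum>i<N. strat_remainder f (\<lambda>s \<omega>. J s \<omega> - J (p i) \<omega>) (p i) (p (Suc i)) \<omega>) - 1 / 2 * drift (\<lambda>s. f s * g s) U t \<omega>"
        unfolding split sum.distrib bridge T4_eq[OF \<omega>] by (simp add: algebra_simps)
    qed
    moreover have "sqrt (4 * \<phi>) * \<eta>' + sqrt (K * \<gamma>) * \<eta>' + sqrt (15 * K * \<gamma>) * \<eta>' + 1 / 2 * sqrt \<phi> * \<eta>' \<le> \<epsilon>"
    proof -
      have "sqrt (4 * \<phi>) * \<eta>' + sqrt (K * \<gamma>) * \<eta>' + sqrt (15 * K * \<gamma>) * \<eta>' + 1 / 2 * sqrt \<phi> * \<eta>' = \<eta>' * C"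
        unfolding C_def by (simp only: distrib_left mult.commute)
      also have "\<dots> \<le> \<eta>' * (C + 1)" using \<eta>'(1) by (intro mult_left_mono) auto
      finally show ?thesis using \<eta>'(2) by simp
    qed
    ultimately show "L1le M (\<lambda>\<omega>. (\<Sum>i<N. strat_remainder f (\<lambda>s \<omega>. J s \<omega> - J (p i) \<omega>) (p i) (p (Suc i)) \<omega>) - 1 / 2 * drift (\<lambda>s. f s * g s) U t \<omega>) \<epsilon>"
      by (rule L1le_mono)
  qed
qed

section \<open>Limits of Stratonovich sums\<close>

text \<open>Stronger than the limit in probability in \<open>has_stratonovich_integral\<close>:
  errors are measured in L^1 and \<delta> is uniform in t. The L^1 bounds simply add over finite
  sums, and Markov's inequality returns to probability.\<close>

definition strat_L1_limit :: "(real \<Rightarrow> 'a \<Rightarrow> real) \<Rightarrow> (real \<Rightarrow> 'a \<Rightarrow> real) \<Rightarrow> bool" where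
  "strat_L1_limit X Y \<longleftrightarrow> (\<forall>\<epsilon>>0. \<exists>\<delta>>0. \<forall>t N p. 0 \<le> t \<longrightarrow> t \<le> T \<longrightarrow> partition_of 0 t N p \<longrightarrow> (\<forall>i<N. p (Suc i) - p i < \<delta>) \<longrightarrow>
     L1le M (\<lambda>\<omega>. stratonovich_sum W X N p \<omega> - Y t \<omega>) \<epsilon>)"

lemma strat_L1_limit_of_remainder:
  assumes Z: "regular Z" and f: "f \<in> L2_Icc T" and I: "ito_limit (\<lambda>s \<omega>. f s * Z s \<omega>) I"
    and strat_remainder: "\<And>\<epsilon>. 0 < \<epsilon> \<Longrightarrow> \<exists>\<delta>>0. \<forall>t N p. t \<le> T \<longrightarrow> partition_of 0 t N p \<longrightarrow> (\<forall>i<N. p (Suc i) - p i < \<delta>) \<longrightarrow>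
      L1le M (\<lambda>\<omega>. (\<Sum>i<N. strat_remainder f (\<lambda>s \<omega>. Z s \<omega> - Z (p i) \<omega>) (p i) (p (Suc i)) \<omega>) - R t \<omega>) \<epsilon>"
  shows "strat_L1_limit (\<lambda>s \<omega>. f s * Z s \<omega>) (\<lambda>t \<omega>. I t \<omega> + R t \<omega>)"
  unfolding strat_L1_limit_def
proof (intro allI impI)
  fix \<epsilon> :: real assume "0 < \<epsilon>"
  then have \<epsilon>: "0 < \<epsilon> / 2" by simp
  obtain \<delta>1 where \<delta>1: "0 < \<delta>1" "\<And>t N p. 0 \<le> t \<Longrightarrow> t \<le> T \<Longrightarrow> partition_of 0 t N p \<Longrightarrow> (\<forall>i<N. p (Suc i) - p i < \<delta>1) \<Longrightarrow>
    L1le M (\<lambda>\<omega>. elem_integral W (ito_approx T f Z N p) \<omega> - I t \<omega>) (\<epsilon> / 2)"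
    using ito_sum_converges[OF Z f I \<epsilon>] by blast
  obtain \<delta>2 where \<delta>2: "0 < \<delta>2" "\<And>t N p. t \<le> T \<Longrightarrow> partition_of 0 t N p \<Longrightarrow> (\<forall>i<N. p (Suc i) - p i < \<delta>2) \<Longrightarrow>
      L1le M (\<lambda>\<omega>. (\<Sum>i<N. strat_remainder f (\<lambda>s \<omega>. Z s \<omega> - Z (p i) \<omega>) (p i) (p (Suc i)) \<omega>) - R t \<omega>) (\<epsilon> / 2)"
    using strat_remainder[OF \<epsilon>] by blast
  show "\<exists>\<delta>>0. \<forall>t N p. 0 \<le> t \<longrightarrow> t \<le> T \<longrightarrow> partition_of 0 t N p \<longrightarrow> (\<forall>i<N. p (Suc i) - p i < \<delta>) \<longrightarrow>
     L1le M (\<lambda>\<omega>. stratonovich_sum W (\<lambda>s \<omega>. f s * Z s \<omega>) N p \<omega> - (I t \<omega> + R t \<omega>)) \<epsilon>"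
  proof (intro exI[of _ "min \<delta>1 \<delta>2"] conjI allI impI)
    show "0 < min \<delta>1 \<delta>2" using \<delta>1 \<delta>2 by simp
    fix t N p assume t: "0 \<le> t" "t \<le> T" and p: "partition_of 0 t N p" and mesh: "\<forall>i<N. p (Suc i) - p i < min \<delta>1 \<delta>2"
    have "L1le M (\<lambda>\<omega>. (elem_integral W (ito_approx T f Z N p) \<omega> - I t \<omega>) +
        ((\<Sum>i<N. strat_remainder f (\<lambda>s \<omega>. Z s \<omega> - Z (p i) \<omega>) (p i) (p (Suc i)) \<omega>) - R t \<omega>)) (\<epsilon> / 2 + \<epsilon> / 2)"
      using mesh \<epsilon> by (intro L1le_add \<delta>1(2) \<delta>2(2) t p) auto
    then show "L1le M (\<lambda>\<omega>. stratonovich_sum W (\<lambda>s \<omega>. f s * Z s \<omega>) N p \<omega> - (I t \<omega> + R t \<omega>)) \<epsilon>"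
      by (rule L1le_cong[OF L1le_mono]) (simp_all add: stratonovich_sum_decomposition[OF Z f p t(2)])
  qed
qed

lemma strat_L1_limit_ito:
  assumes U: "regular U" and f: "f \<in> L2_Icc T" and g: "g \<in> L2_Icc T"
    and J: "ito_limit (\<lambda>s \<omega>. g s * U s \<omega>) J" and I: "ito_limit (\<lambda>s \<omega>. f s * J s \<omega>) I"
  shows "strat_L1_limit (\<lambda>s \<omega>. f s * J s \<omega>) (\<lambda>t \<omega>. I t \<omega> + 1 / 2 * drift (\<lambda>s. f s * g s) U t \<omega>)"
proof (rule strat_L1_limit_of_remainder[OF regular_ito[OF U g J] f I])
  fix \<epsilon> :: real assume "0 < \<epsilon>"
  then show "\<exists>\<delta>>0. \<forall>t N p. t \<le> T \<longrightarrow> partition_of 0 t N p \<longrightarrow> (\<forall>i<N. p (Suc i) - p i < \<delta>) \<longrightarrow>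
      L1le M (\<lambda>\<omega>. (\<Sum>i<N. strat_remainder f (\<lambda>s \<omega>. J s \<omega> - J (p i) \<omega>) (p i) (p (Suc i)) \<omega>) - 1 / 2 * drift (\<lambda>s. f s * g s) U t \<omega>) \<epsilon>"
    by (rule ito_remainder_converges[OF U f g J]) blast
qed

lemma strat_L1_limit_drift:
  assumes U: "regular U" and f: "f \<in> L2_Icc T" and g: "g \<in> L2_Icc T" and h: "h \<in> L2_Icc T"
    and I: "ito_limit (\<lambda>s \<omega>. f s * drift (\<lambda>s. g s * h s) U s \<omega>) I"
  shows "strat_L1_limit (\<lambda>s \<omega>. f s * drift (\<lambda>s. g s * h s) U s \<omega>) I"
proof -
  have "strat_L1_limit (\<lambda>s \<omega>. f s * drift (\<lambda>s. g s * h s) U s \<omega>) (\<lambda>t \<omega>. I t \<omega> + 0)"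
  proof (rule strat_L1_limit_of_remainder[OF regular_drift[OF U g h] f I])
    fix \<epsilon> :: real assume "0 < \<epsilon>"
    then show "\<exists>\<delta>>0. \<forall>t N p. t \<le> T \<longrightarrow> partition_of 0 t N p \<longrightarrow> (\<forall>i<N. p (Suc i) - p i < \<delta>) \<longrightarrow>
      L1le M (\<lambda>\<omega>. (\<Sum>i<N. strat_remainder f (\<lambda>s \<omega>. drift (\<lambda>s. g s * h s) U s \<omega> - drift (\<lambda>s. g s * h s) U (p i) \<omega>) (p i) (p (Suc i)) \<omega>) - 0) \<epsilon>"
      unfolding diff_0_right by (rule drift_remainder_converges[OF U f g h]) blast
  qed
  then show ?thesis by simp
qed

end

section \<open>Convergence in probability and uniqueness\<close>

text \<open>Covers any measurable W, since the modification on a null set compares the sums of two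
  versions of the Brownian motion.\<close>

lemma stratonovich_sum_measurable:
  assumes X: "measurable_process M T X" and M: "sigma_finite_measure M"
    and p: "partition_of 0 t N p" and t: "t \<le> T" and W: "\<And>s. 0 \<le> s \<Longrightarrow> s \<le> T \<Longrightarrow> W s \<in> borel_measurable M"
  shows "stratonovich_sum W X N p \<in> borel_measurable M"
proof -
  have Xm: "case_prod X \<in> borel_measurable (lborel_Icc T \<Otimes>\<^sub>M M)"
    using X by (simp add: measurable_process_def)
  have "(\<lambda>\<omega>. (1 / (p (Suc i) - p i) * (LBINT s:{p i..p (Suc i)}. X s \<omega>)) * (W (p (Suc i)) \<omega> - W (p i) \<omega>)) \<in> borel_measurable M"
    if i: "i < N" for i
  proof -
    have b: "0 \<le> p i" "p i \<le> T" "0 \<le> p (Suc i)" "p (Suc i) \<le> T"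
      using partition_of_bounds[OF p, of i] partition_of_bounds[OF p, of "Suc i"] i t by auto
    have "(\<lambda>z. indicator {p i<..p (Suc i)} (snd z) * X (snd z) (fst z)) \<in> borel_measurable (M \<Otimes>\<^sub>M lborel_Icc T)"
      using measurable_compose[OF measurable_pair_swap' Xm] measurable_compose[OF measurable_snd indicator_measurable_Icc]
      by (intro borel_measurable_times) (simp_all add: case_prod_unfold)
    then have "(\<lambda>\<omega>. \<integral>s. indicator {p i<..p (Suc i)} s * X s \<omega> \<partial>lborel_Icc T) \<in> borel_measurable M"
      using finite_measure_Icc[of T]
      by (intro sigma_finite_measure.borel_measurable_lebesgue_integral) (auto simp: finite_measure_def case_prod_unfold)
    moreover have "(LBINT s:{p i..p (Suc i)}. X s \<omega>) = (\<integral>s. indicator {p i<..p (Suc i)} s * X s \<omega> \<partial>lborel_Icc T)"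
      if "\<omega> \<in> space M" for \<omega>
      using measurable_Pair1[OF Xm that] b by (intro LBINT_eq_integral_Icc) (simp_all only: prod.case)
    ultimately have "(\<lambda>\<omega>. LBINT s:{p i..p (Suc i)}. X s \<omega>) \<in> borel_measurable M"
      by (subst measurable_cong) auto
    then show ?thesis
      by (intro borel_measurable_times borel_measurable_diff borel_measurable_const W b)
  qed
  then show ?thesis
    unfolding stratonovich_sum_def[abs_def] by (intro borel_measurable_sum) auto
qed

text \<open>By continuity, equality at countably many times suffices. The clamping \<open>c\<close>
  moves every rational into [0,T], so that density of the rationals in the whole line also covers
  the endpoints.\<close>

lemma continuous_processes_indistinguishable:
  assumes Y: "continuous_process M T Y" and Y': "continuous_process M T Y'" and T: "0 \<le> T"
    and ae: "\<And>t. t \<in> {0..T} \<Longrightarrow> AE \<omega> in M. Y t \<omega> = Y' t \<omega>"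
  shows "AE \<omega> in M. \<forall>t\<in>{0..T}. Y t \<omega> = Y' t \<omega>"
proof -
  define c where "c q = max 0 (min T q)" for q
  have c01: "c q \<in> {0..T}" for q using T by (auto simp: c_def)
  have "AE \<omega> in M. \<forall>q\<in>\<rat>. Y (c q) \<omega> = Y' (c q) \<omega>"
    using ae c01 countable_rat by (subst AE_ball_countable) auto
  then show ?thesis using AE_space
  proof eventually_elim
    fix \<omega> assume eq: "\<forall>q\<in>\<rat>. Y (c q) \<omega> = Y' (c q) \<omega>" and \<omega>: "\<omega> \<in> space M"
    have cc: "continuous_on UNIV c" unfolding c_def[abs_def] by (intro continuous_intros)
    have "continuous_on {0..T} (\<lambda>t. Y t \<omega>)" "continuous_on {0..T} (\<lambda>t. Y' t \<omega>)"
      using Y Y' \<omega> by (auto simp: continuous_process_def)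
    then have "continuous_on UNIV (\<lambda>q. Y (c q) \<omega>)" "continuous_on UNIV (\<lambda>q. Y' (c q) \<omega>)"
      using c01 by (auto intro: continuous_on_compose2[OF _ cc])
    then have "closed {q. Y (c q) \<omega> = Y' (c q) \<omega>}" by (rule closed_Collect_eq)
    then have "closure \<rat> \<subseteq> {q. Y (c q) \<omega> = Y' (c q) \<omega>}" using eq by (intro closure_minimal) auto
    then have all: "Y (c q) \<omega> = Y' (c q) \<omega>" for q by (auto simp: Rats_closure_real)
    show "\<forall>t\<in>{0..T}. Y t \<omega> = Y' t \<omega>"
    proof
      fix t assume "t \<in> {0..T}"
      then have "c t = t" by (simp add: c_def)
      then show "Y t \<omega> = Y' t \<omega>" using all[of t] by simp
    qed
  qed
qed

lemma measure_le_L1le: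
  assumes "L1le M g (a * b)" "0 < a" "0 \<le> b"
  shows "measure M {\<omega> \<in> space M. a < \<bar>g \<omega>\<bar>} \<le> b"
proof -
  have [measurable]: "g \<in> borel_measurable M" using assms(1) by (rule L1le_measurable)
  have i: "integrable M (\<lambda>\<omega>. \<bar>g \<omega>\<bar>)" using L1le_imp_integrable[OF assms(1)] by (rule integrable_abs)
  have "measure M {\<omega> \<in> space M. a \<le> \<bar>g \<omega>\<bar>} \<le> (\<integral>\<omega>. \<bar>g \<omega>\<bar> \<partial>M) / a"
    by (rule integral_Markov_inequality_measure[OF i, where A="{}"]) (use assms(2) in auto)
  also have "\<dots> \<le> (a * b) / a"
    using assms by (intro divide_right_mono L1le_imp_integral_le) auto
  also have "\<dots> = b" using assms(2) by simp
  finally have le: "measure M {\<omega> \<in> space M. a \<le> \<bar>g \<omega>\<bar>} \<le> b" .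
  \<comment> \<open>Finiteness is required for monotonicity, because \<open>measure\<close> sends
    infinite values to 0.\<close>
  have "emeasure M {\<omega> \<in> space M. a \<le> \<bar>g \<omega>\<bar>} < \<infinity>"
  proof -
    have "emeasure M {\<omega> \<in> space M. 1 \<le> ennreal (1 / a) * ennreal \<bar>g \<omega>\<bar>} \<le> ennreal (1 / a) * (\<integral>\<^sup>+\<omega>. ennreal \<bar>g \<omega>\<bar> * indicator (space M) \<omega> \<partial>M)"
      by (rule nn_integral_Markov_inequality) auto
    also have "\<dots> = ennreal (1 / a) * (\<integral>\<^sup>+\<omega>. ennreal \<bar>g \<omega>\<bar> \<partial>M)"
      by (intro arg_cong2[where f="(*)"] nn_integral_cong) auto
    also have "\<dots> < \<infinity>" using assms(1) by (auto simp: L1le_def ennreal_mult_less_top intro: le_less_trans)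
    also have "{\<omega> \<in> space M. 1 \<le> ennreal (1 / a) * ennreal \<bar>g \<omega>\<bar>} = {\<omega> \<in> space M. a \<le> \<bar>g \<omega>\<bar>}"
      using assms(2) by (auto simp: field_simps simp flip: ennreal_mult ennreal_1)
    finally show ?thesis .
  qed
  then have "measure M {\<omega> \<in> space M. a < \<bar>g \<omega>\<bar>} \<le> measure M {\<omega> \<in> space M. a \<le> \<bar>g \<omega>\<bar>}"
    by (intro measure_mono_fmeasurable) (auto simp: fmeasurable_def)
  then show ?thesis using le by linarith
qed

lemma has_stratonovich_integralD:
  assumes "has_stratonovich_integral M T W X Y" "t \<in> {0..T}" "0 < \<epsilon>" "0 < \<eta>"
  obtains \<delta> where "0 < \<delta>" "\<And>N p. partition_of 0 t N p \<Longrightarrow> \<forall>i<N. p (Suc i) - p i < \<delta> \<Longrightarrow>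
    measure M {\<omega> \<in> space M. \<epsilon> < \<bar>stratonovich_sum W X N p \<omega> - Y t \<omega>\<bar>} < \<eta>"
proof -
  have "\<forall>t\<in>{0..T}. \<forall>\<epsilon>>0. \<forall>\<eta>>0. \<exists>\<delta>>0. \<forall>N p.
        partition_of 0 t N p \<and> (\<forall>i<N. p (Suc i) - p i < \<delta>) \<longrightarrow>
        measure M {\<omega> \<in> space M. \<epsilon> < \<bar>stratonovich_sum W X N p \<omega> - Y t \<omega>\<bar>} < \<eta>"
    using assms(1) unfolding has_stratonovich_integral_def by (elim conjE)
  from this[rule_format, OF assms(2-4)] that show thesis by blast
qed

context brownian_motion
begin

text \<open>Both processes are close in probability to the sum over one sufficiently fine partition,
  hence equal almost surely at each time; continuity removes the dependence of the null set on the
  time. This ties the process picked by \<open>SOME\<close> to a constructed one.\<close>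

lemma stratonovich_integral_unique:
  assumes Y: "has_stratonovich_integral M T W X Y" and Y': "has_stratonovich_integral M T W X Y'"
  shows "AE \<omega> in M. \<forall>t\<in>{0..T}. Y t \<omega> = Y' t \<omega>"
proof (rule continuous_processes_indistinguishable)
  show cp: "continuous_process M T Y" "continuous_process M T Y'"
    using Y Y' by (auto simp: has_stratonovich_integral_def)
  show "0 \<le> T" using T_pos by simp
  fix t assume t: "t \<in> {0..T}"
  have [measurable]: "Y t \<in> borel_measurable M" "Y' t \<in> borel_measurable M"
    using cp t by (auto simp: continuous_process_def)
  have zero: "prob {\<omega> \<in> space M. 2 * \<epsilon> < \<bar>Y t \<omega> - Y' t \<omega>\<bar>} = 0" if \<epsilon>: "0 < \<epsilon>" for \<epsilon>
  proof -
    have "prob {\<omega> \<in> space M. 2 * \<epsilon> < \<bar>Y t \<omega> - Y' t \<omega>\<bar>} \<le> 0 + \<eta>" if \<eta>: "0 < \<eta>" for \<eta>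
    proof -
      obtain d where d: "0 < d" "\<And>N p. partition_of 0 t N p \<Longrightarrow> \<forall>i<N. p (Suc i) - p i < d \<Longrightarrow>
          prob {\<omega> \<in> space M. \<epsilon> < \<bar>stratonovich_sum W X N p \<omega> - Y t \<omega>\<bar>} < \<eta> / 2"
        using has_stratonovich_integralD[OF Y t \<epsilon>, of "\<eta> / 2"] \<eta> by auto
      obtain d' where d': "0 < d'" "\<And>N p. partition_of 0 t N p \<Longrightarrow> \<forall>i<N. p (Suc i) - p i < d' \<Longrightarrow>
          prob {\<omega> \<in> space M. \<epsilon> < \<bar>stratonovich_sum W X N p \<omega> - Y' t \<omega>\<bar>} < \<eta> / 2"
        using has_stratonovich_integralD[OF Y' t \<epsilon>, of "\<eta> / 2"] \<eta> by auto
      obtain N p where p: "partition_of 0 t N p" and mesh: "\<forall>i<N. p (Suc i) - p i < min d d'"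
      proof (cases "t = 0")
        case True
        \<comment> \<open>For t = 0 a partition has no cells, since its points increase
          strictly.\<close>
        then have "partition_of 0 t 0 (\<lambda>_. 0)" by (simp add: partition_of_def)
        then show thesis using that[of 0 "\<lambda>_. 0"] by simp
      next
        case False
        then have tp: "0 < t" using t by simp
        obtain k where k: "t / min d d' < real k" using reals_Archimedean2 by blast
        have "t < real k * min d d'" using k d(1) d'(1) by (simp add: pos_divide_less_eq)
        also have "\<dots> \<le> real (Suc k) * min d d'" using d(1) d'(1) by (intro mult_right_mono) auto
        finally have "t / real (Suc k) < min d d'" by (simp only: pos_divide_less_eq mult.commute of_nat_0_less_iff zero_less_Suc)
        then have "\<forall>i<Suc k. t * real (Suc i) / real (Suc k) - t * real i / real (Suc k) < min d d'"
          unfolding uniform_partition(2)[OF tp] by blast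
        then show thesis using that[OF uniform_partition(1)[OF tp]] by blast
      qed
      have [measurable]: "stratonovich_sum W X N p \<in> borel_measurable M"
      proof (rule stratonovich_sum_measurable[OF _ _ p])
        show "measurable_process M T X" using Y by (simp add: has_stratonovich_integral_def)
        show "sigma_finite_measure M" by unfold_locales
      qed (use t W_measurable in auto)
      let ?A = "{\<omega> \<in> space M. \<epsilon> < \<bar>stratonovich_sum W X N p \<omega> - Y t \<omega>\<bar>}"
      let ?B = "{\<omega> \<in> space M. \<epsilon> < \<bar>stratonovich_sum W X N p \<omega> - Y' t \<omega>\<bar>}"
      have ev: "?A \<in> events" "?B \<in> events" by measurable
      have "prob {\<omega> \<in> space M. 2 * \<epsilon> < \<bar>Y t \<omega> - Y' t \<omega>\<bar>} \<le> prob (?A \<union> ?B)"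
      proof (rule finite_measure_mono)
        show "?A \<union> ?B \<in> events" using ev by (rule sets.Un)
        show "{\<omega> \<in> space M. 2 * \<epsilon> < \<bar>Y t \<omega> - Y' t \<omega>\<bar>} \<subseteq> ?A \<union> ?B" by auto
      qed
      also have "\<dots> \<le> prob ?A + prob ?B"
        using ev by (rule measure_Un_le)
      also have "\<dots> \<le> \<eta>"
      proof -
        have "\<forall>i<N. p (Suc i) - p i < d" "\<forall>i<N. p (Suc i) - p i < d'" using mesh by auto
        from d(2)[OF p this(1)] d'(2)[OF p this(2)] show ?thesis by linarith
      qed
      finally show ?thesis by simp
    qed
    then have "prob {\<omega> \<in> space M. 2 * \<epsilon> < \<bar>Y t \<omega> - Y' t \<omega>\<bar>} \<le> 0" by (rule field_le_epsilon)
    then show ?thesis by (simp add: measure_le_0_iff)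
  qed
  have zero': "prob {\<omega> \<in> space M. \<epsilon> < \<bar>Y t \<omega> - Y' t \<omega>\<bar>} = 0" if "0 < \<epsilon>" for \<epsilon>
    using zero[of "\<epsilon> / 2"] that by simp
  have "AE \<omega> in M. \<not> 1 / real (Suc n) < \<bar>Y t \<omega> - Y' t \<omega>\<bar>" for n
  proof -
    have "prob {\<omega> \<in> space M. 1 / real (Suc n) < \<bar>Y t \<omega> - Y' t \<omega>\<bar>} = 0"
      by (rule zero') simp
    moreover have "{\<omega> \<in> space M. 1 / real (Suc n) < \<bar>Y t \<omega> - Y' t \<omega>\<bar>} \<in> events" by measurable
    ultimately show ?thesis
      by (subst AE_iff_measurable[OF _ refl]) (simp_all add: emeasure_eq_measure)
  qed
  then have "AE \<omega> in M. \<forall>n. \<not> 1 / real (Suc n) < \<bar>Y t \<omega> - Y' t \<omega>\<bar>" by (intro AE_all_countable[THEN iffD2] allI)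
  then show "AE \<omega> in M. Y t \<omega> = Y' t \<omega>"
  proof eventually_elim
    fix \<omega> assume *: "\<forall>n. \<not> 1 / real (Suc n) < \<bar>Y t \<omega> - Y' t \<omega>\<bar>"
    show "Y t \<omega> = Y' t \<omega>"
    proof (rule ccontr)
      assume "Y t \<omega> \<noteq> Y' t \<omega>"
      then have "0 < \<bar>Y t \<omega> - Y' t \<omega>\<bar>" by simp
      from reals_Archimedean[OF this] show False using * by (auto simp: inverse_eq_divide)
    qed
  qed
qed

text \<open>The integrand X' may differ from X on a null set, because the iterated Stratonovich
  integral to be integrated next equals the sum of mixed integrals only almost surely.\<close>

lemma has_stratonovich_integral_of_L1_limit:
  assumes lim: "strat_L1_limit X Y" and Y: "continuous_process M T Y" and X': "measurable_process M T X'"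
    and ae: "AE \<omega> in M. \<forall>s\<in>{0..T}. X' s \<omega> = X s \<omega>"
    and int: "\<And>\<omega>. \<omega> \<in> space M \<Longrightarrow> integrable (lborel_Icc T) (\<lambda>s. X s \<omega>)"
  shows "has_stratonovich_integral M T W X' Y"
  unfolding has_stratonovich_integral_def
proof (intro conjI X' Y ballI allI impI)
  show "AE \<omega> in M. set_integrable lborel {0..T} (\<lambda>s. X' s \<omega>)"
    using ae AE_space
  proof eventually_elim
    fix \<omega> assume eq: "\<forall>s\<in>{0..T}. X' s \<omega> = X s \<omega>" and \<omega>: "\<omega> \<in> space M"
    have "set_integrable lborel {0..T} (\<lambda>s. X s \<omega>)"
      using int[OF \<omega>] by (simp add: integrable_restrict_space set_integrable_def)
    then show "set_integrable lborel {0..T} (\<lambda>s. X' s \<omega>)"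
      by (rule set_integrable_cong[THEN iffD1, rotated -1]) (use eq in auto)
  qed
  fix t \<epsilon> \<eta> :: real assume t: "t \<in> {0..T}" and \<epsilon>: "0 < \<epsilon>" and \<eta>: "0 < \<eta>"
  \<comment> \<open>Markov's inequality then gives \<eta>/2, which leaves room for the strict
    inequality in the definition.\<close>
  have "0 < \<epsilon> * (\<eta> / 2)" using \<epsilon> \<eta> by simp
  then obtain \<delta> where \<delta>: "0 < \<delta>" "\<And>t N p. 0 \<le> t \<Longrightarrow> t \<le> T \<Longrightarrow> partition_of 0 t N p \<Longrightarrow> (\<forall>i<N. p (Suc i) - p i < \<delta>) \<Longrightarrow>
     L1le M (\<lambda>\<omega>. stratonovich_sum W X N p \<omega> - Y t \<omega>) (\<epsilon> * (\<eta> / 2))"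
    using lim unfolding strat_L1_limit_def by blast
  show "\<exists>\<delta>>0. \<forall>N p. partition_of 0 t N p \<and> (\<forall>i<N. p (Suc i) - p i < \<delta>) \<longrightarrow>
        prob {\<omega> \<in> space M. \<epsilon> < \<bar>stratonovich_sum W X' N p \<omega> - Y t \<omega>\<bar>} < \<eta>"
  proof (intro exI[of _ \<delta>] conjI \<delta>(1) allI impI)
    fix N p assume "partition_of 0 t N p \<and> (\<forall>i<N. p (Suc i) - p i < \<delta>)"
    then have p: "partition_of 0 t N p" and mesh: "\<forall>i<N. p (Suc i) - p i < \<delta>" by auto
    have tT: "0 \<le> t" "t \<le> T" using t by auto
    note L = \<delta>(2)[OF tT p mesh]
    have "AE \<omega> in M. stratonovich_sum W X N p \<omega> - Y t \<omega> = stratonovich_sum W X' N p \<omega> - Y t \<omega>"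
      using ae
    proof eventually_elim
      fix \<omega> assume eq: "\<forall>s\<in>{0..T}. X' s \<omega> = X s \<omega>"
      have "(LBINT s:{p i..p (Suc i)}. X s \<omega>) = (LBINT s:{p i..p (Suc i)}. X' s \<omega>)" if "i < N" for i
        unfolding set_lebesgue_integral_def
      proof (rule Bochner_Integration.integral_cong)
        fix s
        have "{p i..p (Suc i)} \<subseteq> {0..T}"
          using partition_of_bounds[OF p, of i] partition_of_bounds[OF p, of "Suc i"] that tT by auto
        then show "indicator {p i..p (Suc i)} s *\<^sub>R X s \<omega> = indicator {p i..p (Suc i)} s *\<^sub>R X' s \<omega>"
          using eq by (auto simp: indicator_def subset_iff)
      qed simp
      then show "stratonovich_sum W X N p \<omega> - Y t \<omega> = stratonovich_sum W X' N p \<omega> - Y t \<omega>"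
        by (simp add: stratonovich_sum_def)
    qed
    moreover have "(\<lambda>\<omega>. stratonovich_sum W X' N p \<omega> - Y t \<omega>) \<in> borel_measurable M"
    proof (intro borel_measurable_diff stratonovich_sum_measurable[OF X' _ p tT(2)])
      show "sigma_finite_measure M" by unfold_locales
    qed (use Y t W_measurable in \<open>auto simp: continuous_process_def\<close>)
    ultimately have "L1le M (\<lambda>\<omega>. stratonovich_sum W X' N p \<omega> - Y t \<omega>) (\<epsilon> * (\<eta> / 2))"
      by (rule L1le_cong_AE[OF L])
    from measure_le_L1le[OF this \<epsilon>] \<eta>
    have "prob {\<omega> \<in> space M. \<epsilon> < \<bar>stratonovich_sum W X' N p \<omega> - Y t \<omega>\<bar>} \<le> \<eta> / 2" by simp
    then show "prob {\<omega> \<in> space M. \<epsilon> < \<bar>stratonovich_sum W X' N p \<omega> - Y t \<omega>\<bar>} < \<eta>" using \<eta> by linarith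
  qed
qed

lemma stratonovich_sum_linear:
  assumes B: "finite B" and p: "partition_of 0 t N p" and t: "t \<le> T"
    and int: "\<And>\<beta>. \<beta> \<in> B \<Longrightarrow> integrable (lborel_Icc T) (\<lambda>s. X \<beta> s \<omega>)"
  shows "stratonovich_sum W (\<lambda>s \<omega>. \<Sum>\<beta>\<in>B. c \<beta> * X \<beta> s \<omega>) N p \<omega> = (\<Sum>\<beta>\<in>B. c \<beta> * stratonovich_sum W (X \<beta>) N p \<omega>)"
proof -
  have "(LBINT s:{p i..p (Suc i)}. \<Sum>\<beta>\<in>B. c \<beta> * X \<beta> s \<omega>) = (\<Sum>\<beta>\<in>B. c \<beta> * (LBINT s:{p i..p (Suc i)}. X \<beta> s \<omega>))"
    if i: "i < N" for i
  proof -
    have b: "0 \<le> p i" "p (Suc i) \<le> T"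
      using partition_of_bounds[OF p, of i] partition_of_bounds[OF p, of "Suc i"] i t by auto
    have m: "(\<lambda>s. X \<beta> s \<omega>) \<in> borel_measurable (lborel_Icc T)" if "\<beta> \<in> B" for \<beta>
      by (rule borel_measurable_integrable[OF int[OF that]])
    have "(LBINT s:{p i..p (Suc i)}. \<Sum>\<beta>\<in>B. c \<beta> * X \<beta> s \<omega>) =
        (\<integral>s. indicator {p i<..p (Suc i)} s * (\<Sum>\<beta>\<in>B. c \<beta> * X \<beta> s \<omega>) \<partial>lborel_Icc T)"
      by (rule LBINT_eq_integral_Icc[OF _ b]) (intro borel_measurable_sum borel_measurable_times borel_measurable_const m)
    also have "\<dots> = (\<integral>s. (\<Sum>\<beta>\<in>B. c \<beta> * (indicator {p i<..p (Suc i)} s * X \<beta> s \<omega>)) \<partial>lborel_Icc T)"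
      by (intro Bochner_Integration.integral_cong) (auto simp: sum_distrib_left mult_ac)
    also have "\<dots> = (\<Sum>\<beta>\<in>B. \<integral>s. c \<beta> * (indicator {p i<..p (Suc i)} s * X \<beta> s \<omega>) \<partial>lborel_Icc T)"
      by (rule Bochner_Integration.integral_sum) (intro integrable_mult_right integrable_indicator_mult int)
    also have "\<dots> = (\<Sum>\<beta>\<in>B. c \<beta> * (LBINT s:{p i..p (Suc i)}. X \<beta> s \<omega>))"
      by (rule sum.cong) (simp_all add: integral_mult_right_zero LBINT_eq_integral_Icc[OF m b])
    finally show ?thesis .
  qed
  then have "stratonovich_sum W (\<lambda>s \<omega>. \<Sum>\<beta>\<in>B. c \<beta> * X \<beta> s \<omega>) N p \<omega> =
      (\<Sum>i<N. \<Sum>\<beta>\<in>B. c \<beta> * ((1 / (p (Suc i) - p i) * (LBINT s:{p i..p (Suc i)}. X \<beta> s \<omega>)) * (W (p (Suc i)) \<omega> - W (p i) \<omega>)))"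
    by (simp add: stratonovich_sum_def sum_distrib_left sum_distrib_right mult_ac)
  also have "\<dots> = (\<Sum>\<beta>\<in>B. c \<beta> * stratonovich_sum W (X \<beta>) N p \<omega>)"
    unfolding stratonovich_sum_def sum_distrib_left by (rule sum.swap)
  finally show ?thesis .
qed

lemma strat_L1_limit_sum:
  assumes B: "finite B"
    and int: "\<And>\<beta> \<omega>. \<beta> \<in> B \<Longrightarrow> \<omega> \<in> space M \<Longrightarrow> integrable (lborel_Icc T) (\<lambda>s. X \<beta> s \<omega>)"
    and lim: "\<And>\<beta>. \<beta> \<in> B \<Longrightarrow> strat_L1_limit (X \<beta>) (Y \<beta>)"
  shows "strat_L1_limit (\<lambda>s \<omega>. \<Sum>\<beta>\<in>B. c \<beta> * X \<beta> s \<omega>) (\<lambda>t \<omega>. \<Sum>\<beta>\<in>B. c \<beta> * Y \<beta> t \<omega>)"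
  unfolding strat_L1_limit_def
proof (intro allI impI)
  fix \<epsilon> :: real assume \<epsilon>: "0 < \<epsilon>"
  define C where "C = (\<Sum>\<beta>\<in>B. \<bar>c \<beta>\<bar>)"
  have C: "0 \<le> C" by (simp add: C_def sum_nonneg)
  obtain \<eta> where \<eta>: "0 < \<eta>" "\<eta> * (C + 1) = \<epsilon>" using ex_scaled_positive[OF \<epsilon> C] by blast
  have "\<forall>\<beta>\<in>B. \<exists>\<delta>>0. \<forall>t N p. 0 \<le> t \<longrightarrow> t \<le> T \<longrightarrow> partition_of 0 t N p \<longrightarrow> (\<forall>i<N. p (Suc i) - p i < \<delta>) \<longrightarrow>
     L1le M (\<lambda>\<omega>. stratonovich_sum W (X \<beta>) N p \<omega> - Y \<beta> t \<omega>) \<eta>"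
    using lim \<eta>(1) unfolding strat_L1_limit_def by blast
  from bchoice[OF this] obtain \<delta> where \<delta>0: "\<forall>\<beta>\<in>B. 0 < \<delta> \<beta> \<and> (\<forall>t N p. 0 \<le> t \<longrightarrow> t \<le> T \<longrightarrow> partition_of 0 t N p \<longrightarrow> (\<forall>i<N. p (Suc i) - p i < \<delta> \<beta>) \<longrightarrow>
     L1le M (\<lambda>\<omega>. stratonovich_sum W (X \<beta>) N p \<omega> - Y \<beta> t \<omega>) \<eta>)" ..
  then have \<delta>: "\<And>\<beta>. \<beta> \<in> B \<Longrightarrow> 0 < \<delta> \<beta>"
    "\<And>\<beta> t N p. \<beta> \<in> B \<Longrightarrow> 0 \<le> t \<Longrightarrow> t \<le> T \<Longrightarrow> partition_of 0 t N p \<Longrightarrow> (\<forall>i<N. p (Suc i) - p i < \<delta> \<beta>) \<Longrightarrow>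
     L1le M (\<lambda>\<omega>. stratonovich_sum W (X \<beta>) N p \<omega> - Y \<beta> t \<omega>) \<eta>"
    by blast+
  \<comment> \<open>The element 1 keeps the minimum defined when B is empty.\<close>
  define d where "d = Min (insert 1 (\<delta> ` B))"
  have d: "0 < d" "\<And>\<beta>. \<beta> \<in> B \<Longrightarrow> d \<le> \<delta> \<beta>"
    unfolding d_def using B \<delta>(1) by auto
  show "\<exists>\<delta>>0. \<forall>t N p. 0 \<le> t \<longrightarrow> t \<le> T \<longrightarrow> partition_of 0 t N p \<longrightarrow> (\<forall>i<N. p (Suc i) - p i < \<delta>) \<longrightarrow>
     L1le M (\<lambda>\<omega>. stratonovich_sum W (\<lambda>s \<omega>. \<Sum>\<beta>\<in>B. c \<beta> * X \<beta> s \<omega>) N p \<omega> - (\<Sum>\<beta>\<in>B. c \<beta> * Y \<beta> t \<omega>)) \<epsilon>"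
  proof (intro exI[of _ d] conjI d(1) allI impI)
    fix t N p assume t: "0 \<le> t" "t \<le> T" and p: "partition_of 0 t N p" and mesh: "\<forall>i<N. p (Suc i) - p i < d"
    have "L1le M (\<lambda>\<omega>. stratonovich_sum W (X \<beta>) N p \<omega> - Y \<beta> t \<omega>) \<eta>" if "\<beta> \<in> B" for \<beta>
    proof (rule \<delta>(2)[OF that t p])
      show "\<forall>i<N. p (Suc i) - p i < \<delta> \<beta>" using mesh d(2)[OF that] by (meson less_le_trans)
    qed
    then have L: "L1le M (\<lambda>\<omega>. \<Sum>\<beta>\<in>B. c \<beta> * (stratonovich_sum W (X \<beta>) N p \<omega> - Y \<beta> t \<omega>)) (\<Sum>\<beta>\<in>B. \<bar>c \<beta>\<bar> * \<eta>)"
      using \<eta>(1) by (intro L1le_sum L1le_cmult) auto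
    have "(\<Sum>\<beta>\<in>B. \<bar>c \<beta>\<bar> * \<eta>) = \<eta> * C" by (simp add: C_def sum_distrib_left mult.commute)
    also have "\<dots> \<le> \<eta> * (C + 1)" using \<eta>(1) by (intro mult_left_mono) auto
    finally have "L1le M (\<lambda>\<omega>. \<Sum>\<beta>\<in>B. c \<beta> * (stratonovich_sum W (X \<beta>) N p \<omega> - Y \<beta> t \<omega>)) \<epsilon>"
      unfolding \<eta>(2) by (rule L1le_mono[OF L])
    then show "L1le M (\<lambda>\<omega>. stratonovich_sum W (\<lambda>s \<omega>. \<Sum>\<beta>\<in>B. c \<beta> * X \<beta> s \<omega>) N p \<omega> - (\<Sum>\<beta>\<in>B. c \<beta> * Y \<beta> t \<omega>)) \<epsilon>"
    proof (rule L1le_cong)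
      fix \<omega> assume \<omega>: "\<omega> \<in> space M"
      show "(\<Sum>\<beta>\<in>B. c \<beta> * (stratonovich_sum W (X \<beta>) N p \<omega> - Y \<beta> t \<omega>)) =
          stratonovich_sum W (\<lambda>s \<omega>. \<Sum>\<beta>\<in>B. c \<beta> * X \<beta> s \<omega>) N p \<omega> - (\<Sum>\<beta>\<in>B. c \<beta> * Y \<beta> t \<omega>)"
        using stratonovich_sum_linear[where X=X and c=c and \<omega>=\<omega>, OF B p t(2) int[OF _ \<omega>]]
        by (simp add: right_diff_distrib sum_subtractf)
    qed
  qed
qed

end

section \<open>Recursion over the multi-indices\<close>

lemma multi_indices_0: "multi_indices 0 = {[]}"
proof -
  have "\<alpha> = []" if "\<alpha> \<in> multi_indices 0" for \<alpha>
    using length_multi_indices[OF that] by simp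
  then show ?thesis by (auto simp: multi_indices_def)
qed

text \<open>Lowering the head of a list that starts with 2 gives a list with sum k that starts with
  1, and removing the head 1 also gives a list with sum k; both operations can be undone.\<close>

lemma multi_indices_Suc:
  "multi_indices (Suc k) = Cons 1 ` multi_indices k \<union>
     (\<lambda>\<beta>. 2 # tl \<beta>) ` {\<beta> \<in> multi_indices k. \<beta> \<noteq> [] \<and> hd \<beta> = 1}"
proof (intro equalityI subsetI)
  fix \<gamma> assume \<gamma>: "\<gamma> \<in> multi_indices (Suc k)"
  then obtain a \<beta> where a: "\<gamma> = a # \<beta>" by (cases \<gamma>) (auto simp: multi_indices_def)
  then have "a = 1 \<or> a = 2" and \<beta>: "set \<beta> \<subseteq> {1, 2}" and sum: "a + sum_list \<beta> = Suc k"
    using \<gamma> by (auto simp: multi_indices_def)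
  then consider "a = 1" | "a = 2" by auto
  then show "\<gamma> \<in> Cons 1 ` multi_indices k \<union> (\<lambda>\<beta>. 2 # tl \<beta>) ` {\<beta> \<in> multi_indices k. \<beta> \<noteq> [] \<and> hd \<beta> = 1}"
  proof cases
    case 1
    then show ?thesis using a \<beta> sum by (auto simp: multi_indices_def)
  next
    case 2
    then have "1 # \<beta> \<in> {\<beta> \<in> multi_indices k. \<beta> \<noteq> [] \<and> hd \<beta> = 1}" using \<beta> sum by (auto simp: multi_indices_def)
    from imageI[OF this, of "\<lambda>\<beta>. 2 # tl \<beta>"] show ?thesis using a 2 by simp
  qed
next
  fix \<gamma> assume "\<gamma> \<in> Cons 1 ` multi_indices k \<union> (\<lambda>\<beta>. 2 # tl \<beta>) ` {\<beta> \<in> multi_indices k. \<beta> \<noteq> [] \<and> hd \<beta> = 1}"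
  then show "\<gamma> \<in> multi_indices (Suc k)"
  proof
    assume "\<gamma> \<in> (\<lambda>\<beta>. 2 # tl \<beta>) ` {\<beta> \<in> multi_indices k. \<beta> \<noteq> [] \<and> hd \<beta> = 1}"
    then obtain \<beta> where \<beta>: "\<gamma> = 2 # tl \<beta>" "\<beta> \<in> multi_indices k" "\<beta> \<noteq> []" "hd \<beta> = 1" by auto
    then obtain \<beta>' where "\<beta> = 1 # \<beta>'" by (cases \<beta>) auto
    then show ?thesis using \<beta> by (auto simp: multi_indices_def)
  qed (auto simp: multi_indices_def)
qed

text \<open>Prepending 1 raises both sum and length and leaves the weight unchanged; raising a
  leading 1 to 2 raises only the sum, which halves the weight.\<close>

lemma multi_indices_sum_Suc:
  fixes I :: "nat list \<Rightarrow> real"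
  shows "(\<Sum>\<gamma>\<in>multi_indices (Suc k). 1 / 2 ^ (Suc k - length \<gamma>) * I \<gamma>) =
    (\<Sum>\<beta>\<in>multi_indices k. 1 / 2 ^ (k - length \<beta>) *
      (I (1 # \<beta>) + (if \<beta> \<noteq> [] \<and> hd \<beta> = 1 then 1 / 2 * I (2 # tl \<beta>) else 0)))"
proof -
  let ?R = "multi_indices k" and ?R1 = "{\<beta> \<in> multi_indices k. \<beta> \<noteq> [] \<and> hd \<beta> = 1}"
  let ?u = "\<lambda>\<gamma>. 1 / 2 ^ (Suc k - length \<gamma>) * I \<gamma>"
  have fin: "finite ?R" by (rule finite_multi_indices)
  have inj2: "inj_on (\<lambda>\<beta>. 2 # tl \<beta>) ?R1"
    by (rule inj_onI) (auto simp: neq_Nil_conv)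
  have "sum ?u (multi_indices (Suc k)) = sum ?u (Cons 1 ` ?R) + sum ?u ((\<lambda>\<beta>. 2 # tl \<beta>) ` ?R1)"
    unfolding multi_indices_Suc using fin by (intro sum.union_disjoint) auto
  also have "sum ?u (Cons 1 ` ?R) = (\<Sum>\<beta>\<in>?R. 1 / 2 ^ (k - length \<beta>) * I (1 # \<beta>))"
    by (subst sum.reindex) auto
  also have "sum ?u ((\<lambda>\<beta>. 2 # tl \<beta>) ` ?R1) = (\<Sum>\<beta>\<in>?R1. 1 / 2 ^ (k - length \<beta>) * (1 / 2 * I (2 # tl \<beta>)))"
  proof (subst sum.reindex[OF inj2], rule sum.cong)
    fix \<beta> assume \<beta>: "\<beta> \<in> ?R1"
    \<comment> \<open>The bound on the length matters because the exponent is a truncated difference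
      of natural numbers.\<close>
    then have "length (2 # tl \<beta>) = length \<beta>" "length \<beta> \<le> k" using length_multi_indices by auto
    then have "Suc k - length (2 # tl \<beta>) = Suc (k - length \<beta>)" by simp
    then show "((\<lambda>\<gamma>. 1 / 2 ^ (Suc k - length \<gamma>) * I \<gamma>) \<circ> (\<lambda>\<beta>. 2 # tl \<beta>)) \<beta> = 1 / 2 ^ (k - length \<beta>) * (1 / 2 * I (2 # tl \<beta>))"
      by (simp add: comp_def)
  qed simp
  also have "\<dots> = (\<Sum>\<beta>\<in>?R. if \<beta> \<noteq> [] \<and> hd \<beta> = 1 then 1 / 2 ^ (k - length \<beta>) * (1 / 2 * I (2 # tl \<beta>)) else 0)"
    by (rule sum.inter_filter[OF fin])
  also have "(\<Sum>\<beta>\<in>?R. 1 / 2 ^ (k - length \<beta>) * I (1 # \<beta>)) + \<dots> =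
      (\<Sum>\<beta>\<in>?R. 1 / 2 ^ (k - length \<beta>) * (I (1 # \<beta>) + (if \<beta> \<noteq> [] \<and> hd \<beta> = 1 then 1 / 2 * I (2 # tl \<beta>) else 0)))"
    unfolding sum.distrib[symmetric] by (intro sum.cong) (auto simp: distrib_left)
  finally show ?thesis .
qed

text \<open>Reversal is an involution of the index set. This removes the \<open>rev\<close> in the
  definition of \<open>mixed_integral\<close> from the sum.\<close>

lemma sum_multi_indices_rev: "(\<Sum>\<alpha>\<in>multi_indices n. u (rev \<alpha>)) = (\<Sum>\<alpha>\<in>multi_indices n. u \<alpha>)"
  by (rule sum.reindex_bij_witness[where i=rev and j=rev]) (auto simp: multi_indices_def)

context brownian_motion
begin

lemma mixed_integral_rev_Cons_1:
  "mixed_integral_rev M T W f (1 # \<beta>) =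
    ito_integral M T W (\<lambda>s \<omega>. f (Suc (sum_list \<beta>)) s * mixed_integral_rev M T W f \<beta> s \<omega>)"
  by (simp add: Let_def)

lemma mixed_integral_rev_Cons_2:
  "mixed_integral_rev M T W f (2 # \<beta>) =
    drift (\<lambda>s. f (Suc (Suc (sum_list \<beta>))) s * f (Suc (sum_list \<beta>)) s) (mixed_integral_rev M T W f \<beta>)"
  by (simp add: Let_def drift_def[abs_def])

text \<open>The index of every function that occurs is bounded by the sum of the multi-index, so all
  of them lie in {1..n}.\<close>

lemma regular_mixed_integral_rev:
  assumes f: "\<And>i. i \<in> {1..n} \<Longrightarrow> f i \<in> L2_Icc T" and \<beta>: "set \<beta> \<subseteq> {1, 2}" "sum_list \<beta> \<le> n"
  shows "regular (mixed_integral_rev M T W f \<beta>)"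
  using \<beta>
proof (induction \<beta>)
  case Nil
  show ?case by (simp add: regular_const)
next
  case (Cons a \<beta>)
  then have IH: "regular (mixed_integral_rev M T W f \<beta>)" and "a = 1 \<or> a = 2" by auto
  then consider "a = 1" | "a = 2" by auto
  then show ?case
  proof cases
    case 1
    then have "f (Suc (sum_list \<beta>)) \<in> L2_Icc T" using Cons.prems by (intro f) auto
    from regular_ito[OF IH this ito_limit_ito_integral[OF IH this]] show ?thesis
      unfolding 1 mixed_integral_rev_Cons_1 .
  next
    case 2
    then have "f (Suc (Suc (sum_list \<beta>))) \<in> L2_Icc T" "f (Suc (sum_list \<beta>)) \<in> L2_Icc T"
      using Cons.prems by (auto intro!: f)
    from regular_drift[OF IH this] show ?thesis
      unfolding 2 mixed_integral_rev_Cons_2 .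
  qed
qed

lemma strat_remainder_zero: "strat_remainder f (\<lambda>s \<omega>. 0) a b \<omega> = 0"
  by (simp add: strat_remainder_def)

text \<open>The head decides about the correction: the empty index is the constant 1, whose
  remainder vanishes identically; head 1 means an Ito integral, which yields the correction; head 2
  means a Lebesgue integral, which yields none.\<close>

lemma strat_L1_limit_mixed_integral_rev:
  assumes f: "\<And>i. i \<in> {1..n} \<Longrightarrow> f i \<in> L2_Icc T" and \<beta>: "\<beta> \<in> multi_indices k" and k: "k < n"
  shows "strat_L1_limit (\<lambda>s \<omega>. f (Suc k) s * mixed_integral_rev M T W f \<beta> s \<omega>)
    (\<lambda>t \<omega>. mixed_integral_rev M T W f (1 # \<beta>) t \<omega> +
      (if \<beta> \<noteq> [] \<and> hd \<beta> = 1 then 1 / 2 * mixed_integral_rev M T W f (2 # tl \<beta>) t \<omega> else 0))"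
proof -
  let ?I = "mixed_integral_rev M T W f"
  have b: "set \<beta> \<subseteq> {1, 2}" "sum_list \<beta> = k" using \<beta> by (auto simp: multi_indices_def)
  have fk: "f (Suc k) \<in> L2_Icc T" using k by (intro f) auto
  have regular: "regular (?I \<beta>)" using b k by (intro regular_mixed_integral_rev[of n] f) auto
  have lim: "ito_limit (\<lambda>s \<omega>. f (Suc k) s * ?I \<beta> s \<omega>) (?I (1 # \<beta>))"
    using ito_limit_ito_integral[OF regular fk] unfolding mixed_integral_rev_Cons_1 b(2) .
  show ?thesis
  proof (cases \<beta>)
    case Nil
    have "strat_L1_limit (\<lambda>s \<omega>. f (Suc k) s * ?I \<beta> s \<omega>) (\<lambda>t \<omega>. ?I (1 # \<beta>) t \<omega> + 0)"
    proof (rule strat_L1_limit_of_remainder[OF regular fk lim])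
      fix \<epsilon> :: real assume "0 < \<epsilon>"
      then show "\<exists>\<delta>>0. \<forall>t N p. t \<le> T \<longrightarrow> partition_of 0 t N p \<longrightarrow> (\<forall>i<N. p (Suc i) - p i < \<delta>) \<longrightarrow>
          L1le M (\<lambda>\<omega>. (\<Sum>i<N. strat_remainder (f (Suc k)) (\<lambda>s \<omega>. ?I \<beta> s \<omega> - ?I \<beta> (p i) \<omega>) (p i) (p (Suc i)) \<omega>) - 0) \<epsilon>"
        by (intro exI[of _ 1]) (simp add: Nil strat_remainder_zero L1le_zero)
    qed
    then show ?thesis by (simp add: Nil)
  next
    case (Cons a \<beta>')
    then have "a = 1 \<or> a = 2" and b': "set \<beta>' \<subseteq> {1, 2}" "a + sum_list \<beta>' = k" using b by auto
    have regular': "regular (?I \<beta>')" using b' k by (intro regular_mixed_integral_rev[of n] f) auto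
    consider "a = 1" | "a = 2" using \<open>a = 1 \<or> a = 2\<close> by auto
    then show ?thesis
    proof cases
      case 1
      then have k': "k = Suc (sum_list \<beta>')" using b' by simp
      have f': "f k \<in> L2_Icc T" using k k' by (intro f) auto
      have eq: "?I \<beta> = ito_integral M T W (\<lambda>s \<omega>. f k s * ?I \<beta>' s \<omega>)"
        unfolding Cons 1 mixed_integral_rev_Cons_1 k' ..
      have J: "ito_limit (\<lambda>s \<omega>. f k s * ?I \<beta>' s \<omega>) (?I \<beta>)"
        unfolding eq by (rule ito_limit_ito_integral[OF regular' f'])
      have "?I (2 # \<beta>') = drift (\<lambda>s. f (Suc k) s * f k s) (?I \<beta>')"
        unfolding mixed_integral_rev_Cons_2 k' ..
      then show ?thesis
        using strat_L1_limit_ito[OF regular' fk f' J lim] Cons 1 by simp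
    next
      case 2
      then have k': "k = Suc (Suc (sum_list \<beta>'))" using b' by simp
      have f': "f k \<in> L2_Icc T" "f (Suc (sum_list \<beta>')) \<in> L2_Icc T" using k k' by (auto intro!: f)
      have eq: "?I \<beta> = drift (\<lambda>s. f k s * f (Suc (sum_list \<beta>')) s) (?I \<beta>')"
        unfolding Cons 2 mixed_integral_rev_Cons_2 k' ..
      have "strat_L1_limit (\<lambda>s \<omega>. f (Suc k) s * ?I \<beta> s \<omega>) (?I (1 # \<beta>))"
        unfolding eq by (rule strat_L1_limit_drift[OF regular' fk f']) (use lim in \<open>simp only: eq\<close>)
      then show ?thesis by (simp add: Cons 2)
    qed
  qed
qed

text \<open>The induction carries more than the formula at one time: continuity, which makes the
  next integrand measurable, and equality at all times off one null set, since the next Stratonovich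
  sum integrates along paths.\<close>

lemma multiple_stratonovich_eq_sum:
  assumes f: "\<And>i. i \<in> {1..n} \<Longrightarrow> f i \<in> L2_Icc T" and k: "k \<le> n"
  shows "continuous_process M T (multiple_stratonovich M T W f k) \<and>
    (AE \<omega> in M. \<forall>t\<in>{0..T}. multiple_stratonovich M T W f k t \<omega> =
      (\<Sum>\<beta>\<in>multi_indices k. 1 / 2 ^ (k - length \<beta>) * mixed_integral_rev M T W f \<beta> t \<omega>))"
  using k
proof (induction k)
  case 0
  show ?case by (simp add: multi_indices_0 regularD(1)[OF regular_const])
next
  case (Suc k)
  let ?I = "mixed_integral_rev M T W f" and ?V = "multiple_stratonovich M T W f"
  define S where "S k t \<omega> = (\<Sum>\<beta>\<in>multi_indices k. 1 / 2 ^ (k - length \<beta>) * ?I \<beta> t \<omega>)" for k t \<omega>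
  have fk: "f (Suc k) \<in> L2_Icc T" using Suc.prems by (intro f) auto
  have cV: "continuous_process M T (?V k)" and ae: "AE \<omega> in M. \<forall>t\<in>{0..T}. ?V k t \<omega> = S k t \<omega>"
    using Suc by (auto simp: S_def)
  have regular: "regular (?I \<beta>)" if "\<beta> \<in> multi_indices j" "j \<le> n" for \<beta> j
    using that by (intro regular_mixed_integral_rev[of n] f) (auto simp: multi_indices_def)
  have cS: "continuous_process M T (S (Suc k))"
    unfolding continuous_process_def
  proof (intro conjI ballI)
    fix t assume t: "t \<in> {0..T}"
    show "S (Suc k) t \<in> borel_measurable M"
      unfolding S_def[abs_def] using t Suc.prems
      by (intro borel_measurable_sum borel_measurable_times borel_measurable_const
          continuous_process_measurable[OF regularD(1)[OF regular]]) auto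
  next
    fix \<omega> assume "\<omega> \<in> space M"
    then show "continuous_on {0..T} (\<lambda>t. S (Suc k) t \<omega>)"
      unfolding S_def using Suc.prems
      by (intro continuous_on_sum continuous_on_mult continuous_on_const regularD(3)[OF regular])
  qed
  have int: "integrable (lborel_Icc T) (\<lambda>s. f (Suc k) s * ?I \<beta> s \<omega>)" if "\<beta> \<in> multi_indices k" "\<omega> \<in> space M" for \<beta> \<omega>
    using Suc.prems by (intro path_integrable regular[OF that(1)] that(2) L2_Icc_integrable fk) simp
  have "strat_L1_limit (\<lambda>s \<omega>. \<Sum>\<beta>\<in>multi_indices k. 1 / 2 ^ (k - length \<beta>) * (f (Suc k) s * ?I \<beta> s \<omega>))
      (\<lambda>t \<omega>. \<Sum>\<beta>\<in>multi_indices k. 1 / 2 ^ (k - length \<beta>) * (?I (1 # \<beta>) t \<omega> +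
        (if \<beta> \<noteq> [] \<and> hd \<beta> = 1 then 1 / 2 * ?I (2 # tl \<beta>) t \<omega> else 0)))"
    using Suc.prems
    by (intro strat_L1_limit_sum finite_multi_indices int strat_L1_limit_mixed_integral_rev[of n] f) auto
  then have lim: "strat_L1_limit (\<lambda>s \<omega>. \<Sum>\<beta>\<in>multi_indices k. 1 / 2 ^ (k - length \<beta>) * (f (Suc k) s * ?I \<beta> s \<omega>)) (S (Suc k))"
    unfolding S_def[abs_def] multi_indices_sum_Suc .
  have "has_stratonovich_integral M T W (\<lambda>s \<omega>. f (Suc k) s * ?V k s \<omega>) (S (Suc k))"
  proof (rule has_stratonovich_integral_of_L1_limit[OF lim cS])
    show "measurable_process M T (\<lambda>s \<omega>. f (Suc k) s * ?V k s \<omega>)"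
      by (rule measurable_process_mult[OF fk cV])
    show "AE \<omega> in M. \<forall>s\<in>{0..T}. f (Suc k) s * ?V k s \<omega> =
        (\<Sum>\<beta>\<in>multi_indices k. 1 / 2 ^ (k - length \<beta>) * (f (Suc k) s * ?I \<beta> s \<omega>))"
      using ae by eventually_elim (auto simp: S_def sum_distrib_left mult_ac)
    show "integrable (lborel_Icc T) (\<lambda>s. \<Sum>\<beta>\<in>multi_indices k. 1 / 2 ^ (k - length \<beta>) * (f (Suc k) s * ?I \<beta> s \<omega>))"
      if "\<omega> \<in> space M" for \<omega>
      using that by (intro Bochner_Integration.integrable_sum integrable_mult_right int)
  qed
  note hs = this
  \<comment> \<open>The integral built from the sum shows existence, so the choice by
    \<open>SOME\<close> is an integral as well; uniqueness then identifies the two.\<close>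
  then have hV: "has_stratonovich_integral M T W (\<lambda>s \<omega>. f (Suc k) s * ?V k s \<omega>) (?V (Suc k))"
    unfolding multiple_stratonovich.simps stratonovich_integral_def
    by (rule someI[where P="has_stratonovich_integral M T W (\<lambda>s \<omega>. f (Suc k) s * ?V k s \<omega>)"])
  show ?case
  proof
    show "continuous_process M T (?V (Suc k))" using hV by (simp only: has_stratonovich_integral_def)
    show "AE \<omega> in M. \<forall>t\<in>{0..T}. ?V (Suc k) t \<omega> =
        (\<Sum>\<beta>\<in>multi_indices (Suc k). 1 / 2 ^ (Suc k - length \<beta>) * ?I \<beta> t \<omega>)"
      using stratonovich_integral_unique[OF hV hs] unfolding S_def .
  qed
qed

lemma multiple_stratonovich_eq_mixed_integrals:
  assumes f: "\<And>i. i \<in> {1..n} \<Longrightarrow> f i \<in> L2_Icc T" and t: "t \<in> {0..T}"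
  shows "AE \<omega> in M. multiple_stratonovich M T W f n t \<omega> =
    (\<Sum>\<alpha>\<in>multi_indices n. 1 / 2 ^ (n - length \<alpha>) * mixed_integral M T W f \<alpha> t \<omega>)"
proof -
  have "(\<Sum>\<alpha>\<in>multi_indices n. 1 / 2 ^ (n - length \<alpha>) * mixed_integral M T W f \<alpha> t \<omega>) =
      (\<Sum>\<alpha>\<in>multi_indices n. 1 / 2 ^ (n - length \<alpha>) * mixed_integral_rev M T W f \<alpha> t \<omega>)" for \<omega>
    using sum_multi_indices_rev[of "\<lambda>\<alpha>. 1 / 2 ^ (n - length \<alpha>) * mixed_integral_rev M T W f \<alpha> t \<omega>" n]
    by (simp add: mixed_integral_def)
  note eq = this
  have "AE \<omega> in M. \<forall>t\<in>{0..T}. multiple_stratonovich M T W f n t \<omega> =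
      (\<Sum>\<beta>\<in>multi_indices n. 1 / 2 ^ (n - length \<beta>) * mixed_integral_rev M T W f \<beta> t \<omega>)"
    by (rule conjunct2[OF multiple_stratonovich_eq_sum[of n f n, OF f order_refl]])
  then show ?thesis
    by eventually_elim (use t eq in simp)
qed

end

section \<open>Modification on a null set\<close>

text \<open>Off N the preimages agree, and inside N they are null sets. As both generators contain
  all null sets, each lies in the \<sigma>-algebra generated by the other.\<close>

lemma brownian_filtration_cong:
  fixes M :: "'a measure" and U V :: "real \<Rightarrow> 'a \<Rightarrow> real"
  assumes N: "N \<in> null_sets M" and eq: "\<And>s \<omega>. \<omega> \<in> space M - N \<Longrightarrow> U s \<omega> = V s \<omega>"
    and U: "\<And>s. s \<in> {0..t} \<Longrightarrow> U s \<in> borel_measurable M" and V: "\<And>s. s \<in> {0..t} \<Longrightarrow> V s \<in> borel_measurable M"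
  shows "brownian_filtration M U t = brownian_filtration M V t"
proof -
  define G where "G U = {U s -` A \<inter> space M | s A. s \<in> {0..t} \<and> A \<in> sets (borel :: real measure)} \<union> null_sets M" for U :: "real \<Rightarrow> 'a \<Rightarrow> real"
  have G: "G U \<subseteq> Pow (space M)" for U by (auto simp: G_def dest: null_setsD2 sets.sets_into_space)
  have sub: "x \<in> sigma_sets (space M) (G V)" if x: "x \<in> G U" and eq: "\<And>s \<omega>. \<omega> \<in> space M - N \<Longrightarrow> U s \<omega> = V s \<omega>"
    and U: "\<And>s. s \<in> {0..t} \<Longrightarrow> U s \<in> borel_measurable M" for x U V
  proof (cases "x \<in> null_sets M")
    case True
    then show ?thesis by (auto simp: G_def intro: sigma_sets.Basic)
  next
    case False
    then obtain s A where x: "x = U s -` A \<inter> space M" and s: "s \<in> {0..t}" and A: "A \<in> sets borel"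
      using x by (auto simp: G_def)
    have S: "sigma_algebra (space M) (sigma_sets (space M) (G V))"
      by (rule sigma_algebra_sigma_sets[OF G])
    have "V s -` A \<inter> space M \<in> G V"
      unfolding G_def using s A by blast
    then have 1: "V s -` A \<inter> space M \<in> sigma_sets (space M) (G V)"
      by (rule sigma_sets.Basic)
    have "N \<in> G V"
      unfolding G_def using N by (rule UnI2)
    then have 2: "N \<in> sigma_sets (space M) (G V)"
      by (rule sigma_sets.Basic)
    have "(U s -` A \<inter> space M) \<inter> N \<in> null_sets M"
      by (rule null_set_Int1[OF N measurable_sets[OF U[OF s] A]])
    then have "(U s -` A \<inter> space M) \<inter> N \<in> G V"
      unfolding G_def by (rule UnI2)
    then have 3: "(U s -` A \<inter> space M) \<inter> N \<in> sigma_sets (space M) (G V)"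
      by (rule sigma_sets.Basic)
    have "((V s -` A \<inter> space M) - N) \<union> ((U s -` A \<inter> space M) \<inter> N) \<in> sigma_sets (space M) (G V)"
      by (rule ring_of_sets.Un[OF _ ring_of_sets.Diff[OF _ 1 2] 3])
        (rule algebra.axioms(1)[OF sigma_algebra.axioms(1)[OF S]])+
    also have "((V s -` A \<inter> space M) - N) \<union> ((U s -` A \<inter> space M) \<inter> N) = x"
      unfolding x using eq[of _ s] by auto
    finally show ?thesis .
  qed
  have "sigma_sets (space M) (G U) = sigma_sets (space M) (G V)"
  proof (rule sigma_sets_eqI)
    show "x \<in> sigma_sets (space M) (G V)" if "x \<in> G U" for x
      by (rule sub[OF that eq U])
    show "x \<in> sigma_sets (space M) (G U)" if "x \<in> G V" for x
      by (rule sub[OF that eq[symmetric] V])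
  qed
  then show ?thesis
    unfolding brownian_filtration_def G_def[symmetric] by (intro sigma_eqI G)
qed

context
  fixes M :: "'a measure" and T :: real and W V :: "real \<Rightarrow> 'a \<Rightarrow> real" and N :: "'a set"
  assumes M: "sigma_finite_measure M"
    and N: "N \<in> null_sets M" and eq: "\<And>s \<omega>. \<omega> \<in> space M - N \<Longrightarrow> W s \<omega> = V s \<omega>"
    and W: "\<And>s. s \<in> {0..T} \<Longrightarrow> W s \<in> borel_measurable M" and V: "\<And>s. s \<in> {0..T} \<Longrightarrow> V s \<in> borel_measurable M"
begin

lemma AE_W_eq: "AE \<omega> in M. \<forall>s. W s \<omega> = V s \<omega>"
  using AE_not_in[OF N] AE_space by eventually_elim (simp add: eq)

lemma simple_process_cong: "simple_process M T W n p \<xi> \<longleftrightarrow> simple_process M T V n p \<xi>"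
proof -
  have "brownian_filtration M W (p i) = brownian_filtration M V (p i)" if "partition_of 0 T n p" "i < n" for i
    using partition_of_bounds[OF that(1), of i] that(2)
    by (intro brownian_filtration_cong[OF N eq] W V) auto
  then show ?thesis by (auto simp: simple_process_def)
qed

lemma has_ito_integral_cong: "has_ito_integral M T W X Y \<longleftrightarrow> has_ito_integral M T V X Y"
proof -
  have "(\<integral>\<^sup>+\<omega>. ennreal ((step_integral W n p \<xi> t \<omega> - Y t \<omega>)\<^sup>2) \<partial>M) =
      (\<integral>\<^sup>+\<omega>. ennreal ((step_integral V n p \<xi> t \<omega> - Y t \<omega>)\<^sup>2) \<partial>M)" for n p \<xi> t
    using AE_W_eq by (intro nn_integral_cong_AE) (auto elim!: eventually_mono simp: step_integral_def)
  then show ?thesis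
    by (simp add: has_ito_integral_def simple_process_cong)
qed

lemma has_stratonovich_integral_cong: "has_stratonovich_integral M T W X Y \<longleftrightarrow> has_stratonovich_integral M T V X Y"
proof -
  have *: "measure M {\<omega> \<in> space M. \<epsilon> < \<bar>stratonovich_sum W X n p \<omega> - Y t \<omega>\<bar>} =
      measure M {\<omega> \<in> space M. \<epsilon> < \<bar>stratonovich_sum V X n p \<omega> - Y t \<omega>\<bar>}"
    if X: "measurable_process M T X" and Y: "continuous_process M T Y" and t: "t \<in> {0..T}" and p: "partition_of 0 t n p"
    for \<epsilon> t n p
  proof (rule measure_eq_AE)
    have tT: "t \<le> T" and [measurable]: "Y t \<in> borel_measurable M" using t Y by (auto simp: continuous_process_def)
    have [measurable]: "stratonovich_sum W X n p \<in> borel_measurable M" "stratonovich_sum V X n p \<in> borel_measurable M"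
      by (rule stratonovich_sum_measurable[OF X M p tT], simp add: W V)+
    show "{\<omega> \<in> space M. \<epsilon> < \<bar>stratonovich_sum W X n p \<omega> - Y t \<omega>\<bar>} \<in> sets M"
      "{\<omega> \<in> space M. \<epsilon> < \<bar>stratonovich_sum V X n p \<omega> - Y t \<omega>\<bar>} \<in> sets M"
      by measurable
    show "AE \<omega> in M. (\<omega> \<in> {\<omega> \<in> space M. \<epsilon> < \<bar>stratonovich_sum W X n p \<omega> - Y t \<omega>\<bar>}) =
        (\<omega> \<in> {\<omega> \<in> space M. \<epsilon> < \<bar>stratonovich_sum V X n p \<omega> - Y t \<omega>\<bar>})"
      using AE_W_eq by eventually_elim (simp add: stratonovich_sum_def)
  qed
  show ?thesis
  proof (cases "measurable_process M T X \<and> continuous_process M T Y")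
    case True
    then have "measure M {\<omega> \<in> space M. \<epsilon> < \<bar>stratonovich_sum W X n p \<omega> - Y t \<omega>\<bar>} < \<eta> \<longleftrightarrow>
      measure M {\<omega> \<in> space M. \<epsilon> < \<bar>stratonovich_sum V X n p \<omega> - Y t \<omega>\<bar>} < \<eta>"
      if "t \<in> {0..T}" "partition_of 0 t n p" for \<epsilon> \<eta> t n p
      using *[OF _ _ that] by simp
    then show ?thesis
      unfolding has_stratonovich_integral_def by (intro conj_cong refl ball_cong all_cong imp_cong ex_cong) auto
  qed (auto simp: has_stratonovich_integral_def)
qed

text \<open>An equality of functions although W and V differ on a null set: the defining predicates
  coincide, so \<open>SOME\<close> makes the same choice.\<close>

lemma multiple_stratonovich_cong: "multiple_stratonovich M T W f k = multiple_stratonovich M T V f k"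
  by (induction k) (simp_all add: stratonovich_integral_def has_stratonovich_integral_cong)

lemma mixed_integral_cong: "mixed_integral M T W f \<alpha> = mixed_integral M T V f \<alpha>"
proof -
  have "ito_integral M T W X = ito_integral M T V X" for X
    by (simp add: ito_integral_def has_ito_integral_cong)
  then have "mixed_integral_rev M T W f \<beta> = mixed_integral_rev M T V f \<beta>" for \<beta>
    by (induction \<beta>) (simp_all add: Let_def)
  then show ?thesis by (simp add: mixed_integral_def)
qed

end

section \<open>Brownian motion after modification\<close>

text \<open>Independence means that the joint law is the product of the marginal laws, and laws are
  unaffected by null sets.\<close>

lemma (in prob_space) indep_vars_cong_AE:
  assumes X: "indep_vars (\<lambda>_. borel :: real measure) X I" and Y: "\<And>i. i \<in> I \<Longrightarrow> Y i \<in> borel_measurable M"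
    and ae: "AE \<omega> in M. \<forall>i\<in>I. X i \<omega> = Y i \<omega>"
  shows "indep_vars (\<lambda>_. borel) Y I"
\<comment> \<open>The characterisation by laws concerns nonempty families; the empty one is
  independent by definition.\<close>
proof (cases "I = {}")
  case True
  then show ?thesis by (simp add: indep_vars_def indep_sets_def)
next
  case False
  have Xm: "X i \<in> borel_measurable M" if "i \<in> I" for i
    using X that by (auto simp: indep_vars_def)
  have "distr M (Pi\<^sub>M I (\<lambda>_. borel :: real measure)) (\<lambda>\<omega>. \<lambda>i\<in>I. Y i \<omega>) = distr M (Pi\<^sub>M I (\<lambda>_. borel :: real measure)) (\<lambda>\<omega>. \<lambda>i\<in>I. X i \<omega>)"
  proof (rule distr_cong_AE)
    show "AE \<omega> in M. (\<lambda>i\<in>I. Y i \<omega>) = (\<lambda>i\<in>I. X i \<omega>)"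
      using ae by eventually_elim (auto simp: restrict_def fun_eq_iff)
    show "(\<lambda>\<omega>. \<lambda>i\<in>I. Y i \<omega>) \<in> M \<rightarrow>\<^sub>M Pi\<^sub>M I (\<lambda>_. borel :: real measure)"
      by (rule measurable_restrict) (rule Y)
    show "(\<lambda>\<omega>. \<lambda>i\<in>I. X i \<omega>) \<in> M \<rightarrow>\<^sub>M Pi\<^sub>M I (\<lambda>_. borel :: real measure)"
      by (rule measurable_restrict) (rule Xm)
  qed (rule refl)+
  also have "\<dots> = (\<Pi>\<^sub>M i\<in>I. distr M borel (X i))"
    using X indep_vars_iff_distr_eq_PiM'[OF False Xm] by simp
  also have "\<dots> = (\<Pi>\<^sub>M i\<in>I. distr M borel (Y i))"
  proof (rule PiM_cong)
    fix i assume i: "i \<in> I"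
    show "distr M borel (X i) = distr M borel (Y i)"
    proof (rule distr_cong_AE)
      show "AE \<omega> in M. X i \<omega> = Y i \<omega>" using ae by eventually_elim (simp add: i)
    qed (simp_all add: Xm Y i)
  qed simp
  finally show ?thesis
    using indep_vars_iff_distr_eq_PiM'[OF False Y] by simp
qed

lemma standard_brownian_motion_cong_AE:
  assumes bm: "standard_brownian_motion M T W" and N: "N \<in> null_sets M"
    and eq: "\<And>s \<omega>. \<omega> \<in> space M - N \<Longrightarrow> W s \<omega> = V s \<omega>"
    and V: "\<And>s. s \<in> {0..T} \<Longrightarrow> V s \<in> borel_measurable M"
  shows "standard_brownian_motion M T V"
proof -
  interpret prob_space M using bm by (simp add: standard_brownian_motion_def)
  have ae: "AE \<omega> in M. \<forall>s. W s \<omega> = V s \<omega>"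
    using AE_not_in[OF N] AE_space by eventually_elim (simp add: eq)
  have W: "W s \<in> borel_measurable M" if "s \<in> {0..T}" for s
    using bm that by (auto simp: standard_brownian_motion_def)
  show ?thesis
    unfolding standard_brownian_motion_def
  proof (intro conjI ballI allI impI)
    show "prob_space M" by unfold_locales
    show "V t \<in> borel_measurable M" if "t \<in> {0..T}" for t by (rule V[OF that])
    have "AE \<omega> in M. W 0 \<omega> = 0" using bm by (simp add: standard_brownian_motion_def)
    then show "AE \<omega> in M. V 0 \<omega> = 0" using ae by eventually_elim simp
    have "AE \<omega> in M. continuous_on {0..T} (\<lambda>t. W t \<omega>)" using bm by (simp add: standard_brownian_motion_def)
    then show "AE \<omega> in M. continuous_on {0..T} (\<lambda>t. V t \<omega>)" using ae by eventually_elim simp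
  next
    fix n p assume p: "(\<forall>i<n. p i < p (Suc i)) \<and> 0 \<le> p 0 \<and> p n \<le> T"
    then have "partition_of (p 0) (p n) n p" by (simp add: partition_of_def)
    from partition_of_bounds[OF this] p have b: "p i \<in> {0..T}" if "i \<le> n" for i using that by force
    show "indep_vars (\<lambda>_. borel) (\<lambda>i \<omega>. V (p (Suc i)) \<omega> - V (p i) \<omega>) {..<n}"
    proof (rule indep_vars_cong_AE)
      show "indep_vars (\<lambda>_. borel) (\<lambda>i \<omega>. W (p (Suc i)) \<omega> - W (p i) \<omega>) {..<n}"
        using bm p unfolding standard_brownian_motion_def by blast
      show "(\<lambda>\<omega>. V (p (Suc i)) \<omega> - V (p i) \<omega>) \<in> borel_measurable M" if "i \<in> {..<n}" for i
        using that by (intro borel_measurable_diff V b) auto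
      show "AE \<omega> in M. \<forall>i\<in>{..<n}. W (p (Suc i)) \<omega> - W (p i) \<omega> = V (p (Suc i)) \<omega> - V (p i) \<omega>"
        using ae by eventually_elim simp
    qed
  next
    fix s t assume st: "0 \<le> s \<and> s < t \<and> t \<le> T"
    have D: "distributed M lborel (\<lambda>\<omega>. W t \<omega> - W s \<omega>) (normal_density 0 (sqrt (t - s)))"
      using bm st unfolding standard_brownian_motion_def by blast
    have m: "(\<lambda>\<omega>. V t \<omega> - V s \<omega>) \<in> borel_measurable M" "(\<lambda>\<omega>. W t \<omega> - W s \<omega>) \<in> borel_measurable M"
      using st by (auto intro!: borel_measurable_diff V W)
    have "distr M lborel (\<lambda>\<omega>. V t \<omega> - V s \<omega>) = distr M lborel (\<lambda>\<omega>. W t \<omega> - W s \<omega>)"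
      using ae m by (intro distr_cong_AE) (auto elim!: eventually_mono)
    then show "distributed M lborel (\<lambda>\<omega>. V t \<omega> - V s \<omega>) (normal_density 0 (sqrt (t - s)))"
      using D m(1) by (simp add: distributed_def)
  qed
qed

theorem proposition3p1:
  fixes M :: "'a measure"
    and T :: real
    and n :: nat
    and W :: "real \<Rightarrow> 'a \<Rightarrow> real"
    and f :: "nat \<Rightarrow> real \<Rightarrow> real"
  assumes "0 < T"
    and "1 \<le> n"
    and "standard_brownian_motion M T W"
    and "\<And>i. i \<in> {1..n} \<Longrightarrow> f i \<in> L2_Icc T"
  shows "\<forall>t\<in>{0..T}. AE \<omega> in M.
           multiple_stratonovich M T W f n t \<omega> =
             (\<Sum>\<alpha>\<in>multi_indices n. 1 / 2 ^ (n - length \<alpha>) * mixed_integral M T W f \<alpha> t \<omega>)"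
proof -
  interpret prob_space M using assms(3) by (simp add: standard_brownian_motion_def)
  have W: "W s \<in> borel_measurable M" if "s \<in> {0..T}" for s
    using assms(3) that by (auto simp: standard_brownian_motion_def)
  have "AE \<omega> in M. W 0 \<omega> = 0" "AE \<omega> in M. continuous_on {0..T} (\<lambda>t. W t \<omega>)"
    using assms(3) by (auto simp: standard_brownian_motion_def)
  then have "AE \<omega> in M. W 0 \<omega> = 0 \<and> continuous_on {0..T} (\<lambda>t. W t \<omega>)" by eventually_elim simp
  then obtain N where N: "N \<in> null_sets M"
    "\<And>\<omega>. \<omega> \<in> space M - N \<Longrightarrow> W 0 \<omega> = 0 \<and> continuous_on {0..T} (\<lambda>t. W t \<omega>)"
    by (auto elim!: AE_E3)
  \<comment> \<open>On the exceptional null set W is replaced by the zero path, which starts at 0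
    and is continuous.\<close>
  define V where "V s \<omega> = (if \<omega> \<in> N then 0 else W s \<omega>)" for s \<omega>
  have eq: "W s \<omega> = V s \<omega>" if "\<omega> \<in> space M - N" for s \<omega> using that by (simp add: V_def)
  have V: "V s \<in> borel_measurable M" if "s \<in> {0..T}" for s
  proof -
    have [measurable]: "N \<in> events" "W s \<in> borel_measurable M" using N(1) W[OF that] by auto
    show ?thesis unfolding V_def[abs_def] by measurable
  qed
  interpret V: brownian_motion M T V
  proof
    show "0 < T" by fact
    show "standard_brownian_motion M T V"
      by (rule standard_brownian_motion_cong_AE[OF assms(3) N(1) eq V])
    fix \<omega> assume \<omega>: "\<omega> \<in> space M"
    show "V 0 \<omega> = 0" using N(2)[of \<omega>] \<omega> by (auto simp: V_def)
    show "continuous_on {0..T} (\<lambda>t. V t \<omega>)"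
      using N(2)[of \<omega>] \<omega> by (cases "\<omega> \<in> N") (auto simp: V_def)
  qed
  have M: "sigma_finite_measure M" by unfold_locales
  have "multiple_stratonovich M T W f n = multiple_stratonovich M T V f n"
    by (rule multiple_stratonovich_cong[OF M N(1) eq W V])
  moreover have "mixed_integral M T W f \<alpha> = mixed_integral M T V f \<alpha>" for \<alpha>
    by (rule mixed_integral_cong[OF M N(1) eq W V])
  ultimately show ?thesis
    using V.multiple_stratonovich_eq_mixed_integrals[OF assms(4)] by simp
qed

end
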